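(* Let $\theta>0$ and let $(u,m)$ be a constructed solution of (P) (as defined in the context). As $t\to0^+$, the map $x\mapsto t^\alpha m(t,t^\alpha x)$ converges, in the $L^\infty(\mathbb{R})$ weak-$*$ sense, to the self-similar profile $\phi$.
   Context: Let $T>0$, $\theta>0$, $\alpha=\frac{2}{2+\theta}\in(0,1)$, and $\phi(r)=\left(\frac12\alpha(1-\alpha)(R_\alpha^2-r^2)\right)_+^{1/\theta}$, where $R_\alpha>0$ is chosen such that $\int_{\mathbb{R}}\phi=1$. The terminal density $m_T:\mathbb{R}\to[0,\infty)$ is a probability density supported in an interval $[a,b]$, smooth in $(a,b)$, with $m_T^\theta\in C^{1,\sigma}(a,b)$ for some $\sigma>0$, and for some $C_0>1$ $$C_0^{-1}\,\mathrm{dist}(x,\{a,b\})^{1/\theta}\le m_T(x)\le C_0\,\mathrm{dist}(x,\{a,b\})^{1/\theta},\qquad x\in[a,b].$$ The planning problem (P) is $$-u_t+\tfrac12|u_x|^2=m^\theta,\qquad m_t-(mu_x)_x=0\quad\text{in }(0,T)\times\mathbb{R},\qquad m(0)=\delta_0,\quad m(T)=m_T.$$ A solution of (P) is a pair $(u,m)\in C^1((0,T)\times\mathbb{R})\times\big(C([0,T];\mathcal{P}(\mathbb{R}))\cap C((0,T)\times\mathbb{R})\big)$ ($\mathcal{P}(\mathbb{R})$: Borel probability measures with the weak topology) such that the first equation holds classically, the second in the distributional sense, and $m(0,\cdot)=\delta_0$, $m(T,\cdot)=m_T$. Approximation: for $\varepsilon\in(0,1)$ let $m_0^{(\varepsilon)}(x)=\varepsilon^{-\alpha}\phi(\varepsilon^{-\alpha}x)$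 and let $(u^{(\varepsilon)},m^{(\varepsilon)})$ be the solution of the same system with $m^{(\varepsilon)}(0)=m_0^{(\varepsilon)}$, $m^{(\varepsilon)}(T)=m_T$. It is known that such a solution exists, with $u^{(\varepsilon)}$ of class $C^1$ and globally Lipschitz, $m^{(\varepsilon)}$ globally Hölder continuous, both smooth in $\{m^{(\varepsilon)}>0\}$; $m^{(\varepsilon)}$ is unique and $u^{(\varepsilon)}$ is unique up to an additive constant in $\{m^{(\varepsilon)}>0\}$. The function $u^{(\varepsilon)}$ is normalized by $\int_{\mathbb{R}}u^{(\varepsilon)}(T)m_T=0$ and is chosen outside $\{m^{(\varepsilon)}>0\}$ so that $\|u_x^{(\varepsilon)}(t)\|_{L^\infty(\{m^{(\varepsilon)}(t)=0\})}\le C(t+\varepsilon)^{\alpha-1}$ for $t\in[0,T]$, with $C$ independent of $\varepsilon$ (such a choice is possible). A constructed solution of (P) is a solution $(u,m)$ of (P) that is the locally uniform limit in $(0,T)\times\mathbb{R}$ of $(u^{(\varepsilon_k)},m^{(\varepsilon_k)})$ along some sequence $\varepsilon_k\to0^+$ (such limits exist). *)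

theory Defs
  imports "HOL-Probability.Probability"
begin

abbreviation dt :: "(real \<Rightarrow> real \<Rightarrow> real) \<Rightarrow> real \<Rightarrow> real \<Rightarrow> real" where
  "dt f \<equiv> \<lambda>t x. deriv (\<lambda>s. f s x) t"

abbreviation dx :: "(real \<Rightarrow> real \<Rightarrow> real) \<Rightarrow> real \<Rightarrow> real \<Rightarrow> real" where
  "dx f \<equiv> \<lambda>t x. deriv (f t) x"

text \<open>The class \<open>C\<^sup>n(S)\<close>, meant for open \<open>S\<close>: all partial derivatives up to order \<open>n\<close>
  exist and are continuous on \<open>S\<close>.\<close>

primrec Ck_on :: "nat \<Rightarrow> (real \<times> real) set \<Rightarrow> (real \<Rightarrow> real \<Rightarrow> real) \<Rightarrow> bool" where
  "Ck_on 0 S f \<longleftrightarrow> continuous_on S (\<lambda>(t, x). f t x)"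
| "Ck_on (Suc n) S f \<longleftrightarrow>
     continuous_on S (\<lambda>(t, x). f t x) \<and>
     (\<forall>(t, x)\<in>S. (\<lambda>s. f s x) differentiable (at t) \<and> f t differentiable (at x)) \<and>
     Ck_on n S (dt f) \<and> Ck_on n S (dx f)"

definition Cinf_on :: "(real \<times> real) set \<Rightarrow> (real \<Rightarrow> real \<Rightarrow> real) \<Rightarrow> bool" where
  "Cinf_on S f \<longleftrightarrow> (\<forall>n. Ck_on n S f)"

abbreviation strip :: "real \<Rightarrow> (real \<times> real) set" where
  "strip T \<equiv> {0<..<T} \<times> UNIV"

definition test_fun :: "real \<Rightarrow> (real \<Rightarrow> real \<Rightarrow> real) \<Rightarrow> bool" where
  "test_fun T \<psi> \<longleftrightarrow> Cinf_on UNIV \<psi> \<and>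
     (\<exists>K. compact K \<and> K \<subseteq> strip T \<and> (\<forall>t x. (t, x) \<notin> K \<longrightarrow> \<psi> t x = 0))"

definition globally_holder :: "real \<Rightarrow> (real \<Rightarrow> real \<Rightarrow> real) \<Rightarrow> bool" where
  "globally_holder T f \<longleftrightarrow> (\<exists>K \<gamma>. 0 < \<gamma> \<and> \<gamma> \<le> 1 \<and>
     (\<forall>p\<in>{0..T} \<times> UNIV. \<forall>q\<in>{0..T} \<times> UNIV.
        \<bar>case_prod f p - case_prod f q\<bar> \<le> K * dist p q powr \<gamma>))"

definition alpha :: "real \<Rightarrow> real" where
  "alpha \<theta> = 2 / (2 + \<theta>)"

definition phi :: "real \<Rightarrow> real \<Rightarrow> real \<Rightarrow> real" where
  "phi \<theta> R r = max 0 (1/2 * alpha \<theta> * (1 - alpha \<theta>) * (R\<^sup>2 - r\<^sup>2)) powr (1 / \<theta>)"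

definition profile_radius :: "real \<Rightarrow> real \<Rightarrow> bool" where
  "profile_radius \<theta> R \<longleftrightarrow> 0 < R \<and> (LINT r|lborel. phi \<theta> R r) = 1"

definition prob_density :: "(real \<Rightarrow> real) \<Rightarrow> bool" where
  "prob_density f \<longleftrightarrow> f \<in> borel_measurable borel \<and> (\<forall>x. 0 \<le> f x) \<and>
     (LINT x|lborel. f x) = 1"

definition terminal_density :: "real \<Rightarrow> real \<Rightarrow> real \<Rightarrow> (real \<Rightarrow> real) \<Rightarrow> bool" where
  "terminal_density \<theta> a b mT \<longleftrightarrow>
     a < b \<and> prob_density mT \<and> (\<forall>x. x \<notin> {a..b} \<longrightarrow> mT x = 0) \<and>
     (\<forall>n. \<forall>x\<in>{a<..<b}. (deriv ^^ n) mT differentiable (at x)) \<and>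
     (\<exists>\<sigma>>0. \<exists>K. (\<forall>x\<in>{a<..<b}. (\<lambda>y. mT y powr \<theta>) differentiable (at x)) \<and>
        (\<forall>x\<in>{a<..<b}. \<forall>y\<in>{a<..<b}.
           \<bar>deriv (\<lambda>z. mT z powr \<theta>) x - deriv (\<lambda>z. mT z powr \<theta>) y\<bar> \<le> K * \<bar>x - y\<bar> powr \<sigma>)) \<and>
     (\<exists>C0>1. \<forall>x\<in>{a..b}.
        inverse C0 * infdist x {a, b} powr (1 / \<theta>) \<le> mT x \<and>
        mT x \<le> C0 * infdist x {a, b} powr (1 / \<theta>))"

abbreviation law :: "(real \<Rightarrow> real) \<Rightarrow> real measure" where
  "law f \<equiv> density lborel (\<lambda>x. ennreal (f x))"

text \<open>The single unknown \<open>m\<close> of the system is both a curve of probability measures on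
  \<open>[0,T]\<close> and a continuous function on \<open>(0,T) \<times> \<real>\<close>.  It is represented by
  the curve \<open>\<mu>\<close> together with its density \<open>m\<close>.\<close>

definition weakly_continuous_curve :: "real \<Rightarrow> (real \<Rightarrow> real measure) \<Rightarrow> bool" where
  "weakly_continuous_curve T \<mu> \<longleftrightarrow>
     (\<forall>t\<in>{0..T}. real_distribution (\<mu> t)) \<and>
     (\<forall>f::real \<Rightarrow> real. continuous_on UNIV f \<and> bounded (range f) \<longrightarrow>
        continuous_on {0..T} (\<lambda>t. LINT x|\<mu> t. f x))"

definition mfg_solution ::
  "real \<Rightarrow> real \<Rightarrow> real measure \<Rightarrow> real measure \<Rightarrow>
   (real \<Rightarrow> real \<Rightarrow> real) \<Rightarrow> (real \<Rightarrow> real measure) \<Rightarrow> (real \<Rightarrow> real \<Rightarrow> real) \<Rightarrow> bool" where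
  "mfg_solution \<theta> T \<mu>0 \<mu>T u \<mu> m \<longleftrightarrow>
     Ck_on 1 (strip T) u \<and>
     weakly_continuous_curve T \<mu> \<and>
     continuous_on (strip T) (\<lambda>(t, x). m t x) \<and>
     (\<forall>t\<in>{0<..<T}. (\<forall>x. 0 \<le> m t x) \<and> \<mu> t = law (m t)) \<and>
     (\<forall>t\<in>{0<..<T}. \<forall>x. - dt u t x + 1/2 * (dx u t x)\<^sup>2 = m t x powr \<theta>) \<and>
     (\<forall>\<psi>. test_fun T \<psi> \<longrightarrow>
        (LINT p:strip T|lborel.
           (case p of (t, x) \<Rightarrow> - m t x * dt \<psi> t x + m t x * dx u t x * dx \<psi> t x)) = 0) \<and>
     \<mu> 0 = \<mu>0 \<and> \<mu> T = \<mu>T"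

text \<open>In \<open>approximating_family\<close>, \<open>U \<epsilon>\<close> and \<open>M \<epsilon>\<close> are \<open>u\<^sup>(\<^sup>\<epsilon>\<^sup>)\<close> and
  \<open>m\<^sup>(\<^sup>\<epsilon>\<^sup>)\<close>, the latter having a density at every \<open>t \<in> [0,T]\<close>.
  For \<open>t = 0\<close> and \<open>t = T\<close> the derivative of \<open>U \<epsilon> t\<close> is the almost everywhere derivative of a
  Lipschitz function.\<close>

definition approx_initial :: "real \<Rightarrow> real \<Rightarrow> real \<Rightarrow> real \<Rightarrow> real" where
  "approx_initial \<theta> R \<epsilon> x =
     \<epsilon> powr (- alpha \<theta>) * phi \<theta> R (\<epsilon> powr (- alpha \<theta>) * x)"

definition approximating_family ::
  "real \<Rightarrow> real \<Rightarrow> real \<Rightarrow> (real \<Rightarrow> real) \<Rightarrow>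
   (real \<Rightarrow> real \<Rightarrow> real \<Rightarrow> real) \<Rightarrow> (real \<Rightarrow> real \<Rightarrow> real \<Rightarrow> real) \<Rightarrow> bool" where
  "approximating_family \<theta> T R mT U M \<longleftrightarrow>
     (\<forall>\<epsilon>\<in>{0<..<1}.
        mfg_solution \<theta> T (law (approx_initial \<theta> R \<epsilon>)) (law mT)
          (U \<epsilon>) (\<lambda>t. law (M \<epsilon> t)) (M \<epsilon>) \<and>
        M \<epsilon> 0 = approx_initial \<theta> R \<epsilon> \<and> M \<epsilon> T = mT \<and>
        (\<exists>L. L-lipschitz_on ({0..T} \<times> UNIV) (\<lambda>(t, x). U \<epsilon> t x)) \<and>
        globally_holder T (M \<epsilon>) \<and>
        Cinf_on {(t, x). t \<in> {0<..<T} \<and> 0 < M \<epsilon> t x} (U \<epsilon>) \<and>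
        Cinf_on {(t, x). t \<in> {0<..<T} \<and> 0 < M \<epsilon> t x} (M \<epsilon>) \<and>
        (LINT x|lborel. U \<epsilon> T x * mT x) = 0) \<and>
     (\<exists>C. \<forall>\<epsilon>\<in>{0<..<1}. \<forall>t\<in>{0..T}. AE x in lborel.
        M \<epsilon> t x = 0 \<longrightarrow> \<bar>dx (U \<epsilon>) t x\<bar> \<le> C * (t + \<epsilon>) powr (alpha \<theta> - 1))"

definition loc_uniform_limit ::
  "real \<Rightarrow> (nat \<Rightarrow> real \<Rightarrow> real \<Rightarrow> real) \<Rightarrow> (real \<Rightarrow> real \<Rightarrow> real) \<Rightarrow> bool" where
  "loc_uniform_limit T F f \<longleftrightarrow>
     (\<forall>K. compact K \<and> K \<subseteq> strip T \<longrightarrow>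
        uniform_limit K (\<lambda>k (t, x). F k t x) (\<lambda>(t, x). f t x) sequentially)"

definition constructed_solution ::
  "real \<Rightarrow> real \<Rightarrow> (real \<Rightarrow> real) \<Rightarrow>
   (real \<Rightarrow> real \<Rightarrow> real \<Rightarrow> real) \<Rightarrow> (real \<Rightarrow> real \<Rightarrow> real \<Rightarrow> real) \<Rightarrow>
   (real \<Rightarrow> real \<Rightarrow> real) \<Rightarrow> (real \<Rightarrow> real \<Rightarrow> real) \<Rightarrow> bool" where
  "constructed_solution \<theta> T mT U M u m \<longleftrightarrow>
     (\<exists>\<mu>. mfg_solution \<theta> T (return borel 0) (law mT) u \<mu> m) \<and>
     (\<exists>\<epsilon>. (\<forall>k. \<epsilon> k \<in> {0<..<1}) \<and> \<epsilon> \<longlonglongrightarrow> 0 \<and>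
        loc_uniform_limit T (\<lambda>k. U (\<epsilon> k)) u \<and> loc_uniform_limit T (\<lambda>k. M (\<epsilon> k)) m)"

definition Linf :: "(real \<Rightarrow> real) \<Rightarrow> bool" where
  "Linf f \<longleftrightarrow> f \<in> borel_measurable lborel \<and> (\<exists>C. AE x in lborel. \<bar>f x\<bar> \<le> C)"

text \<open>Membership in \<open>L\<^sup>\<infinity>\<close> is part of the notion; otherwise the Bochner integrals below
  could be \<open>0\<close> for lack of integrability.\<close>

definition weak_star_tendsto ::
  "('i \<Rightarrow> real \<Rightarrow> real) \<Rightarrow> (real \<Rightarrow> real) \<Rightarrow> 'i filter \<Rightarrow> bool" where
  "weak_star_tendsto f g F \<longleftrightarrow>
     (\<forall>\<^sub>F i in F. Linf (f i)) \<and> Linf g \<and>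
     (\<forall>h. integrable lborel h \<longrightarrow>
        ((\<lambda>i. LINT x|lborel. f i x * h x) \<longlongrightarrow> (LINT x|lborel. g x * h x)) F)"

end

theory Submission
  imports Defs "HOL-Computational_Algebra.Polynomial"
begin

text \<open>
  Write \<open>\<tau> = t + \<epsilon>\<close> and compare \<open>m\<^sup>(\<^sup>\<epsilon>\<^sup>)(t)\<close> with the self-similar density
  \<open>\<tau>\<^sup>-\<^sup>\<alpha> \<phi>(\<tau>\<^sup>-\<^sup>\<alpha> x)\<close>, which has the same initial value.  Let \<open>\<Delta>(t)\<close> be half the squared Wasserstein
  distance of the two, realised by the monotone map \<open>S = \<tau>\<^sup>\<alpha> \<eta>(F)\<close>, where \<open>F\<close> is the distribution function of
  \<open>m\<^sup>(\<^sup>\<epsilon>\<^sup>)(t)\<close> and \<open>\<eta>\<close> the quantile function of \<open>\<phi>\<close>.  Displacement convexity of the energy, tested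
  through the Hamilton-Jacobi equation, shows that \<open>\<Delta>' - (1 + \<alpha>) \<Delta> / \<tau>\<close> is
  nondecreasing.  Hence \<open>\<Delta> / \<tau>\<^sup>1\<^sup>+\<^sup>\<alpha>\<close> is quasi-convex, and since \<open>\<Delta>(0) = 0\<close> it is bounded
  uniformly in \<open>\<epsilon>\<close>.  As \<open>1 + \<alpha> > 2 \<alpha>\<close>, the rescaled distance tends to \<open>0\<close>, which gives the
  convergence against Lipschitz functions.  It extends to \<open>L\<^sup>1\<close> because \<open>\<tau>\<^sup>\<alpha> m\<^sup>(\<^sup>\<epsilon>\<^sup>)\<close> is uniformly bounded:
  the bound on \<open>u\<^sub>x\<close> in the vacuum confines the support to \<open>|x| \<le> Q \<tau>\<^sup>\<alpha>\<close>, and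
  then the maximum principle applies to \<open>log m + \<alpha> log \<tau> + k x\<^sup>2 / \<tau>\<^sup>2\<^sup>\<alpha>\<close>.
\<close>

section \<open>Smooth bumps and weak derivatives\<close>

text \<open>Two regularisations replace it. The quantile function \<open>eta\<close> has infinite
  slope at 0 and 1, so its argument is squeezed by \<kappa>; the defect \<open>err\<close> tends to
  0 with \<kappa>. The term of the first derivative that contains \<open>dx U\<close> becomes a
  difference quotient of \<open>U\<close> between x and x + l (S - x): its time derivative involves
  first derivatives of \<open>U\<close> only, and the Hamilton-Jacobi equation at the two points
  bounds it from below. First l, then \<kappa>, tends to 0. The exponent: with p in place of 1 +
  \<alpha> the argument leaves the quadratic form V^2 - p z V + (p - \<alpha> (1 - \<alpha>)) z^2 /
  2 in the relative velocity V and z = (x - S) / \<tau>. It is nonnegative iff (p - 1)^2 \<le>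
  \<alpha>^2 + (1 - \<alpha>)^2. The choice p = 1 + \<alpha> satisfies this and exceeds 2 \<alpha>,
  as the decay requires.\<close>

definition bump :: "real poly \<Rightarrow> nat \<Rightarrow> real \<Rightarrow> real" where
  "bump p k x = (if 0 < x \<and> x < 1
     then poly p x * (1 / (x * (1 - x))) ^ k * exp (- (1 / (x * (1 - x)))) else 0)"

text \<open>Product rule with the factor w^(k+2) taken out, where w = 1 / (x (1 - x));
  \<open>[:0,1,-1:]\<close> is 1 / w and \<open>[:1,-2:]\<close> its derivative. The parameters
  \<open>p\<close> and \<open>k\<close> of \<open>bump\<close> exist so that the class is closed
  under differentiation.\<close>

definition bump_deriv_poly :: "real poly \<Rightarrow> nat \<Rightarrow> real poly" where
  "bump_deriv_poly p k = pderiv p * [:0,1,-1:]^2 + p * [:1,-2:] - smult (real k) (p * [:1,-2:] * [:0,1,-1:])"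

lemma exp_ge_power: "0 \<le> x \<Longrightarrow> x ^ n / fact n \<le> exp (x::real)"
proof -
  assume x: "0 \<le> x"
  have "(\<Sum>i\<in>{n}. inverse (fact i) * x ^ i) \<le> (\<Sum>i. inverse (fact i) * x ^ i)"
    using summable_exp[of x] x by (intro sum_le_suminf) auto
  then show ?thesis by (simp add: exp_def field_simps divideR_right scaleR_conv_of_real)
qed

lemma has_real_derivative_zero_quadratic:
  fixes f :: "real \<Rightarrow> real"
  assumes "\<And>x. \<bar>f x\<bar> \<le> C * (x - c)\<^sup>2"
  shows "(f has_real_derivative 0) (at c)"
proof -
  have fc: "f c = 0" using assms[of c] by simp
  have "((\<lambda>x. (f x - f c) / (x - c)) \<longlongrightarrow> 0) (at c)"
  proof (rule Lim_null_comparison)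
    show "\<forall>\<^sub>F x in at c. norm ((f x - f c) / (x - c)) \<le> C * \<bar>x - c\<bar>"
    proof (rule eventually_at_filter[THEN iffD2], rule always_eventually, intro allI impI)
      fix x assume "x \<noteq> c"
      then have "0 < \<bar>x - c\<bar>" "(x - c)\<^sup>2 = \<bar>x - c\<bar> * \<bar>x - c\<bar>"
        by (auto simp: power2_eq_square)
      then show "norm ((f x - f c) / (x - c)) \<le> C * \<bar>x - c\<bar>"
        using assms[of x] by (simp only: fc diff_0_right real_norm_def abs_divide pos_divide_le_eq mult.assoc)
    qed
    show "((\<lambda>x. C * \<bar>x - c\<bar>) \<longlongrightarrow> 0) (at c)"
      by (rule tendsto_eq_intros refl | simp)+
  qed
  then show ?thesis by (simp add: has_field_derivative_iff)
qed

text \<open>At 0 and 1 the derivative cannot be read off the formula; a quadratic bound at each end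
  gives derivative 0 there. It comes from exp w \<ge> w^(k+2) / (k+2)!, so that w^k exp (- w) is at
  most (k+2)! / w^2 = (k+2)! x^2 (1 - x)^2.\<close>

lemma bump_bound: "\<exists>C\<ge>0. \<forall>x. \<bar>bump p k x\<bar> \<le> C * x\<^sup>2 \<and> \<bar>bump p k x\<bar> \<le> C * (1 - x)\<^sup>2"
proof -
  have "bounded (poly p ` {0..1})"
    by (intro compact_imp_bounded compact_continuous_image continuous_intros compact_Icc)
  then obtain B where "\<forall>y\<in>poly p ` {0..1}. norm y \<le> B" unfolding bounded_iff by blast
  then have B: "\<bar>poly p x\<bar> \<le> B" if "x \<in> {0..1}" for x using that by simp
  have B0: "0 \<le> B" using B[of 0] by auto
  have main: "\<bar>bump p k x\<bar> \<le> B * fact (k+2) * x\<^sup>2 * (1-x)\<^sup>2" if x: "0 < x" "x < 1" for x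
  proof -
    define w where "w = 1 / (x * (1 - x))"
    have w: "0 < w" using x by (simp add: w_def)
    define F :: real where "F = fact (k+2)"
    have F: "0 < F" by (simp add: F_def)
    have "w ^ (k+2) / F \<le> exp w" unfolding F_def using w by (intro exp_ge_power) auto
    then have "w ^ k * w\<^sup>2 \<le> F * exp w"
      using F by (simp only: pos_divide_le_eq power_add mult.commute)
    then have "w ^ k * exp (- w) \<le> F / w\<^sup>2"
      using w by (simp add: exp_minus pos_le_divide_eq divide_le_eq field_simps)
    moreover have "1 / w\<^sup>2 = x\<^sup>2 * (1 - x)\<^sup>2" by (simp add: w_def power_divide power_mult_distrib)
    ultimately have 1: "w ^ k * exp (- w) \<le> fact (k+2) * (x\<^sup>2 * (1 - x)\<^sup>2)"
      unfolding F_def by (metis mult.right_neutral times_divide_eq_right)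
    have "\<bar>bump p k x\<bar> = \<bar>poly p x\<bar> * (w ^ k * exp (- w))"
      using x w by (simp add: bump_def w_def abs_mult)
    also have "\<dots> \<le> B * (fact (k+2) * (x\<^sup>2 * (1 - x)\<^sup>2))"
      using B[of x] x 1 w B0 by (intro mult_mono[of "\<bar>poly p x\<bar>" B "w ^ k * exp (- w)"]) auto
    finally show ?thesis by (simp add: mult_ac)
  qed
  show ?thesis
  proof (intro exI[of _ "B * fact (k+2)"] conjI allI)
    fix x :: real
    have c: "0 \<le> B * fact (k+2)" using B0 by simp
    show "\<bar>bump p k x\<bar> \<le> B * fact (k + 2) * x\<^sup>2"
    proof (cases "0 < x \<and> x < 1")
      case True
      have "B * fact (k+2) * x\<^sup>2 * (1-x)\<^sup>2 \<le> B * fact (k+2) * x\<^sup>2 * 1"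
        using True c B0 by (intro mult_left_mono power_le_one mult_nonneg_nonneg) auto
      with main[of x] True show ?thesis by simp
    qed (use c in \<open>auto simp: bump_def\<close>)
    show "\<bar>bump p k x\<bar> \<le> B * fact (k + 2) * (1-x)\<^sup>2"
    proof (cases "0 < x \<and> x < 1")
      case True
      have "(B * fact (k+2) * (1-x)\<^sup>2) * x\<^sup>2 \<le> B * fact (k+2) * (1-x)\<^sup>2 * 1"
        using True c B0 by (intro mult_left_mono power_le_one mult_nonneg_nonneg) auto
      with main[of x] True show ?thesis by (simp add: mult_ac)
    qed (use c in \<open>auto simp: bump_def\<close>)
  qed (use B0 in simp)
qed

lemma bump_has_derivative:
  "(bump p k has_real_derivative bump (bump_deriv_poly p k) (k + 2) x) (at x)"
proof -
  consider "x < 0" | "x > 1" | "x = 0" | "x = 1" | "0 < x" "x < 1" by linarith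
  then show ?thesis
  proof cases
    case 1
    have "((\<lambda>_. 0) has_real_derivative 0) (at x)" by simp
    then have "(bump p k has_real_derivative 0) (at x)"
      by (rule has_field_derivative_transform_within_open[of _ _ _ "{..<0}"]) (use 1 in \<open>auto simp: bump_def\<close>)
    with 1 show ?thesis by (simp add: bump_def[of _ _ x])
  next
    case 2
    have "((\<lambda>_. 0) has_real_derivative 0) (at x)" by simp
    then have "(bump p k has_real_derivative 0) (at x)"
      by (rule has_field_derivative_transform_within_open[of _ _ _ "{1<..}"]) (use 2 in \<open>auto simp: bump_def\<close>)
    with 2 show ?thesis by (simp add: bump_def[of _ _ x])
  next
    case 3
    obtain C where "\<And>x. \<bar>bump p k x\<bar> \<le> C * x\<^sup>2" using bump_bound by blast
    then have "(bump p k has_real_derivative 0) (at 0)"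
      by (intro has_real_derivative_zero_quadratic[of _ C]) simp
    with 3 show ?thesis by (simp add: bump_def[of "bump_deriv_poly _ _"])
  next
    case 4
    obtain C where "\<And>x. \<bar>bump p k x\<bar> \<le> C * (1-x)\<^sup>2" using bump_bound by blast
    then have "(bump p k has_real_derivative 0) (at 1)"
      by (intro has_real_derivative_zero_quadratic[of _ C]) (simp add: power2_commute)
    with 4 show ?thesis by (simp add: bump_def[of "bump_deriv_poly _ _"])
  next
    case 5
    define w where "w = (\<lambda>x::real. 1 / (x * (1 - x)))"
    have w0: "w x \<noteq> 0" "w x * (x * (1-x)) = 1" using 5 by (auto simp: w_def)
    have dw: "(w has_real_derivative - (1 - 2 * x) * (w x)\<^sup>2) (at x)"
      unfolding w_def using 5
      by (auto intro!: derivative_eq_intros simp: power2_eq_square divide_simps)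
    have dp: "((\<lambda>x. w x ^ k) has_real_derivative real k * w x ^ (k - 1) * (- (1 - 2 * x) * (w x)\<^sup>2)) (at x)"
      by (rule derivative_eq_intros dw refl)+ simp
    have rk: "real k * w x ^ (k - 1) * (- (1 - 2 * x) * (w x)\<^sup>2) = - real k * (1 - 2*x) * w x ^ (k+1)"
      by (cases k) (simp_all add: power2_eq_square algebra_simps)
    have "((\<lambda>x. poly p x * w x ^ k * exp (- w x)) has_real_derivative
      poly (bump_deriv_poly p k) x * w x ^ (k+2) * exp (- w x)) (at x)"
    proof (rule DERIV_cong)
      show "((\<lambda>x. poly p x * w x ^ k * exp (- w x)) has_real_derivative
        (poly p x * w x ^ k) * (exp (- w x) * (- (- (1 - 2 * x) * (w x)\<^sup>2)))
        + (poly p x * (- real k * (1 - 2*x) * w x ^ (k+1)) + poly (pderiv p) x * w x ^ k) * exp (- w x)) (at x)"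
        by (rule DERIV_mult' DERIV_chain2[OF DERIV_exp] DERIV_minus dw dp[unfolded rk] poly_DERIV)+
      define y where "y = x * (1 - x)"
      have wy: "w x * y = 1" using w0(2) by (simp add: y_def)
      have e: "w x ^ k = w x ^ (k+2) * y\<^sup>2" "w x ^ (k+1) = w x ^ (k+2) * y"
      proof -
        have "w x ^ (k+2) * y\<^sup>2 = w x ^ k * (w x * y)\<^sup>2"
          by (simp only: power_add power_mult_distrib mult.assoc)
        then show "w x ^ k = w x ^ (k+2) * y\<^sup>2" by (simp add: wy)
        have "w x ^ (k+2) * y = w x ^ (k+1) * (w x * y)" by simp
        then show "w x ^ (k+1) = w x ^ (k+2) * y" by (simp add: wy)
      qed
      have pl: "poly [:0,1,-1:] x = y" "poly [:1,-2:] x = 1 - 2 * x"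
        by (simp_all add: y_def algebra_simps)
      have e2: "w x ^ k * (w x)\<^sup>2 = w x ^ (k+2)" by (simp add: power_add power2_eq_square)
      show "(poly p x * w x ^ k) * (exp (- w x) * (- (- (1 - 2 * x) * (w x)\<^sup>2)))
        + (poly p x * (- real k * (1 - 2*x) * w x ^ (k+1)) + poly (pderiv p) x * w x ^ k) * exp (- w x)
        = poly (bump_deriv_poly p k) x * w x ^ (k+2) * exp (- w x)" (is "?l = ?r")
      proof -
        have "?l = (poly p x * (w x ^ k * (w x)\<^sup>2) * (1 - 2*x)
           + poly p x * (- real k * (1 - 2*x) * w x ^ (k+1)) + poly (pderiv p) x * w x ^ k) * exp (- w x)"
          by (simp add: algebra_simps)
        also have "\<dots> = ?r"
          unfolding e2 unfolding e bump_deriv_poly_def poly_diff poly_add poly_mult poly_smult poly_power pl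
          by (simp add: algebra_simps)
        finally show ?thesis .
      qed
    qed
    then have "(bump p k has_real_derivative poly (bump_deriv_poly p k) x * w x ^ (k+2) * exp (- w x)) (at x)"
      by (rule has_field_derivative_transform_within_open[of _ _ _ "{0<..<1}"]) (use 5 in \<open>auto simp: bump_def w_def\<close>)
    with 5 show ?thesis by (simp add: bump_def[of _ _ x] w_def)
  qed
qed

section \<open>Smooth functions of one variable and separated test functions\<close>

definition smooth :: "(real \<Rightarrow> real) \<Rightarrow> bool" where
  "smooth f \<longleftrightarrow> (\<forall>n x. (deriv ^^ n) f differentiable (at x))"

lemma smooth_if_derivative:
  assumes "\<And>x. (f has_real_derivative f' x) (at x)" "smooth f'"
  shows "smooth f"
  unfolding smooth_def
proof (intro allI)
  fix n x
  have "deriv f = f'" using assms(1) DERIV_imp_deriv by blast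
  then show "(deriv ^^ n) f differentiable (at x)"
    using assms by (cases n) (auto simp: smooth_def funpow_Suc_right real_differentiable_def simp del: funpow.simps(2))
qed

lemma smooth_deriv: "smooth f \<Longrightarrow> smooth (deriv f)"
  unfolding smooth_def by (metis funpow_Suc_right comp_apply)

lemma smooth_has_deriv: "smooth f \<Longrightarrow> (f has_real_derivative deriv f x) (at x)"
  unfolding smooth_def
  by (metis DERIV_deriv_iff_real_differentiable funpow_0)

text \<open>Invariance of a set of functions under differentiation replaces an induction on the
  order for each family: all iterated derivatives stay in the set and hence are
  differentiable.\<close>

lemma smooth_coinduct:
  assumes "f \<in> S" and step: "\<And>f. f \<in> S \<Longrightarrow> \<exists>f'\<in>S. \<forall>x. (f has_real_derivative f' x) (at x)"
  shows "smooth f"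
proof -
  have d: "deriv f \<in> S \<and> (\<forall>x. (f has_real_derivative deriv f x) (at x))" if f: "f \<in> S" for f
  proof -
    obtain f' where f': "f' \<in> S" "\<forall>x. (f has_real_derivative f' x) (at x)" using step[OF f] by auto
    then have "deriv f = f'" using DERIV_imp_deriv by blast
    with f' show ?thesis by simp
  qed
  have "(deriv ^^ n) f \<in> S" for n by (induction n) (use assms(1) d in auto)
  then show ?thesis using d by (auto simp: smooth_def real_differentiable_def)
qed

lemma smooth_bump: "smooth (bump p k)"
  by (rule smooth_coinduct[of _ "{bump p k |p k. True}"]) (use bump_has_derivative in blast)+

lemma smooth_continuous: "smooth f \<Longrightarrow> continuous_on S f"
  by (meson DERIV_isCont continuous_at_imp_continuous_on smooth_has_deriv)

lemma smooth_affine: assumes "smooth f" shows "smooth (\<lambda>x. k * f (c * x + d))"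
proof (rule smooth_coinduct[of _ "{\<lambda>x. k * f (c * x + d) |f k. smooth f}"])
  fix g assume "g \<in> {\<lambda>x. k * f (c * x + d) |f k. smooth f}"
  then obtain f k where g: "g = (\<lambda>x. k * f (c * x + d))" "smooth f" by auto
  have "(g has_real_derivative (k * c) * deriv f (c * x + d)) (at x)" for x
    unfolding g(1) by (auto intro!: derivative_eq_intros DERIV_chain2[OF smooth_has_deriv[OF g(2)]])
  moreover have "(\<lambda>x. (k * c) * deriv f (c * x + d)) \<in> {\<lambda>x. k * f (c * x + d) |f k. smooth f}"
    using smooth_deriv[OF g(2)] by blast
  ultimately show "\<exists>f'\<in>{\<lambda>x. k * f (c * x + d) |f k. smooth f}. \<forall>x. (g has_real_derivative f' x) (at x)"
    by (intro bexI[of _ "\<lambda>x. (k * c) * deriv f (c * x + d)"]) auto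
qed (use assms in blast)

lemma smooth_diff: assumes "smooth f" "smooth g" shows "smooth (\<lambda>x. f x - g x)"
proof (rule smooth_coinduct[of _ "{\<lambda>x. f x - g x |f g. smooth f \<and> smooth g}"])
  fix h assume "h \<in> {\<lambda>x. f x - g x |f g. smooth f \<and> smooth g}"
  then obtain f g where g: "h = (\<lambda>x. f x - g x)" "smooth f" "smooth g" by auto
  have "(h has_real_derivative deriv f x - deriv g x) (at x)" for x
    unfolding g(1) by (intro DERIV_diff smooth_has_deriv g)
  then show "\<exists>f'\<in>{\<lambda>x. f x - g x |f g. smooth f \<and> smooth g}. \<forall>x. (h has_real_derivative f' x) (at x)"
    using smooth_deriv[OF g(2)] smooth_deriv[OF g(3)]
    by (intro bexI[of _ "\<lambda>x. deriv f x - deriv g x"]) auto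
qed (use assms in blast)

lemma Ck_on_product:
  "smooth p \<Longrightarrow> smooth q \<Longrightarrow> Ck_on n UNIV (\<lambda>t x. p t * q x)"
proof (induction n arbitrary: p q)
  case 0
  then show ?case
    by (auto simp: case_prod_unfold intro!: continuous_intros continuous_on_compose2[OF smooth_continuous[of p UNIV]] continuous_on_compose2[OF smooth_continuous[of q UNIV]])
next
  case (Suc n)
  have 1: "dt (\<lambda>t x. p t * q x) = (\<lambda>t x. deriv p t * q x)"
    by (intro ext DERIV_imp_deriv DERIV_cmult_right smooth_has_deriv Suc)
  have 2: "dx (\<lambda>t x. p t * q x) = (\<lambda>t x. p t * deriv q x)"
    by (intro ext DERIV_imp_deriv DERIV_cmult smooth_has_deriv Suc)
  have 3: "continuous_on UNIV (\<lambda>(t, x). p t * q x)"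
    by (auto simp: case_prod_unfold intro!: continuous_intros continuous_on_compose2[OF smooth_continuous[of p UNIV]] continuous_on_compose2[OF smooth_continuous[of q UNIV]] Suc)
  have 4: "(\<lambda>s. p s * q x) differentiable (at t)" "(\<lambda>x. p t * q x) differentiable (at x)" for t x
    using DERIV_cmult_right[OF smooth_has_deriv[OF Suc.prems(1)]] DERIV_cmult[OF smooth_has_deriv[OF Suc.prems(2)]]
    by (meson real_differentiable_def)+
  have 5: "\<forall>(t, x)\<in>UNIV. (\<lambda>s. p s * q x) differentiable at t \<and> (\<lambda>x. p t * q x) differentiable at x"
    using 4 by simp
  show ?case unfolding Ck_on.simps 1 2 using 3 5 Suc.IH[OF smooth_deriv[OF Suc.prems(1)] Suc.prems(2)] Suc.IH[OF Suc.prems(1) smooth_deriv[OF Suc.prems(2)]]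
    by (intro conjI)
qed

text \<open>Products are the only test functions inserted into the weak equation; separating the
  variables lets \<open>box_identity\<close> treat time and space one after the other.\<close>

lemma test_fun_product:
  assumes "smooth p" "smooth q" "0 < t1" "t2 < T"
    "\<And>t. t \<notin> {t1..t2} \<Longrightarrow> p t = 0" "\<And>x. x \<notin> {x1..x2} \<Longrightarrow> q x = 0"
  shows "test_fun T (\<lambda>t x. p t * q x)"
  unfolding test_fun_def Cinf_on_def
proof (intro conjI allI exI[of _ "{t1..t2} \<times> {x1..x2}"])
  show "Ck_on n UNIV (\<lambda>t x. p t * q x)" for n using assms Ck_on_product by blast
  show "compact ({t1..t2} \<times> {x1..x2})" by (intro compact_Times) auto
qed (use assms in auto)

lemma smooth_step_exists:
  "\<exists>\<sigma> \<beta>. smooth \<sigma> \<and> smooth \<beta> \<and> (\<forall>x. (\<sigma> has_real_derivative \<beta> x) (at x)) \<and> (\<forall>x. 0 \<le> \<beta> x)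
     \<and> (\<forall>x. x \<notin> {0..1} \<longrightarrow> \<beta> x = 0) \<and> (\<forall>x\<le>0. \<sigma> x = 0) \<and> (\<forall>x\<ge>1. \<sigma> x = (1::real))"
proof -
  define b where "b = bump 1 0"
  have b: "smooth b" "continuous_on S b" for S using smooth_bump smooth_continuous by (auto simp: b_def)
  have b0: "0 \<le> b x" "x \<notin> {0..1} \<Longrightarrow> b x = 0" for x by (auto simp: b_def bump_def)
  define c where "c = integral {0..1} b"
  have bI: "b integrable_on {x..y}" for x y using b(2) by (rule integrable_continuous_interval)
  have "c > 0"
  proof -
    have "c \<noteq> 0"
    proof
      assume "c = 0"
      then have "b (1/2) = 0"
        unfolding c_def using integral_eq_0_iff[of 0 1 b] b b0 by (auto)
      then show False by (simp add: b_def bump_def)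
    qed
    moreover have "c \<ge> 0" unfolding c_def using b0 by (intro integral_nonneg bI) auto
    ultimately show ?thesis by simp
  qed
  \<comment> \<open>The lower limit -1 leaves room to the left of 0: the cases x > -1 and x < 0,
    treated in \<open>d1\<close> and \<open>d2\<close>, overlap and cover the line.\<close>
  define \<sigma> where "\<sigma> = (\<lambda>x. (integral {-1..x} b - 0) / c)"
  have z: "integral {-1..x} b = 0" if "x \<le> 0" for x
  proof -
    have "integral {-1..x} b = integral {-1..x} (\<lambda>_. 0)"
      by (rule integral_cong) (use that b0(2) in \<open>auto simp: b_def bump_def\<close>)
    then show ?thesis by simp
  qed
  have d1: "(\<sigma> has_real_derivative b x / c) (at x)" if x: "x > -1" for x
  proof -
    have "((\<lambda>u. integral {-1..u} b) has_real_derivative b x) (at x within {-1..x+1})"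
      by (rule integral_has_real_derivative) (use b x in auto)
    then have "((\<lambda>u. integral {-1..u} b) has_real_derivative b x) (at x)"
      using x by (simp add: at_within_Icc_at)
    then show ?thesis unfolding \<sigma>_def using \<open>c > 0\<close> by (auto intro!: derivative_eq_intros)
  qed
  have d2: "(\<sigma> has_real_derivative b x / c) (at x)" if x: "x < 0" for x
  proof -
    have "((\<lambda>_. 0) has_real_derivative 0) (at x)" by simp
    then have "(\<sigma> has_real_derivative 0) (at x)"
      by (rule has_field_derivative_transform_within_open[of _ _ _ "{..<0}"])
        (use x z in \<open>auto simp: \<sigma>_def\<close>)
    then show ?thesis using x by (simp add: b_def bump_def)
  qed
  have d: "(\<sigma> has_real_derivative (1/c) * b (1 * x + 0)) (at x)" for x
    using d1[of x] d2[of x] by (cases "x < 0") auto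
  have sb: "smooth (\<lambda>x. (1/c) * b (1 * x + 0))" by (rule smooth_affine[OF b(1)])
  have one: "\<sigma> x = 1" if "x \<ge> 1" for x
  proof -
    have "integral {-1..x} b = integral {-1..0} b + integral {0..x} b"
      using that by (intro Henstock_Kurzweil_Integration.integral_combine[symmetric] bI) auto
    also have "integral {0..x} b = integral {0..1} b + integral {1..x} b"
      using that by (intro Henstock_Kurzweil_Integration.integral_combine[symmetric] bI) auto
    also have "integral {1..x} b = integral {1..x} (\<lambda>_. 0)"
      by (rule integral_cong) (auto simp: b_def bump_def)
    finally show ?thesis using z[of 0] \<open>c > 0\<close> by (simp add: \<sigma>_def c_def)
  qed
  show ?thesis
  proof (intro exI conjI allI impI)
    show "smooth \<sigma>" using smooth_if_derivative[OF d sb] .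
    show "(\<sigma> has_real_derivative (1/c) * b (1 * x + 0)) (at x)" for x by (rule d)
    show "\<sigma> x = 0" if "x \<le> 0" for x using z[OF that] by (simp add: \<sigma>_def)
  qed (use sb \<open>c>0\<close> b0 one in auto)
qed

lemma smooth_bounded_continuous_integrable:
  "smooth p \<Longrightarrow> continuous_on {c..d} f \<Longrightarrow> (\<lambda>x. p x * f x) integrable_on {c..(d::real)}"
  by (rule integrable_continuous_interval[OF continuous_on_mult[OF smooth_continuous]])

lemma abs_integral_le:
  fixes f :: "real \<Rightarrow> real"
  assumes "f integrable_on S" "g integrable_on S" "\<And>x. x \<in> S \<Longrightarrow> \<bar>f x\<bar> \<le> g x"
  shows "\<bar>integral S f\<bar> \<le> integral S g"
  using Henstock_Kurzweil_Integration.integral_norm_bound_integral[of f S g] assms by simp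

text \<open>Du Bois-Reymond: testing with differences of translates of an approximate step shows that
  a function with vanishing distributional derivative takes equal values at any two points.\<close>

lemma du_bois_reymond:
  fixes W :: "real \<Rightarrow> real"
  assumes W: "continuous_on {c..d} W"
    and test: "\<And>p p' c' d'. smooth p \<Longrightarrow> smooth p' \<Longrightarrow> (\<And>x. (p has_real_derivative p' x) (at x)) \<Longrightarrow>
      c < c' \<Longrightarrow> c' < d' \<Longrightarrow> d' < d \<Longrightarrow> (\<And>x. x \<notin> {c'..d'} \<Longrightarrow> p x = 0) \<Longrightarrow> integral {c..d} (\<lambda>x. p' x * W x) = 0"
    and t: "c < t1" "t1 < t2" "t2 < d"
  shows "W t1 = W t2"
proof (rule ccontr)
  assume ne: "W t1 \<noteq> W t2"
  obtain \<sigma> \<beta> where s: "smooth \<sigma>" "smooth \<beta>" "\<And>x. (\<sigma> has_real_derivative \<beta> x) (at x)" "\<And>x. 0 \<le> \<beta> x"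
     "\<And>x. x \<notin> {0..1} \<Longrightarrow> \<beta> x = 0" "\<And>x. x \<le> 0 \<Longrightarrow> \<sigma> x = 0" "\<And>x. x \<ge> 1 \<Longrightarrow> \<sigma> x = (1::real)"
    using smooth_step_exists by metis
  define e where "e = \<bar>W t1 - W t2\<bar> / 2"
  have e: "0 < e" using ne by (simp add: e_def)
  have near: "\<exists>\<delta>>0. \<forall>x\<in>{t..t+\<delta>}. \<bar>W x - W t\<bar> < e" if "c < t" "t < d" for t
  proof -
    have "isCont W t" using W that by (auto simp: continuous_on_interior interior_atLeastAtMost_real)
    then obtain \<delta> where "\<delta> > 0" "\<forall>x. dist x t < \<delta> \<longrightarrow> dist (W x) (W t) < e"
      using e by (metis continuous_at_eps_delta dist_real_def)
    then show ?thesis by (intro exI[of _ "\<delta>/2"]) (auto simp: dist_real_def)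
  qed
  obtain \<delta>1 where d1: "\<delta>1 > 0" "\<And>x. x\<in>{t1..t1+\<delta>1} \<Longrightarrow> \<bar>W x - W t1\<bar> < e" using near[of t1] t by auto
  obtain \<delta>2 where d2: "\<delta>2 > 0" "\<And>x. x\<in>{t2..t2+\<delta>2} \<Longrightarrow> \<bar>W x - W t2\<bar> < e" using near[of t2] t by auto
  define \<delta> where "\<delta> = Min {\<delta>1, \<delta>2, (d - t2) / 2}"
  have d: "0 < \<delta>" "\<delta> \<le> \<delta>1" "\<delta> \<le> \<delta>2" "t2 + \<delta> < d"
  proof -
    have "t2 + (d - t2) / 2 < d" using t by (auto simp: field_simps)
    moreover have "\<delta> \<le> (d - t2) / 2" unfolding \<delta>_def by (rule Min_le) auto
    ultimately show "t2 + \<delta> < d" by linarith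
  qed (use d1 d2 t in \<open>auto simp: \<delta>_def\<close>)
  \<comment> \<open>\<open>S t\<close> rises from 0 to 1 on [t, t + \<delta>] and \<open>B t\<close>
    is its derivative, a kernel of mass 1. The constant factors put both into the form of
    \<open>smooth_affine\<close>.\<close>
  define S where "S = (\<lambda>t x. 1 * \<sigma> ((1/\<delta>) * x + (- t / \<delta>)))"
  define B where "B = (\<lambda>t x. (1/\<delta>) * \<beta> ((1/\<delta>) * x + (- t / \<delta>)))"
  have SB: "smooth (S t)" "smooth (B t)" for t unfolding S_def B_def by (intro smooth_affine s)+
  have arg: "(1/\<delta>) * x + (- t / \<delta>) = (x - t) / \<delta>" for x t by (simp add: diff_divide_distrib)
  have SBd: "(S t has_real_derivative B t x) (at x)" for t x
  proof -
    have "((\<lambda>x. (1/\<delta>) * x + (- t / \<delta>)) has_real_derivative 1/\<delta>) (at x)"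
      using d(1) by (auto intro!: derivative_eq_intros)
    from DERIV_cmult[OF DERIV_chain2[OF s(3) this], of 1]
    show ?thesis by (simp add: S_def B_def)
  qed
  have S0: "S t x = 0" if "x \<le> t" for t x unfolding S_def arg using s(6) d(1) that by (simp add: divide_le_0_iff)
  have S1: "S t x = 1" if "x \<ge> t + \<delta>" for t x unfolding S_def arg using s(7)[of "(x-t)/\<delta>"] d(1) that by (simp add: le_divide_eq)
  have B0: "B t x = 0" if "x \<notin> {t..t+\<delta>}" for t x
  proof -
    have "x - t < 0 \<or> \<delta> < x - t" using that by auto
    then have "(x - t) / \<delta> \<notin> {0..1}" using d(1) by (auto simp: zero_le_divide_iff le_divide_eq divide_le_eq)
    then show ?thesis unfolding B_def arg by (simp add: s(5))
  qed
  have Bp: "0 \<le> B t x" for t x unfolding B_def using s(4) d(1) by simp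
  have int: "(\<lambda>x. B t x * f x) integrable_on {a..b}" if "continuous_on {a..b} f" for t f a b
    using SB that by (intro smooth_bounded_continuous_integrable)
  have Bint: "integral {c..d} (B t) = 1" if "c < t" "t + \<delta> < d" for t
  proof -
    have "(B t has_integral (S t d - S t c)) {c..d}"
      by (rule fundamental_theorem_of_calculus)
        (use t SBd in \<open>auto simp: has_real_derivative_iff_has_vector_derivative[symmetric] intro: DERIV_subset\<close>)
    then show ?thesis using S0[of c t] S1[of t d] that by (simp add: integral_unique)
  qed
  have close: "\<bar>integral {c..d} (\<lambda>x. B t x * W x) - W t\<bar> \<le> e0"
    if "c < t" "t + \<delta> < d" "\<And>x. x\<in>{t..t+\<delta>} \<Longrightarrow> \<bar>W x - W t\<bar> \<le> e0" for t e0
  proof -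
    have Bi: "B t integrable_on {c..d}" using int[of c d "\<lambda>_. 1" t] by simp
    have "integral {c..d} (\<lambda>x. B t x * W x) - W t = integral {c..d} (\<lambda>x. B t x * W x) - integral {c..d} (\<lambda>x. B t x * W t)"
      using Bint[OF that(1,2)] by simp
    also have "\<dots> = integral {c..d} (\<lambda>x. B t x * W x - B t x * W t)"
      by (intro Henstock_Kurzweil_Integration.integral_diff[symmetric] int W) simp
    finally have eq: "integral {c..d} (\<lambda>x. B t x * W x) - W t = integral {c..d} (\<lambda>x. B t x * (W x - W t))"
      by (simp add: algebra_simps)
    have "\<bar>integral {c..d} (\<lambda>x. B t x * (W x - W t))\<bar> \<le> integral {c..d} (\<lambda>x. B t x * e0)"
    proof (rule abs_integral_le)
      show "(\<lambda>x. B t x * (W x - W t)) integrable_on {c..d}" by (intro int continuous_intros W)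
      show "(\<lambda>x. B t x * e0) integrable_on {c..d}" by (intro int) simp
      fix x assume "x \<in> {c..d}"
      show "\<bar>B t x * (W x - W t)\<bar> \<le> B t x * e0"
        using B0[of x t] Bp[of t x] that(3)[of x] by (cases "x \<in> {t..t+\<delta>}") (auto simp: abs_mult intro: mult_left_mono)
    qed
    also have "\<dots> = e0" using Bint[OF that(1,2)] by simp
    finally show ?thesis by (simp add: eq)
  qed
  \<comment> \<open>On the compact interval the deviation attains a maximum, which is still below
    \<open>e\<close>. The strict gap matters because \<open>close\<close> yields only \<le>, while
    \<open>e\<close> is exactly half of the difference to be contradicted.\<close>
  have strict: "\<exists>e0<e. \<forall>x\<in>{t..t+\<delta>}. \<bar>W x - W t\<bar> \<le> e0"
    if "c < t" "t + \<delta> < d" "\<And>x. x\<in>{t..t+\<delta>} \<Longrightarrow> \<bar>W x - W t\<bar> < e" for t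
  proof -
    have "continuous_on {t..t+\<delta>} (\<lambda>x. \<bar>W x - W t\<bar>)"
      by (intro continuous_intros continuous_on_subset[OF W]) (use that in auto)
    then obtain z where "z \<in> {t..t+\<delta>}" "\<forall>y\<in>{t..t+\<delta>}. \<bar>W y - W t\<bar> \<le> \<bar>W z - W t\<bar>"
      using continuous_attains_sup[of "{t..t+\<delta>}" "\<lambda>x. \<bar>W x - W t\<bar>"] d(1) by auto
    then show ?thesis using that(3)[of z] by auto
  qed
  have tt: "t1 + \<delta> < d" using t d by simp
  obtain e1 where e1: "e1 < e" "\<forall>x\<in>{t1..t1+\<delta>}. \<bar>W x - W t1\<bar> \<le> e1"
    using strict[of t1] t tt d1(2) d(2) by force
  obtain e2 where e2: "e2 < e" "\<forall>x\<in>{t2..t2+\<delta>}. \<bar>W x - W t2\<bar> \<le> e2"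
    using strict[of t2] t d(4) d2(2) d(3) by force
  \<comment> \<open>The test function rises near t1 and falls again near t2, so its derivative
    compares the averages of \<open>W\<close> at the two points.\<close>
  have "integral {c..d} (\<lambda>x. (B t1 x - B t2 x) * W x) = 0"
  proof (rule test[of "\<lambda>x. S t1 x - S t2 x" _ t1 "t2 + \<delta>"])
    show "smooth (\<lambda>x. S t1 x - S t2 x)" "smooth (\<lambda>x. B t1 x - B t2 x)" by (intro smooth_diff SB)+
    show "((\<lambda>x. S t1 x - S t2 x) has_real_derivative B t1 x - B t2 x) (at x)" for x
      by (intro DERIV_diff SBd)
    show "S t1 x - S t2 x = 0" if "x \<notin> {t1..t2 + \<delta>}" for x
      using that S0[of x t1] S0[of x t2] S1[of t1 x] S1[of t2 x] t d(1) by (cases "x < t1") auto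
  qed (use t d in auto)
  moreover have "integral {c..d} (\<lambda>x. (B t1 x - B t2 x) * W x)
     = integral {c..d} (\<lambda>x. B t1 x * W x) - integral {c..d} (\<lambda>x. B t2 x * W x)"
    unfolding left_diff_distrib by (intro Henstock_Kurzweil_Integration.integral_diff int W)
  ultimately have "integral {c..d} (\<lambda>x. B t1 x * W x) = integral {c..d} (\<lambda>x. B t2 x * W x)" by simp
  moreover have "\<bar>integral {c..d} (\<lambda>x. B t1 x * W x) - W t1\<bar> \<le> e1" using close[of t1 e1] t tt e1 by auto
  moreover have "\<bar>integral {c..d} (\<lambda>x. B t2 x * W x) - W t2\<bar> \<le> e2" using close[of t2 e2] t d e2 by auto
  ultimately have "\<bar>W t1 - W t2\<bar> \<le> e1 + e2" by linarith
  with e1 e2 show False unfolding e_def by argo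
qed

text \<open>Subtracting the primitive of \<open>J\<close> from \<open>I\<close> leaves a function
  with vanishing distributional derivative, to which \<open>du_bois_reymond\<close> applies.\<close>

lemma weak_derivative_integrated:
  fixes I J :: "real \<Rightarrow> real"
  assumes I: "continuous_on {c..d} I" and J: "continuous_on {c..d} J"
    and test: "\<And>p p' c' d'. smooth p \<Longrightarrow> smooth p' \<Longrightarrow> (\<And>x. (p has_real_derivative p' x) (at x)) \<Longrightarrow>
      c < c' \<Longrightarrow> c' < d' \<Longrightarrow> d' < d \<Longrightarrow> (\<And>x. x \<notin> {c'..d'} \<Longrightarrow> p x = 0) \<Longrightarrow>
      integral {c..d} (\<lambda>x. p' x * I x) + integral {c..d} (\<lambda>x. p x * J x) = 0"
    and t: "c < t1" "t1 < t2" "t2 < d"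
  shows "I t2 - I t1 = integral {t1..t2} J"
proof -
  define W where "W = (\<lambda>t. I t - integral {c..t} J)"
  have Ji: "J integrable_on {c..d}" by (intro integrable_continuous_interval J)
  have Jc: "continuous_on {c..d} (\<lambda>t. integral {c..t} J)" by (intro indefinite_integral_continuous_1 Ji)
  have Wc: "continuous_on {c..d} W" unfolding W_def by (intro continuous_intros I Jc)
  have "W t1 = W t2"
  proof (rule du_bois_reymond[OF Wc _ t])
    fix p p' c' d'
    assume p: "smooth p" "smooth p'" "\<And>x. (p has_real_derivative p' x) (at x)"
      "c < c'" "c' < d'" "d' < d" "\<And>x. x \<notin> {c'..d'} \<Longrightarrow> p x = 0"
    have "((\<lambda>x. p' x * integral {c..x} J + p x * J x) has_integral (p d * integral {c..d} J - p c * integral {c..c} J)) {c..d}"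
    proof (rule fundamental_theorem_of_calculus)
      fix x assume x: "x \<in> {c..d}"
      have "((\<lambda>x. p x * integral {c..x} J) has_real_derivative p' x * integral {c..x} J + J x * p x) (at x within {c..d})"
        by (rule DERIV_mult[OF DERIV_subset[OF p(3)] integral_has_real_derivative]) (use J x in auto)
      then show "((\<lambda>x. p x * integral {c..x} J) has_vector_derivative p' x * integral {c..x} J + p x * J x) (at x within {c..d})"
        by (simp add: has_real_derivative_iff_has_vector_derivative mult.commute)
    qed (use p in simp)
    moreover have "p d = 0" "p c = 0" using p(4-7) by auto
    ultimately have 1: "integral {c..d} (\<lambda>x. p' x * integral {c..x} J + p x * J x) = 0"
      by (simp add: integral_unique)
    have "integral {c..d} (\<lambda>x. p' x * W x) = integral {c..d} (\<lambda>x. p' x * I x + p x * J x - (p' x * integral {c..x} J + p x * J x))"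
      by (rule integral_cong) (simp add: W_def algebra_simps)
    also have "\<dots> = integral {c..d} (\<lambda>x. p' x * I x + p x * J x) - integral {c..d} (\<lambda>x. p' x * integral {c..x} J + p x * J x)"
      by (intro Henstock_Kurzweil_Integration.integral_diff integrable_continuous_interval continuous_intros
           smooth_continuous p I J Jc)
    also have "integral {c..d} (\<lambda>x. p' x * I x + p x * J x) = integral {c..d} (\<lambda>x. p' x * I x) + integral {c..d} (\<lambda>x. p x * J x)"
      by (intro Henstock_Kurzweil_Integration.integral_add integrable_continuous_interval continuous_intros
           smooth_continuous p I J)
    finally show "integral {c..d} (\<lambda>x. p' x * W x) = 0" using test[OF p] 1 by simp
  qed
  moreover have "integral {c..t1} J + integral {t1..t2} J = integral {c..t2} J"
    by (rule Henstock_Kurzweil_Integration.integral_combine) (use t in \<open>auto intro: integrable_on_subinterval[OF Ji]\<close>)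
  ultimately show ?thesis by (simp add: W_def)
qed

section \<open>Weak equations in integrated form\<close>

lemma continuous_on_slice2:
  "continuous_on (A \<times> B) (\<lambda>(t, x). f t x) \<Longrightarrow> t \<in> A \<Longrightarrow> C \<subseteq> B \<Longrightarrow> continuous_on C (\<lambda>x. f t x)"
  by (rule continuous_on_compose2[of "A \<times> B" "\<lambda>(t, x). f t x" C "\<lambda>x. (t, x)", simplified])
    (auto intro!: continuous_intros)

lemma continuous_on_slice1:
  "continuous_on (A \<times> B) (\<lambda>(t, x). f t x) \<Longrightarrow> x \<in> B \<Longrightarrow> C \<subseteq> A \<Longrightarrow> continuous_on C (\<lambda>t. f t x)"
  by (rule continuous_on_compose2[of "A \<times> B" "\<lambda>(t, x). f t x" C "\<lambda>t. (t, x)", simplified])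
    (auto intro!: continuous_intros)

lemma continuous_on_integral_slice:
  fixes h :: "'a::topological_space \<Rightarrow> real \<Rightarrow> real"
  shows "continuous_on (A \<times> {y..z}) (\<lambda>(t, x). h t x) \<Longrightarrow> continuous_on A (\<lambda>t. integral {y..z} (\<lambda>x. h t x))"
  using integral_continuous_on_param[of A y z h] by simp

lemma continuous_on_fst_smooth: "smooth p \<Longrightarrow> continuous_on A (\<lambda>y. p (fst y))"
  by (rule continuous_on_compose2[OF smooth_continuous[of p UNIV]]) (auto intro!: continuous_intros)

lemma continuous_on_snd_smooth: "smooth p \<Longrightarrow> continuous_on A (\<lambda>y. p (snd y))"
  by (rule continuous_on_compose2[OF smooth_continuous[of p UNIV]]) (auto intro!: continuous_intros)

text \<open>\<open>weak_derivative_integrated\<close> is applied twice, in t against a fixed space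
  factor and then in x between fixed times. This turns the distributional equation
  \<open>a_t = b_x\<close> into a balance over boxes.\<close>

lemma box_identity:
  fixes a b :: "real \<Rightarrow> real \<Rightarrow> real"
  assumes a: "continuous_on (strip T) (\<lambda>(t, x). a t x)" and b: "continuous_on (strip T) (\<lambda>(t, x). b t x)"
    and weak: "\<And>\<psi>. test_fun T \<psi> \<Longrightarrow>
        (LINT p:strip T|lborel. (case p of (t, x) \<Rightarrow> - a t x * dt \<psi> t x + b t x * dx \<psi> t x)) = 0"
    and t: "0 < t1" "t1 < t2" "t2 < T" and x: "x1 < x2"
  shows "integral {x1..x2} (a t2) - integral {x1..x2} (a t1)
       = integral {t1..t2} (\<lambda>t. b t x2) - integral {t1..t2} (\<lambda>t. b t x1)"
proof -
  \<comment> \<open>The larger box [c, d] x [y, z] gives the test functions room to vanish before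
    its boundary.\<close>
  define c d where "c = t1 / 2" and "d = (t2 + T) / 2"
  have cd: "0 < c" "c < t1" "t2 < d" "d < T" using t by (auto simp: c_def d_def)
  define y z where "y = x1 - 1" and "z = x2 + 1"
  have yz: "y < x1" "x2 < z" by (auto simp: y_def z_def)
  have sub: "{c..d} \<times> A \<subseteq> strip T" for A using cd by auto
  have sub': "{t1..t2} \<times> A \<subseteq> strip T" for A using t by auto
  have ac: "continuous_on ({c..d} \<times> {y..z}) (\<lambda>(t, x). a t x)" "continuous_on ({c..d} \<times> {y..z}) (\<lambda>(t, x). b t x)"
    using sub continuous_on_subset a b by blast+
  note ac' = ac[unfolded case_prod_unfold]
  \<comment> \<open>First application, in t: the moment of \<open>a\<close> against q has derivative
    minus the moment of \<open>b\<close> against q'.\<close>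
  have tst: "integral {y..z} (\<lambda>x. a t2 x * q x) - integral {y..z} (\<lambda>x. a t1 x * q x)
      = integral {t1..t2} (\<lambda>t. - integral {y..z} (\<lambda>x. b t x * q' x))"
    if q: "smooth q" "smooth q'" "\<And>x. (q has_real_derivative q' x) (at x)"
      "y < y'" "y' < z'" "z' < z" "\<And>x. x \<notin> {y'..z'} \<Longrightarrow> q x = 0" for q q' y' z'
  proof (rule weak_derivative_integrated[where c = c and d = d])
    have I1: "continuous_on {c..d} (\<lambda>t. integral {y..z} (\<lambda>x. a t x * q x))"
      by (intro continuous_on_integral_slice, unfold case_prod_unfold,
          intro continuous_intros ac' continuous_on_snd_smooth q)
    have I2: "continuous_on {c..d} (\<lambda>t. integral {y..z} (\<lambda>x. b t x * q' x))"
      by (intro continuous_on_integral_slice, unfold case_prod_unfold,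
          intro continuous_intros ac' continuous_on_snd_smooth q)
    show "continuous_on {c..d} (\<lambda>t. integral {y..z} (\<lambda>x. a t x * q x))"
      "continuous_on {c..d} (\<lambda>t. - integral {y..z} (\<lambda>x. b t x * q' x))"
      by (intro continuous_on_minus I1 I2)+
    fix p p' c' d'
    assume p: "smooth p" "smooth p'" "\<And>x. (p has_real_derivative p' x) (at x)"
      "c < c'" "c' < d'" "d' < d" "\<And>x. x \<notin> {c'..d'} \<Longrightarrow> p x = 0"
    have zero': "f' x = 0" if "\<And>x. x \<notin> {u..v} \<Longrightarrow> f x = 0" "\<And>x. (f has_real_derivative f' x) (at x)" "x \<notin> {u..v}"
      for f f' :: "real \<Rightarrow> real" and u v x
    proof -
      have "(f has_real_derivative 0) (at x)"
        by (rule has_field_derivative_transform_within_open[of "\<lambda>_. 0" _ _ "- {u..v}"])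
          (use that in \<open>auto intro!: open_Compl\<close>)
      then show ?thesis using that(2) DERIV_unique by blast
    qed
    define \<psi> where "\<psi> = (\<lambda>t x. p t * q x)"
    have "test_fun T \<psi>" unfolding \<psi>_def
      by (rule test_fun_product[of _ _ c' d' T y' z']) (use p q cd in auto)
    moreover have d1: "dt \<psi> t x = p' t * q x" "dx \<psi> t x = p t * q' x" for t x
      unfolding \<psi>_def by (intro DERIV_imp_deriv DERIV_cmult_right DERIV_cmult p q)+
    define f where "f = (\<lambda>pt. case pt of (t, x) \<Rightarrow> - a t x * (p' t * q x) + b t x * (p t * q' x))"
    have fc: "continuous_on (cbox (c, y) (d, z)) f"
      unfolding f_def case_prod_unfold cbox_Pair_eq box_real
      by (intro continuous_intros ac' continuous_on_fst_smooth continuous_on_snd_smooth p q)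
    have "(LINT p:strip T|lborel. f p) = 0"
      using weak[OF calculation] unfolding d1 f_def by simp
    moreover have "(LINT p:strip T|lborel. f p) = (LINT p:cbox (c, y) (d, z)|lborel. f p)"
      unfolding set_lebesgue_integral_def
    proof (rule Bochner_Integration.integral_cong[OF refl])
      fix r :: "real \<times> real"
      obtain t x where r: "r = (t, x)" by force
      have "f (t, x) = 0" if "(t, x) \<notin> cbox (c, y) (d, z)"
      proof -
        have "t \<notin> {c'..d'} \<or> x \<notin> {y'..z'}" using that p(4-6) q(4-6) by (auto simp: cbox_Pair_eq)
        then show ?thesis using p(7) q(7) zero'[of c' d' p p' t, OF p(7) p(3)] zero'[of y' z' q q' x, OF q(7) q(3)]
          by (auto simp: f_def)
      qed
      moreover have "cbox (c, y) (d, z) \<subseteq> strip T" using sub[of "{y..z}"] by (simp add: cbox_Pair_eq)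
      ultimately show "indicator (strip T) r *\<^sub>R f r = indicator (cbox (c, y) (d, z)) r *\<^sub>R f r"
        unfolding r by (cases "(t, x) \<in> cbox (c, y) (d, z)") (metis indicator_simps(1) subsetD, simp)
    qed
    moreover have "(LINT p:cbox (c, y) (d, z)|lborel. f p) = integral (cbox (c, y) (d, z)) f"
      by (rule set_borel_integral_eq_integral, unfold set_integrable_def, rule borel_integrable_compact[OF compact_cbox fc])
    moreover have "integral (cbox (c, y) (d, z)) f = integral {c..d} (\<lambda>t. integral {y..z} (\<lambda>x. f (t, x)))"
      using integral_prod_continuous[OF fc] by simp
    moreover have "integral {c..d} (\<lambda>t. integral {y..z} (\<lambda>x. f (t, x)))
      = integral {c..d} (\<lambda>t. - (p' t * integral {y..z} (\<lambda>x. a t x * q x)) + p t * integral {y..z} (\<lambda>x. b t x * q' x))"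
    proof (rule integral_cong)
      fix t assume tt: "t \<in> {c..d}"
      have s: "continuous_on {y..z} (a t)" "continuous_on {y..z} (b t)"
        using continuous_on_slice2[OF ac(1) tt] continuous_on_slice2[OF ac(2) tt] by auto
      have "integral {y..z} (\<lambda>x. f (t, x)) = integral {y..z} (\<lambda>x. - p' t * (a t x * q x) + p t * (b t x * q' x))"
        by (rule integral_cong) (simp add: f_def)
      also have "\<dots> = integral {y..z} (\<lambda>x. - p' t * (a t x * q x)) + integral {y..z} (\<lambda>x. p t * (b t x * q' x))"
        by (intro Henstock_Kurzweil_Integration.integral_add integrable_continuous_interval continuous_intros s smooth_continuous q)
      finally show "integral {y..z} (\<lambda>x. f (t, x)) =
         - (p' t * integral {y..z} (\<lambda>x. a t x * q x)) + p t * integral {y..z} (\<lambda>x. b t x * q' x)" by simp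
    qed
    moreover have "\<dots> = integral {c..d} (\<lambda>t. - (p' t * integral {y..z} (\<lambda>x. a t x * q x))) + integral {c..d} (\<lambda>t. p t * integral {y..z} (\<lambda>x. b t x * q' x))"
      by (intro Henstock_Kurzweil_Integration.integral_add integrable_continuous_interval continuous_intros
          smooth_continuous[OF p(1)] smooth_continuous[OF p(2)] I1 I2)
    ultimately show "integral {c..d} (\<lambda>t. p' t * integral {y..z} (\<lambda>x. a t x * q x)) +
        integral {c..d} (\<lambda>t. p t * (- integral {y..z} (\<lambda>x. b t x * q' x))) = 0"
      by simp
  qed (use cd t in auto)
  have bc: "continuous_on ({y..z} \<times> {t1..t2}) (\<lambda>(x, t). b t x)"
    unfolding case_prod_unfold
    by (rule continuous_on_compose2[OF b[unfolded case_prod_unfold], of _ "\<lambda>y. (snd y, fst y)", simplified])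
      (use t in \<open>auto intro!: continuous_intros\<close>)
  have a12: "continuous_on S (a t1)" "continuous_on S (a t2)" for S
    using continuous_on_slice2[OF a, of t1 S] continuous_on_slice2[OF a, of t2 S] t by auto
  \<comment> \<open>Second application, in x, to the time integral of \<open>b\<close>: its weak
    derivative is the increment of \<open>a\<close>, by \<open>tst\<close> and an exchange of the
    integrals.\<close>
  have "integral {t1..t2} (\<lambda>t. b t x2) - integral {t1..t2} (\<lambda>t. b t x1) = integral {x1..x2} (\<lambda>x. a t2 x - a t1 x)"
  proof (rule weak_derivative_integrated[where c = y and d = z])
    show "continuous_on {y..z} (\<lambda>x. integral {t1..t2} (\<lambda>t. b t x))"
      by (intro continuous_on_integral_slice bc)
    show "continuous_on {y..z} (\<lambda>x. a t2 x - a t1 x)" by (intro continuous_intros a12)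
    fix q q' y' z'
    assume q: "smooth q" "smooth q'" "\<And>x. (q has_real_derivative q' x) (at x)"
      "y < y'" "y' < z'" "z' < z" "\<And>x. x \<notin> {y'..z'} \<Longrightarrow> q x = 0"
    have "integral {y..z} (\<lambda>x. q x * (a t2 x - a t1 x)) = integral {y..z} (\<lambda>x. a t2 x * q x - a t1 x * q x)"
      by (simp add: algebra_simps)
    also have "\<dots> = integral {y..z} (\<lambda>x. a t2 x * q x) - integral {y..z} (\<lambda>x. a t1 x * q x)"
      by (intro Henstock_Kurzweil_Integration.integral_diff integrable_continuous_interval continuous_intros a12 smooth_continuous q)
    also have "\<dots> = - integral {t1..t2} (\<lambda>t. integral {y..z} (\<lambda>x. b t x * q' x))" using tst[OF q] by simp
    also have "integral {t1..t2} (\<lambda>t. integral {y..z} (\<lambda>x. b t x * q' x))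
       = integral {y..z} (\<lambda>x. integral {t1..t2} (\<lambda>t. b t x * q' x))"
    proof -
      have "continuous_on (cbox (t1, y) (t2, z)) (\<lambda>(t, x). b t x * q' x)"
        unfolding case_prod_unfold using continuous_on_subset[OF b sub'[of "{y..z}"]]
        by (intro continuous_intros continuous_on_snd_smooth q) (auto simp: cbox_Pair_eq case_prod_unfold)
      then show ?thesis using integral_swap_continuous[of t1 y t2 z "\<lambda>t x. b t x * q' x"] by simp
    qed
    finally show "integral {y..z} (\<lambda>x. q' x * integral {t1..t2} (\<lambda>t. b t x)) + integral {y..z} (\<lambda>x. q x * (a t2 x - a t1 x)) = 0"
      by (simp add: mult.commute)
  qed (use yz x in auto)
  also have "\<dots> = integral {x1..x2} (a t2) - integral {x1..x2} (a t1)"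
    by (intro Henstock_Kurzweil_Integration.integral_diff integrable_continuous_interval a12)
  finally show ?thesis by simp
qed

section \<open>Transport of mass by a continuous flux\<close>

text \<open>Joint differentiability rather than a pair of partial derivatives: the chain rule along
  curves, \<open>has_grad_curve\<close>, would fail for the latter.\<close>

definition has_grad :: "(real \<Rightarrow> real \<Rightarrow> real) \<Rightarrow> real \<Rightarrow> real \<Rightarrow> real \<Rightarrow> real \<Rightarrow> bool" where
  "has_grad f a b t x \<longleftrightarrow>
     ((\<lambda>p. f (fst p) (snd p)) has_derivative (\<lambda>h. a * fst h + b * snd h)) (at (t, x))"

lemma has_grad_partials:
  fixes f :: "real \<Rightarrow> real \<Rightarrow> real"
  assumes "open S" "(t, x) \<in> S"
    and ft: "((\<lambda>s. f s x) has_real_derivative ft) (at t)"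
    and fx: "\<And>s y. (s, y) \<in> S \<Longrightarrow> (f s has_real_derivative fx s y) (at y)"
    and cont: "continuous_on S (\<lambda>(s, y). fx s y)"
  shows "has_grad f ft (fx t x) t x"
proof -
  obtain A B where AB: "open A" "open B" "t \<in> A" "x \<in> B" "A \<times> B \<subseteq> S"
    using open_prod_elim[OF assms(1,2)] by (metis mem_Sigma_iff)
  obtain e where e: "e > 0" "ball x e \<subseteq> B" using AB open_contains_ball by blast
  define Y where "Y = ball x e"
  have Y: "open Y" "convex Y" "x \<in> Y" "A \<times> Y \<subseteq> S" using e AB by (auto simp: Y_def)
  have "((\<lambda>(s, y). f s y) has_derivative (\<lambda>(ts, ty). ft * ts + blinfun_scaleR_left (fx t x) ty)) (at (t, x) within A \<times> Y)"
  proof (rule has_derivative_partialsI[where fx = "\<lambda>h. ft * h" and fy = "\<lambda>s y. blinfun_scaleR_left (fx s y)"])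
    show "((\<lambda>s. f s x) has_derivative (\<lambda>h. ft * h)) (at t within A)"
      using ft unfolding has_field_derivative_def by (rule has_derivative_at_withinI)
    show "((\<lambda>y. f s y) has_derivative blinfun_apply (blinfun_scaleR_left (fx s y))) (at y within Y)"
      if "s \<in> A" "y \<in> Y" for s y
    proof -
      have "(f s has_real_derivative fx s y) (at y)" using fx that Y by blast
      moreover have "blinfun_apply (blinfun_scaleR_left (fx s y)) = (*) (fx s y)"
        by (auto simp: fun_eq_iff)
      ultimately show ?thesis
        by (auto simp: has_field_derivative_def intro!: has_derivative_at_withinI)
    qed
    have "continuous_on (A \<times> Y) (\<lambda>(s, y). fx s y)" using cont Y continuous_on_subset by blast
    then have "continuous_on (A \<times> Y) (\<lambda>(s, y). blinfun_scaleR_left (fx s y) :: real \<Rightarrow>\<^sub>L real)"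
      unfolding case_prod_unfold by (intro continuous_intros bounded_linear.continuous_on[OF bounded_linear_blinfun_scaleR_left])
    then show "continuous (at (t, x) within A \<times> Y) (\<lambda>(s, y). blinfun_scaleR_left (fx s y) :: real \<Rightarrow>\<^sub>L real)"
      using AB Y by (simp add: continuous_on_eq_continuous_within)
  qed (use Y in auto)
  then have "((\<lambda>(s, y). f s y) has_derivative (\<lambda>(ts, ty). ft * ts + blinfun_scaleR_left (fx t x) ty)) (at (t, x))"
    using at_within_open[of "(t, x)" "A \<times> Y"] AB Y by (simp add: open_Times)
  then show ?thesis unfolding has_grad_def case_prod_unfold by (simp add: mult.commute)
qed

lemma has_grad_curve:
  assumes "has_grad f a b (g t) (h t)" "(g has_real_derivative g') (at t)" "(h has_real_derivative h') (at t)"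
  shows "((\<lambda>s. f (g s) (h s)) has_real_derivative a * g' + b * h') (at t)"
proof -
  have "((\<lambda>s. (g s, h s)) has_derivative (\<lambda>k. (g' * k, h' * k))) (at t)"
    using assms(2,3) by (auto simp: has_field_derivative_def intro!: has_derivative_Pair)
  moreover have "(\<lambda>k. a * (g' * k) + b * (h' * k)) = (*) (a * g' + b * h')"
    by (auto simp: fun_eq_iff algebra_simps)
  ultimately show ?thesis
    using has_derivative_compose[of "\<lambda>s. (g s, h s)" "\<lambda>k. (g' * k, h' * k)" t UNIV
        "\<lambda>p. f (fst p) (snd p)" "\<lambda>h. a * fst h + b * snd h"] assms(1)
    by (simp add: has_field_derivative_def has_grad_def)
qed

lemma has_grad_fst: "has_grad f a b t x \<Longrightarrow> ((\<lambda>s. f s x) has_real_derivative a) (at t)"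
  using has_grad_curve[of f a b "\<lambda>s. s" t "\<lambda>_. x" 1 0] by simp

lemma has_grad_snd: "has_grad f a b t x \<Longrightarrow> (f t has_real_derivative b) (at x)"
  using has_grad_curve[of f a b "\<lambda>_. t" x "\<lambda>y. y" 0 1] by simp

lemma has_grad_compose:
  assumes "has_grad f a b t (g t x)" "has_grad g c d t x"
  shows "has_grad (\<lambda>t x. f t (g t x)) (a + b * c) (b * d) t x"
proof -
  have "((\<lambda>p. (fst p, g (fst p) (snd p))) has_derivative (\<lambda>h. (fst h, c * fst h + d * snd h))) (at (t, x))"
    using assms(2) unfolding has_grad_def by (auto intro!: has_derivative_Pair derivative_intros)
  from has_derivative_compose[OF this, of "\<lambda>p. f (fst p) (snd p)" "\<lambda>h. a * fst h + b * snd h"] assms(1)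
  show ?thesis by (simp add: has_grad_def algebra_simps)
qed

lemma has_grad_chain:
  assumes "(f has_real_derivative f') (at (g t x))" "has_grad g c d t x"
  shows "has_grad (\<lambda>t x. f (g t x)) (f' * c) (f' * d) t x"
  using has_derivative_compose[OF assms(2)[unfolded has_grad_def], of f "(*) f'"] assms(1)
  by (simp add: has_grad_def has_field_derivative_def algebra_simps)

lemma has_grad_add: "has_grad f a b t x \<Longrightarrow> has_grad g c d t x \<Longrightarrow> has_grad (\<lambda>t x. f t x + g t x) (a + c) (b + d) t x"
  unfolding has_grad_def by (drule (1) has_derivative_add) (simp add: algebra_simps)

lemma has_grad_diff: "has_grad f a b t x \<Longrightarrow> has_grad g c d t x \<Longrightarrow> has_grad (\<lambda>t x. f t x - g t x) (a - c) (b - d) t x"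
  unfolding has_grad_def by (drule (1) has_derivative_diff) (simp add: algebra_simps)

lemma has_grad_mult: "has_grad f a b t x \<Longrightarrow> has_grad g c d t x \<Longrightarrow>
   has_grad (\<lambda>t x. f t x * g t x) (a * g t x + f t x * c) (b * g t x + f t x * d) t x"
  unfolding has_grad_def by (drule (1) has_derivative_mult) (simp add: algebra_simps)

lemma has_grad_time: "(f has_real_derivative f') (at t) \<Longrightarrow> has_grad (\<lambda>t x. f t) f' 0 t x"
  unfolding has_grad_def has_field_derivative_def
  by (drule has_derivative_compose[OF has_derivative_fst[OF has_derivative_ident], of _ _ "(t, x)" _, simplified]) simp

lemma has_grad_space: "has_grad (\<lambda>t x. x) 0 1 t x"
  unfolding has_grad_def by (auto intro!: derivative_eq_intros)

lemma has_grad_cong: "has_grad f a b t x \<Longrightarrow> a = c \<Longrightarrow> b = d \<Longrightarrow> has_grad f c d t x"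
  by simp

lemma has_real_derivative_of_integral:
  fixes f g :: "real \<Rightarrow> real"
  assumes "\<And>s t. l < s \<Longrightarrow> s < t \<Longrightarrow> t < r \<Longrightarrow> f t - f s = integral {s..t} g"
    and g: "continuous_on {l<..<r} g" and t: "l < t" "t < r"
  shows "(f has_real_derivative g t) (at t)"
proof -
  obtain s u where s: "l < s" "s < t" "t < u" "u < r" using t dense by meson
  have gc: "continuous_on {s..u} g" using g s by (auto intro: continuous_on_subset)
  have "((\<lambda>y. integral {s..y} g) has_real_derivative g t) (at t within {s..u})"
    by (rule integral_has_real_derivative[OF gc]) (use s in auto)
  then have "((\<lambda>y. integral {s..y} g) has_real_derivative g t) (at t)"
    using s by (simp add: at_within_Icc_at)
  then have "((\<lambda>y. f s + integral {s..y} g) has_real_derivative g t) (at t)"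
    by (auto intro!: derivative_eq_intros)
  then show ?thesis
  proof (rule has_field_derivative_transform_within_open)
    show "open {s<..<u}" "t \<in> {s<..<u}" using s by auto
    show "f s + integral {s..y} g = f y" if "y \<in> {s<..<u}" for y
      using assms(1)[of s y] that s by auto
  qed
qed

text \<open>The primitive is rewritten as an integral over a fixed interval, so that parameter-continuity
  of integrals applies.\<close>

lemma continuous_on_primitive:
  fixes M :: "real \<Rightarrow> real \<Rightarrow> real"
  assumes M: "continuous_on (A \<times> UNIV) (\<lambda>(t, x). M t x)"
  shows "continuous_on (A \<times> {c..}) (\<lambda>(t, x). integral {c..x} (M t))"
proof -
  have eq: "integral {c..x} (M t) = integral {0..1} (\<lambda>r. (x - c) * M t (c + (x - c) * r))"
    if "t \<in> A" "c \<le> x" for t x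
  proof -
    have "((\<lambda>r. (x - c) *\<^sub>R M t (c + (x - c) * r)) has_integral integral {c + (x-c)*0..c + (x-c)*1} (M t)) {0..1}"
    proof (rule has_integral_substitution[where c = c and d = x])
      show "(\<lambda>r. c + (x - c) * r) ` {0..1} \<subseteq> {c..x}"
      proof safe
        fix r :: real assume r: "r \<in> {0..1}"
        have "(x - c) * r \<le> (x - c) * 1" using r that by (intro mult_left_mono) auto
        then show "c + (x - c) * r \<in> {c..x}" using r that by auto
      qed
      show "continuous_on {c..x} (M t)" by (rule continuous_on_slice2[OF M]) (use that in auto)
    qed (use that in \<open>auto intro!: derivative_eq_intros\<close>)
    then have "((\<lambda>r. (x - c) * M t (c + (x - c) * r)) has_integral integral {c..x} (M t)) {0..1}" by simp
    from integral_unique[OF this] show ?thesis by (simp only:)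
  qed
  have "continuous_on ((A \<times> {c..}) \<times> {0..1}) (\<lambda>(p, r). (snd p - c) * M (fst p) (c + (snd p - c) * r))"
    unfolding case_prod_unfold
    by (intro continuous_intros continuous_on_compose2[OF M[unfolded case_prod_unfold], of _ "\<lambda>q. (fst (fst q), c + (snd (fst q) - c) * snd q)", simplified]) auto
  then have "continuous_on (A \<times> {c..}) (\<lambda>p. integral {0..1} (\<lambda>r. (snd p - c) * M (fst p) (c + (snd p - c) * r)))"
    by (rule continuous_on_integral_slice)
  then show ?thesis
    by (rule continuous_on_eq) (auto simp: eq)
qed

text \<open>The equation \<open>M_t = b_x\<close> integrated over boxes, so \<open>b\<close> is
  minus the mass flux. With b = M dx U the mass moves with velocity - dx U.\<close>

definition flux_balance :: "real \<Rightarrow> (real \<Rightarrow> real \<Rightarrow> real) \<Rightarrow> (real \<Rightarrow> real \<Rightarrow> real) \<Rightarrow> bool" where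
  "flux_balance T M b \<longleftrightarrow> (\<forall>t1 t2 x1 x2. 0 < t1 \<and> t1 < t2 \<and> t2 < T \<and> x1 < x2 \<longrightarrow>
     integral {x1..x2} (M t2) - integral {x1..x2} (M t1)
       = integral {t1..t2} (\<lambda>t. b t x2) - integral {t1..t2} (\<lambda>t. b t x1))"

text \<open>The balance makes the primitive of \<open>M\<close> a potential of the field (b, M), up
  to a normalisation at \<open>c\<close>. This permits differentiating the masses of moving
  intervals without any derivative of \<open>M\<close>.\<close>

lemma primitive_has_grad:
  assumes M: "continuous_on ({0..T} \<times> UNIV) (\<lambda>(t, x). M t x)"
    and b: "continuous_on (strip T) (\<lambda>(t, x). b t x)"
    and bal: "flux_balance T M b" and t: "0 < t" "t < T" and x: "c < x"
  shows "has_grad (\<lambda>t x. integral {c..x} (M t)) (b t x - b t c) (M t x) t x"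
proof (rule has_grad_partials[where S = "{0<..<T} \<times> {c<..}"])
  show "open ({0<..<T} \<times> {c<..})" by (intro open_Times) auto
  show "((\<lambda>s. integral {c..x} (M s)) has_real_derivative b t x - b t c) (at t)"
  proof (rule has_real_derivative_of_integral[of 0 T _ "\<lambda>t. b t x - b t c"])
    have bs: "continuous_on S (\<lambda>s. b s y)" if "S \<subseteq> {0<..<T}" for y S
      by (rule continuous_on_slice1[OF b]) (use that in auto)
    show "continuous_on {0<..<T} (\<lambda>t. b t x - b t c)" by (intro continuous_intros bs) auto
    fix s u assume su: "0 < s" "s < u" "u < T"
    have "integral {s..u} (\<lambda>t. b t x) - integral {s..u} (\<lambda>t. b t c) = integral {s..u} (\<lambda>t. b t x - b t c)"
      by (intro Henstock_Kurzweil_Integration.integral_diff[symmetric] integrable_continuous_interval bs) (use su in auto)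
    then show "integral {c..x} (M u) - integral {c..x} (M s) = integral {s..u} (\<lambda>t. b t x - b t c)"
      using bal su x unfolding flux_balance_def by simp
  qed (use t in auto)
  show "((\<lambda>y. integral {c..y} (M s)) has_real_derivative M s y) (at y)" if "(s, y) \<in> {0<..<T} \<times> {c<..}" for s y
  proof -
    have "((\<lambda>y. integral {c..y} (M s)) has_real_derivative M s y) (at y within {c..y+1})"
      by (rule integral_has_real_derivative) (use that in \<open>auto intro: continuous_on_slice2[OF M]\<close>)
    then show ?thesis using that by (simp add: at_within_Icc_at)
  qed
  show "continuous_on ({0<..<T} \<times> {c<..}) (\<lambda>(s, y). M s y)" by (rule continuous_on_subset[OF M]) auto
qed (use t x in auto)

text \<open>The mass between r + L t and a right end that moves inwards with speed L cannot grow,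
  because mass moves no faster than L. At time 0 it vanishes.\<close>

lemma finite_speed:
  assumes "0 < T" "0 \<le> L"
    and M: "continuous_on ({0..T} \<times> UNIV) (\<lambda>(t, x). M t x)" and M0: "\<And>t x. t \<in> {0..T} \<Longrightarrow> 0 \<le> M t x"
    and b: "continuous_on (strip T) (\<lambda>(t, x). b t x)" and bL: "\<And>t x. t \<in> {0<..<T} \<Longrightarrow> \<bar>b t x\<bar> \<le> L * M t x"
    and bal: "flux_balance T M b" and init: "\<And>x. r < x \<Longrightarrow> M 0 x = 0"
    and t: "t \<in> {0..T}" and x: "r + L * t < x"
  shows "M t x = 0"
proof -
  \<comment> \<open>\<open>c\<close> is a base point to the left of the initial edge, and
    \<open>z\<close> is so large that z - L t stays beyond x up to time T.\<close>
  define c where "c = r - 1"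
  define z where "z = x + L * T + 1"
  define H where "H = (\<lambda>t x. integral {c..x} (M t))"
  have Ms: "continuous_on S (M s)" if "s \<in> {0..T}" for S s by (rule continuous_on_slice2[OF M]) (use that in auto)
  have Hc: "continuous_on ({0..T} \<times> {c..}) (\<lambda>(t, x). H t x)" unfolding H_def by (rule continuous_on_primitive[OF M])
  define e where "e = (\<lambda>s. H s (z - L * s) - H s (r + L * s))"
  have LT: "L * s \<le> L * t" "L * t \<le> L * T" if "s \<in> {0..t}" for s
    using that t assms(2) by (auto intro: mult_left_mono)
  have Lp: "0 \<le> L * s" if "0 \<le> s" for s using that assms(2) by auto
  have ord: "r + L * s < z - L * s" "c < r + L * s" "c < z - L * s" "x < z - L * s" if "s \<in> {0..t}" for s
    using LT[OF that] Lp[of s] Lp[of T] x t that by (auto simp: z_def c_def)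
  have Hdiff: "H s y' - H s y = integral {y..y'} (M s)" if "s \<in> {0..T}" "c \<le> y" "y \<le> y'" for s y y'
    unfolding H_def using Henstock_Kurzweil_Integration.integral_combine[of c y y' "M s"]
      integrable_continuous_interval[OF Ms] that by simp
  have "e t \<le> e 0" if "0 < t"
  proof (rule DERIV_nonpos_imp_decreasing_open[of 0 t])
    show "continuous_on {0..t} e"
      unfolding e_def
      by (intro continuous_intros continuous_on_compose2[OF Hc, of _ "\<lambda>s. (s, z - L * s)", simplified]
           continuous_on_compose2[OF Hc, of _ "\<lambda>s. (s, r + L * s)", simplified])
        (use ord t in \<open>auto intro: less_imp_le\<close>)
    fix s assume s: "0 < s" "s < t"
    have g: "has_grad H (b s y - b s c) (M s y) s y" if "c < y" for y
      unfolding H_def by (rule primitive_has_grad[OF M b bal]) (use s t that in auto)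
    have "(e has_real_derivative ((b s (z - L * s) - b s c) * 1 + M s (z - L * s) * (- L)
        - ((b s (r + L * s) - b s c) * 1 + M s (r + L * s) * L))) (at s)"
      unfolding e_def
      by (intro DERIV_diff has_grad_curve[of H _ _ "\<lambda>s. s"] g ord)
        (use s in \<open>auto intro!: derivative_eq_intros\<close>)
    moreover have "(b s (z - L * s) - b s c) * 1 + M s (z - L * s) * (- L)
        - ((b s (r + L * s) - b s c) * 1 + M s (r + L * s) * L) \<le> 0"
      using bL[of s "z - L * s"] bL[of s "r + L * s"] s t by (auto simp: algebra_simps abs_le_iff)
    ultimately show "\<exists>y. (e has_real_derivative y) (at s) \<and> y \<le> 0" by blast
  qed (use that in auto)
  then have le: "e t \<le> e 0" using t by (cases "t = 0") auto
  have "e 0 = integral {r..z} (M 0)" using Hdiff[of 0 r z] ord[of 0] assms(1) t by (simp add: e_def c_def)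
  also have "\<dots> = integral {r..z} (\<lambda>_. 0)"
    by (rule integral_spike[of "{r}"]) (use init in auto)
  finally have "e t \<le> 0" using le by simp
  moreover have et: "e t = integral {r + L * t..z - L * t} (M t)"
    using Hdiff[of t "r + L * t" "z - L * t"] ord[of t] t by (simp add: e_def)
  moreover have "0 \<le> integral {r + L * t..z - L * t} (M t)"
    by (intro integral_nonneg integrable_continuous_interval Ms t M0)
  ultimately have "integral {r + L * t..z - L * t} (M t) = 0" by simp
  then show ?thesis
    using integral_eq_0_iff[of "r + L * t" "z - L * t" "M t"] Ms[OF t] M0[OF t] ord[of t] x t by force
qed

lemma flux_balance_reflect:
  assumes M: "continuous_on ({0..T} \<times> UNIV) (\<lambda>(t, x). M t x)" and bal: "flux_balance T M b"
  shows "flux_balance T (\<lambda>t x. M t (- x)) (\<lambda>t x. - b t (- x))"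
  unfolding flux_balance_def
proof (intro allI impI)
  fix t1 t2 x1 x2 :: real assume h: "0 < t1 \<and> t1 < t2 \<and> t2 < T \<and> x1 < x2"
  have "integral {- x2..- x1} (M t2) - integral {- x2..- x1} (M t1)
       = integral {t1..t2} (\<lambda>t. b t (- x1)) - integral {t1..t2} (\<lambda>t. b t (- x2))"
    using bal h unfolding flux_balance_def by simp
  moreover have "integral {- x2..- x1} (M t) = integral {x1..x2} (\<lambda>x. M t (- x))" for t
    using Henstock_Kurzweil_Integration.integral_reflect_real[of x2 x1 "\<lambda>x. M t (- x)"] by simp
  ultimately show "integral {x1..x2} (\<lambda>x. M t2 (- x)) - integral {x1..x2} (\<lambda>x. M t1 (- x)) =
       integral {t1..t2} (\<lambda>t. - b t (- x2)) - integral {t1..t2} (\<lambda>t. - b t (- x1))"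
    by simp
qed

lemma finite_speed_two_sided:
  assumes "0 < T" "0 \<le> L"
    and M: "continuous_on ({0..T} \<times> UNIV) (\<lambda>(t, x). M t x)" and M0: "\<And>t x. t \<in> {0..T} \<Longrightarrow> 0 \<le> M t x"
    and b: "continuous_on (strip T) (\<lambda>(t, x). b t x)" and bL: "\<And>t x. t \<in> {0<..<T} \<Longrightarrow> \<bar>b t x\<bar> \<le> L * M t x"
    and bal: "flux_balance T M b" and init: "\<And>x. r < \<bar>x\<bar> \<Longrightarrow> M 0 x = 0"
    and t: "t \<in> {0..T}" and x: "r + L * t < \<bar>x\<bar>"
  shows "M t x = 0"
proof (cases "0 \<le> x")
  case True
  show ?thesis by (rule finite_speed[OF assms(1,2) M M0 b bL bal _ t]) (use x True init in auto)
next
  case False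
  have M': "continuous_on ({0..T} \<times> UNIV) (\<lambda>(t, x). M t (- x))"
    unfolding case_prod_unfold
    by (intro continuous_on_compose2[OF M[unfolded case_prod_unfold], of _ "\<lambda>q. (fst q, - snd q)", simplified] continuous_intros) auto
  have b': "continuous_on (strip T) (\<lambda>(t, x). - b t (- x))"
    unfolding case_prod_unfold
    by (intro continuous_intros continuous_on_compose2[OF b[unfolded case_prod_unfold], of _ "\<lambda>q. (fst q, - snd q)", simplified]) auto
  have "M t (- (- x)) = 0"
    by (rule finite_speed[OF assms(1,2) M' _ b' _ flux_balance_reflect[OF M bal] _ t])
      (use x False init M0 bL in auto)
  then show ?thesis by simp
qed

section \<open>Distribution functions of a transported density\<close>

locale transport =
  fixes T N :: real and M b :: "real \<Rightarrow> real \<Rightarrow> real"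
  assumes T: "0 < T" and N: "0 < N"
    and M_cont: "continuous_on ({0..T} \<times> UNIV) (\<lambda>(t, x). M t x)"
    and M_nonneg: "t \<in> {0..T} \<Longrightarrow> 0 \<le> M t x"
    and b_cont: "continuous_on (strip T) (\<lambda>(t, x). b t x)"
    and b_zero: "t \<in> {0<..<T} \<Longrightarrow> M t x = 0 \<Longrightarrow> b t x = 0"
    and balance: "flux_balance T M b"
    and M_support: "t \<in> {0..T} \<Longrightarrow> N \<le> \<bar>x\<bar> \<Longrightarrow> M t x = 0"
    and M_mass: "t \<in> {0..T} \<Longrightarrow> integral {-N..N} (M t) = 1"
begin

text \<open>The base point lies strictly to the left of -N, so that \<open>F\<close> is
  differentiable on all of [-N, N], ends included.\<close>

definition F :: "real \<Rightarrow> real \<Rightarrow> real" where "F t x = integral {-N-1..x} (M t)"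

lemma M_slice: "t \<in> {0..T} \<Longrightarrow> continuous_on S (M t)"
  by (rule continuous_on_slice2[OF M_cont]) auto

lemma M_integrable: "t \<in> {0..T} \<Longrightarrow> M t integrable_on {x..y}"
  by (intro integrable_continuous_interval M_slice)

lemma F_has_grad: "t \<in> {0<..<T} \<Longrightarrow> -N-1 < x \<Longrightarrow> has_grad F (b t x) (M t x) t x"
  using primitive_has_grad[OF M_cont b_cont balance, of t "-N-1" x] b_zero[of t "-N-1"] M_support[of t "-N-1"] N
  by (auto simp: F_def[abs_def])

lemma F_cont: "continuous_on ({0..T} \<times> {-N-1..}) (\<lambda>(t, x). F t x)"
  unfolding F_def by (rule continuous_on_primitive[OF M_cont])

lemma F_has_derivative: "t \<in> {0..T} \<Longrightarrow> -N-1 < x \<Longrightarrow> (F t has_real_derivative M t x) (at x)"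
proof -
  assume h: "t \<in> {0..T}" "-N-1 < x"
  have "(F t has_real_derivative M t x) (at x within {-N-1..x+1})"
    unfolding F_def[abs_def] by (rule integral_has_real_derivative) (use h in \<open>auto intro: M_slice\<close>)
  then show ?thesis using h by (simp add: at_within_Icc_at)
qed

lemma F_diff: "t \<in> {0..T} \<Longrightarrow> -N-1 \<le> x \<Longrightarrow> x \<le> y \<Longrightarrow> F t y - F t x = integral {x..y} (M t)"
  unfolding F_def using Henstock_Kurzweil_Integration.integral_combine[of "-N-1" x y "M t"] M_integrable by simp

lemma F_left: "t \<in> {0..T} \<Longrightarrow> x \<le> -N \<Longrightarrow> F t x = 0"
proof -
  assume h: "t \<in> {0..T}" "x \<le> -N"
  have "F t x = integral {-N-1..x} (\<lambda>_. 0)"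
    unfolding F_def by (rule integral_cong) (use h M_support N in auto)
  then show ?thesis by simp
qed

lemma F_right: "t \<in> {0..T} \<Longrightarrow> N \<le> x \<Longrightarrow> F t x = 1"
proof -
  assume h: "t \<in> {0..T}" "N \<le> x"
  have "integral {N..x} (M t) = integral {N..x} (\<lambda>_. 0)"
    by (rule integral_cong) (use h M_support N in auto)
  then show ?thesis using F_diff[of t "-N" N] F_diff[of t N x] F_left[of t "-N"] M_mass h N by simp
qed

lemma F_mono: "t \<in> {0..T} \<Longrightarrow> -N-1 \<le> x \<Longrightarrow> x \<le> y \<Longrightarrow> F t x \<le> F t y"
  using F_diff[of t x y] integral_nonneg[OF M_integrable, of t x y] M_nonneg by fastforce

lemma F_range: "t \<in> {0..T} \<Longrightarrow> -N-1 \<le> x \<Longrightarrow> F t x \<in> {0..1}"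
proof -
  assume h: "t \<in> {0..T}" "-N-1 \<le> x"
  have "F t (-N-1) \<le> F t x" "F t x \<le> F t (max x N)" using h by (auto intro!: F_mono)
  then show ?thesis using F_left[of t "-N-1"] F_right[of t "max x N"] h by auto
qed

text \<open>Differentiation of \<open>\<integral> M g\<close>: the time derivative falling on \<open>M\<close> is moved to \<open>F\<close> by
  integration by parts, which requires no regularity of \<open>M\<close> beyond continuity.\<close>

lemma integral_has_derivative:
  assumes g: "\<And>t x. t \<in> {0<..<T} \<Longrightarrow> x \<in> {-N..N} \<Longrightarrow> has_grad g (gt t x) (gx t x) t x"
    and gtc: "continuous_on ({0<..<T} \<times> {-N..N}) (\<lambda>(t, x). gt t x)"
    and gxc: "continuous_on ({0<..<T} \<times> {-N..N}) (\<lambda>(t, x). gx t x)"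
    and t: "t \<in> {0<..<T}"
  shows "((\<lambda>t. integral {-N..N} (\<lambda>x. M t x * g t x)) has_real_derivative
           integral {-N..N} (\<lambda>x. M t x * gt t x - b t x * gx t x)) (at t)"
proof -
  \<comment> \<open>Two separate times, r in the density and s in \<open>g\<close>. Each is
    differentiated alone, s under the integral and r after the integration by parts
    \<open>Geq\<close>; the diagonal r = s is then a curve for
    \<open>has_grad_curve\<close>.\<close>
  define G where "G = (\<lambda>t s. integral {-N..N} (\<lambda>x. M t x * g s x))"
  have gs: "continuous_on {-N..N} (g s)" if "s \<in> {0<..<T}" for s
    using has_grad_snd[OF g[OF that]] by (meson DERIV_isCont continuous_at_imp_continuous_on)
  have sl: "continuous_on {-N..N} (gt s)" "continuous_on {-N..N} (gx s)" if "s \<in> {0<..<T}" for s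
    using continuous_on_slice2[OF gtc that] continuous_on_slice2[OF gxc that] by auto
  have Mi: "continuous_on S (\<lambda>p. M (fst p) (snd p))" if "S \<subseteq> {0..T} \<times> UNIV" for S
    using continuous_on_subset[OF M_cont that] by (simp add: case_prod_unfold)
  have bi: "continuous_on S (\<lambda>p. b (fst p) (snd p))" if "S \<subseteq> {0<..<T} \<times> UNIV" for S
    using continuous_on_subset[OF b_cont that] by (simp add: case_prod_unfold)
  have bs: "continuous_on S (b s)" if "s \<in> {0<..<T}" for s S
    using continuous_on_slice2[OF b_cont that, of S] by simp
  have Gs: "(G r has_real_derivative integral {-N..N} (\<lambda>x. M r x * gt s x)) (at s)"
    if "r \<in> {0<..<T}" "s \<in> {0<..<T}" for r s
  proof -
    have "((\<lambda>s. integral (cbox (-N) N) (\<lambda>x. M r x * g s x)) has_field_derivative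
        integral (cbox (-N) N) (\<lambda>x. M r x * gt s x)) (at s within {0<..<T})"
    proof (rule leibniz_rule_field_derivative)
      fix s x assume "s \<in> {0<..<T}" "x \<in> cbox (-N) N"
      then show "((\<lambda>s. M r x * g s x) has_real_derivative M r x * gt s x) (at s within {0<..<T})"
        by (intro DERIV_cmult DERIV_subset[OF has_grad_fst[OF g]]) auto
    next
      show "(\<lambda>x. M r x * g s x) integrable_on cbox (-N) N" if "s \<in> {0<..<T}" for s
        unfolding box_real using \<open>r \<in> _\<close> by (intro integrable_continuous_interval continuous_intros gs that M_slice) auto
      have "continuous_on ({0<..<T} \<times> {-N..N}) (\<lambda>p. M r (snd p))"
        using \<open>r \<in> _\<close> by (intro continuous_on_compose2[OF M_slice[of r UNIV], of _ snd] continuous_intros) auto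
      then show "continuous_on ({0<..<T} \<times> cbox (-N) N) (\<lambda>(s, x). M r x * gt s x)"
        unfolding box_real using gtc unfolding case_prod_unfold by (intro continuous_intros)
    qed (use that in auto)
    then show ?thesis using that unfolding G_def by (simp add: at_within_open[of s "{0<..<T}"])
  qed
  have Geq: "G r s = g s N - integral {-N..N} (\<lambda>x. F r x * gx s x)" if "r \<in> {0<..<T}" "s \<in> {0<..<T}" for r s
  proof -
    have Fc: "continuous_on {-N..N} (F r)"
      using F_has_derivative[of r] that N by (intro DERIV_continuous_on[of _ _ "M r"] DERIV_subset[OF F_has_derivative]) auto
    have "((\<lambda>x. M r x * g s x + gx s x * F r x) has_integral (F r N * g s N - F r (-N) * g s (-N))) {-N..N}"
    proof (rule fundamental_theorem_of_calculus)
      fix x assume "x \<in> {-N..N}"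
      then have "((\<lambda>x. F r x * g s x) has_real_derivative (M r x * g s x + gx s x * F r x)) (at x within {-N..N})"
        using that by (intro DERIV_mult DERIV_subset[OF F_has_derivative] DERIV_subset[OF has_grad_snd[OF g]]) auto
      then show "((\<lambda>x. F r x * g s x) has_vector_derivative (M r x * g s x + gx s x * F r x)) (at x within {-N..N})"
        by (simp add: has_real_derivative_iff_has_vector_derivative)
    qed (use N in auto)
    then have "integral {-N..N} (\<lambda>x. M r x * g s x + gx s x * F r x) = g s N"
      using F_left[of r "-N"] F_right[of r N] that by (simp add: integral_unique)
    moreover have "integral {-N..N} (\<lambda>x. M r x * g s x + gx s x * F r x) = G r s + integral {-N..N} (\<lambda>x. gx s x * F r x)"
      unfolding G_def using that
      by (intro Henstock_Kurzweil_Integration.integral_add integrable_continuous_interval continuous_intros Fc sl gs M_slice) auto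
    ultimately show ?thesis by (simp add: mult.commute)
  qed
  have Gt: "((\<lambda>r. G r t) has_real_derivative - integral {-N..N} (\<lambda>x. b t x * gx t x)) (at t)"
  proof -
    have "((\<lambda>r. integral (cbox (-N) N) (\<lambda>x. F r x * gx t x)) has_field_derivative
        integral (cbox (-N) N) (\<lambda>x. b t x * gx t x)) (at t within {0<..<T})"
    proof (rule leibniz_rule_field_derivative[where fx = "\<lambda>r x. b r x * gx t x"])
      fix r x assume "r \<in> {0<..<T}" "x \<in> cbox (-N) N"
      then show "((\<lambda>r. F r x * gx t x) has_real_derivative b r x * gx t x) (at r within {0<..<T})"
        by (intro DERIV_cmult_right DERIV_subset[OF has_grad_fst[OF F_has_grad]]) auto
    next
      show "(\<lambda>x. F r x * gx t x) integrable_on cbox (-N) N" if "r \<in> {0<..<T}" for r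
        unfolding box_real using that t
        by (intro integrable_continuous_interval continuous_intros sl continuous_on_slice2[OF F_cont]) auto
      have "continuous_on ({0<..<T} \<times> {-N..N}) (\<lambda>p. gx t (snd p))"
        using t by (intro continuous_on_compose2[OF sl(2)[OF t], of _ snd] continuous_intros) auto
      then show "continuous_on ({0<..<T} \<times> cbox (-N) N) (\<lambda>(s, x). b s x * gx t x)"
        unfolding box_real case_prod_unfold by (intro continuous_intros bi) auto
    qed (use t in auto)
    then have "((\<lambda>r. integral {-N..N} (\<lambda>x. F r x * gx t x)) has_real_derivative
        integral {-N..N} (\<lambda>x. b t x * gx t x)) (at t)"
      using t by (simp add: at_within_open[of t "{0<..<T}"])
    then have "((\<lambda>r. g t N - integral {-N..N} (\<lambda>x. F r x * gx t x)) has_real_derivative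
        - integral {-N..N} (\<lambda>x. b t x * gx t x)) (at t)"
      by (auto intro!: derivative_eq_intros)
    then show ?thesis
      by (rule has_field_derivative_transform_within_open[of _ _ _ "{0<..<T}"]) (use t Geq in auto)
  qed
  have "has_grad G (- integral {-N..N} (\<lambda>x. b t x * gx t x)) (integral {-N..N} (\<lambda>x. M t x * gt t x)) t t"
  proof (rule has_grad_partials[of "{0<..<T} \<times> {0<..<T}" t t G, where fx = "\<lambda>t s. integral {-N..N} (\<lambda>x. M t x * gt s x)"])
    have "continuous_on (({0<..<T} \<times> {0<..<T}) \<times> {-N..N}) (\<lambda>(p, x). M (fst p) x * gt (snd p) x)"
      unfolding case_prod_unfold
      by (intro continuous_intros continuous_on_compose2[OF M_cont[unfolded case_prod_unfold], of _ "\<lambda>q. (fst (fst q), snd q)", simplified]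
          continuous_on_compose2[OF gtc[unfolded case_prod_unfold], of _ "\<lambda>q. (snd (fst q), snd q)", simplified]) auto
    then have "continuous_on ({0<..<T} \<times> {0<..<T}) (\<lambda>p. integral {-N..N} (\<lambda>x. M (fst p) x * gt (snd p) x))"
      by (rule continuous_on_integral_slice)
    then show "continuous_on ({0<..<T} \<times> {0<..<T}) (\<lambda>(t, s). integral {-N..N} (\<lambda>x. M t x * gt s x))"
      by (simp add: case_prod_unfold)
  qed (use t Gs Gt in \<open>auto intro: open_Times\<close>)
  from has_grad_curve[of G _ _ "\<lambda>s. s" t "\<lambda>s. s" 1 1, OF this]
  have "((\<lambda>s. G s s) has_real_derivative (integral {-N..N} (\<lambda>x. M t x * gt t x) - integral {-N..N} (\<lambda>x. b t x * gx t x))) (at t)"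
    by (simp add: algebra_simps)
  moreover have "integral {-N..N} (\<lambda>x. M t x * gt t x - b t x * gx t x)
     = integral {-N..N} (\<lambda>x. M t x * gt t x) - integral {-N..N} (\<lambda>x. b t x * gx t x)"
    using t by (intro Henstock_Kurzweil_Integration.integral_diff integrable_continuous_interval continuous_intros M_slice sl bs) auto
  ultimately show ?thesis by (simp add: G_def)
qed

end

section \<open>Convexity and the self-similar profile\<close>

text \<open>Convexity of z^(-\<theta>) in tangent form, from ln z \<le> z - 1 and 1 + w \<le> exp
  w.\<close>

lemma powr_neg_tangent:
  fixes x y \<theta> :: real
  assumes "0 < x" "0 < y" "0 < \<theta>"
  shows "y powr (-\<theta>) - \<theta> * y powr (-\<theta>) * (x / y - 1) \<le> x powr (-\<theta>)"
proof -
  have "1 - \<theta> * (x / y - 1) \<le> 1 + - \<theta> * ln (x / y)"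
    using ln_le_minus_one[of "x / y"] assms by simp
  also have "\<dots> \<le> exp (- \<theta> * ln (x / y))" by (rule exp_ge_add_one_self)
  also have "\<dots> = (x / y) powr (-\<theta>)" using assms by (simp add: powr_def)
  finally have "y powr (-\<theta>) * (1 - \<theta> * (x / y - 1)) \<le> y powr (-\<theta>) * (x / y) powr (-\<theta>)"
    by (intro mult_left_mono) auto
  also have "\<dots> = x powr (-\<theta>)" using assms by (simp add: powr_mult[symmetric])
  finally show ?thesis by (simp add: algebra_simps)
qed

text \<open>Average of the tangent inequalities at the intermediate point. One end is 1 because the
  Jacobian of a displacement interpolation has the form 1 - l + l x.\<close>

lemma powr_neg_convex:
  fixes x \<theta> l :: real
  assumes "0 < x" "0 < \<theta>" "0 \<le> l" "l < 1"
  shows "(1 - l + l * x) powr (-\<theta>) \<le> (1 - l) + l * x powr (-\<theta>)"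
proof -
  define y where "y = 1 - l + l * x"
  have y: "0 < y" unfolding y_def using assms by (simp add: add_pos_nonneg)
  have "(1 - l) * (y powr (-\<theta>) - \<theta> * y powr (-\<theta>) * (1 / y - 1)) \<le> (1 - l) * 1 powr (-\<theta>)"
    by (rule mult_left_mono[OF powr_neg_tangent]) (use assms y in auto)
  moreover have "l * (y powr (-\<theta>) - \<theta> * y powr (-\<theta>) * (x / y - 1)) \<le> l * x powr (-\<theta>)"
    by (rule mult_left_mono[OF powr_neg_tangent]) (use assms y in auto)
  moreover have "(1 - l) * (y powr (-\<theta>) - \<theta> * y powr (-\<theta>) * (1 / y - 1)) + l * (y powr (-\<theta>) - \<theta> * y powr (-\<theta>) * (x / y - 1)) = y powr (-\<theta>)"
  proof -
    have "(1 - l) * (1 / y - 1) + l * (x / y - 1) = (1 - l + l * x) / y - 1" by (simp add: diff_divide_distrib add_divide_distrib algebra_simps)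
    also have "\<dots> = 0" using y by (simp add: y_def)
    finally have z: "(1 - l) * (1 / y - 1) + l * (x / y - 1) = 0" .
    have "(1 - l) * (y powr (-\<theta>) - \<theta> * y powr (-\<theta>) * (1 / y - 1)) + l * (y powr (-\<theta>) - \<theta> * y powr (-\<theta>) * (x / y - 1))
       = y powr (-\<theta>) - \<theta> * y powr (-\<theta>) * ((1 - l) * (1 / y - 1) + l * (x / y - 1))" by (simp add: algebra_simps)
    then show ?thesis by (simp add: z)
  qed
  ultimately show ?thesis by (simp add: y_def)
qed

text \<open>Young's inequality with exponents 1 + \<theta> and (1 + \<theta>) / \<theta>; the powers
  of \<open>J\<close> cancel in the product. When \<open>J\<close> is the Jacobian of a map, the
  first term on the right integrates to the energy of an image density, and the second to an energy
  after the change of variables.\<close>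

lemma weighted_young:
  fixes a k J \<theta> :: real
  assumes "0 \<le> a" "0 \<le> k" "0 < J" "0 < \<theta>"
  shows "a * k powr \<theta> \<le> 1 / (1 + \<theta>) * (a powr (1 + \<theta>) * J powr (-\<theta>)) + \<theta> / (1 + \<theta>) * (k powr (1 + \<theta>) * J)"
proof (cases "a = 0 \<or> k = 0")
  case True
  then show ?thesis using assms by auto
next
  case False
  then have p: "0 < a" "0 < k" using assms by auto
  define X Y where "X = a powr (1 + \<theta>) * J powr (-\<theta>)" and "Y = k powr (1 + \<theta>) * J"
  have XY: "0 < X" "0 < Y" using p assms by (auto simp: X_def Y_def)
  have "X powr (1 / (1 + \<theta>)) * Y powr (\<theta> / (1 + \<theta>)) \<le> 1 / (1 + \<theta>) * X + \<theta> / (1 + \<theta>) * Y"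
    by (rule Youngs_inequality_0) (use assms XY in \<open>auto simp: field_simps\<close>)
  moreover have "X powr (1 / (1 + \<theta>)) = a * J powr (- \<theta> / (1 + \<theta>))"
    using p assms by (simp add: X_def powr_mult powr_powr)
  moreover have "Y powr (\<theta> / (1 + \<theta>)) = k powr \<theta> * J powr (\<theta> / (1 + \<theta>))"
    using p assms by (simp add: Y_def powr_mult powr_powr)
  moreover have "J powr (- \<theta> / (1 + \<theta>)) * J powr (\<theta> / (1 + \<theta>)) = 1"
    using assms by (simp add: powr_add[symmetric])
  ultimately show ?thesis by (simp add: X_def Y_def mult_ac)
qed

lemma continuous_on_powr_nonneg:
  fixes f :: "'a::topological_space \<Rightarrow> real"
  assumes "continuous_on S f" "\<And>x. x \<in> S \<Longrightarrow> 0 \<le> f x" "0 < \<theta>"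
  shows "continuous_on S (\<lambda>x. f x powr \<theta>)"
  using assms by (intro continuous_on_powr') auto

lemma integral_zero_outside:
  fixes f :: "real \<Rightarrow> real"
  assumes "u \<le> a" "b \<le> v" "\<And>x. x \<notin> {a..b} \<Longrightarrow> f x = 0"
  shows "integral {u..v} f = integral {a..b} f"
proof -
  have "f = (\<lambda>x. if x \<in> {a..b} then f x else 0)" using assms(3) by auto
  then have "integral {u..v} f = integral {u..v} (\<lambda>x. if x \<in> {a..b} then f x else 0)" by (rule arg_cong)
  also have "\<dots> = integral {a..b} f"
    using assms by (simp only: integral_restrict_Int) (simp add: Int_absorb2 subset_iff)
  finally show ?thesis .
qed

text \<open>Since S' = s m, the map pushes \<open>m\<close> to a density with value 1 / s at the
  image point, and the interpolation x + l (S - x) has Jacobian 1 - l + l s m.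
  \<open>weighted_young\<close> with this Jacobian separates two energies: that of the interpolated
  density, convex in l by \<open>powr_neg_convex\<close>, and one that a change of variables returns
  to the energy of \<open>m\<close>. Positivity is asked of \<open>s\<close>, while \<open>m\<close>
  may vanish.\<close>

lemma displacement_convexity:
  fixes m S s :: "real \<Rightarrow> real"
  assumes th: "0 < \<theta>" and N: "0 < N" and l: "0 < l" "l < 1"
    and m: "continuous_on UNIV m" "\<And>x. 0 \<le> m x" "\<And>x. N \<le> \<bar>x\<bar> \<Longrightarrow> m x = 0"
    and S: "\<And>x. x \<in> {-N..N} \<Longrightarrow> (S has_real_derivative s x * m x) (at x)"
    and s: "continuous_on {-N..N} s" "\<And>x. x \<in> {-N..N} \<Longrightarrow> 0 < s x"
  shows "integral {-N..N} (\<lambda>x. m x * m (x + l * (S x - x)) powr \<theta>)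
    \<le> integral {-N..N} (\<lambda>x. m x powr (1 + \<theta>))
      + l / (1 + \<theta>) * (integral {-N..N} (\<lambda>x. m x * s x powr (-\<theta>)) - integral {-N..N} (\<lambda>x. m x powr (1 + \<theta>)))"
proof -
  define P where "P = (\<lambda>x. x + l * (S x - x))"
  define J where "J = (\<lambda>x. 1 - l + l * (s x * m x))"
  have mc: "continuous_on A m" for A using m(1) continuous_on_subset by blast
  have Jp: "0 < J x" if "x \<in> {-N..N}" for x
    unfolding J_def using l s(2)[OF that] m(2)[of x] by (simp add: add_pos_nonneg)
  have Jc: "continuous_on {-N..N} J" unfolding J_def by (intro continuous_intros s mc)
  have Sc: "continuous_on {-N..N} S" using S by (meson DERIV_isCont continuous_at_imp_continuous_on)
  have Pd: "(P has_real_derivative J x) (at x)" if "x \<in> {-N..N}" for x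
    unfolding P_def J_def by (auto intro!: derivative_eq_intros S that simp: algebra_simps)
  have Pc: "continuous_on {-N..N} P" unfolding P_def by (intro continuous_intros Sc)
  have mP: "continuous_on {-N..N} (\<lambda>x. m (P x))"
    by (rule continuous_on_compose2[OF m(1) Pc]) auto
  have pc: "continuous_on A (\<lambda>x. m x powr (1 + \<theta>))" for A
    by (intro continuous_on_powr_nonneg mc m) (use th in auto)
  have ipw: "(\<lambda>x. m x powr (1 + \<theta>)) integrable_on {u..v}" for u v by (intro integrable_continuous_interval pc)
  define A where "A = integral {-N..N} (\<lambda>x. m x powr (1 + \<theta>))"
  define B where "B = integral {-N..N} (\<lambda>x. m x * s x powr (-\<theta>))"
  have sc: "continuous_on {-N..N} (\<lambda>x. s x powr (-\<theta>))"
    by (intro continuous_on_powr s continuous_intros) (use s(2) in force)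
  have subst: "integral {-N..N} (\<lambda>x. m (P x) powr (1 + \<theta>) * J x) \<le> A"
  proof -
    have mono: "P x \<le> P y" if "x \<in> {-N..N}" "y \<in> {-N..N}" "x \<le> y" for x y
    proof (rule DERIV_nonneg_imp_nondecreasing[OF that(3)])
      fix z assume "x \<le> z" "z \<le> y"
      then have "z \<in> {-N..N}" using that by auto
      then show "\<exists>d. (P has_real_derivative d) (at z) \<and> 0 \<le> d" using Pd[of z] Jp[of z] less_imp_le by blast
    qed
    have "((\<lambda>x. J x *\<^sub>R (m (P x) powr (1 + \<theta>))) has_integral integral {P (-N)..P N} (\<lambda>x. m x powr (1 + \<theta>))) {-N..N}"
    proof (rule has_integral_substitution[where c = "P (-N)" and d = "P N"])
      show "P ` {-N..N} \<subseteq> {P (-N)..P N}" using mono N by auto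
    qed (use N mono Pd in \<open>auto intro: pc DERIV_subset\<close>)
    then have "integral {-N..N} (\<lambda>x. m (P x) powr (1 + \<theta>) * J x) = integral {P (-N)..P N} (\<lambda>x. m x powr (1 + \<theta>))"
      by (simp add: integral_unique mult.commute)
    \<comment> \<open>The interpolation may map [-N, N] onto another interval. Enlarging to an
      interval that contains both and cutting back is harmless because \<open>m\<close> vanishes
      outside [-N, N].\<close>
    also have "\<dots> \<le> integral {min (P (-N)) (-N)..max (P N) N} (\<lambda>x. m x powr (1 + \<theta>))"
      by (rule integral_subset_le) (use ipw in auto)
    also have "\<dots> = integral {-N..N} (\<lambda>x. m x powr (1 + \<theta>))"
      by (rule integral_zero_outside) (use m(3) in \<open>auto simp: abs_if split: if_splits\<close>)
    finally show ?thesis by (simp add: A_def)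
  qed
  have i1: "(\<lambda>x. m x * m (P x) powr \<theta>) integrable_on {-N..N}"
    by (intro integrable_continuous_interval continuous_intros mc continuous_on_powr_nonneg mP m th)
  have i2: "(\<lambda>x. m x powr (1 + \<theta>)) integrable_on {-N..N}" by (rule ipw)
  have i3: "(\<lambda>x. m x * s x powr (-\<theta>)) integrable_on {-N..N}"
    by (intro integrable_continuous_interval continuous_intros mc sc)
  have i4: "(\<lambda>x. m (P x) powr (1 + \<theta>) * J x) integrable_on {-N..N}"
    by (intro integrable_continuous_interval continuous_intros Jc continuous_on_powr_nonneg mP m) (use th in auto)
  have "integral {-N..N} (\<lambda>x. m x * m (P x) powr \<theta>)
     \<le> integral {-N..N} (\<lambda>x. 1 / (1 + \<theta>) * ((1 - l) * m x powr (1 + \<theta>) + l * (m x * s x powr (-\<theta>)))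
          + \<theta> / (1 + \<theta>) * (m (P x) powr (1 + \<theta>) * J x))"
  proof (rule integral_le[OF i1])
    show "(\<lambda>x. 1 / (1 + \<theta>) * ((1 - l) * m x powr (1 + \<theta>) + l * (m x * s x powr (-\<theta>)))
          + \<theta> / (1 + \<theta>) * (m (P x) powr (1 + \<theta>) * J x)) integrable_on {-N..N}"
      by (intro Henstock_Kurzweil_Integration.integrable_add integrable_on_mult_right i2 i3 i4)
    fix x assume x: "x \<in> {-N..N}"
    have "m x powr (1 + \<theta>) * J x powr (-\<theta>) \<le> (1 - l) * m x powr (1 + \<theta>) + l * (m x * s x powr (-\<theta>))"
    proof (cases "m x = 0")
      case False
      then have mx: "0 < m x" using m(2)[of x] by simp
      have "J x powr (-\<theta>) \<le> (1 - l) + l * (s x * m x) powr (-\<theta>)"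
        unfolding J_def using mx s(2)[OF x] th l by (intro powr_neg_convex) auto
      then have "m x powr (1 + \<theta>) * J x powr (-\<theta>) \<le> m x powr (1 + \<theta>) * ((1 - l) + l * (s x * m x) powr (-\<theta>))"
        by (intro mult_left_mono) auto
      also have "\<dots> = (1 - l) * m x powr (1 + \<theta>) + l * (s x powr (-\<theta>) * (m x powr (1 + \<theta>) * m x powr (-\<theta>)))"
        using mx s(2)[OF x] by (simp add: powr_mult algebra_simps)
      also have "m x powr (1 + \<theta>) * m x powr (-\<theta>) = m x" using mx by (simp add: powr_add[symmetric])
      finally show ?thesis by (simp add: mult_ac)
    qed (use th in simp)
    then have "1 / (1 + \<theta>) * (m x powr (1 + \<theta>) * J x powr (-\<theta>))
       \<le> 1 / (1 + \<theta>) * ((1 - l) * m x powr (1 + \<theta>) + l * (m x * s x powr (-\<theta>)))"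
      using th by (intro mult_left_mono) auto
    then show "m x * m (P x) powr \<theta> \<le> 1 / (1 + \<theta>) * ((1 - l) * m x powr (1 + \<theta>) + l * (m x * s x powr (-\<theta>)))
          + \<theta> / (1 + \<theta>) * (m (P x) powr (1 + \<theta>) * J x)"
      using weighted_young[of "m x" "m (P x)" "J x" \<theta>] m(2) Jp[OF x] th by fastforce
  qed
  also have "\<dots> = 1 / (1 + \<theta>) * ((1 - l) * A + l * B) + \<theta> / (1 + \<theta>) * integral {-N..N} (\<lambda>x. m (P x) powr (1 + \<theta>) * J x)"
    unfolding A_def B_def
    by (simp only: Henstock_Kurzweil_Integration.integral_add integral_mult_right integrable_on_mult_right i2 i3 i4
        Henstock_Kurzweil_Integration.integrable_add)
  also have "\<dots> \<le> 1 / (1 + \<theta>) * ((1 - l) * A + l * B) + \<theta> / (1 + \<theta>) * A"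
    using subst th by (intro add_left_mono mult_left_mono) auto
  also have "\<dots> = A + l / (1 + \<theta>) * (B - A)"
    using th by (simp add: divide_simps) (simp add: algebra_simps)
  finally show ?thesis by (simp add: A_def B_def P_def)
qed

section \<open>The self-similar profile and its quantile function\<close>

locale profile =
  fixes \<theta> R :: real
  assumes th: "0 < \<theta>" and rad: "profile_radius \<theta> R"
begin

abbreviation (input) "\<alpha> \<equiv> alpha \<theta>"

lemma R: "0 < R" using rad by (simp add: profile_radius_def)

text \<open>The last identity is the scaling law: the power \<theta> of the density
  \<tau>^(-\<alpha>) \<phi>(x / \<tau>^\<alpha>) has the order \<tau>^(2 \<alpha> - 2), which is
  that of the squared velocity along x = y \<tau>^\<alpha>.\<close>

lemma al: "0 < \<alpha>" "\<alpha> < 1" "\<alpha> * \<theta> = 2 - 2 * \<alpha>"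
  using th by (auto simp: alpha_def field_simps)

lemma ka: "0 < 1/2 * \<alpha> * (1 - \<alpha>)" using al by simp

lemma phi_nonneg: "0 \<le> phi \<theta> R r" by (simp add: phi_def)

lemma phi_pos: "\<bar>r\<bar> < R \<Longrightarrow> 0 < phi \<theta> R r"
proof -
  assume "\<bar>r\<bar> < R"
  then have "r\<^sup>2 < R\<^sup>2" by (metis abs_ge_zero power2_abs power_strict_mono zero_less_numeral)
  then have "0 < 1/2 * \<alpha> * (1 - \<alpha>) * (R\<^sup>2 - r\<^sup>2)" by (intro mult_pos_pos[OF ka]) auto
  then show ?thesis by (metis max.absorb2 order_less_imp_le order_less_irrefl phi_def powr_gt_zero)
qed

lemma phi_zero: "R \<le> \<bar>r\<bar> \<Longrightarrow> phi \<theta> R r = 0"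
proof -
  assume "R \<le> \<bar>r\<bar>"
  then have "R\<^sup>2 \<le> r\<^sup>2" using R by (metis abs_le_square_iff abs_of_pos)
  then have "1/2 * \<alpha> * (1 - \<alpha>) * (R\<^sup>2 - r\<^sup>2) \<le> 0" using ka by (intro mult_nonneg_nonpos) auto
  then show ?thesis by (simp add: phi_def)
qed

lemma phi_powr: "phi \<theta> R r powr \<theta> = max 0 (1/2 * \<alpha> * (1 - \<alpha>) * (R\<^sup>2 - r\<^sup>2))"
  using th by (simp add: phi_def powr_powr)

lemma phi_cont: "continuous_on S (phi \<theta> R)"
  unfolding phi_def using th by (intro continuous_on_powr_nonneg continuous_intros) auto

lemma phi_le: "phi \<theta> R r \<le> phi \<theta> R 0"
proof -
  have "1/2 * \<alpha> * (1 - \<alpha>) * (R\<^sup>2 - r\<^sup>2) \<le> 1/2 * \<alpha> * (1 - \<alpha>) * (R\<^sup>2 - 0\<^sup>2)"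
    using ka by (intro mult_left_mono) auto
  then show ?thesis unfolding phi_def using th by (intro powr_mono2) auto
qed

lemma phi_integral: "integral {-R..R} (phi \<theta> R) = 1"
proof -
  have "(LINT r|lborel. phi \<theta> R r) = (LINT r:{-R..R}|lborel. phi \<theta> R r)"
    unfolding set_lebesgue_integral_def
  proof (rule Bochner_Integration.integral_cong)
    show "phi \<theta> R r = indicator {-R..R} r *\<^sub>R phi \<theta> R r" for r
      using phi_zero[of r] by (cases "r \<in> {-R..R}") auto
  qed simp
  also have "\<dots> = integral {-R..R} (phi \<theta> R)"
    by (intro set_borel_integral_eq_integral borel_integrable_atLeastAtMost' phi_cont)
  finally show ?thesis using rad by (simp add: profile_radius_def)
qed

definition Phi :: "real \<Rightarrow> real" where "Phi x = integral {-R..x} (phi \<theta> R)"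

lemma Phi_deriv: "x \<in> {-R..R} \<Longrightarrow> (Phi has_real_derivative phi \<theta> R x) (at x within {-R..R})"
  unfolding Phi_def[abs_def] by (rule integral_has_real_derivative[OF phi_cont])

lemma Phi_ends: "Phi (-R) = 0" "Phi R = 1" using phi_integral by (auto simp: Phi_def)

lemma Phi_cont: "continuous_on {-R..R} Phi" using Phi_deriv by (rule DERIV_continuous_on)

lemma Phi_deriv_at: "-R < x \<Longrightarrow> x < R \<Longrightarrow> (Phi has_real_derivative phi \<theta> R x) (at x)"
  using Phi_deriv[of x] by (simp add: at_within_Icc_at)

lemma Phi_strict: "-R \<le> x \<Longrightarrow> x < y \<Longrightarrow> y \<le> R \<Longrightarrow> Phi x < Phi y"
proof (rule DERIV_pos_imp_increasing_open[of x y])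
  assume h: "-R \<le> x" "x < y" "y \<le> R"
  then show "continuous_on {x..y} Phi" by (intro continuous_on_subset[OF Phi_cont]) auto
  show "\<exists>d. (Phi has_real_derivative d) (at z) \<and> 0 < d" if "x < z" "z < y" for z
    using Phi_deriv_at[of z] phi_pos[of z] that h by (intro exI[of _ "phi \<theta> R z"]) auto
qed

lemma Phi_inj: "inj_on Phi {-R..R}"
  by (rule inj_onI) (metis Phi_strict atLeastAtMost_iff linorder_neqE_linordered_idom order_less_irrefl)

lemma Phi_image: "Phi ` {-R..R} = {0..1}"
proof
  show "Phi ` {-R..R} \<subseteq> {0..1}"
  proof safe
    fix x assume "x \<in> {-R..R}"
    then show "Phi x \<in> {0..1}"
      using Phi_strict[of "-R" x] Phi_strict[of x R] Phi_ends R by (cases "x = -R"; cases "x = R") auto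
  qed
  show "{0..1} \<subseteq> Phi ` {-R..R}"
  proof
    fix s :: real assume "s \<in> {0..1}"
    then obtain x where "-R \<le> x" "x \<le> R" "Phi x = s"
      using IVT'[of Phi "-R" s R] Phi_ends Phi_cont R by auto
    then show "s \<in> Phi ` {-R..R}" by auto
  qed
qed

definition eta :: "real \<Rightarrow> real" where "eta = the_inv_into {-R..R} Phi"

lemma eta_Phi: "x \<in> {-R..R} \<Longrightarrow> eta (Phi x) = x"
  unfolding eta_def by (rule the_inv_into_f_f[OF Phi_inj])

lemma Phi_eta: "s \<in> {0..1} \<Longrightarrow> Phi (eta s) = s" "s \<in> {0..1} \<Longrightarrow> eta s \<in> {-R..R}"
  unfolding eta_def using f_the_inv_into_f[OF Phi_inj] the_inv_into_into[OF Phi_inj _ order_refl] Phi_image by auto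

lemma eta_cont: "continuous_on {0..1} eta"
  using continuous_on_inv[OF Phi_cont compact_Icc, of eta] eta_Phi Phi_image by simp

lemma eta_interior: "0 < s \<Longrightarrow> s < 1 \<Longrightarrow> -R < eta s \<and> eta s < R"
  using Phi_eta[of s] Phi_ends by (metis atLeastAtMost_iff less_eq_real_def order_less_irrefl)

lemma eta_deriv: "0 < s \<Longrightarrow> s < 1 \<Longrightarrow> (eta has_real_derivative inverse (phi \<theta> R (eta s))) (at s)"
proof (rule DERIV_inverse_function[where f = Phi and a = 0 and b = 1])
  assume s: "0 < s" "s < 1"
  show "(Phi has_real_derivative phi \<theta> R (eta s)) (at (eta s))"
    using eta_interior[OF s] by (intro Phi_deriv_at) auto
  show "phi \<theta> R (eta s) \<noteq> 0" using phi_pos[of "eta s"] eta_interior[OF s] by (simp add: abs_less_iff)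
  show "isCont eta s" using eta_cont s by (simp add: continuous_on_interior interior_atLeastAtMost_real)
qed (use Phi_eta in auto)

lemma integral_eta:
  assumes h: "continuous_on {-R..R} h"
  shows "integral {0..1} (\<lambda>s. h (eta s)) = integral {-R..R} (\<lambda>x. phi \<theta> R x * h x)"
proof -
  have hc: "continuous_on {0..1} (\<lambda>s. h (eta s))"
    by (rule continuous_on_compose2[OF h eta_cont]) (use Phi_eta in auto)
  have "((\<lambda>x. phi \<theta> R x *\<^sub>R h (eta (Phi x))) has_integral integral {Phi (-R)..Phi R} (\<lambda>s. h (eta s))) {-R..R}"
    by (rule has_integral_substitution[where c = 0 and d = 1])
      (use R Phi_ends Phi_image hc Phi_deriv in auto)
  then have "integral {-R..R} (\<lambda>x. phi \<theta> R x * h (eta (Phi x))) = integral {0..1} (\<lambda>s. h (eta s))"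
    by (simp add: Phi_ends integral_unique)
  moreover have "integral {-R..R} (\<lambda>x. phi \<theta> R x * h (eta (Phi x))) = integral {-R..R} (\<lambda>x. phi \<theta> R x * h x)"
    by (rule integral_cong) (simp add: eta_Phi)
  ultimately show ?thesis by simp
qed

text \<open>The profile quantile function has infinite slope at both ends; squeezing its argument by
  \<open>\<kappa> > 0\<close> gives a competitor that is \<open>C\<^sup>1\<close> up to the ends.\<close>

definition etak :: "real \<Rightarrow> real \<Rightarrow> real" where "etak \<kappa> s = eta (\<kappa> + (1 - 2 * \<kappa>) * s)"
definition etak' :: "real \<Rightarrow> real \<Rightarrow> real" where
  "etak' \<kappa> s = inverse (phi \<theta> R (etak \<kappa> s)) * (1 - 2 * \<kappa>)"

definition energy :: real where "energy = integral {-R..R} (\<lambda>x. phi \<theta> R x powr (1 + \<theta>))"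
definition moment :: real where "moment = integral {0..1} (\<lambda>s. (eta s)\<^sup>2)"

lemma squeeze:
  fixes \<kappa> s :: real
  shows "0 < \<kappa> \<Longrightarrow> \<kappa> < 1/2 \<Longrightarrow> s \<in> {0..1} \<Longrightarrow> \<kappa> \<le> \<kappa> + (1 - 2 * \<kappa>) * s \<and> \<kappa> + (1 - 2 * \<kappa>) * s \<le> 1 - \<kappa>"
proof -
  assume h: "0 < \<kappa>" "\<kappa> < 1/2" "s \<in> {0..1}"
  have "(1 - 2 * \<kappa>) * s \<le> (1 - 2 * \<kappa>) * 1" "0 \<le> (1 - 2 * \<kappa>) * s" using h by (auto intro!: mult_left_mono)
  then show ?thesis by simp
qed

lemma squeeze':
  fixes \<kappa> s :: real
  assumes "0 < \<kappa>" "\<kappa> < 1/2" "s \<in> {0..1}"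
  shows "0 < \<kappa> + (1 - 2 * \<kappa>) * s" "\<kappa> + (1 - 2 * \<kappa>) * s < 1"
  using squeeze[OF assms] assms by linarith+

lemma etak_range: "0 < \<kappa> \<Longrightarrow> \<kappa> < 1/2 \<Longrightarrow> s \<in> {0..1} \<Longrightarrow> \<bar>etak \<kappa> s\<bar> < R"
  unfolding etak_def abs_less_iff using eta_interior[OF squeeze'] by fastforce

lemma etak_deriv: "0 < \<kappa> \<Longrightarrow> \<kappa> < 1/2 \<Longrightarrow> s \<in> {0..1} \<Longrightarrow> (etak \<kappa> has_real_derivative etak' \<kappa> s) (at s)"
  unfolding etak_def[abs_def] etak'_def etak_def
  by (rule DERIV_chain2[where f = eta and g = "\<lambda>s. \<kappa> + (1 - 2 * \<kappa>) * s", OF eta_deriv[OF squeeze']])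
    (auto intro!: derivative_eq_intros)

lemma etak'_pos: "0 < \<kappa> \<Longrightarrow> \<kappa> < 1/2 \<Longrightarrow> s \<in> {0..1} \<Longrightarrow> 0 < etak' \<kappa> s"
  unfolding etak'_def using phi_pos[OF etak_range] by simp

lemma etak_cont: "0 < \<kappa> \<Longrightarrow> \<kappa> < 1/2 \<Longrightarrow> continuous_on {0..1} (etak \<kappa>)"
  using etak_deriv by (meson DERIV_isCont continuous_at_imp_continuous_on)

lemma etak'_cont: "0 < \<kappa> \<Longrightarrow> \<kappa> < 1/2 \<Longrightarrow> continuous_on {0..1} (etak' \<kappa>)"
  unfolding etak'_def using phi_pos[OF etak_range]
  by (intro continuous_intros continuous_on_compose2[OF phi_cont[of UNIV] etak_cont]) fastforce+

lemma integral_squeeze_le: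
  fixes h :: "real \<Rightarrow> real"
  assumes h: "continuous_on {0..1} h" "\<And>s. s \<in> {0..1} \<Longrightarrow> 0 \<le> h s" and k: "0 < \<kappa>" "\<kappa> < 1/2"
  shows "(1 - 2 * \<kappa>) * integral {0..1} (\<lambda>s. h (\<kappa> + (1 - 2 * \<kappa>) * s)) \<le> integral {0..1} h"
proof -
  have "((\<lambda>s. (1 - 2 * \<kappa>) *\<^sub>R h (\<kappa> + (1 - 2 * \<kappa>) * s)) has_integral
      integral {\<kappa> + (1 - 2 * \<kappa>) * 0..\<kappa> + (1 - 2 * \<kappa>) * 1} h) {0..1}"
    by (rule has_integral_substitution[where c = 0 and d = 1])
      (use k squeeze[OF k] h in \<open>fastforce intro!: derivative_eq_intros\<close>)+
  then have "(1 - 2 * \<kappa>) * integral {0..1} (\<lambda>s. h (\<kappa> + (1 - 2 * \<kappa>) * s)) = integral {\<kappa>..1-\<kappa>} h"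
    by (simp add: integral_unique[symmetric] has_integral_iff)
  also have "\<dots> \<le> integral {0..1} h"
    by (rule integral_subset_le) (use k h in \<open>auto intro!: integrable_continuous_interval intro: continuous_on_subset\<close>)
  finally show ?thesis .
qed

text \<open>The parabola \<open>phi_powr\<close> multiplied by the density and integrated. By this
  identity the main terms of \<open>err_bound\<close> cancel exactly when nothing is
  squeezed.\<close>

lemma energy_moment: "1/2 * \<alpha> * (1 - \<alpha>) * R\<^sup>2 - energy = 1/2 * \<alpha> * (1 - \<alpha>) * moment"
proof -
  have "energy = integral {-R..R} (\<lambda>x. phi \<theta> R x * (1/2 * \<alpha> * (1 - \<alpha>) * (R\<^sup>2 - x\<^sup>2)))"
    unfolding energy_def
  proof (rule integral_cong)
    fix x assume "x \<in> {-R..R}"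
    then have "x\<^sup>2 \<le> R\<^sup>2" using R by (simp add: abs_le_square_iff[symmetric] abs_le_iff)
    then have "phi \<theta> R x powr \<theta> = 1/2 * \<alpha> * (1 - \<alpha>) * (R\<^sup>2 - x\<^sup>2)"
      unfolding phi_powr using ka by (simp add: mult_nonneg_nonneg)
    moreover have "phi \<theta> R x powr (1 + \<theta>) = phi \<theta> R x * phi \<theta> R x powr \<theta>"
      using phi_nonneg by (simp add: powr_add)
    ultimately show "phi \<theta> R x powr (1 + \<theta>) = phi \<theta> R x * (1/2 * \<alpha> * (1 - \<alpha>) * (R\<^sup>2 - x\<^sup>2))" by simp
  qed
  also have "\<dots> = integral {-R..R} (\<lambda>x. 1/2 * \<alpha> * (1 - \<alpha>) * R\<^sup>2 * phi \<theta> R x - 1/2 * \<alpha> * (1 - \<alpha>) * (phi \<theta> R x * x\<^sup>2))"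
    by (rule integral_cong) (simp only: algebra_simps)
  also have "\<dots> = 1/2 * \<alpha> * (1 - \<alpha>) * R\<^sup>2 * integral {-R..R} (phi \<theta> R) - 1/2 * \<alpha> * (1 - \<alpha>) * integral {-R..R} (\<lambda>x. phi \<theta> R x * x\<^sup>2)"
    by (subst Henstock_Kurzweil_Integration.integral_diff)
      (auto intro!: integrable_continuous_interval continuous_intros phi_cont)
  also have "integral {-R..R} (\<lambda>x. phi \<theta> R x * x\<^sup>2) = moment"
    unfolding moment_def by (rule integral_eta[symmetric]) (intro continuous_intros)
  finally show ?thesis by (simp add: phi_integral)
qed

lemma energy_nonneg: "0 \<le> energy"
  unfolding energy_def by (intro integral_nonneg integrable_continuous_interval continuous_on_powr_nonneg phi_cont phi_nonneg)
    (use th in auto)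

lemma moment_nonneg: "0 \<le> moment"
  unfolding moment_def by (intro integral_nonneg integrable_continuous_interval continuous_intros eta_cont) auto

text \<open>In the exponent -1 - \<theta>, the part - \<theta> comes from the slope of the squeezed
  argument and -1 from the change of variables.\<close>

lemma squeezed_energy:
  assumes k: "0 < \<kappa>" "\<kappa> < 1/2"
  shows "integral {0..1} (\<lambda>s. etak' \<kappa> s powr (-\<theta>)) \<le> (1 - 2 * \<kappa>) powr (-1-\<theta>) * energy"
proof -
  define h where "h = (\<lambda>s. phi \<theta> R (eta s) powr \<theta>)"
  have pc: "continuous_on S (\<lambda>x. phi \<theta> R x powr \<theta>)" for S by (intro continuous_on_powr_nonneg phi_cont phi_nonneg th)
  have hc: "continuous_on {0..1} h" unfolding h_def
    by (rule continuous_on_compose2[OF pc[of UNIV] eta_cont]) auto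
  have eq: "etak' \<kappa> s powr (-\<theta>) = (1 - 2 * \<kappa>) powr (-\<theta>) * h (\<kappa> + (1 - 2 * \<kappa>) * s)" if "s \<in> {0..1}" for s
    using phi_pos[OF etak_range[OF k that]] k
    by (simp add: etak'_def etak_def h_def powr_mult powr_minus inverse_powr mult.commute)
  have "integral {0..1} (\<lambda>s. etak' \<kappa> s powr (-\<theta>)) = (1 - 2 * \<kappa>) powr (-\<theta>) * integral {0..1} (\<lambda>s. h (\<kappa> + (1 - 2 * \<kappa>) * s))"
    by (subst integral_mult_right[symmetric], rule integral_cong) (rule eq)
  also have "\<dots> = (1 - 2 * \<kappa>) powr (-1-\<theta>) * ((1 - 2 * \<kappa>) * integral {0..1} (\<lambda>s. h (\<kappa> + (1 - 2 * \<kappa>) * s)))"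
    using k by (simp add: powr_diff powr_minus field_simps)
  also have "\<dots> \<le> (1 - 2 * \<kappa>) powr (-1-\<theta>) * integral {0..1} h"
    by (intro mult_left_mono integral_squeeze_le hc k) (auto simp: h_def)
  also have "integral {0..1} h = integral {-R..R} (\<lambda>x. phi \<theta> R x * phi \<theta> R x powr \<theta>)"
    unfolding h_def by (rule integral_eta[OF pc])
  also have "\<dots> = energy" unfolding energy_def
    by (rule integral_cong) (use phi_nonneg in \<open>simp add: powr_add\<close>)
  finally show ?thesis .
qed

lemma squeezed_moment:
  assumes k: "0 < \<kappa>" "\<kappa> < 1/2"
  shows "integral {0..1} (\<lambda>s. (etak \<kappa> s)\<^sup>2) \<le> (1 - 2 * \<kappa>) powr (-1-\<theta>) * moment"
proof -
  have "(1 - 2 * \<kappa>) * integral {0..1} (\<lambda>s. (etak \<kappa> s)\<^sup>2) \<le> moment"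
    unfolding moment_def etak_def
    using integral_squeeze_le[of "\<lambda>s. (eta s)\<^sup>2", OF _ _ k] by (simp add: eta_cont continuous_intros)
  then have "integral {0..1} (\<lambda>s. (etak \<kappa> s)\<^sup>2) \<le> (1 - 2 * \<kappa>) powr (-1) * moment"
    using k by (simp add: powr_minus_divide field_simps)
  \<comment> \<open>The factor is weakened to that of \<open>squeezed_energy\<close>, so that a
    single constant describes both errors.\<close>
  also have "\<dots> \<le> (1 - 2 * \<kappa>) powr (-1-\<theta>) * moment"
    using k th moment_nonneg by (intro mult_right_mono powr_mono') auto
  finally show ?thesis .
qed

lemma etak_tendsto: "0 < d \<Longrightarrow> \<exists>k0. 0 < k0 \<and> k0 < 1/2 \<and> (\<forall>\<kappa> s. 0 < \<kappa> \<longrightarrow> \<kappa> < k0 \<longrightarrow> s \<in> {0..1} \<longrightarrow> \<bar>etak \<kappa> s - eta s\<bar> < d)"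
proof -
  assume d: "0 < d"
  have "uniformly_continuous_on {0..1} eta" by (intro compact_uniformly_continuous eta_cont compact_Icc)
  then obtain e where e: "e > 0" "\<And>s s'. s \<in> {0..1} \<Longrightarrow> s' \<in> {0..1} \<Longrightarrow> \<bar>s' - s\<bar> < e \<Longrightarrow> \<bar>eta s' - eta s\<bar> < d"
    unfolding uniformly_continuous_on_def dist_real_def using d by meson
  show ?thesis
  proof (intro exI[of _ "min (1/4) e"] conjI allI impI)
    fix \<kappa> s :: real assume h: "0 < \<kappa>" "\<kappa> < min (1/4) e" "s \<in> {0..1}"
    have "\<bar>\<kappa> * (1 - 2 * s)\<bar> \<le> \<kappa> * 1" using h unfolding abs_mult by (intro mult_mono) auto
    then have "\<bar>\<kappa> + (1 - 2 * \<kappa>) * s - s\<bar> < e" using h by (simp add: algebra_simps)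
    moreover have "\<kappa> + (1 - 2 * \<kappa>) * s \<in> {0..1}" using squeeze[of \<kappa> s] h by auto
    ultimately show "\<bar>etak \<kappa> s - eta s\<bar> < d" unfolding etak_def using e(2) h by blast
  qed (use e in auto)
qed

end

section \<open>Solutions started from the self-similar profile\<close>

text \<open>\<open>Ut\<close>, \<open>Ux\<close> are taken at x and \<open>Pt\<close>,
  \<open>Px\<close> at the interpolated point x + l (S - x), with \<open>m\<close> and
  \<open>k\<close> the \<theta>-th powers of the density there. The right side is the derivative,
  along the velocity - Ux, of the integrand in \<open>perturbed_rate\<close>. Along this flow S
  moves with the self-similar velocity \<alpha> S / \<tau>, by the assumption
  \<open>S\<close>.\<close>

lemma action_dissipation:
  fixes Ut Ux Pt Px m k S x \<tau> \<alpha> l St Sx :: real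
  assumes pos: "0 < \<tau>" "0 < l" "0 < \<alpha>" "\<alpha> < 1"
    and S: "St - Ux * Sx = \<alpha> * S / \<tau>"
    and HJ: "- Ut + 1/2 * Ux\<^sup>2 = m" "- Pt + 1/2 * Px\<^sup>2 = k"
  shows "(m - k) / l - l / 2 * (- Ux - \<alpha> * S / \<tau>)\<^sup>2 - 1/2 * \<alpha> * (1 - \<alpha>) / \<tau>\<^sup>2 * (S\<^sup>2 - x\<^sup>2)
    \<le> ((Pt + Px * (l * St) - Ut) / l
        - (- \<alpha> / \<tau>\<^sup>2 * (S * (x - S)) + \<alpha> / \<tau> * (St * (x - S) - S * St)
           - (1 + \<alpha>) / 2 / \<tau>\<^sup>2 * (x - S)\<^sup>2 - (1 + \<alpha>) / \<tau> * ((x - S) * St)))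
      - Ux * ((Px * (1 + l * (Sx - 1)) - Ux) / l
        - (\<alpha> / \<tau> * (Sx * (x - S) + S * (1 - Sx)) + (1 + \<alpha>) / \<tau> * ((x - S) * (1 - Sx))))"
    (is "?L \<le> ?R")
proof -
  \<comment> \<open>Here v is the flow velocity, V its excess over the self-similar velocity
    \<alpha> q, and z the scaled displacement.\<close>
  define v where "v = - Ux"
  define q where "q = S / \<tau>"
  define V where "V = v - \<alpha> * q"
  define Z where "Z = x - S"
  define z where "z = Z / \<tau>"
  have st: "St = \<alpha> * q - v * Sx" using S by (simp add: v_def q_def)
  have zq: "Z = z * \<tau>" "S = q * \<tau>" "x = (z + q) * \<tau>" using pos by (auto simp: z_def q_def Z_def field_simps)
  have "(Pt + Px * (l * St) - Ut) / l - Ux * ((Px * (1 + l * (Sx - 1)) - Ux) / l)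
     = (Pt + Px * (v + l * (\<alpha> * q - v)) - (Ut - v\<^sup>2)) / l"
    unfolding st v_def by (simp add: diff_divide_distrib[symmetric] power2_eq_square algebra_simps)
  also have "\<dots> \<ge> (m - k - 1/2 * (v - l * V)\<^sup>2 + 1/2 * v\<^sup>2) / l"
  proof (rule divide_right_mono)
    \<comment> \<open>The interpolated point moves with velocity v - l V, and the Hamilton-Jacobi
      equation there leaves a perfect square, which is dropped.\<close>
    have "Pt + Px * (v - l * V) - (Ut - v\<^sup>2) - (m - k - 1/2 * (v - l * V)\<^sup>2 + 1/2 * v\<^sup>2) = 1/2 * (Px + (v - l * V))\<^sup>2"
      using HJ unfolding v_def by (simp add: power2_eq_square algebra_simps)
    then show "m - k - 1/2 * (v - l * V)\<^sup>2 + 1/2 * v\<^sup>2 \<le> Pt + Px * (v + l * (\<alpha> * q - v)) - (Ut - v\<^sup>2)"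
    proof -
      assume e: "Pt + Px * (v - l * V) - (Ut - v\<^sup>2) - (m - k - 1/2 * (v - l * V)\<^sup>2 + 1/2 * v\<^sup>2) = 1/2 * (Px + (v - l * V))\<^sup>2"
      have eq: "v + l * (\<alpha> * q - v) = v - l * V" by (simp add: V_def algebra_simps)
      have "0 \<le> 1/2 * (Px + (v - l * V))\<^sup>2" by simp
      then show ?thesis unfolding eq using e by linarith
    qed
  qed (use pos in simp)
  also have "(m - k - 1/2 * (v - l * V)\<^sup>2 + 1/2 * v\<^sup>2) / l = (m - k) / l + v * V - l / 2 * V\<^sup>2"
    using pos by (simp add: field_simps power2_eq_square)
  finally have 1: "(m - k) / l + v * V - l / 2 * V\<^sup>2
     \<le> (Pt + Px * (l * St) - Ut) / l - Ux * ((Px * (1 + l * (Sx - 1)) - Ux) / l)" .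
  have 2: "(- \<alpha> / \<tau>\<^sup>2 * (S * (x - S)) + \<alpha> / \<tau> * (St * (x - S) - S * St)
           - (1 + \<alpha>) / 2 / \<tau>\<^sup>2 * (x - S)\<^sup>2 - (1 + \<alpha>) / \<tau> * ((x - S) * St))
      - Ux * (\<alpha> / \<tau> * (Sx * (x - S) + S * (1 - Sx)) + (1 + \<alpha>) / \<tau> * ((x - S) * (1 - Sx)))
     = - \<alpha> * q * z + \<alpha> * (\<alpha> * q * z + q * V) - (1 + \<alpha>) / 2 * z\<^sup>2 + (1 + \<alpha>) * z * V"
    unfolding st Z_def[symmetric] zq V_def v_def using pos
    by (simp add: power2_eq_square field_simps)
  \<comment> \<open>Here the exponent 1 + \<alpha> proves admissible: the quadratic form in V and z
    is a sum of two squares even after - \<alpha> (1 - \<alpha>) z^2 / 2 has been spent on the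
    difference S^2 - x^2.\<close>
  have 3: "(v * V - (- \<alpha> * q * z + \<alpha> * (\<alpha> * q * z + q * V) - (1 + \<alpha>) / 2 * z\<^sup>2 + (1 + \<alpha>) * z * V))
      - (- 1/2 * \<alpha> * (1 - \<alpha>) * (q\<^sup>2 - (z + q)\<^sup>2))
    = (V - (1 + \<alpha>) / 2 * z)\<^sup>2 + ((1 - \<alpha>) / 2 * z)\<^sup>2"
    unfolding V_def by (simp add: power2_eq_square field_simps)
  have 4: "1/2 * \<alpha> * (1 - \<alpha>) / \<tau>\<^sup>2 * (S\<^sup>2 - x\<^sup>2) = 1/2 * \<alpha> * (1 - \<alpha>) * (q\<^sup>2 - (z + q)\<^sup>2)"
    unfolding zq using pos by (simp add: power2_eq_square field_simps)
  have 5: "- Ux - \<alpha> * S / \<tau> = V" by (simp add: V_def v_def q_def)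
  define X where "X = (Pt + Px * (l * St) - Ut) / l"
  define Y where "Y = (Px * (1 + l * (Sx - 1)) - Ux) / l"
  define A where "A = - \<alpha> / \<tau>\<^sup>2 * (S * (x - S)) + \<alpha> / \<tau> * (St * (x - S) - S * St)
           - (1 + \<alpha>) / 2 / \<tau>\<^sup>2 * (x - S)\<^sup>2 - (1 + \<alpha>) / \<tau> * ((x - S) * St)"
  define B where "B = \<alpha> / \<tau> * (Sx * (x - S) + S * (1 - Sx)) + (1 + \<alpha>) / \<tau> * ((x - S) * (1 - Sx))"
  define D where "D = - \<alpha> * q * z + \<alpha> * (\<alpha> * q * z + q * V) - (1 + \<alpha>) / 2 * z\<^sup>2 + (1 + \<alpha>) * z * V"
  have "(X - A) - Ux * (Y - B) = (X - Ux * Y) - (A - Ux * B)" by (simp add: algebra_simps)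
  also have "A - Ux * B = D" using 2 unfolding A_def B_def D_def .
  finally have r: "?R = (X - Ux * Y) - D" unfolding X_def A_def Y_def B_def .
  have "(m - k) / l + v * V - l / 2 * V\<^sup>2 \<le> X - Ux * Y" using 1 unfolding X_def Y_def .
  moreover have "v * V - D + 1/2 * \<alpha> * (1 - \<alpha>) * (q\<^sup>2 - (z + q)\<^sup>2) \<ge> 0"
    using 3 unfolding D_def by (simp add: algebra_simps)
  ultimately show ?thesis unfolding r 4 5 by linarith
qed

locale mfg_eps = profile \<theta> R + transport T N M "\<lambda>t x. M t x * dx U t x"
  for \<theta> R T N :: real and U M :: "real \<Rightarrow> real \<Rightarrow> real" +
  fixes \<epsilon> L :: real
  assumes eps: "0 < \<epsilon>"
    and U_C1: "Ck_on 1 (strip T) U"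
    and U_bound: "t \<in> {0<..<T} \<Longrightarrow> \<bar>dx U t x\<bar> \<le> L"
    and HJ: "t \<in> {0<..<T} \<Longrightarrow> - dt U t x + 1/2 * (dx U t x)\<^sup>2 = M t x powr \<theta>"
begin

lemma U_cont: "continuous_on (strip T) (\<lambda>(t, x). dt U t x)" "continuous_on (strip T) (\<lambda>(t, x). dx U t x)"
  using U_C1 by (auto simp: numeral_eq_Suc)

lemma U_has_grad: "t \<in> {0<..<T} \<Longrightarrow> has_grad U (dt U t x) (dx U t x) t x"
proof (rule has_grad_partials[where S = "strip T" and fx = "dx U"])
  show "open (strip T)" by (intro open_Times) auto
  have d: "\<forall>(t, x)\<in>strip T. (\<lambda>s. U s x) differentiable (at t) \<and> U t differentiable (at x)"
    using U_C1 by (simp add: numeral_eq_Suc)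
  show "((\<lambda>s. U s x) has_real_derivative dt U t x) (at t)" if "t \<in> {0<..<T}"
    using d that by (auto simp: DERIV_deriv_iff_real_differentiable)
  show "(U s has_real_derivative dx U s y) (at y)" if "(s, y) \<in> strip T" for s y
    using d that by (auto simp: DERIV_deriv_iff_real_differentiable)
qed (use U_cont in auto)

definition S :: "real \<Rightarrow> real \<Rightarrow> real \<Rightarrow> real" where
  "S \<kappa> t x = (t + \<epsilon>) powr \<alpha> * etak \<kappa> (F t x)"

text \<open>The space derivative of \<open>S\<close> is S' M. Splitting off \<open>M\<close> leaves
  a factor that stays positive in the vacuum; it is the reciprocal of the image density.\<close>

definition S' :: "real \<Rightarrow> real \<Rightarrow> real \<Rightarrow> real" where
  "S' \<kappa> t x = (t + \<epsilon>) powr \<alpha> * etak' \<kappa> (F t x)"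

text \<open>The second summand is \<open>dx U\<close> times the space derivative of
  \<open>S\<close>, so that along the flow with velocity - dx U the map only dilates.\<close>

definition St :: "real \<Rightarrow> real \<Rightarrow> real \<Rightarrow> real" where
  "St \<kappa> t x = \<alpha> * S \<kappa> t x / (t + \<epsilon>) + S' \<kappa> t x * (M t x * dx U t x)"

lemma tau: "t \<in> {0..T} \<Longrightarrow> 0 < t + \<epsilon>" using eps by simp

text \<open>For the rescaled profile, the energy and the second moment divided by \<tau>^2 carry the
  same power of \<tau>. All terms of \<open>perturbed_rate\<close> can therefore be compared through
  one factor.\<close>

lemma scale_identity: "t \<in> {0..T} \<Longrightarrow> ((t + \<epsilon>) powr \<alpha>) powr (-\<theta>) = ((t + \<epsilon>) powr \<alpha>)\<^sup>2 / (t + \<epsilon>)\<^sup>2"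
proof -
  assume "t \<in> {0..T}"
  then have t: "0 < t + \<epsilon>" by (rule tau)
  have "((t + \<epsilon>) powr \<alpha>) powr (-\<theta>) = (t + \<epsilon>) powr (2 * \<alpha> - 2)"
    using al(3) by (simp add: powr_powr)
  also have "\<dots> = (t + \<epsilon>) powr (2 * \<alpha>) / (t + \<epsilon>) powr 2" by (rule powr_diff)
  also have "\<dots> = ((t + \<epsilon>) powr \<alpha>)\<^sup>2 / (t + \<epsilon>)\<^sup>2"
    using t by (simp add: powr_power mult.commute)
  finally show ?thesis .
qed

lemma Frange: "t \<in> {0..T} \<Longrightarrow> x \<in> {-N..N} \<Longrightarrow> F t x \<in> {0..1}"
  by (rule F_range) auto

lemma time_powr: "t \<in> {0<..<T} \<Longrightarrow> has_grad (\<lambda>t x. (t + \<epsilon>) powr \<alpha>) (\<alpha> * (t + \<epsilon>) powr \<alpha> / (t + \<epsilon>)) 0 t x"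
  using eps by (intro has_grad_time) (auto intro!: derivative_eq_intros simp: powr_diff)

context
  fixes \<kappa> :: real assumes k: "0 < \<kappa>" "\<kappa> < 1/2"
begin

lemma S_has_grad:
  assumes t: "t \<in> {0<..<T}" and x: "x \<in> {-N..N}"
  shows "has_grad (S \<kappa>) (St \<kappa> t x) (S' \<kappa> t x * M t x) t x"
proof -
  have "has_grad (\<lambda>t x. etak \<kappa> (F t x)) (etak' \<kappa> (F t x) * (M t x * dx U t x)) (etak' \<kappa> (F t x) * M t x) t x"
    by (intro has_grad_chain F_has_grad etak_deriv k Frange) (use t x in auto)
  from has_grad_mult[OF time_powr[OF t] this]
  show ?thesis unfolding S_def[abs_def] St_def S'_def
    by (rule has_grad_cong) (simp_all add: S_def)
qed

lemma S_bound: "t \<in> {0..T} \<Longrightarrow> x \<in> {-N..N} \<Longrightarrow> \<bar>S \<kappa> t x\<bar> \<le> (t + \<epsilon>) powr \<alpha> * R"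
  unfolding S_def abs_mult using etak_range[OF k Frange, of t x] by (intro mult_mono) auto

lemma F_cont': "continuous_on ({0..T} \<times> {-N..N}) (\<lambda>p. F (fst p) (snd p))"
  by (rule continuous_on_subset[OF F_cont[unfolded case_prod_unfold]]) auto

lemma S_cont: "continuous_on ({0..T} \<times> {-N..N}) (\<lambda>p. S \<kappa> (fst p) (snd p))"
  unfolding S_def
  by (intro continuous_intros continuous_on_compose2[OF etak_cont[OF k] F_cont'])
    (use eps Frange in \<open>auto simp: add_nonneg_pos less_imp_neq[symmetric]\<close>)

lemma S'_cont: "continuous_on ({0..T} \<times> {-N..N}) (\<lambda>p. S' \<kappa> (fst p) (snd p))"
  unfolding S'_def
  by (intro continuous_intros continuous_on_compose2[OF etak'_cont[OF k] F_cont'])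
    (use eps Frange in \<open>auto simp: add_nonneg_pos less_imp_neq[symmetric]\<close>)

lemma S'_pos: "t \<in> {0..T} \<Longrightarrow> x \<in> {-N..N} \<Longrightarrow> 0 < S' \<kappa> t x"
  unfolding S'_def using etak'_pos[OF k Frange, of t x] eps by simp

lemma slice_conts:
  assumes t: "t \<in> {0..T}"
  shows "continuous_on {-N..N} (S \<kappa> t)" "continuous_on {-N..N} (S' \<kappa> t)" "continuous_on {-N..N} (F t)"
  using continuous_on_slice2[of "{0..T}" "{-N..N}" "S \<kappa>" t "{-N..N}"] S_cont
    continuous_on_slice2[of "{0..T}" "{-N..N}" "S' \<kappa>" t "{-N..N}"] S'_cont
    continuous_on_slice2[of "{0..T}" "{-N..N}" "F" t "{-N..N}"] F_cont' t
  by (auto simp: case_prod_unfold)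

text \<open>\<open>F\<close> transports the density to the uniform one on [0, 1]. It may be constant
  across vacuum gaps, which carry no mass, and its inverse is never formed.\<close>

lemma integral_F:
  assumes t: "t \<in> {0..T}" and h: "continuous_on {0..1} h"
  shows "integral {-N..N} (\<lambda>x. M t x * h (F t x)) = integral {0..1} h"
proof -
  have "((\<lambda>x. M t x *\<^sub>R h (F t x)) has_integral integral {F t (-N)..F t N} h) {-N..N}"
    by (rule has_integral_substitution[where c = 0 and d = 1])
      (use N h t Frange[OF t] F_left[OF t] F_right[OF t] in \<open>auto intro!: DERIV_subset[OF F_has_derivative]\<close>)
  then show ?thesis using F_left[OF t, of "-N"] F_right[OF t, of N] by (simp add: integral_unique)
qed

lemma integral_S_powers:
  assumes t: "t \<in> {0..T}"
  shows "integral {-N..N} (\<lambda>x. M t x * (S \<kappa> t x)\<^sup>2) = ((t + \<epsilon>) powr \<alpha>)\<^sup>2 * integral {0..1} (\<lambda>s. (etak \<kappa> s)\<^sup>2)"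
    "integral {-N..N} (\<lambda>x. M t x * S' \<kappa> t x powr (-\<theta>))
       = ((t + \<epsilon>) powr \<alpha>)\<^sup>2 / (t + \<epsilon>)\<^sup>2 * integral {0..1} (\<lambda>s. etak' \<kappa> s powr (-\<theta>))"
proof -
  have "integral {-N..N} (\<lambda>x. M t x * (S \<kappa> t x)\<^sup>2) = integral {0..1} (\<lambda>s. ((t + \<epsilon>) powr \<alpha>)\<^sup>2 * (etak \<kappa> s)\<^sup>2)"
    unfolding S_def power_mult_distrib
    by (rule integral_F[OF t]) (intro continuous_intros etak_cont k)
  then show "integral {-N..N} (\<lambda>x. M t x * (S \<kappa> t x)\<^sup>2) = ((t + \<epsilon>) powr \<alpha>)\<^sup>2 * integral {0..1} (\<lambda>s. (etak \<kappa> s)\<^sup>2)"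
    by simp
  have ec: "continuous_on {0..1} (\<lambda>s. etak' \<kappa> s powr (-\<theta>))"
    by (intro continuous_on_powr etak'_cont k continuous_intros) (use etak'_pos[OF k] in force)
  have "integral {-N..N} (\<lambda>x. M t x * S' \<kappa> t x powr (-\<theta>))
     = integral {-N..N} (\<lambda>x. M t x * (((t + \<epsilon>) powr \<alpha>) powr (-\<theta>) * etak' \<kappa> (F t x) powr (-\<theta>)))"
    by (rule integral_cong) (use etak'_pos[OF k Frange[OF t]] in \<open>simp add: S'_def powr_mult less_imp_le\<close>)
  also have "\<dots> = integral {0..1} (\<lambda>s. ((t + \<epsilon>) powr \<alpha>) powr (-\<theta>) * etak' \<kappa> s powr (-\<theta>))"
    by (rule integral_F[OF t, of "\<lambda>s. ((t + \<epsilon>) powr \<alpha>) powr (-\<theta>) * etak' \<kappa> s powr (-\<theta>)"]) (intro continuous_intros ec)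
  finally show "integral {-N..N} (\<lambda>x. M t x * S' \<kappa> t x powr (-\<theta>))
       = ((t + \<epsilon>) powr \<alpha>)\<^sup>2 / (t + \<epsilon>)\<^sup>2 * integral {0..1} (\<lambda>s. etak' \<kappa> s powr (-\<theta>))"
    by (simp add: scale_identity[OF t])
qed

end

text \<open>Young's inequality against the self-similar density at the same point: the flat convexity of
  the energy suffices here, the loss it causes is absorbed by the exponent \<open>(1 + \<alpha>) / 2 < 1\<close>.\<close>

lemma energy_lower_bound:
  assumes t: "t \<in> {0..T}"
  shows "((t + \<epsilon>) powr \<alpha>)\<^sup>2 / (t + \<epsilon>)\<^sup>2 * (1/2 * \<alpha> * (1 - \<alpha>) * R\<^sup>2 - \<theta> / (1 + \<theta>) * energy)
      - 1/2 * \<alpha> * (1 - \<alpha>) / (t + \<epsilon>)\<^sup>2 * integral {-N..N} (\<lambda>x. M t x * x\<^sup>2)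
    \<le> 1 / (1 + \<theta>) * integral {-N..N} (\<lambda>x. M t x powr (1 + \<theta>))"
proof -
  define c where "c = (t + \<epsilon>) powr \<alpha>"
  define a where "a = 1/2 * \<alpha> * (1 - \<alpha>)"
  define \<tau> where "\<tau> = t + \<epsilon>"
  have c: "0 < c" using eps t by (simp add: c_def)
  have tp: "0 < \<tau>" using tau[OF t] by (simp add: \<tau>_def)
  have a: "0 < a" using ka by (simp add: a_def)
  have cth: "c powr (-\<theta>) = c\<^sup>2 / \<tau>\<^sup>2" unfolding c_def \<tau>_def by (rule scale_identity[OF t])
  \<comment> \<open>The self-similar density at time t, of width scale c.\<close>
  define w where "w = (\<lambda>x. phi \<theta> R (x / c) / c)"
  have w0: "0 \<le> w x" for x using c phi_nonneg by (simp add: w_def)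
  have pw: "continuous_on A (\<lambda>y. phi \<theta> R y powr (1 + \<theta>))" for A
    by (intro continuous_on_powr_nonneg phi_cont phi_nonneg) (use th in auto)
  have wc: "continuous_on A (\<lambda>x. w x powr (1 + \<theta>))" for A
    unfolding w_def using c phi_nonneg th
    by (intro continuous_on_powr_nonneg continuous_intros continuous_on_compose2[OF phi_cont[of UNIV]]) auto
  have wint: "integral {-N..N} (\<lambda>x. w x powr (1 + \<theta>)) \<le> c\<^sup>2 / \<tau>\<^sup>2 * energy"
  proof -
    have "((\<lambda>x. (1 / c) *\<^sub>R (phi \<theta> R (x / c) powr (1 + \<theta>))) has_integral integral {(-N) / c..N / c} (\<lambda>y. phi \<theta> R y powr (1 + \<theta>))) {-N..N}"
      by (rule has_integral_substitution[where c = "(-N)/c" and d = "N/c"])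
        (use c N in \<open>auto intro!: derivative_eq_intros pw simp: divide_right_mono frac_le\<close>)
    then have 1: "integral {-N..N} (\<lambda>x. 1 / c * (phi \<theta> R (x / c) powr (1 + \<theta>))) = integral {(-N) / c..N / c} (\<lambda>y. phi \<theta> R y powr (1 + \<theta>))"
      unfolding real_scaleR_def by (rule integral_unique)
    also have "\<dots> \<le> integral {min ((-N) / c) (-R)..max (N / c) R} (\<lambda>y. phi \<theta> R y powr (1 + \<theta>))"
      by (rule integral_subset_le) (auto intro!: integrable_continuous_interval pw)
    also have "\<dots> = energy" unfolding energy_def
    proof (rule integral_zero_outside)
      show "phi \<theta> R y powr (1 + \<theta>) = 0" if "y \<notin> {-R..R}" for y
        using phi_zero[of y] that by (auto simp: abs_if split: if_splits)
    qed auto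
    finally have 2: "integral {-N..N} (\<lambda>x. 1 / c * (phi \<theta> R (x / c) powr (1 + \<theta>))) \<le> energy" .
    have "w x powr (1 + \<theta>) = c powr (-\<theta>) * (1 / c * (phi \<theta> R (x / c) powr (1 + \<theta>)))" for x
    proof -
      have "w x powr (1 + \<theta>) = phi \<theta> R (x / c) powr (1 + \<theta>) / c powr (1 + \<theta>)"
        unfolding w_def using c phi_nonneg by (simp add: powr_divide)
      also have "c powr (1 + \<theta>) = c * c powr \<theta>" using c by (simp add: powr_add)
      finally show ?thesis using c by (simp add: powr_minus field_simps)
    qed
    then have "integral {-N..N} (\<lambda>x. w x powr (1 + \<theta>)) = c powr (-\<theta>) * integral {-N..N} (\<lambda>x. 1 / c * (phi \<theta> R (x / c) powr (1 + \<theta>)))"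
      by (simp only: integral_mult_right)
    also have "\<dots> \<le> c powr (-\<theta>) * energy" using 2 by (intro mult_left_mono) auto
    finally show ?thesis by (simp add: cth)
  qed
  \<comment> \<open>Dropping the positive part in \<open>phi_powr\<close> gives a parabola that
    bounds the power from below on the whole line, also outside the support of
    \<open>w\<close>.\<close>
  have wth: "a / \<tau>\<^sup>2 * (c\<^sup>2 * R\<^sup>2 - x\<^sup>2) \<le> w x powr \<theta>" for x
  proof -
    have "w x powr \<theta> = c powr (-\<theta>) * phi \<theta> R (x / c) powr \<theta>"
      unfolding w_def using c phi_nonneg by (simp add: powr_divide powr_minus field_simps)
    also have "\<dots> \<ge> c powr (-\<theta>) * (a * (R\<^sup>2 - (x / c)\<^sup>2))"
      unfolding phi_powr a_def by (intro mult_left_mono) auto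
    also have "c powr (-\<theta>) * (a * (R\<^sup>2 - (x / c)\<^sup>2)) = a / \<tau>\<^sup>2 * (c\<^sup>2 * R\<^sup>2 - x\<^sup>2)"
      unfolding cth using c tp by (simp add: field_simps power_divide)
    finally show ?thesis .
  qed
  have Mc: "continuous_on A (M t)" for A by (rule M_slice[OF t])
  have Mp: "continuous_on A (\<lambda>x. M t x powr (1 + \<theta>))" for A
    by (intro continuous_on_powr_nonneg Mc M_nonneg t) (use th in auto)
  have ineq: "a / \<tau>\<^sup>2 * (c\<^sup>2 * R\<^sup>2) * M t x - a / \<tau>\<^sup>2 * (M t x * x\<^sup>2) \<le> 1 / (1 + \<theta>) * M t x powr (1 + \<theta>) + \<theta> / (1 + \<theta>) * w x powr (1 + \<theta>)" for x
  proof -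
    have "M t x * (a / \<tau>\<^sup>2 * (c\<^sup>2 * R\<^sup>2 - x\<^sup>2)) \<le> M t x * w x powr \<theta>"
      by (intro mult_left_mono wth M_nonneg t)
    also have "\<dots> \<le> 1 / (1 + \<theta>) * M t x powr (1 + \<theta>) + \<theta> / (1 + \<theta>) * w x powr (1 + \<theta>)"
      using weighted_young[OF M_nonneg[OF t] w0 zero_less_one th, of x x] by simp
    finally show ?thesis by (simp add: algebra_simps)
  qed
  have iM: "M t integrable_on {-N..N}" "(\<lambda>x. M t x * x\<^sup>2) integrable_on {-N..N}" "(\<lambda>x. M t x powr (1 + \<theta>)) integrable_on {-N..N}"
    "(\<lambda>x. w x powr (1 + \<theta>)) integrable_on {-N..N}"
    by (intro integrable_continuous_interval continuous_intros Mc Mp wc)+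
  have "integral {-N..N} (\<lambda>x. a / \<tau>\<^sup>2 * (c\<^sup>2 * R\<^sup>2) * M t x - a / \<tau>\<^sup>2 * (M t x * x\<^sup>2))
     \<le> integral {-N..N} (\<lambda>x. 1 / (1 + \<theta>) * M t x powr (1 + \<theta>) + \<theta> / (1 + \<theta>) * w x powr (1 + \<theta>))"
    by (intro integral_le ineq Henstock_Kurzweil_Integration.integrable_diff Henstock_Kurzweil_Integration.integrable_add integrable_on_mult_right iM)
  also have "\<dots> = 1 / (1 + \<theta>) * integral {-N..N} (\<lambda>x. M t x powr (1 + \<theta>)) + \<theta> / (1 + \<theta>) * integral {-N..N} (\<lambda>x. w x powr (1 + \<theta>))"
    by (simp only: Henstock_Kurzweil_Integration.integral_add integral_mult_right integrable_on_mult_right iM)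
  also have "\<dots> \<le> 1 / (1 + \<theta>) * integral {-N..N} (\<lambda>x. M t x powr (1 + \<theta>)) + \<theta> / (1 + \<theta>) * (c\<^sup>2 / \<tau>\<^sup>2 * energy)"
    using wint th by (intro add_left_mono mult_left_mono) auto
  also have "integral {-N..N} (\<lambda>x. a / \<tau>\<^sup>2 * (c\<^sup>2 * R\<^sup>2) * M t x - a / \<tau>\<^sup>2 * (M t x * x\<^sup>2))
     = a / \<tau>\<^sup>2 * (c\<^sup>2 * R\<^sup>2) * integral {-N..N} (M t) - a / \<tau>\<^sup>2 * integral {-N..N} (\<lambda>x. M t x * x\<^sup>2)"
    by (simp only: Henstock_Kurzweil_Integration.integral_diff integral_mult_right integrable_on_mult_right iM)
  finally show ?thesis
    unfolding M_mass[OF t] c_def[symmetric] a_def[symmetric] unfolding \<tau>_def[symmetric]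
    by (simp add: algebra_simps add_divide_distrib diff_divide_distrib)
qed

end

section \<open>Quasi-convexity of the squared distance to the self-similar solution\<close>

context mfg_eps
begin

context
  fixes \<kappa> :: real assumes k: "0 < \<kappa>" "\<kappa> < 1/2"
begin

definition Del :: "real \<Rightarrow> real" where
  "Del t = integral {-N..N} (\<lambda>x. M t x * (1/2 * (x - S \<kappa> t x)\<^sup>2))"

text \<open>By \<open>Del_deriv\<close> this is \<open>Del' - (1 + \<alpha>) Del / \<tau>\<close>,
  written as one integral so that it can be recognised as the limit of the perturbed
  quantity.\<close>

definition rho :: "real \<Rightarrow> real" where
  "rho t = integral {-N..N} (\<lambda>x. M t x * ((x - S \<kappa> t x) * (- dx U t x - \<alpha> * S \<kappa> t x / (t + \<epsilon>))
      - (1 + \<alpha>) / 2 / (t + \<epsilon>) * (x - S \<kappa> t x)\<^sup>2))"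

text \<open>Uniform in time: \<epsilon>^(2 \<alpha> - 2) is the largest value of \<tau>^(2 \<alpha>
  - 2), and the middle factor is the loss by squeezing in \<open>squeezed_energy\<close> and
  \<open>squeezed_moment\<close>.\<close>

definition err :: real where
  "err = \<epsilon> powr (2 * \<alpha> - 2) * ((1 - 2 * \<kappa>) powr (-1-\<theta>) - 1) * (energy + moment)"

abbreviation (input) "dmn \<equiv> {0<..<T} \<times> {-N..N}"

lemma box_conts:
  "continuous_on dmn (\<lambda>p. S \<kappa> (fst p) (snd p))" "continuous_on dmn (\<lambda>p. S' \<kappa> (fst p) (snd p))"
  "continuous_on dmn (\<lambda>p. M (fst p) (snd p))" "continuous_on dmn (\<lambda>p. dt U (fst p) (snd p))"
  "continuous_on dmn (\<lambda>p. dx U (fst p) (snd p))" "continuous_on dmn (\<lambda>p. St \<kappa> (fst p) (snd p))"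
  "continuous_on dmn (\<lambda>p. fst p + \<epsilon>)"
proof -
  show 1: "continuous_on dmn (\<lambda>p. S \<kappa> (fst p) (snd p))" by (rule continuous_on_subset[OF S_cont[OF k]]) auto
  show 2: "continuous_on dmn (\<lambda>p. S' \<kappa> (fst p) (snd p))" by (rule continuous_on_subset[OF S'_cont[OF k]]) auto
  show 3: "continuous_on dmn (\<lambda>p. M (fst p) (snd p))" by (rule continuous_on_subset[OF M_cont[unfolded case_prod_unfold]]) auto
  show "continuous_on dmn (\<lambda>p. dt U (fst p) (snd p))" by (rule continuous_on_subset[OF U_cont(1)[unfolded case_prod_unfold]]) auto
  show 4: "continuous_on dmn (\<lambda>p. dx U (fst p) (snd p))" by (rule continuous_on_subset[OF U_cont(2)[unfolded case_prod_unfold]]) auto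
  show 5: "continuous_on dmn (\<lambda>p. fst p + \<epsilon>)" by (intro continuous_intros)
  show "continuous_on dmn (\<lambda>p. St \<kappa> (fst p) (snd p))"
    unfolding St_def by (intro continuous_intros 1 2 3 4) (use eps in auto)
qed

lemma tau_ne: "p \<in> dmn \<Longrightarrow> fst p + \<epsilon> \<noteq> 0" "p \<in> dmn \<Longrightarrow> (fst p + \<epsilon>)\<^sup>2 \<noteq> 0"
  using eps by auto

lemma Del_deriv:
  assumes t: "t \<in> {0<..<T}"
  shows "(Del has_real_derivative rho t + (1 + \<alpha>) / (t + \<epsilon>) * Del t) (at t)"
proof -
  have "((\<lambda>t. integral {-N..N} (\<lambda>x. M t x * (1/2 * ((x - S \<kappa> t x) * (x - S \<kappa> t x))))) has_real_derivative
      integral {-N..N} (\<lambda>x. M t x * (- (x - S \<kappa> t x) * St \<kappa> t x) - M t x * dx U t x * ((x - S \<kappa> t x) * (1 - S' \<kappa> t x * M t x)))) (at t)"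
  proof (rule integral_has_derivative[OF _ _ _ t])
    fix t x assume h: "t \<in> {0<..<T}" "x \<in> {-N..N}"
    have "has_grad (\<lambda>t x. x - S \<kappa> t x) (0 - St \<kappa> t x) (1 - S' \<kappa> t x * M t x) t x"
      by (intro has_grad_diff has_grad_space S_has_grad k h)
    from has_grad_mult[OF has_grad_time[OF DERIV_const[of "1/2"]] has_grad_mult[OF this this]]
    show "has_grad (\<lambda>t x. 1/2 * ((x - S \<kappa> t x) * (x - S \<kappa> t x))) (- (x - S \<kappa> t x) * St \<kappa> t x) ((x - S \<kappa> t x) * (1 - S' \<kappa> t x * M t x)) t x"
      by (rule has_grad_cong) (simp_all add: algebra_simps)
  qed (unfold case_prod_unfold, (intro continuous_intros box_conts)+)
  moreover have "(\<lambda>t. integral {-N..N} (\<lambda>x. M t x * (1/2 * ((x - S \<kappa> t x) * (x - S \<kappa> t x))))) = Del"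
    by (simp add: Del_def fun_eq_iff power2_eq_square)
  moreover have "integral {-N..N} (\<lambda>x. M t x * (- (x - S \<kappa> t x) * St \<kappa> t x) - M t x * dx U t x * ((x - S \<kappa> t x) * (1 - S' \<kappa> t x * M t x)))
     = rho t + (1 + \<alpha>) / (t + \<epsilon>) * Del t"
  proof -
    have t': "t \<in> {0..T}" using t by auto
    have c: "continuous_on {-N..N} (M t)" "continuous_on {-N..N} (S \<kappa> t)" "continuous_on {-N..N} (dx U t)"
      using M_slice[OF t'] slice_conts[OF k t'] continuous_on_slice2[OF U_cont(2) t] by auto
    have "rho t + (1 + \<alpha>) / (t + \<epsilon>) * Del t = integral {-N..N} (\<lambda>x. M t x * ((x - S \<kappa> t x) * (- dx U t x - \<alpha> * S \<kappa> t x / (t + \<epsilon>))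
      - (1 + \<alpha>) / 2 / (t + \<epsilon>) * (x - S \<kappa> t x)\<^sup>2) + (1 + \<alpha>) / (t + \<epsilon>) * (M t x * (1/2 * (x - S \<kappa> t x)\<^sup>2)))"
      unfolding rho_def Del_def integral_mult_right[symmetric]
      by (intro Henstock_Kurzweil_Integration.integral_add[symmetric] integrable_continuous_interval continuous_intros c)
        (use eps t in auto)
    also have "\<dots> = integral {-N..N} (\<lambda>x. M t x * (- (x - S \<kappa> t x) * St \<kappa> t x) - M t x * dx U t x * ((x - S \<kappa> t x) * (1 - S' \<kappa> t x * M t x)))"
    proof (rule integral_cong)
      fix x
      define i z where "i = 1 / (t + \<epsilon>)" and "z = (x - S \<kappa> t x)\<^sup>2"
      have e: "(1 + \<alpha>) / 2 / (t + \<epsilon>) * z = i * ((1 + \<alpha>) * z / 2)"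
        "(1 + \<alpha>) / (t + \<epsilon>) * (M t x * (1/2 * z)) = M t x * (i * ((1 + \<alpha>) * z / 2))"
        "\<alpha> * S \<kappa> t x / (t + \<epsilon>) = i * (\<alpha> * S \<kappa> t x)"
        by (simp_all add: i_def)
      show "M t x * ((x - S \<kappa> t x) * (- dx U t x - \<alpha> * S \<kappa> t x / (t + \<epsilon>))
          - (1 + \<alpha>) / 2 / (t + \<epsilon>) * (x - S \<kappa> t x)\<^sup>2) + (1 + \<alpha>) / (t + \<epsilon>) * (M t x * (1/2 * (x - S \<kappa> t x)\<^sup>2))
        = M t x * (- (x - S \<kappa> t x) * St \<kappa> t x) - M t x * dx U t x * ((x - S \<kappa> t x) * (1 - S' \<kappa> t x * M t x))"
        unfolding z_def[symmetric] St_def e by (simp add: algebra_simps)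
    qed
    finally show ?thesis by simp
  qed
  ultimately show ?thesis by simp
qed

text \<open>With the unsqueezed energy and moment the bracket vanishes by
  \<open>energy_moment\<close>. Squeezing multiplies each by at most (1 - 2 \<kappa>)^(-1-\<theta>),
  and only the excess over 1 remains.\<close>

lemma err_bound:
  assumes t: "t \<in> {0..T}"
  shows "- err \<le> ((t + \<epsilon>) powr \<alpha>)\<^sup>2 / (t + \<epsilon>)\<^sup>2 *
    (1/2 * \<alpha> * (1 - \<alpha>) * R\<^sup>2 - \<theta> / (1 + \<theta>) * energy - 1 / (1 + \<theta>) * integral {0..1} (\<lambda>s. etak' \<kappa> s powr (-\<theta>))
      - 1/2 * \<alpha> * (1 - \<alpha>) * integral {0..1} (\<lambda>s. (etak \<kappa> s)\<^sup>2))"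
proof -
  define a where "a = 1/2 * \<alpha> * (1 - \<alpha>)"
  define c where "c = (1 - 2 * \<kappa>) powr (-1-\<theta>)"
  have a: "0 < a" "a \<le> 1"
  proof -
    have "\<alpha> * (1 - \<alpha>) \<le> 1 * 1" using al by (intro mult_mono) auto
    then show "a \<le> 1" by (simp add: a_def)
  qed (use ka in \<open>simp add: a_def\<close>)
  have c: "1 \<le> c"
    using k th powr_mono2'[of "-1-\<theta>" "1 - 2 * \<kappa>" 1] by (simp add: c_def)
  define q1 where "q1 = integral {0..1} (\<lambda>s. etak' \<kappa> s powr (-\<theta>))"
  define q2 where "q2 = integral {0..1} (\<lambda>s. (etak \<kappa> s)\<^sup>2)"
  have q: "q1 \<le> c * energy" "q2 \<le> c * moment"
    unfolding q1_def q2_def c_def using squeezed_energy[OF k] squeezed_moment[OF k] by auto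
  define s where "s = ((t + \<epsilon>) powr \<alpha>)\<^sup>2 / (t + \<epsilon>)\<^sup>2"
  have s: "0 \<le> s" "s \<le> \<epsilon> powr (2 * \<alpha> - 2)"
  proof -
    have "s = (t + \<epsilon>) powr (2 * \<alpha> - 2)"
      unfolding s_def using scale_identity[OF t] al(3) by (simp add: powr_powr)
    also have "\<dots> \<le> \<epsilon> powr (2 * \<alpha> - 2)" using al eps t by (intro powr_mono2') auto
    finally show "s \<le> \<epsilon> powr (2 * \<alpha> - 2)" .
  qed (simp add: s_def)
  have em: "a * R\<^sup>2 = energy + a * moment" using energy_moment by (simp add: a_def)
  have "a * q2 \<le> a * (c * moment)" using q a by (intro mult_left_mono) auto
  moreover have "1 / (1 + \<theta>) * q1 \<le> 1 / (1 + \<theta>) * (c * energy)" using q th by (intro mult_left_mono) auto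
  moreover have "energy = 1 / (1 + \<theta>) * energy + \<theta> / (1 + \<theta>) * energy"
  proof -
    have "1 / (1 + \<theta>) + \<theta> / (1 + \<theta>) = 1" using th by (simp add: add_divide_distrib[symmetric])
    then show ?thesis by (metis distrib_right mult_1)
  qed
  moreover have "1 / (1 + \<theta>) * ((c - 1) * energy) \<le> 1 * ((c - 1) * energy)"
    using th c energy_nonneg by (intro mult_right_mono) auto
  moreover have "a * ((c - 1) * moment) \<le> 1 * ((c - 1) * moment)"
    using a c moment_nonneg by (intro mult_right_mono) auto
  ultimately have "- ((c - 1) * (energy + moment)) \<le> a * R\<^sup>2 - \<theta> / (1 + \<theta>) * energy - 1 / (1 + \<theta>) * q1 - a * q2"
    unfolding em by (simp add: algebra_simps)
  then have "s * (- ((c - 1) * (energy + moment))) \<le> s * (a * R\<^sup>2 - \<theta> / (1 + \<theta>) * energy - 1 / (1 + \<theta>) * q1 - a * q2)"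
    using s by (intro mult_left_mono) auto
  moreover have "s * ((c - 1) * (energy + moment)) \<le> \<epsilon> powr (2 * \<alpha> - 2) * ((c - 1) * (energy + moment))"
    using s c energy_nonneg moment_nonneg by (intro mult_right_mono) auto
  ultimately show ?thesis
    unfolding err_def a_def[symmetric] q1_def[symmetric] q2_def[symmetric] s_def[symmetric] c_def[symmetric]
    by (simp add: mult.assoc)
qed

lemma displacement_at:
  assumes t: "t \<in> {0..T}" and l: "0 < l" "l < 1"
  shows "integral {-N..N} (\<lambda>x. M t x * M t (x + l * (S \<kappa> t x - x)) powr \<theta>)
    \<le> integral {-N..N} (\<lambda>x. M t x powr (1 + \<theta>))
      + l / (1 + \<theta>) * (((t + \<epsilon>) powr \<alpha>)\<^sup>2 / (t + \<epsilon>)\<^sup>2 * integral {0..1} (\<lambda>s. etak' \<kappa> s powr (-\<theta>))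
         - integral {-N..N} (\<lambda>x. M t x powr (1 + \<theta>)))"
  unfolding integral_S_powers(2)[OF k t, symmetric]
proof (rule displacement_convexity[OF th N l])
  show "(S \<kappa> t has_real_derivative S' \<kappa> t x * M t x) (at x)" if "x \<in> {-N..N}" for x
  proof -
    have "(etak \<kappa> has_real_derivative etak' \<kappa> (F t x)) (at (F t x))"
      by (rule etak_deriv[OF k Frange[OF t that]])
    from DERIV_cmult[OF DERIV_chain2[OF this F_has_derivative[OF t]], of "(t + \<epsilon>) powr \<alpha>"] that
    show ?thesis unfolding S_def[abs_def] S'_def by (simp add: mult_ac)
  qed
qed (use M_slice[OF t] M_nonneg[OF t] M_support[OF t] slice_conts[OF k t] S'_pos[OF k t] in auto)

text \<open>A crude bound on the relative velocity. It enters only with the factor l and disappears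
  as l tends to 0, so it may depend badly on \<epsilon>.\<close>

definition speed :: real where "speed = L + R * \<epsilon> powr (\<alpha> - 1)"

lemma speed_bound:
  assumes t: "t \<in> {0<..<T}" and x: "x \<in> {-N..N}"
  shows "(- dx U t x - \<alpha> * S \<kappa> t x / (t + \<epsilon>))\<^sup>2 \<le> speed\<^sup>2"
proof -
  have t': "t \<in> {0..T}" using t by auto
  have tp: "0 < t + \<epsilon>" by (rule tau[OF t'])
  have "\<bar>\<alpha> * S \<kappa> t x / (t + \<epsilon>)\<bar> = \<alpha> * \<bar>S \<kappa> t x\<bar> / (t + \<epsilon>)" using al tp by (simp add: abs_mult)
  also have "\<dots> \<le> 1 * ((t + \<epsilon>) powr \<alpha> * R) / (t + \<epsilon>)"
    using al tp by (intro divide_right_mono mult_mono S_bound[OF k t' x]) auto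
  also have "\<dots> = R * (t + \<epsilon>) powr (\<alpha> - 1)" using tp by (simp add: powr_diff)
  also have "\<dots> \<le> R * \<epsilon> powr (\<alpha> - 1)" using R eps al t by (intro mult_left_mono powr_mono2') auto
  finally have "\<bar>- dx U t x - \<alpha> * S \<kappa> t x / (t + \<epsilon>)\<bar> \<le> speed"
    using U_bound[OF t, of x] unfolding speed_def by linarith
  then show ?thesis by (metis abs_ge_zero power2_abs power_mono)
qed

text \<open>The integrand contains \<open>U\<close> undifferentiated, so C^1 regularity suffices for
  the time derivative. The lower bound adds up four facts: \<open>action_dissipation\<close> at each
  point, \<open>displacement_at\<close> for the powers of the density at x and at the interpolated
  point, \<open>energy_lower_bound\<close> for the energy that is left over, and
  \<open>err_bound\<close> for the profile side.\<close>

lemma perturbed_rate: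
  assumes l: "0 < l" "l < 1" and t: "t \<in> {0<..<T}"
  shows "\<exists>D. ((\<lambda>t. integral {-N..N} (\<lambda>x. M t x * ((U t (x + l * (S \<kappa> t x - x)) - U t x) / l
      - (\<alpha> / (t + \<epsilon>) * (S \<kappa> t x * (x - S \<kappa> t x)) + (1 + \<alpha>) / 2 / (t + \<epsilon>) * (x - S \<kappa> t x)\<^sup>2))))
     has_real_derivative D) (at t) \<and> - (l * speed\<^sup>2 + err) \<le> D"
proof -
  define P where "P = (\<lambda>t x. x + l * (S \<kappa> t x - x))"
  \<comment> \<open>\<open>gt\<close> and \<open>gx\<close> are the derivatives of the integrand;
    under the integral they combine to M (gt - dx U gx), the derivative along the flow.\<close>
  define gt where "gt = (\<lambda>t x. (dt U t (P t x) + dx U t (P t x) * (l * St \<kappa> t x) - dt U t x) / l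
        - (- \<alpha> / (t + \<epsilon>)\<^sup>2 * (S \<kappa> t x * (x - S \<kappa> t x)) + \<alpha> / (t + \<epsilon>) * (St \<kappa> t x * (x - S \<kappa> t x) - S \<kappa> t x * St \<kappa> t x)
           - (1 + \<alpha>) / 2 / (t + \<epsilon>)\<^sup>2 * (x - S \<kappa> t x)\<^sup>2 - (1 + \<alpha>) / (t + \<epsilon>) * ((x - S \<kappa> t x) * St \<kappa> t x)))"
  define gx where "gx = (\<lambda>t x. (dx U t (P t x) * (1 + l * (S' \<kappa> t x * M t x - 1)) - dx U t x) / l
        - (\<alpha> / (t + \<epsilon>) * (S' \<kappa> t x * M t x * (x - S \<kappa> t x) + S \<kappa> t x * (1 - S' \<kappa> t x * M t x))
           + (1 + \<alpha>) / (t + \<epsilon>) * ((x - S \<kappa> t x) * (1 - S' \<kappa> t x * M t x))))"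
  have Pc: "continuous_on dmn (\<lambda>p. (fst p, P (fst p) (snd p)))"
    unfolding P_def by (intro continuous_intros box_conts)
  have UP: "continuous_on dmn (\<lambda>p. dt U (fst p) (P (fst p) (snd p)))" "continuous_on dmn (\<lambda>p. dx U (fst p) (P (fst p) (snd p)))"
  proof -
    have "(\<lambda>p. (fst p, P (fst p) (snd p))) ` dmn \<subseteq> strip T" by auto
    then show "continuous_on dmn (\<lambda>p. dt U (fst p) (P (fst p) (snd p)))" "continuous_on dmn (\<lambda>p. dx U (fst p) (P (fst p) (snd p)))"
      using continuous_on_compose2[OF U_cont(1)[unfolded case_prod_unfold] Pc]
        continuous_on_compose2[OF U_cont(2)[unfolded case_prod_unfold] Pc] by simp_all
  qed
  have grad: "has_grad (\<lambda>t x. (U t (P t x) - U t x) / l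
      - (\<alpha> / (t + \<epsilon>) * (S \<kappa> t x * (x - S \<kappa> t x)) + (1 + \<alpha>) / 2 / (t + \<epsilon>) * (x - S \<kappa> t x)\<^sup>2)) (gt t x) (gx t x) t x"
    if h: "t \<in> {0<..<T}" "x \<in> {-N..N}" for t x
  proof -
    have te: "t + \<epsilon> \<noteq> 0" using h eps by auto
    have gS: "has_grad (S \<kappa>) (St \<kappa> t x) (S' \<kappa> t x * M t x) t x" by (rule S_has_grad[OF k h])
    have gP: "has_grad P (0 + (0 * (S \<kappa> t x - x) + l * (St \<kappa> t x - 0))) (1 + (0 * (S \<kappa> t x - x) + l * (S' \<kappa> t x * M t x - 1))) t x"
      unfolding P_def by (intro has_grad_add has_grad_mult has_grad_diff has_grad_space gS has_grad_time DERIV_const)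
    have gUP: "has_grad (\<lambda>t x. U t (P t x)) (dt U t (P t x) + dx U t (P t x) * (0 + (0 * (S \<kappa> t x - x) + l * (St \<kappa> t x - 0))))
        (dx U t (P t x) * (1 + (0 * (S \<kappa> t x - x) + l * (S' \<kappa> t x * M t x - 1)))) t x"
      by (rule has_grad_compose[OF U_has_grad[OF h(1)] gP])
    have ta: "((\<lambda>t. c / (t + \<epsilon>)) has_real_derivative - c / (t + \<epsilon>)\<^sup>2) (at t)" for c
      using te by (auto intro!: derivative_eq_intros simp: power2_eq_square)
    note gd = has_grad_diff[OF has_grad_space gS]
    note g1 = has_grad_mult[OF has_grad_time[OF ta[of \<alpha>]] has_grad_mult[OF gS gd]]
    note g2 = has_grad_mult[OF has_grad_time[OF ta[of "(1 + \<alpha>) / 2"]] has_grad_mult[OF gd gd]]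
    note g3 = has_grad_mult[OF has_grad_diff[OF gUP U_has_grad[OF h(1)]] has_grad_time[OF DERIV_const[of "1 / l"]]]
    note g4 = has_grad_diff[OF g3 has_grad_add[OF g1 g2]]
    note g5 = g4[unfolded times_divide_eq_right mult_1_right]
    have hy: "(1 + \<alpha>) / 2 / (t + \<epsilon>) * (2 * y) = (1 + \<alpha>) / (t + \<epsilon>) * y" for y
      using te by (simp add: divide_simps)
    have h: "(1 + \<alpha>) / 2 / (t + \<epsilon>) * ((0 - s) * z + z * (0 - s)) = - ((1 + \<alpha>) / (t + \<epsilon>) * (z * s))"
      "(1 + \<alpha>) / 2 / (t + \<epsilon>) * ((1 - s) * z + z * (1 - s)) = (1 + \<alpha>) / (t + \<epsilon>) * (z * (1 - s))" for s z
    proof -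
      have e: "(0 - s) * z + z * (0 - s) = 2 * (- (z * s))" "(1 - s) * z + z * (1 - s) = 2 * (z * (1 - s))"
        by (simp_all add: algebra_simps)
      show "(1 + \<alpha>) / 2 / (t + \<epsilon>) * ((0 - s) * z + z * (0 - s)) = - ((1 + \<alpha>) / (t + \<epsilon>) * (z * s))"
        "(1 + \<alpha>) / 2 / (t + \<epsilon>) * ((1 - s) * z + z * (1 - s)) = (1 + \<alpha>) / (t + \<epsilon>) * (z * (1 - s))"
        unfolding e hy by simp_all
    qed
    show ?thesis
      unfolding power2_eq_square[of "x - S \<kappa> t x" for t x]
      by (rule has_grad_cong[OF g5]) (simp_all only: h, simp_all add: gt_def gx_def power2_eq_square)
  qed
  define D where "D = integral {-N..N} (\<lambda>x. M t x * gt t x - M t x * dx U t x * gx t x)"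
  have conts: "continuous_on dmn (\<lambda>(t, x). gt t x)" "continuous_on dmn (\<lambda>(t, x). gx t x)"
  proof -
    have tinv: "continuous_on dmn (\<lambda>p. c / (fst p + \<epsilon>))" "continuous_on dmn (\<lambda>p. c / (fst p + \<epsilon>)\<^sup>2)" for c
      by (intro continuous_on_divide continuous_on_const continuous_on_power box_conts ballI tau_ne; assumption)+
    have divl: "continuous_on dmn f \<Longrightarrow> continuous_on dmn (\<lambda>p. f p / l)" for f :: "real \<times> real \<Rightarrow> real"
      using l by (intro continuous_on_divide continuous_on_const) auto
    have sn: "continuous_on dmn snd" by (intro continuous_intros)
    note rules = continuous_on_diff continuous_on_add continuous_on_mult continuous_on_power continuous_on_const
      sn tinv divl box_conts(1-6) UP
    show "continuous_on dmn (\<lambda>(t, x). gt t x)"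
      unfolding gt_def case_prod_unfold by (intro rules)
    show "continuous_on dmn (\<lambda>(t, x). gx t x)"
      unfolding gx_def case_prod_unfold by (intro rules)
  qed
  have "((\<lambda>t. integral {-N..N} (\<lambda>x. M t x * ((U t (P t x) - U t x) / l
      - (\<alpha> / (t + \<epsilon>) * (S \<kappa> t x * (x - S \<kappa> t x)) + (1 + \<alpha>) / 2 / (t + \<epsilon>) * (x - S \<kappa> t x)\<^sup>2))))
     has_real_derivative D) (at t)"
    unfolding D_def by (rule integral_has_derivative[OF grad conts t])
  moreover have "- (l * speed\<^sup>2 + err) \<le> D"
  proof -
    have t': "t \<in> {0..T}" using t by auto
    have tp: "0 < t + \<epsilon>" by (rule tau[OF t'])
    define a where "a = 1/2 * \<alpha> * (1 - \<alpha>)"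
    define A where "A = integral {-N..N} (\<lambda>x. M t x powr (1 + \<theta>))"
    define c2 where "c2 = ((t + \<epsilon>) powr \<alpha>)\<^sup>2"
    define q1 where "q1 = integral {0..1} (\<lambda>s. etak' \<kappa> s powr (-\<theta>))"
    define q2 where "q2 = integral {0..1} (\<lambda>s. (etak \<kappa> s)\<^sup>2)"
    define B where "B = integral {-N..N} (\<lambda>x. M t x * M t (P t x) powr \<theta>)"
    define I2 where "I2 = integral {-N..N} (\<lambda>x. M t x * x\<^sup>2)"
    have Mc: "continuous_on X (M t)" for X by (rule M_slice[OF t'])
    have c: "continuous_on {-N..N} (S \<kappa> t)" "continuous_on {-N..N} (dx U t)"
      using slice_conts[OF k t'] continuous_on_slice2[OF U_cont(2) t] by auto
    have Pt: "continuous_on {-N..N} (P t)" unfolding P_def by (intro continuous_intros c)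
    have Mp: "continuous_on {-N..N} (\<lambda>x. M t x powr (1 + \<theta>))" "continuous_on {-N..N} (\<lambda>x. M t (P t x) powr \<theta>)"
      using th by (intro continuous_on_powr_nonneg Mc M_nonneg t' continuous_on_compose2[OF Mc[of UNIV] Pt]; simp)+
    have pt: "M t x powr (1 + \<theta>) / l - (M t x * M t (P t x) powr \<theta>) / l - l / 2 * speed\<^sup>2 * M t x
        - a / (t + \<epsilon>)\<^sup>2 * (M t x * (S \<kappa> t x)\<^sup>2) + a / (t + \<epsilon>)\<^sup>2 * (M t x * x\<^sup>2)
       \<le> M t x * gt t x - M t x * dx U t x * gx t x" (is "?l \<le> ?r") if x: "x \<in> {-N..N}" for x
    proof -
      have "(M t x powr \<theta> - M t (P t x) powr \<theta>) / l - l / 2 * (- dx U t x - \<alpha> * S \<kappa> t x / (t + \<epsilon>))\<^sup>2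
          - 1/2 * \<alpha> * (1 - \<alpha>) / (t + \<epsilon>)\<^sup>2 * ((S \<kappa> t x)\<^sup>2 - x\<^sup>2) \<le> gt t x - dx U t x * gx t x"
        unfolding gt_def gx_def
        by (rule action_dissipation[OF tp l(1) al(1,2) _ HJ[OF t] HJ[OF t]]) (simp add: St_def algebra_simps)
      moreover have "l / 2 * (- dx U t x - \<alpha> * S \<kappa> t x / (t + \<epsilon>))\<^sup>2 \<le> l / 2 * speed\<^sup>2"
        using speed_bound[OF t x] l by (intro mult_left_mono) auto
      ultimately have "(M t x powr \<theta> - M t (P t x) powr \<theta>) / l - l / 2 * speed\<^sup>2
          - a / (t + \<epsilon>)\<^sup>2 * ((S \<kappa> t x)\<^sup>2 - x\<^sup>2) \<le> gt t x - dx U t x * gx t x"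
        unfolding a_def by linarith
      then have "M t x * ((M t x powr \<theta> - M t (P t x) powr \<theta>) / l - l / 2 * speed\<^sup>2
          - a / (t + \<epsilon>)\<^sup>2 * ((S \<kappa> t x)\<^sup>2 - x\<^sup>2)) \<le> M t x * (gt t x - dx U t x * gx t x)"
        by (intro mult_left_mono M_nonneg t')
      moreover have "M t x powr (1 + \<theta>) = M t x * M t x powr \<theta>" using M_nonneg[OF t', of x] by (simp add: powr_add)
      ultimately show ?thesis by (simp add: algebra_simps diff_divide_distrib)
    qed
    have gc: "continuous_on {-N..N} (gt t)" "continuous_on {-N..N} (gx t)"
      using continuous_on_slice2[OF conts(1) t] continuous_on_slice2[OF conts(2) t] by auto
    have ints: "(\<lambda>x. M t x powr (1 + \<theta>)) integrable_on {-N..N}" "(\<lambda>x. M t x * M t (P t x) powr \<theta>) integrable_on {-N..N}"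
      "M t integrable_on {-N..N}" "(\<lambda>x. M t x * (S \<kappa> t x)\<^sup>2) integrable_on {-N..N}" "(\<lambda>x. M t x * x\<^sup>2) integrable_on {-N..N}"
      by (intro integrable_continuous_interval continuous_intros Mc Mp c)+
    have hI: "((\<lambda>x. M t x powr (1 + \<theta>)) has_integral A) {-N..N}"
      "((\<lambda>x. M t x * M t (P t x) powr \<theta>) has_integral B) {-N..N}"
      "(M t has_integral 1) {-N..N}" "((\<lambda>x. M t x * (S \<kappa> t x)\<^sup>2) has_integral c2 * q2) {-N..N}"
      "((\<lambda>x. M t x * x\<^sup>2) has_integral I2) {-N..N}"
      using ints[THEN integrable_integral] integral_S_powers(1)[OF k t'] M_mass[OF t']
      unfolding A_def B_def I2_def c2_def q2_def by simp_all
    have "((\<lambda>x. M t x powr (1 + \<theta>) / l - (M t x * M t (P t x) powr \<theta>) / l - l / 2 * speed\<^sup>2 * M t x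
        - a / (t + \<epsilon>)\<^sup>2 * (M t x * (S \<kappa> t x)\<^sup>2) + a / (t + \<epsilon>)\<^sup>2 * (M t x * x\<^sup>2)) has_integral
        A / l - B / l - l / 2 * speed\<^sup>2 * 1 - a / (t + \<epsilon>)\<^sup>2 * (c2 * q2) + a / (t + \<epsilon>)\<^sup>2 * I2) {-N..N}"
      by (intro has_integral_add has_integral_diff has_integral_mult_right has_integral_divide hI)
    moreover have "((\<lambda>x. M t x * gt t x - M t x * dx U t x * gx t x) has_integral D) {-N..N}"
      unfolding D_def by (intro integrable_integral integrable_continuous_interval continuous_intros Mc c gc)
    ultimately have "A / l - B / l - l / 2 * speed\<^sup>2 * 1 - a / (t + \<epsilon>)\<^sup>2 * (c2 * q2) + a / (t + \<epsilon>)\<^sup>2 * I2 \<le> D"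
      by (rule has_integral_le) (rule pt)
    \<comment> \<open>The factor l in front of the energy difference in
      \<open>displacement_at\<close> compensates the division by l.\<close>
    moreover have "- (1 / (1 + \<theta>) * (c2 / (t + \<epsilon>)\<^sup>2 * q1 - A)) \<le> A / l - B / l"
    proof -
      have "B \<le> A + l / (1 + \<theta>) * (c2 / (t + \<epsilon>)\<^sup>2 * q1 - A)"
        using displacement_at[OF t' l] unfolding A_def B_def c2_def q1_def P_def .
      then have "B / l \<le> (A + l / (1 + \<theta>) * (c2 / (t + \<epsilon>)\<^sup>2 * q1 - A)) / l"
        using l by (intro divide_right_mono) auto
      also have "\<dots> = A / l + 1 / (1 + \<theta>) * (c2 / (t + \<epsilon>)\<^sup>2 * q1 - A)"
        using l by (simp add: add_divide_distrib)
      finally show ?thesis by linarith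
    qed
    moreover have "c2 / (t + \<epsilon>)\<^sup>2 * (a * R\<^sup>2 - \<theta> / (1 + \<theta>) * energy) - a / (t + \<epsilon>)\<^sup>2 * I2 \<le> 1 / (1 + \<theta>) * A"
      using energy_lower_bound[OF t'] unfolding a_def c2_def I2_def A_def .
    moreover have "- err \<le> c2 / (t + \<epsilon>)\<^sup>2 * (a * R\<^sup>2 - \<theta> / (1 + \<theta>) * energy - 1 / (1 + \<theta>) * q1 - a * q2)"
      using err_bound[OF t'] unfolding a_def c2_def q1_def q2_def .
    moreover have "c2 / (t + \<epsilon>)\<^sup>2 * (a * R\<^sup>2 - \<theta> / (1 + \<theta>) * energy - 1 / (1 + \<theta>) * q1 - a * q2)
       = c2 / (t + \<epsilon>)\<^sup>2 * (a * R\<^sup>2 - \<theta> / (1 + \<theta>) * energy) - 1 / (1 + \<theta>) * (c2 / (t + \<epsilon>)\<^sup>2 * q1) - a / (t + \<epsilon>)\<^sup>2 * (c2 * q2)"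
      by (simp add: algebra_simps)
    moreover have "1 / (1 + \<theta>) * (c2 / (t + \<epsilon>)\<^sup>2 * q1 - A) = 1 / (1 + \<theta>) * (c2 / (t + \<epsilon>)\<^sup>2 * q1) - 1 / (1 + \<theta>) * A"
      by (rule right_diff_distrib)
    moreover have "l / 2 * speed\<^sup>2 \<le> l * speed\<^sup>2" using l by (intro mult_right_mono) auto
    ultimately show ?thesis by linarith
  qed
  ultimately show ?thesis unfolding P_def by blast
qed

text \<open>Letting \<open>l \<rightarrow> 0\<close>: the perturbed quantity is a difference quotient in \<open>l\<close>.\<close>

lemma perturbed_tendsto:
  assumes t: "t \<in> {0<..<T}"
  shows "((\<lambda>l. integral {-N..N} (\<lambda>x. M t x * ((U t (x + l * (S \<kappa> t x - x)) - U t x) / l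
      - (\<alpha> / (t + \<epsilon>) * (S \<kappa> t x * (x - S \<kappa> t x)) + (1 + \<alpha>) / 2 / (t + \<epsilon>) * (x - S \<kappa> t x)\<^sup>2))))
     \<longlongrightarrow> rho t) (at_right 0)"
proof -
  have t': "t \<in> {0..T}" using t by auto
  have tp: "0 < t + \<epsilon>" by (rule tau[OF t'])
  have c: "continuous_on {-N..N} (S \<kappa> t)" "continuous_on X (dx U t)" "continuous_on {-N..N} (M t)" for X
    using slice_conts[OF k t'] continuous_on_slice2[OF U_cont(2) t] M_slice[OF t'] by auto
  have Uc: "continuous_on X (U t)" for X
    using has_grad_snd[OF U_has_grad[OF t]] by (meson DERIV_isCont continuous_at_imp_continuous_on)
  define P where "P = (\<lambda>l x. x + l * (S \<kappa> t x - x))"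
  define J where "J = (\<lambda>l. integral {-N..N} (\<lambda>x. M t x * U t (P l x)))"
  define Q where "Q = (\<lambda>x. \<alpha> / (t + \<epsilon>) * (S \<kappa> t x * (x - S \<kappa> t x)) + (1 + \<alpha>) / 2 / (t + \<epsilon>) * (x - S \<kappa> t x)\<^sup>2)"
  have Qc: "continuous_on {-N..N} Q" unfolding Q_def using tp by (intro continuous_intros c) auto
  have Pc: "continuous_on {-N..N} (P l)" for l unfolding P_def by (intro continuous_intros c)
  have UPc: "continuous_on {-N..N} (\<lambda>x. U t (P l x))" for l
    by (rule continuous_on_compose2[OF Uc[of UNIV] Pc]) auto
  have "(J has_real_derivative integral {-N..N} (\<lambda>x. M t x * (dx U t (P 0 x) * (S \<kappa> t x - x)))) (at 0)"
  proof -
    have "((\<lambda>l. integral (cbox (-N) N) (\<lambda>x. M t x * U t (P l x))) has_field_derivative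
        integral (cbox (-N) N) (\<lambda>x. M t x * (dx U t (P 0 x) * (S \<kappa> t x - x)))) (at 0 within UNIV)"
    proof (rule leibniz_rule_field_derivative[where fx = "\<lambda>l x. M t x * (dx U t (P l x) * (S \<kappa> t x - x))"])
      fix l x
      have "((\<lambda>l. P l x) has_real_derivative (S \<kappa> t x - x)) (at l)"
        unfolding P_def by (auto intro!: derivative_eq_intros)
      from DERIV_cmult[OF DERIV_chain2[OF has_grad_snd[OF U_has_grad[OF t]] this]]
      show "((\<lambda>l. M t x * U t (P l x)) has_real_derivative M t x * (dx U t (P l x) * (S \<kappa> t x - x))) (at l within UNIV)"
        by simp
    next
      show "(\<lambda>x. M t x * U t (P l x)) integrable_on cbox (-N) N" for l
        unfolding box_real by (intro integrable_continuous_interval continuous_intros c UPc)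
      have s: "continuous_on (UNIV \<times> {-N..N}) (\<lambda>p. S \<kappa> t (snd p))" "continuous_on (UNIV \<times> {-N..N}) (\<lambda>p. M t (snd p))"
        by (rule continuous_on_compose2[OF c(1)] continuous_on_compose2[OF c(3)], auto intro!: continuous_intros)+
      have "continuous_on (UNIV \<times> {-N..N}) (\<lambda>p. P (fst p) (snd p))"
        unfolding P_def by (intro continuous_intros s)
      then have "continuous_on (UNIV \<times> {-N..N}) (\<lambda>p. dx U t (P (fst p) (snd p)))"
        by (rule continuous_on_compose2[OF c(2)[of UNIV]]) auto
      then show "continuous_on (UNIV \<times> cbox (-N) N) (\<lambda>(l, x). M t x * (dx U t (P l x) * (S \<kappa> t x - x)))"
        unfolding box_real case_prod_unfold by (intro continuous_intros s)
    qed auto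
    then show ?thesis by (simp add: J_def)
  qed
  then have "((\<lambda>l. (J l - J 0) / l) \<longlongrightarrow> integral {-N..N} (\<lambda>x. M t x * (dx U t (P 0 x) * (S \<kappa> t x - x)))) (at 0)"
    by (simp add: has_field_derivative_iff)
  then have c1: "((\<lambda>l. (J l - J 0) / l - integral {-N..N} (\<lambda>x. M t x * Q x)) \<longlongrightarrow>
      integral {-N..N} (\<lambda>x. M t x * (dx U t x * (S \<kappa> t x - x))) - integral {-N..N} (\<lambda>x. M t x * Q x)) (at_right 0)"
    by (intro tendsto_diff tendsto_const) (simp add: P_def filterlim_at_split)
  have c2: "integral {-N..N} (\<lambda>x. M t x * (dx U t x * (S \<kappa> t x - x))) - integral {-N..N} (\<lambda>x. M t x * Q x) = rho t"
  proof -
    have "integral {-N..N} (\<lambda>x. M t x * (dx U t x * (S \<kappa> t x - x))) - integral {-N..N} (\<lambda>x. M t x * Q x)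
       = integral {-N..N} (\<lambda>x. M t x * (dx U t x * (S \<kappa> t x - x)) - M t x * Q x)"
      by (intro Henstock_Kurzweil_Integration.integral_diff[symmetric] integrable_continuous_interval continuous_intros c Qc)
    also have "\<dots> = rho t" unfolding rho_def
      by (rule integral_cong) (simp add: Q_def algebra_simps diff_divide_distrib)
    finally show ?thesis .
  qed
  have c3: "\<forall>\<^sub>F l in at_right 0. (J l - J 0) / l - integral {-N..N} (\<lambda>x. M t x * Q x)
     = integral {-N..N} (\<lambda>x. M t x * ((U t (P l x) - U t x) / l - Q x))"
  proof (rule eventually_at_rightI[of 0 1])
    fix l :: real assume l: "l \<in> {0<..<1}"
    have "J l - J 0 = integral {-N..N} (\<lambda>x. M t x * U t (P l x) - M t x * U t x)"
    proof -
      have J0: "J 0 = integral {-N..N} (\<lambda>x. M t x * U t x)" by (simp add: J_def P_def)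
      show ?thesis unfolding J0 unfolding J_def
        by (intro Henstock_Kurzweil_Integration.integral_diff[symmetric] integrable_continuous_interval continuous_intros c UPc Uc)
    qed
    then have "(J l - J 0) / l = integral {-N..N} (\<lambda>x. (M t x * U t (P l x) - M t x * U t x) / l)" by simp
    then have "(J l - J 0) / l - integral {-N..N} (\<lambda>x. M t x * Q x)
       = integral {-N..N} (\<lambda>x. (M t x * U t (P l x) - M t x * U t x) / l - M t x * Q x)"
      unfolding \<open>(J l - J 0) / l = _\<close> using l
      by (intro Henstock_Kurzweil_Integration.integral_diff[symmetric] integrable_continuous_interval continuous_intros c UPc Uc Qc) auto
    also have "\<dots> = integral {-N..N} (\<lambda>x. M t x * ((U t (P l x) - U t x) / l - Q x))"
      by (rule integral_cong) (simp add: algebra_simps diff_divide_distrib)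
    finally show "(J l - J 0) / l - integral {-N..N} (\<lambda>x. M t x * Q x)
     = integral {-N..N} (\<lambda>x. M t x * ((U t (P l x) - U t x) / l - Q x))" .
  qed auto
  show ?thesis using Lim_transform_eventually[OF c1[unfolded c2] c3] unfolding P_def Q_def .
qed

text \<open>A bound on derivatives does not pass to the limit l \<rightarrow> 0, but its integrated
  form over [r, t] does; \<open>rho\<close> itself contains \<open>dx U\<close> and need not be
  differentiable.\<close>

lemma rho_almost_mono:
  assumes "0 < r" "r < t" "t < T"
  shows "rho r - err * (t - r) \<le> rho t"
proof -
  define G where "G = (\<lambda>l t. integral {-N..N} (\<lambda>x. M t x * ((U t (x + l * (S \<kappa> t x - x)) - U t x) / l
      - (\<alpha> / (t + \<epsilon>) * (S \<kappa> t x * (x - S \<kappa> t x)) + (1 + \<alpha>) / 2 / (t + \<epsilon>) * (x - S \<kappa> t x)\<^sup>2))))"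
  have step: "G l r - (l * speed\<^sup>2 + err) * (t - r) \<le> G l t" if l: "l \<in> {0<..<1}" for l
  proof -
    have rate: "\<exists>D. (G l has_real_derivative D) (at s) \<and> - (l * speed\<^sup>2 + err) \<le> D" if "r \<le> s" "s \<le> t" for s
      unfolding G_def using perturbed_rate[of l s] that l assms by auto
    have "\<exists>D. ((\<lambda>s. G l s + (l * speed\<^sup>2 + err) * s) has_real_derivative D) (at s) \<and> 0 \<le> D" if rs: "r \<le> s" "s \<le> t" for s
    proof -
      obtain D where D: "(G l has_real_derivative D) (at s)" "- (l * speed\<^sup>2 + err) \<le> D"
        using rate[OF rs] by blast
      then have "((\<lambda>s. G l s + (l * speed\<^sup>2 + err) * s) has_real_derivative D + (l * speed\<^sup>2 + err)) (at s)"
        by (auto intro!: derivative_eq_intros)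
      then show ?thesis using D(2) by (intro exI[of _ "D + (l * speed\<^sup>2 + err)"]) auto
    qed
    from DERIV_nonneg_imp_nondecreasing[OF less_imp_le[OF assms(2)] this]
    have "G l r + (l * speed\<^sup>2 + err) * r \<le> G l t + (l * speed\<^sup>2 + err) * t" by blast
    then show ?thesis by (simp add: algebra_simps)
  qed
  have lim: "((\<lambda>l. G l s) \<longlongrightarrow> rho s) (at_right 0)" if "s \<in> {0<..<T}" for s
    unfolding G_def by (rule perturbed_tendsto[OF that])
  have "rho r - (0 * speed\<^sup>2 + err) * (t - r) \<le> rho t"
  proof (rule tendsto_le[of "at_right (0::real)" "\<lambda>l. G l t" _ "\<lambda>l. G l r - (l * speed\<^sup>2 + err) * (t - r)"])
    show "((\<lambda>l. G l r - (l * speed\<^sup>2 + err) * (t - r)) \<longlongrightarrow> rho r - (0 * speed\<^sup>2 + err) * (t - r)) (at_right 0)"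
      by (intro tendsto_intros lim) (use assms in auto)
    show "\<forall>\<^sub>F l in at_right 0. G l r - (l * speed\<^sup>2 + err) * (t - r) \<le> G l t"
      by (rule eventually_at_rightI[of 0 1]) (use step in auto)
  qed (use lim[of t] assms in auto)
  then show ?thesis by simp
qed

text \<open>\<open>h = Del / \<tau>\<^sup>(\<^sup>1\<^sup>+\<^sup>\<alpha>\<^sup>)\<close> satisfies \<open>\<tau>\<^sup>(\<^sup>1\<^sup>+\<^sup>\<alpha>\<^sup>) h' = rho\<close>; adding the convex corrector absorbs the
  defect \<open>err\<close> of monotonicity, and a function whose derivative changes sign at most once, from
  negative to positive, lies below the larger of its end values.\<close>

lemma Del_cont: "continuous_on {0..T} Del"
  unfolding Del_def
proof (rule continuous_on_integral_slice)
  show "continuous_on ({0..T} \<times> {-N..N}) (\<lambda>(t, x). M t x * (1/2 * (x - S \<kappa> t x)\<^sup>2))"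
    unfolding case_prod_unfold
    by (intro continuous_intros S_cont[OF k] continuous_on_subset[OF M_cont[unfolded case_prod_unfold]]) auto
qed

lemma Del_bound:
  assumes t: "t \<in> {0..T}"
  shows "Del t \<le> (t + \<epsilon>) powr (1 + \<alpha>) *
    (max (Del 0 / \<epsilon> powr (1 + \<alpha>)) (Del T / (T + \<epsilon>) powr (1 + \<alpha>)) + err * \<epsilon> powr (- (1 + \<alpha>)) * (T + \<epsilon>)\<^sup>2)"
proof -
  have e0: "0 \<le> err"
    unfolding err_def using k th powr_mono2'[of "-1-\<theta>" "1 - 2 * \<kappa>" 1] energy_nonneg moment_nonneg by simp
  \<comment> \<open>Chosen so that K \<epsilon>^(1+\<alpha>) = err: the increments of K
    \<tau>^(2+\<alpha>) then dominate \<open>err\<close> times the elapsed time. Differentiating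
    \<tau>^2 produces two copies, of which one compensates \<open>err\<close> and the other is
    nondecreasing.\<close>
  define K where "K = err * \<epsilon> powr (- (1 + \<alpha>))"
  have K0: "0 \<le> K" unfolding K_def using e0 by simp
  define h where "h = (\<lambda>t. Del t / (t + \<epsilon>) powr (1 + \<alpha>) + K * (t + \<epsilon>)\<^sup>2)"
  have hd: "(h has_real_derivative (rho s + 2 * K * (s + \<epsilon>) powr (2 + \<alpha>)) / (s + \<epsilon>) powr (1 + \<alpha>)) (at s)" if s: "0 < s" "s < T" for s
  proof -
    have sp: "0 < s + \<epsilon>" using s eps by simp
    have p: "(s + \<epsilon>) powr (1 + \<alpha>) \<noteq> 0" using sp by simp
    have "(h has_real_derivative ((rho s + (1 + \<alpha>) / (s + \<epsilon>) * Del s) * (s + \<epsilon>) powr (1 + \<alpha>)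
        - Del s * ((1 + \<alpha>) * (s + \<epsilon>) powr \<alpha>)) / ((s + \<epsilon>) powr (1 + \<alpha>) * (s + \<epsilon>) powr (1 + \<alpha>)) + K * (2 * (s + \<epsilon>))) (at s)"
      unfolding h_def using sp s
      by (auto intro!: derivative_eq_intros Del_deriv)
    also have "((rho s + (1 + \<alpha>) / (s + \<epsilon>) * Del s) * (s + \<epsilon>) powr (1 + \<alpha>)
        - Del s * ((1 + \<alpha>) * (s + \<epsilon>) powr \<alpha>)) / ((s + \<epsilon>) powr (1 + \<alpha>) * (s + \<epsilon>) powr (1 + \<alpha>)) + K * (2 * (s + \<epsilon>))
      = (rho s + 2 * K * (s + \<epsilon>) powr (2 + \<alpha>)) / (s + \<epsilon>) powr (1 + \<alpha>)"
    proof -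
      define p where "p = (s + \<epsilon>) powr \<alpha>"
      have pp: "0 < p" using sp by (simp add: p_def)
      have a: "(s + \<epsilon>) powr (1 + \<alpha>) = (s + \<epsilon>) * p" "(s + \<epsilon>) powr (2 + \<alpha>) = (s + \<epsilon>) * ((s + \<epsilon>) * p)"
        using sp by (simp_all add: powr_add p_def power2_eq_square)
      define q where "q = s + \<epsilon>"
      have "0 < q" using sp by (simp add: q_def)
      then show ?thesis unfolding a unfolding p_def[symmetric] unfolding q_def[symmetric] using pp by (simp add: field_simps power2_eq_square)
    qed
    finally show ?thesis .
  qed
  have mono: "rho r + 2 * K * (r + \<epsilon>) powr (2 + \<alpha>) \<le> rho s + 2 * K * (s + \<epsilon>) powr (2 + \<alpha>)" if rs: "0 < r" "r < s" "s < T" for r s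
  proof -
    have rp: "0 < r + \<epsilon>" using rs eps by simp
    have "(r + \<epsilon>) powr (1 + \<alpha>) * (s + \<epsilon>) \<le> (s + \<epsilon>) powr (1 + \<alpha>) * (s + \<epsilon>)"
      using rs rp al by (intro mult_right_mono powr_mono2) auto
    moreover have "\<epsilon> powr (1 + \<alpha>) * (s - r) \<le> (r + \<epsilon>) powr (1 + \<alpha>) * (s - r)"
      using rs eps al by (intro mult_right_mono powr_mono2) auto
    moreover have "(s + \<epsilon>) powr (2 + \<alpha>) = (s + \<epsilon>) powr (1 + \<alpha>) * (s + \<epsilon>)" "(r + \<epsilon>) powr (2 + \<alpha>) = (r + \<epsilon>) powr (1 + \<alpha>) * (r + \<epsilon>)"
      using rp rs powr_add[of "s + \<epsilon>" "1 + \<alpha>" 1] powr_add[of "r + \<epsilon>" "1 + \<alpha>" 1] by (simp_all add: add.commute)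
    ultimately have "\<epsilon> powr (1 + \<alpha>) * (s - r) \<le> (s + \<epsilon>) powr (2 + \<alpha>) - (r + \<epsilon>) powr (2 + \<alpha>)"
      by (simp add: algebra_simps)
    then have "K * (\<epsilon> powr (1 + \<alpha>) * (s - r)) \<le> K * ((s + \<epsilon>) powr (2 + \<alpha>) - (r + \<epsilon>) powr (2 + \<alpha>))"
      by (rule mult_left_mono[OF _ K0])
    moreover have "K * (\<epsilon> powr (1 + \<alpha>) * (s - r)) = err * (s - r)"
    proof -
      have "\<epsilon> powr (- (1 + \<alpha>)) * \<epsilon> powr (1 + \<alpha>) = 1"
        using eps unfolding powr_add[symmetric] by simp
      then show ?thesis unfolding K_def by (metis mult.assoc mult.right_neutral)
    qed
    moreover have "0 \<le> K * ((s + \<epsilon>) powr (2 + \<alpha>) - (r + \<epsilon>) powr (2 + \<alpha>))"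
      using rs rp al by (intro mult_nonneg_nonneg K0) (auto intro!: powr_mono2)
    ultimately show ?thesis using rho_almost_mono[OF rs] by (simp add: algebra_simps)
  qed
  have hc: "continuous_on {0..T} h"
    unfolding h_def by (intro continuous_intros Del_cont) (use eps in \<open>auto simp: add_nonneg_pos less_imp_neq[symmetric]\<close>)
  have "h t \<le> max (h 0) (h T)"
  proof (rule ccontr)
    assume "\<not> h t \<le> max (h 0) (h T)"
    then have lt: "h 0 < h t" "h T < h t" by auto
    then have t0: "0 < t" "t < T" using t by (auto simp: less_le)
    have hdiff: "h differentiable (at z)" if "0 < z" "z < T" for z
      using hd[OF that] real_differentiable_def by blast
    \<comment> \<open>A value above both ends yields a positive slope before t and a negative one
      after it, against the monotone numerator in \<open>hd\<close>.\<close>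
    have "\<exists>l z. 0 < z \<and> z < t \<and> (h has_real_derivative l) (at z) \<and> h t - h 0 = (t - 0) * l"
      by (rule MVT) (use t0 hdiff hc in \<open>auto intro: continuous_on_subset\<close>)
    then obtain l1 z1 where z1: "0 < z1" "z1 < t" "(h has_real_derivative l1) (at z1)" "h t - h 0 = (t - 0) * l1" by blast
    have "\<exists>l z. t < z \<and> z < T \<and> (h has_real_derivative l) (at z) \<and> h T - h t = (T - t) * l"
      by (rule MVT) (use t0 hdiff hc in \<open>auto intro: continuous_on_subset\<close>)
    then obtain l2 z2 where z2: "t < z2" "z2 < T" "(h has_real_derivative l2) (at z2)" "h T - h t = (T - t) * l2" by blast
    have l: "0 < l1" "l2 < 0" using z1(4) z2(4) lt t0 by (auto simp: zero_less_mult_iff mult_less_0_iff) (smt (verit) mult_nonneg_nonneg mult_nonneg_nonpos)+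
    have "l1 = (rho z1 + 2 * K * (z1 + \<epsilon>) powr (2 + \<alpha>)) / (z1 + \<epsilon>) powr (1 + \<alpha>)"
      using DERIV_unique[OF z1(3) hd] z1 z2 by auto
    then have "0 < rho z1 + 2 * K * (z1 + \<epsilon>) powr (2 + \<alpha>)" using l(1) z1 eps by (simp add: zero_less_divide_iff)
    moreover have "l2 = (rho z2 + 2 * K * (z2 + \<epsilon>) powr (2 + \<alpha>)) / (z2 + \<epsilon>) powr (1 + \<alpha>)"
      using DERIV_unique[OF z2(3) hd] z1 z2 by auto
    then have "rho z2 + 2 * K * (z2 + \<epsilon>) powr (2 + \<alpha>) < 0" using l(2) z2 t0 eps by (simp add: divide_less_0_iff)
    ultimately show False using mono[of z1 z2] z1 z2 by linarith
  qed
  moreover have "Del t / (t + \<epsilon>) powr (1 + \<alpha>) \<le> h t" unfolding h_def using K0 by simp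
  moreover have "max (h 0) (h T) \<le> max (Del 0 / \<epsilon> powr (1 + \<alpha>)) (Del T / (T + \<epsilon>) powr (1 + \<alpha>)) + K * (T + \<epsilon>)\<^sup>2"
  proof -
    have "K * \<epsilon>\<^sup>2 \<le> K * (T + \<epsilon>)\<^sup>2" using T eps by (intro mult_left_mono K0 power_mono) auto
    then show ?thesis unfolding h_def by auto
  qed
  ultimately have "Del t / (t + \<epsilon>) powr (1 + \<alpha>) \<le> max (Del 0 / \<epsilon> powr (1 + \<alpha>)) (Del T / (T + \<epsilon>) powr (1 + \<alpha>)) + K * (T + \<epsilon>)\<^sup>2"
    by linarith
  then show ?thesis using eps t unfolding K_def by (simp add: divide_le_eq mult.commute add_nonneg_pos)
qed

end

end

section \<open>Decay of the distance\<close>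

locale mfg_eps_init = mfg_eps \<theta> R T N U M \<epsilon> L
  for \<theta> R T N :: real and U M :: "real \<Rightarrow> real \<Rightarrow> real" and \<epsilon> L :: real +
  fixes B :: real
  assumes init: "M 0 x = \<epsilon> powr (- \<alpha>) * phi \<theta> R (\<epsilon> powr (- \<alpha>) * x)"
    and N_large: "R * \<epsilon> powr \<alpha> \<le> N"
    and terminal: "M T x \<noteq> 0 \<Longrightarrow> \<bar>x\<bar> \<le> B" and B: "0 \<le> B"
begin

text \<open>Initially the density is the profile scaled by \<epsilon>^\<alpha>, so
  \<open>eta\<close> applied to \<open>F\<close> gives back x / \<epsilon>^\<alpha>. Without
  squeezing the map \<open>S\<close> starts as the identity on the support, which is why the
  comparison starts at \<tau> = \<epsilon>.\<close>

lemma F_init: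
  assumes x: "\<bar>x\<bar> \<le> R * \<epsilon> powr \<alpha>"
  shows "F 0 x = Phi (x / \<epsilon> powr \<alpha>)" "x / \<epsilon> powr \<alpha> \<in> {-R..R}"
proof -
  define c where "c = \<epsilon> powr \<alpha>"
  have c: "0 < c" using eps by (simp add: c_def)
  have i: "M 0 y = 1 / c * phi \<theta> R (y / c)" for y
    unfolding init c_def using eps by (simp add: powr_minus field_simps)
  have xc: "-R \<le> x / c" "x / c \<le> R" using x c unfolding c_def[symmetric] by (auto simp: field_simps abs_le_iff)
  then show "x / \<epsilon> powr \<alpha> \<in> {-R..R}" by (simp add: c_def)
  have Nc: "(-N-1) / c \<le> -R" using N_large c unfolding c_def[symmetric] by (simp add: field_simps)
  have "-N-1 \<le> x" using x N_large by linarith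
  then have "((\<lambda>y. (1 / c) *\<^sub>R phi \<theta> R (y / c)) has_integral integral {(-N-1) / c..x / c} (phi \<theta> R)) {-N-1..x}"
    by (intro has_integral_substitution[where c = "(-N-1) / c" and d = "x / c"])
      (use c in \<open>auto intro!: derivative_eq_intros phi_cont simp: divide_right_mono\<close>)
  then have "F 0 x = integral {(-N-1) / c..x / c} (phi \<theta> R)"
    unfolding F_def i[abs_def] real_scaleR_def by (rule integral_unique)
  also have "\<dots> = integral {(-N-1) / c..-R} (phi \<theta> R) + Phi (x / c)"
    unfolding Phi_def using Nc xc
    by (intro Henstock_Kurzweil_Integration.integral_combine[symmetric] integrable_continuous_interval phi_cont) auto
  also have "integral {(-N-1) / c..-R} (phi \<theta> R) = integral {(-N-1) / c..-R} (\<lambda>_. 0)"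
    by (rule integral_cong) (use phi_zero R in auto)
  finally show "F 0 x = Phi (x / \<epsilon> powr \<alpha>)" by (simp add: c_def)
qed

lemma Del_init:
  assumes k: "0 < \<kappa>" "\<kappa> < 1/2" and d: "\<And>s. s \<in> {0..1} \<Longrightarrow> \<bar>etak \<kappa> s - eta s\<bar> \<le> d"
  shows "Del \<kappa> 0 \<le> 1/2 * (\<epsilon> powr \<alpha> * d)\<^sup>2"
proof -
  have z: "0 \<in> {0..T}" using T by simp
  have c: "0 < \<epsilon> powr \<alpha>" using eps by simp
  have "Del \<kappa> 0 \<le> integral {-N..N} (\<lambda>x. M 0 x * (1/2 * (\<epsilon> powr \<alpha> * d)\<^sup>2))"
    unfolding Del_def[OF k]
  proof (rule integral_le)
    show "(\<lambda>x. M 0 x * (1/2 * (x - S \<kappa> 0 x)\<^sup>2)) integrable_on {-N..N}"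
      "(\<lambda>x. M 0 x * (1/2 * (\<epsilon> powr \<alpha> * d)\<^sup>2)) integrable_on {-N..N}"
      by (intro integrable_continuous_interval continuous_intros M_slice[OF z] slice_conts[OF k z])+
    fix x assume x: "x \<in> {-N..N}"
    show "M 0 x * (1/2 * (x - S \<kappa> 0 x)\<^sup>2) \<le> M 0 x * (1/2 * (\<epsilon> powr \<alpha> * d)\<^sup>2)"
    proof (cases "\<bar>x\<bar> \<le> R * \<epsilon> powr \<alpha>")
      case True
      define y where "y = x / \<epsilon> powr \<alpha>"
      have y: "F 0 x = Phi y" "y \<in> {-R..R}" using F_init[OF True] by (auto simp: y_def)
      have "eta (F 0 x) = y" unfolding y(1) by (rule eta_Phi[OF y(2)])
      then have "x = \<epsilon> powr \<alpha> * eta (F 0 x)" unfolding y_def using c by simp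
      then have "x - S \<kappa> 0 x = \<epsilon> powr \<alpha> * (eta (F 0 x) - etak \<kappa> (F 0 x))"
        unfolding S_def by (simp add: algebra_simps)
      moreover have "\<bar>\<epsilon> powr \<alpha> * (eta (F 0 x) - etak \<kappa> (F 0 x))\<bar> \<le> \<epsilon> powr \<alpha> * d"
        using d[OF Frange[OF z x]] c unfolding abs_mult by (intro mult_mono) (auto simp: abs_minus_commute)
      ultimately have "(x - S \<kappa> 0 x)\<^sup>2 \<le> (\<epsilon> powr \<alpha> * d)\<^sup>2" by (metis abs_ge_zero power2_abs power_mono)
      then show ?thesis by (intro mult_left_mono M_nonneg z) auto
    next
      case False
      then have "R \<le> \<bar>\<epsilon> powr (- \<alpha>) * x\<bar>" using c by (simp add: powr_minus abs_mult field_simps)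
      then have "M 0 x = 0" unfolding init by (simp add: phi_zero)
      then show ?thesis by simp
    qed
  qed
  also have "\<dots> = integral {-N..N} (M 0) * (1/2 * (\<epsilon> powr \<alpha> * d)\<^sup>2)" by (rule integral_mult_left)
  finally show ?thesis using M_mass[OF z] by simp
qed

text \<open>No closeness is available at time T; the sizes of the two supports bound the distance,
  uniformly in \<kappa>.\<close>

lemma Del_terminal:
  assumes k: "0 < \<kappa>" "\<kappa> < 1/2"
  shows "Del \<kappa> T \<le> 1/2 * (B + (T + \<epsilon>) powr \<alpha> * R)\<^sup>2"
proof -
  have z: "T \<in> {0..T}" using T by simp
  have "Del \<kappa> T \<le> integral {-N..N} (\<lambda>x. M T x * (1/2 * (B + (T + \<epsilon>) powr \<alpha> * R)\<^sup>2))"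
    unfolding Del_def[OF k]
  proof (rule integral_le)
    show "(\<lambda>x. M T x * (1/2 * (x - S \<kappa> T x)\<^sup>2)) integrable_on {-N..N}"
      "(\<lambda>x. M T x * (1/2 * (B + (T + \<epsilon>) powr \<alpha> * R)\<^sup>2)) integrable_on {-N..N}"
      by (intro integrable_continuous_interval continuous_intros M_slice[OF z] slice_conts[OF k z])+
    fix x assume x: "x \<in> {-N..N}"
    show "M T x * (1/2 * (x - S \<kappa> T x)\<^sup>2) \<le> M T x * (1/2 * (B + (T + \<epsilon>) powr \<alpha> * R)\<^sup>2)"
    proof (cases "M T x = 0")
      case False
      then have "\<bar>x - S \<kappa> T x\<bar> \<le> B + (T + \<epsilon>) powr \<alpha> * R"
        using terminal[OF False] S_bound[OF k z x] by linarith
      then have "(x - S \<kappa> T x)\<^sup>2 \<le> (B + (T + \<epsilon>) powr \<alpha> * R)\<^sup>2" by (metis abs_ge_zero power2_abs power_mono)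
      then show ?thesis by (intro mult_left_mono M_nonneg z) auto
    qed simp
  qed
  also have "\<dots> = integral {-N..N} (M T) * (1/2 * (B + (T + \<epsilon>) powr \<alpha> * R)\<^sup>2)" by (rule integral_mult_left)
  finally show ?thesis using M_mass[OF z] by simp
qed

lemma err_tendsto: "(err \<longlongrightarrow> 0) (at_right 0)"
proof -
  have "((\<lambda>\<kappa>. \<epsilon> powr (2 * \<alpha> - 2) * ((1 - 2 * \<kappa>) powr (-1-\<theta>) - 1) * (energy + moment)) \<longlongrightarrow>
     \<epsilon> powr (2 * \<alpha> - 2) * ((1 - 2 * 0) powr (-1-\<theta>) - 1) * (energy + moment)) (at_right 0)"
    by (intro tendsto_intros) auto
  moreover have "\<forall>\<^sub>F \<kappa> in at_right 0. \<epsilon> powr (2 * \<alpha> - 2) * ((1 - 2 * \<kappa>) powr (-1-\<theta>) - 1) * (energy + moment) = err \<kappa>"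
    by (rule eventually_at_rightI[of 0 "1/2"]) (auto simp: err_def)
  ultimately show ?thesis using Lim_transform_eventually by force
qed

text \<open>A Lipschitz test function turns the squared distance into a first-order estimate at the
  cost of the parameter \<delta>, to be optimised later. The squeezing is removed on the way, and
  since the initial distance vanishes with \<kappa>, the constant on the right comes from the
  terminal time alone.\<close>

lemma coupling:
  assumes t: "t \<in> {0..T}" and g: "\<And>x y. \<bar>g x - g y\<bar> \<le> G * \<bar>x - y\<bar>" and gc: "continuous_on UNIV g"
    and del: "0 < \<delta>"
  shows "\<bar>integral {-N..N} (\<lambda>x. M t x * g x) - integral {-R..R} (\<lambda>y. phi \<theta> R y * g ((t + \<epsilon>) powr \<alpha> * y))\<bar>
    \<le> G * (\<delta> / 2 + (t + \<epsilon>) powr (1 + \<alpha>) * (1/2 * (B + (T + \<epsilon>) powr \<alpha> * R)\<^sup>2 / (T + \<epsilon>) powr (1 + \<alpha>)) / \<delta>)"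
proof -
  define c where "c = (t + \<epsilon>) powr \<alpha>"
  define D where "D = 1/2 * (B + (T + \<epsilon>) powr \<alpha> * R)\<^sup>2 / (T + \<epsilon>) powr (1 + \<alpha>)"
  have c: "0 \<le> c" by (simp add: c_def)
  have G: "0 \<le> G" using g[of 0 1] by simp
  have gco: "continuous_on X (\<lambda>x. g (f x))" if "continuous_on X f" for X f
    by (rule continuous_on_compose2[OF gc that]) auto
  define X where "X = \<bar>integral {-N..N} (\<lambda>x. M t x * g x) - integral {0..1} (\<lambda>s. g (c * eta s))\<bar>"
  \<comment> \<open>The bound with a slack d that covers the distance of \<open>etak\<close> to
    \<open>eta\<close>, the defect \<open>err\<close> and the initial distance at once. At d = 0 the
    maximum is D because D is nonnegative.\<close>
  define f where "f = (\<lambda>d. G * (\<delta> / 2 + (t + \<epsilon>) powr (1 + \<alpha>) * (max (1/2 * (\<epsilon> powr \<alpha> * d)\<^sup>2 / \<epsilon> powr (1 + \<alpha>)) D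
      + d * \<epsilon> powr (- (1 + \<alpha>)) * (T + \<epsilon>)\<^sup>2) / \<delta>) + G * c * d)"
  have bound: "X \<le> f d" if d: "0 < d" for d
  proof -
    obtain k0 where k0: "0 < k0" "k0 < 1/2" "\<And>\<kappa> s. 0 < \<kappa> \<Longrightarrow> \<kappa> < k0 \<Longrightarrow> s \<in> {0..1} \<Longrightarrow> \<bar>etak \<kappa> s - eta s\<bar> < d"
      using etak_tendsto[OF d] by blast
    have "\<forall>\<^sub>F \<kappa> in at_right 0. err \<kappa> < d" using err_tendsto d by (rule order_tendstoD)
    then obtain b where b: "0 < b" "\<And>\<kappa>. 0 < \<kappa> \<Longrightarrow> \<kappa> < b \<Longrightarrow> err \<kappa> < d"
      unfolding eventually_at_right_field by auto
    define \<kappa> where "\<kappa> = min k0 b / 2"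
    have k: "0 < \<kappa>" "\<kappa> < 1/2" "\<kappa> < k0" "\<kappa> < b" using k0 b by (auto simp: \<kappa>_def)
    note kk = k(1,2)
    have close: "\<bar>etak \<kappa> s - eta s\<bar> \<le> d" if "s \<in> {0..1}" for s using k0(3)[OF k(1,3) that] by simp
    have Dl: "Del \<kappa> t \<le> (t + \<epsilon>) powr (1 + \<alpha>) * (max (1/2 * (\<epsilon> powr \<alpha> * d)\<^sup>2 / \<epsilon> powr (1 + \<alpha>)) D
      + d * \<epsilon> powr (- (1 + \<alpha>)) * (T + \<epsilon>)\<^sup>2)"
    proof -
      have "max (Del \<kappa> 0 / \<epsilon> powr (1 + \<alpha>)) (Del \<kappa> T / (T + \<epsilon>) powr (1 + \<alpha>))
         \<le> max (1/2 * (\<epsilon> powr \<alpha> * d)\<^sup>2 / \<epsilon> powr (1 + \<alpha>)) D"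
        unfolding D_def using Del_init[OF kk close] Del_terminal[OF kk] by (intro max.mono divide_right_mono) auto
      moreover have "err \<kappa> * \<epsilon> powr (- (1 + \<alpha>)) * (T + \<epsilon>)\<^sup>2 \<le> d * \<epsilon> powr (- (1 + \<alpha>)) * (T + \<epsilon>)\<^sup>2"
        using b(2)[OF k(1,4)] by (intro mult_right_mono) auto
      ultimately have "(t + \<epsilon>) powr (1 + \<alpha>) * (max (Del \<kappa> 0 / \<epsilon> powr (1 + \<alpha>)) (Del \<kappa> T / (T + \<epsilon>) powr (1 + \<alpha>))
          + err \<kappa> * \<epsilon> powr (- (1 + \<alpha>)) * (T + \<epsilon>)\<^sup>2)
         \<le> (t + \<epsilon>) powr (1 + \<alpha>) * (max (1/2 * (\<epsilon> powr \<alpha> * d)\<^sup>2 / \<epsilon> powr (1 + \<alpha>)) D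
          + d * \<epsilon> powr (- (1 + \<alpha>)) * (T + \<epsilon>)\<^sup>2)"
        by (intro mult_left_mono add_mono) auto
      then show ?thesis using Del_bound[OF kk t] by linarith
    qed
    have Mc: "continuous_on Y (M t)" for Y by (rule M_slice[OF t])
    have Sc: "continuous_on {-N..N} (S \<kappa> t)" by (rule slice_conts[OF kk t])
    have gS: "integral {-N..N} (\<lambda>x. M t x * g (S \<kappa> t x)) = integral {0..1} (\<lambda>s. g (c * etak \<kappa> s))"
      unfolding S_def c_def
      by (rule integral_F[OF kk t]) (intro gco continuous_intros etak_cont kk)
    have "\<bar>integral {-N..N} (\<lambda>x. M t x * g x) - integral {-N..N} (\<lambda>x. M t x * g (S \<kappa> t x))\<bar>
       = \<bar>integral {-N..N} (\<lambda>x. M t x * g x - M t x * g (S \<kappa> t x))\<bar>"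
      by (subst Henstock_Kurzweil_Integration.integral_diff)
        (auto intro!: integrable_continuous_interval continuous_on_mult Mc gco Sc gc continuous_on_subset[OF gc])
    also have "\<dots> \<le> integral {-N..N} (\<lambda>x. G * (\<delta> / 2) * M t x + G / \<delta> * (M t x * (1/2 * (x - S \<kappa> t x)\<^sup>2)))"
    proof (rule abs_integral_le)
      show "(\<lambda>x. M t x * g x - M t x * g (S \<kappa> t x)) integrable_on {-N..N}"
        by (intro integrable_continuous_interval continuous_on_mult continuous_on_diff Mc gco Sc continuous_on_subset[OF gc]) auto
      show "(\<lambda>x. G * (\<delta> / 2) * M t x + G / \<delta> * (M t x * (1/2 * (x - S \<kappa> t x)\<^sup>2))) integrable_on {-N..N}"
        by (intro integrable_continuous_interval continuous_intros Mc Sc)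
      fix x assume "x \<in> {-N..N}"
      define z where "z = \<bar>x - S \<kappa> t x\<bar>"
      have "0 \<le> (z - \<delta>)\<^sup>2" by simp
      then have "z \<le> \<delta> / 2 + 1 / \<delta> * (1/2 * z\<^sup>2)" using del by (simp add: field_simps power2_eq_square)
      then have "G * z \<le> G * (\<delta> / 2 + 1 / \<delta> * (1/2 * z\<^sup>2))" by (rule mult_left_mono[OF _ G])
      then have "\<bar>g x - g (S \<kappa> t x)\<bar> \<le> G * (\<delta> / 2 + 1 / \<delta> * (1/2 * z\<^sup>2))" using g[of x "S \<kappa> t x"] unfolding z_def by linarith
      then have "M t x * \<bar>g x - g (S \<kappa> t x)\<bar> \<le> M t x * (G * (\<delta> / 2 + 1 / \<delta> * (1/2 * z\<^sup>2)))"
        by (intro mult_left_mono M_nonneg t)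
      moreover have "\<bar>M t x * g x - M t x * g (S \<kappa> t x)\<bar> = M t x * \<bar>g x - g (S \<kappa> t x)\<bar>"
        using M_nonneg[OF t, of x] by (simp add: right_diff_distrib[symmetric] abs_mult)
      moreover have "z\<^sup>2 = (x - S \<kappa> t x)\<^sup>2" by (simp add: z_def)
      ultimately show "\<bar>M t x * g x - M t x * g (S \<kappa> t x)\<bar> \<le> G * (\<delta> / 2) * M t x + G / \<delta> * (M t x * (1/2 * (x - S \<kappa> t x)\<^sup>2))"
        by (simp add: algebra_simps)
    qed
    also have "\<dots> = G * (\<delta> / 2) * integral {-N..N} (M t) + G / \<delta> * Del \<kappa> t"
      unfolding Del_def[OF kk] integral_mult_right[symmetric]
      by (intro Henstock_Kurzweil_Integration.integral_add integrable_continuous_interval continuous_intros Mc Sc)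
    also have "\<dots> \<le> G * (\<delta> / 2) * 1 + G / \<delta> * ((t + \<epsilon>) powr (1 + \<alpha>) * (max (1/2 * (\<epsilon> powr \<alpha> * d)\<^sup>2 / \<epsilon> powr (1 + \<alpha>)) D
      + d * \<epsilon> powr (- (1 + \<alpha>)) * (T + \<epsilon>)\<^sup>2))"
      unfolding M_mass[OF t] using G del by (intro add_left_mono mult_left_mono Dl) auto
    finally have 1: "\<bar>integral {-N..N} (\<lambda>x. M t x * g x) - integral {0..1} (\<lambda>s. g (c * etak \<kappa> s))\<bar> \<le>
      G * (\<delta> / 2) * 1 + G / \<delta> * ((t + \<epsilon>) powr (1 + \<alpha>) * (max (1/2 * (\<epsilon> powr \<alpha> * d)\<^sup>2 / \<epsilon> powr (1 + \<alpha>)) D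
      + d * \<epsilon> powr (- (1 + \<alpha>)) * (T + \<epsilon>)\<^sup>2))" unfolding gS .
    have ge: "continuous_on {0..1} (\<lambda>s. g (c * etak \<kappa> s))" "continuous_on {0..1} (\<lambda>s. g (c * eta s))"
      by (intro gco continuous_intros etak_cont kk eta_cont)+
    have "\<bar>integral {0..1} (\<lambda>s. g (c * etak \<kappa> s)) - integral {0..1} (\<lambda>s. g (c * eta s))\<bar>
      = \<bar>integral {0..1} (\<lambda>s. g (c * etak \<kappa> s) - g (c * eta s))\<bar>"
      by (subst Henstock_Kurzweil_Integration.integral_diff) (auto intro!: integrable_continuous_interval ge)
    also have "\<dots> \<le> integral {0..1} (\<lambda>s::real. G * c * d)"
    proof (rule abs_integral_le)
      show "(\<lambda>s. g (c * etak \<kappa> s) - g (c * eta s)) integrable_on {0..1}"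
        by (intro integrable_continuous_interval continuous_on_diff ge)
      fix s :: real assume s: "s \<in> {0..1}"
      have "\<bar>g (c * etak \<kappa> s) - g (c * eta s)\<bar> \<le> G * \<bar>c * etak \<kappa> s - c * eta s\<bar>" by (rule g)
      also have "\<bar>c * etak \<kappa> s - c * eta s\<bar> = c * \<bar>etak \<kappa> s - eta s\<bar>" using c by (simp add: right_diff_distrib[symmetric] abs_mult)
      also have "G * (c * \<bar>etak \<kappa> s - eta s\<bar>) \<le> G * (c * d)" by (intro mult_left_mono close s c G)
      finally show "\<bar>g (c * etak \<kappa> s) - g (c * eta s)\<bar> \<le> G * c * d" by (simp add: mult.assoc)
    qed auto
    finally have 2: "\<bar>integral {0..1} (\<lambda>s. g (c * etak \<kappa> s)) - integral {0..1} (\<lambda>s. g (c * eta s))\<bar> \<le> G * c * d" by simp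
    have "X \<le> (G * (\<delta> / 2) * 1 + G / \<delta> * ((t + \<epsilon>) powr (1 + \<alpha>) * (max (1/2 * (\<epsilon> powr \<alpha> * d)\<^sup>2 / \<epsilon> powr (1 + \<alpha>)) D
      + d * \<epsilon> powr (- (1 + \<alpha>)) * (T + \<epsilon>)\<^sup>2))) + G * c * d" using 1 2 unfolding X_def by linarith
    also have "\<dots> = f d" unfolding f_def by (simp add: distrib_left add_divide_distrib)
    finally show ?thesis .
  qed
  have "(f \<longlongrightarrow> f 0) (at_right 0)"
    unfolding f_def using del eps by (intro tendsto_intros) auto
  then have "X \<le> f 0"
    by (rule tendsto_lowerbound) (auto intro!: eventually_at_rightI[of 0 1] bound)
  also have "f 0 = G * (\<delta> / 2 + (t + \<epsilon>) powr (1 + \<alpha>) * D / \<delta>)"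
    using T eps by (simp add: f_def D_def)
  finally have X: "X \<le> G * (\<delta> / 2 + (t + \<epsilon>) powr (1 + \<alpha>) * D / \<delta>)" .
  have "integral {0..1} (\<lambda>s. g (c * eta s)) = integral {-R..R} (\<lambda>y. phi \<theta> R y * g (c * y))"
    by (rule integral_eta) (intro gco continuous_intros)
  then show ?thesis using X by (simp add: X_def c_def D_def)
qed

end

section \<open>Growth of the support\<close>

text \<open>The mean value theorem is applied twice to the second difference over a small square, in
  either order. The partial derivatives are free functions, so the lemma doubles as a compatibility
  condition: \<open>mixed\<close> reads the continuity equation off \<open>F\<close>, and
  \<open>log_density_equation\<close> an equation for ln M off \<open>dx U\<close>.\<close>

lemma mixed_partials_eq:
  fixes a b c d :: "real \<Rightarrow> real \<Rightarrow> real"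
  assumes S: "open S" "(t, x) \<in> S"
    and f1: "\<And>s y. (s, y) \<in> S \<Longrightarrow> ((\<lambda>s. f s y) has_real_derivative a s y) (at s)"
    and f2: "\<And>s y. (s, y) \<in> S \<Longrightarrow> (f s has_real_derivative b s y) (at y)"
    and a: "\<And>s y. (s, y) \<in> S \<Longrightarrow> (a s has_real_derivative c s y) (at y)"
    and b: "\<And>s y. (s, y) \<in> S \<Longrightarrow> ((\<lambda>s. b s y) has_real_derivative d s y) (at s)"
    and cc: "continuous_on S (\<lambda>(s, y). c s y)" and dc: "continuous_on S (\<lambda>(s, y). d s y)"
  shows "c t x = d t x"
proof (rule ccontr)
  assume ne: "c t x \<noteq> d t x"
  define e where "e = \<bar>c t x - d t x\<bar> / 2"
  have e: "0 < e" using ne by (simp add: e_def)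
  have lim: "\<exists>\<delta>>0. \<forall>s y. \<bar>s - t\<bar> \<le> \<delta> \<longrightarrow> \<bar>y - x\<bar> \<le> \<delta> \<longrightarrow> (s, y) \<in> S \<and> \<bar>g s y - g t x\<bar> < e"
    if g: "continuous_on S (\<lambda>(s, y). g s y)" for g :: "real \<Rightarrow> real \<Rightarrow> real"
  proof -
    have "isCont (\<lambda>(s, y). g s y) (t, x)" using g S by (simp add: continuous_on_eq_continuous_at)
    then obtain \<delta>1 where d1: "\<delta>1 > 0" "\<And>p. dist p (t, x) < \<delta>1 \<Longrightarrow> \<bar>(case p of (s, y) \<Rightarrow> g s y) - g t x\<bar> < e"
      unfolding continuous_at_eps_delta dist_real_def using e by (metis case_prod_conv)
    obtain \<delta>2 where d2: "\<delta>2 > 0" "ball (t, x) \<delta>2 \<subseteq> S" using S open_contains_ball by blast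
    define \<delta> where "\<delta> = min \<delta>1 \<delta>2 / 3"
    have near: "dist (s, y) (t, x) < min \<delta>1 \<delta>2" if "\<bar>s - t\<bar> \<le> \<delta>" "\<bar>y - x\<bar> \<le> \<delta>" for s y
    proof -
      have "dist (s, y) (t, x) \<le> \<bar>s - t\<bar> + \<bar>y - x\<bar>"
        using sqrt_sum_squares_le_sum_abs[of "s - t" "y - x"] by (simp add: dist_Pair_Pair dist_real_def)
      also have "\<dots> \<le> 2 * \<delta>" using that by simp
      also have "\<dots> < min \<delta>1 \<delta>2" using d1 d2 by (auto simp: \<delta>_def min_def)
      finally show ?thesis .
    qed
    show ?thesis
    proof (intro exI[of _ \<delta>] conjI allI impI)
      fix s y assume h: "\<bar>s - t\<bar> \<le> \<delta>" "\<bar>y - x\<bar> \<le> \<delta>"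
      show "(s, y) \<in> S" using near[OF h] d2(2) by (auto simp: dist_commute)
      show "\<bar>g s y - g t x\<bar> < e" using d1(2)[of "(s, y)"] near[OF h] by simp
    qed (use d1 d2 in \<open>simp add: \<delta>_def\<close>)
  qed
  obtain \<delta>1 where d1: "\<delta>1 > 0" "\<And>s y. \<bar>s - t\<bar> \<le> \<delta>1 \<Longrightarrow> \<bar>y - x\<bar> \<le> \<delta>1 \<Longrightarrow> (s, y) \<in> S \<and> \<bar>c s y - c t x\<bar> < e"
    using lim[OF cc] by blast
  obtain \<delta>2 where d2: "\<delta>2 > 0" "\<And>s y. \<bar>s - t\<bar> \<le> \<delta>2 \<Longrightarrow> \<bar>y - x\<bar> \<le> \<delta>2 \<Longrightarrow> (s, y) \<in> S \<and> \<bar>d s y - d t x\<bar> < e"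
    using lim[OF dc] by blast
  define h where "h = min \<delta>1 \<delta>2"
  have h: "0 < h" using d1 d2 by (simp add: h_def)
  have hl: "h \<le> \<delta>1" "h \<le> \<delta>2" by (auto simp: h_def)
  have inS: "(s, y) \<in> S" if "t \<le> s" "s \<le> t + h" "x \<le> y" "y \<le> x + h" for s y
    using d1(2)[of s y] that by (simp add: h_def)
  have "\<exists>z>t. z < t + h \<and> (f (t + h) (x + h) - f (t + h) x) - (f t (x + h) - f t x) = (t + h - t) * (a z (x + h) - a z x)"
    by (rule MVT2[of t "t + h" "\<lambda>s. f s (x + h) - f s x"]) (use h inS f1 in \<open>auto intro!: DERIV_diff\<close>)
  then obtain s1 where s1: "t < s1" "s1 < t + h" "(f (t + h) (x + h) - f (t + h) x) - (f t (x + h) - f t x) = h * (a s1 (x + h) - a s1 x)" by auto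
  have "\<exists>z>x. z < x + h \<and> a s1 (x + h) - a s1 x = (x + h - x) * c s1 z"
    by (rule MVT2) (use h inS a s1 in auto)
  then obtain y1 where y1: "x < y1" "y1 < x + h" "a s1 (x + h) - a s1 x = h * c s1 y1" by auto
  have "\<exists>z>x. z < x + h \<and> (f (t + h) (x + h) - f t (x + h)) - (f (t + h) x - f t x) = (x + h - x) * (b (t + h) z - b t z)"
    by (rule MVT2[of x "x + h" "\<lambda>y. f (t + h) y - f t y"]) (use h inS f2 in \<open>auto intro!: DERIV_diff\<close>)
  then obtain y2 where y2: "x < y2" "y2 < x + h" "(f (t + h) (x + h) - f t (x + h)) - (f (t + h) x - f t x) = h * (b (t + h) y2 - b t y2)" by auto
  have "\<exists>z>t. z < t + h \<and> b (t + h) y2 - b t y2 = (t + h - t) * d z y2"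
    by (rule MVT2) (use h inS b y2 in auto)
  then obtain s2 where s2: "t < s2" "s2 < t + h" "b (t + h) y2 - b t y2 = h * d s2 y2" by auto
  have "f (t + h) (x + h) - f (t + h) x - (f t (x + h) - f t x) = f (t + h) (x + h) - f t (x + h) - (f (t + h) x - f t x)"
    by simp
  then have "h * (h * c s1 y1) = h * (h * d s2 y2)" using s1(3) y1(3) y2(3) s2(3) by simp
  then have "c s1 y1 = d s2 y2" using h by simp
  moreover have "\<bar>c s1 y1 - c t x\<bar> < e" using d1(2)[of s1 y1] s1 y1 hl by auto
  moreover have "\<bar>d s2 y2 - d t x\<bar> < e" using d2(2)[of s2 y2] s2 y2 hl by auto
  ultimately show False unfolding e_def by argo
qed

lemma second_derivative_at_max:
  fixes \<phi> :: "real \<Rightarrow> real"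
  assumes r: "0 < r" and max: "\<And>s. \<bar>s\<bar> < r \<Longrightarrow> \<phi> s \<le> \<phi> 0"
    and d: "\<And>s. \<bar>s\<bar> < r \<Longrightarrow> (\<phi> has_real_derivative \<phi>' s) (at s)"
    and D: "(\<phi>' has_real_derivative D) (at 0)"
  shows "\<phi>' 0 = 0" "D \<le> 0"
proof -
  show z: "\<phi>' 0 = 0"
    by (rule DERIV_local_max[OF d r]) (use r max in auto)
  show "D \<le> 0"
  proof (rule ccontr)
    assume "\<not> D \<le> 0"
    then obtain \<delta> where dl: "\<delta> > 0" "\<And>h. 0 < h \<Longrightarrow> h < \<delta> \<Longrightarrow> \<phi>' 0 < \<phi>' (0 + h)"
      using DERIV_pos_inc_right[OF D] by auto
    define s where "s = min \<delta> r / 2"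
    have s: "0 < s" "s < \<delta>" "s < r" using dl r by (auto simp: s_def)
    have "\<phi> 0 < \<phi> s"
    proof (rule DERIV_pos_imp_increasing_open[OF s(1)])
      show "\<exists>y. (\<phi> has_real_derivative y) (at u) \<and> 0 < y" if "0 < u" "u < s" for u
        using d[of u] dl(2)[of u] that s z by (intro exI[of _ "\<phi>' u"]) auto
      have "isCont \<phi> u" if "u \<in> {0..s}" for u using d[of u] that s DERIV_isCont by force
      then show "continuous_on {0..s} \<phi>" by (simp add: continuous_at_imp_continuous_on)
    qed
    with max[of s] s show False by simp
  qed
qed

lemma Ck_on_Suc_has_grad:
  assumes "open S" "Ck_on (Suc n) S f" "(t, x) \<in> S"
  shows "has_grad f (dt f t x) (dx f t x) t x"
proof (rule has_grad_partials[where S = S and fx = "dx f"])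
  have d: "\<forall>(t, x)\<in>S. (\<lambda>s. f s x) differentiable (at t) \<and> f t differentiable (at x)"
    using assms(2) by simp
  show "((\<lambda>s. f s x) has_real_derivative dt f t x) (at t)"
    using d assms(3) by (auto simp: DERIV_deriv_iff_real_differentiable)
  show "(f s has_real_derivative dx f s y) (at y)" if "(s, y) \<in> S" for s y
    using d that by (auto simp: DERIV_deriv_iff_real_differentiable)
  have "Ck_on n S (dx f)" using assms(2) by simp
  then show "continuous_on S (\<lambda>(s, y). dx f s y)" by (cases n) auto
qed (use assms in auto)

lemma Ck_on_continuous: "Ck_on n S f \<Longrightarrow> continuous_on S (\<lambda>(t, x). f t x)"
  by (cases n) auto

text \<open>The edge of the support moves with the flux velocity \<open>- p\<close>, which by continuity of
  \<open>p\<close> is controlled by its values on the vacuum side.\<close>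

lemma vacuum_barrier:
  fixes M q p :: "real \<Rightarrow> real \<Rightarrow> real" and b b' B :: "real \<Rightarrow> real"
  assumes "0 < T"
    and M: "continuous_on ({0..T} \<times> UNIV) (\<lambda>(t, x). M t x)" and M0: "\<And>t x. t \<in> {0..T} \<Longrightarrow> 0 \<le> M t x"
    and q: "continuous_on (strip T) (\<lambda>(t, x). q t x)" and qp: "\<And>t x. t \<in> {0<..<T} \<Longrightarrow> q t x = M t x * p t x"
    and p: "continuous_on (strip T) (\<lambda>(t, x). p t x)"
    and bal: "flux_balance T M q"
    and supp: "\<And>t x. t \<in> {0..T} \<Longrightarrow> N \<le> \<bar>x\<bar> \<Longrightarrow> M t x = 0"
    and b: "\<And>t. t \<in> {0<..<T} \<Longrightarrow> (b has_real_derivative b' t) (at t)" "continuous_on {0..T} b"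
       "continuous_on {0<..<T} b'" "\<And>t. t \<in> {0..T} \<Longrightarrow> 0 \<le> b t"
    and vac: "\<And>t. t \<in> {0<..<T} \<Longrightarrow> AE x in lborel. M t x = 0 \<longrightarrow> \<bar>p t x\<bar> \<le> B t"
    and Bb: "\<And>t. t \<in> {0<..<T} \<Longrightarrow> B t < b' t"
    and init: "0 < t3" "\<And>t x. t \<in> {0..T} \<Longrightarrow> t < t3 \<Longrightarrow> b t < x \<Longrightarrow> M t x = 0"
    and t: "t1 \<in> {0<..<T}" and x: "b t1 < x"
  shows "M t1 x = 0"
proof -
  have Ms: "continuous_on S (M s)" if "s \<in> {0..T}" for S s by (rule continuous_on_slice2[OF M]) (use that in auto)
  have "compact (b ` {0..T})" by (intro compact_continuous_image b compact_Icc)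
  then obtain Z0 where Z0: "\<And>t. t \<in> {0..T} \<Longrightarrow> b t \<le> Z0"
    by (meson bounded_imp_bdd_above bdd_above_def compact_imp_bounded imageI)
  \<comment> \<open>Z lies to the right of the support and of every position of the barrier, and c
    to the left of both.\<close>
  define Z where "Z = max N Z0 + 1"
  define c where "c = - \<bar>N\<bar> - 1"
  have cb: "c < b t" if "t \<in> {0..T}" for t using b(4)[OF that] by (simp add: c_def)
  have bZ: "b t < Z" "N < Z" if "t \<in> {0..T}" for t using Z0[OF that] by (auto simp: Z_def)
  have cZ: "c \<le> Z" unfolding Z_def c_def by linarith
  have NZ: "N \<le> \<bar>Z\<bar>" by (simp add: Z_def)
  define H where "H = (\<lambda>t x. integral {c..x} (M t))"
  have Hg: "has_grad H (q t x) (M t x) t x" if "t \<in> {0<..<T}" "c < x" for t x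
    using primitive_has_grad[OF M q bal, of t c x] qp[OF that(1), of c] supp[of t c] that
    by (simp add: H_def c_def)
  \<comment> \<open>The mass beyond the barrier. By \<open>outd\<close> it decreases as long as p +
    b' is nonnegative at the edge.\<close>
  define out where "out = (\<lambda>t. H t Z - H t (b t))"
  have out_int: "out t = integral {b t..Z} (M t)" if "t \<in> {0..T}" for t
    unfolding out_def H_def
    using Henstock_Kurzweil_Integration.integral_combine[of c "b t" Z "M t"]
      integrable_continuous_interval[OF Ms[OF that]] cb[OF that] bZ[OF that] by simp
  have out0: "0 \<le> out t" if "t \<in> {0..T}" for t
    unfolding out_int[OF that] by (intro integral_nonneg integrable_continuous_interval Ms M0 that)
  have vacuum: "M t y = 0" if "t \<in> {0..T}" "out t = 0" "b t < y" for t y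
  proof (cases "y \<le> Z")
    case True
    then show ?thesis
      using integral_eq_0_iff[of "b t" Z "M t"] Ms[OF that(1)] M0[OF that(1)] bZ[OF that(1)] that out_int by auto
  next
    case False
    then show ?thesis using supp[OF that(1), of y] by (auto simp: Z_def)
  qed
  have Hc: "continuous_on ({0..T} \<times> {c..}) (\<lambda>(t, x). H t x)" unfolding H_def by (rule continuous_on_primitive[OF M])
  have outc: "continuous_on {0..T} out"
    unfolding out_def
    by (intro continuous_intros continuous_on_compose2[OF Hc[unfolded case_prod_unfold], of _ "\<lambda>s. (s, Z)", simplified]
          continuous_on_compose2[OF Hc[unfolded case_prod_unfold], of _ "\<lambda>s. (s, b s)", simplified] b)
      (use cb bZ cZ in \<open>auto intro: less_imp_le\<close>)
  have outd: "(out has_real_derivative - (M t (b t) * (p t (b t) + b' t))) (at t)" if tt: "t \<in> {0<..<T}" for t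
  proof -
    have t': "t \<in> {0..T}" using tt by auto
    have "(out has_real_derivative (q t Z * 1 + M t Z * 0) - (q t (b t) * 1 + M t (b t) * b' t)) (at t)"
      unfolding out_def using cb[OF t'] bZ[OF t']
      by (intro DERIV_diff has_grad_curve[of H _ _ "\<lambda>s. s"] Hg tt b(1) DERIV_ident DERIV_const) auto
    then show ?thesis using qp[OF tt] supp[OF t' NZ] by (simp add: algebra_simps)
  qed
  \<comment> \<open>When no mass lies outside, an interval to the right of the edge is vacuum. The
    bound there holds only almost everywhere, but continuity of \<open>p\<close> carries it to the
    edge.\<close>
  have edge: "\<bar>p t (b t)\<bar> \<le> B t" if tt: "t \<in> {0<..<T}" "out t = 0" for t
  proof (rule ccontr)
    assume "\<not> \<bar>p t (b t)\<bar> \<le> B t"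
    then have gt: "B t < \<bar>p t (b t)\<bar>" by simp
    have pc: "isCont (\<lambda>y. \<bar>p t y\<bar>) (b t)"
      using continuous_on_slice2[OF p tt(1), of UNIV] by (auto simp: continuous_on_eq_continuous_at intro!: continuous_intros)
    have "\<forall>\<^sub>F y in at (b t). B t < \<bar>p t y\<bar>"
      using pc gt unfolding isCont_def by (rule order_tendstoD)
    then obtain d where d: "d > 0" "\<And>y. y \<noteq> b t \<Longrightarrow> dist y (b t) < d \<Longrightarrow> B t < \<bar>p t y\<bar>"
      unfolding eventually_at by auto
    have "AE y in lborel. y \<notin> {b t<..<b t + d}"
      using vac[OF tt(1)]
    proof eventually_elim
      case (elim y)
      then show ?case using d(2)[of y] vacuum[of t y] tt by (auto simp: dist_real_def)
    qed
    then have "{b t<..<b t + d} \<in> null_sets lborel" by (subst (asm) AE_iff_null_sets[symmetric]) auto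
    then show False using d(1) by (simp add: null_sets_def emeasure_lborel_Ioo)
  qed
  have "out t1 = 0"
  proof (rule ccontr)
    assume ne: "out t1 \<noteq> 0"
    have t1: "0 < t1" "t1 < T" using t by auto
    \<comment> \<open>The times without mass outside; the last of them, t0, leads to the
      contradiction. At t0 the bound \<open>edge\<close> makes p + b' positive, hence also shortly
      afterwards, so \<open>out\<close> cannot leave 0.\<close>
    define A where "A = {s \<in> {0..t1}. out s = 0}"
    have Ac: "compact A"
    proof -
      have "continuous_on {0..t1} out" by (rule continuous_on_subset[OF outc]) (use t1 in auto)
      then have "closed {s \<in> {0..t1}. out s = 0}" by (intro continuous_closed_preimage_constant) auto
      then show ?thesis unfolding compact_eq_bounded_closed A_def
        by (auto intro: bounded_subset[of "{0..t1}"])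
    qed
    define s0 where "s0 = min (t3 / 2) t1"
    have s0: "0 < s0" "s0 < t3" "s0 \<le> t1" using init(1) t1 by (auto simp: s0_def)
    have "out s0 = 0"
    proof -
      have s: "s0 \<in> {0..T}" using s0 t1 by auto
      have "integral {b s0..Z} (M s0) = integral {b s0..Z} (\<lambda>_. 0)"
        by (rule integral_spike[of "{b s0}"]) (use init(2)[OF s s0(2)] in auto)
      then show ?thesis using out_int[OF s] by simp
    qed
    then have s0A: "s0 \<in> A" using s0 by (simp add: A_def)
    then obtain t0 where t0: "t0 \<in> A" "\<And>s. s \<in> A \<Longrightarrow> s \<le> t0"
      using compact_attains_sup[OF Ac] by blast
    have t0': "0 < t0" "t0 < t1" "out t0 = 0"
      using t0(2)[OF s0A] s0 t0(1) ne by (auto simp: A_def less_le)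
    have tt0: "t0 \<in> {0<..<T}" using t0' t1 by auto
    have pos: "0 < p t0 (b t0) + b' t0" using edge[OF tt0 t0'(3)] Bb[OF tt0] by (simp add: abs_le_iff)
    have bcont: "continuous_on {0<..<T} b" by (rule continuous_on_subset[OF b(2)]) auto
    have "continuous_on {0<..<T} (\<lambda>t. p t (b t) + b' t)"
      by (intro continuous_on_add b(3) continuous_on_compose2[OF p[unfolded case_prod_unfold], of _ "\<lambda>s. (s, b s)", simplified] continuous_on_Pair continuous_on_id bcont) auto
    then have "isCont (\<lambda>t. p t (b t) + b' t) t0" using tt0 by (simp add: continuous_on_eq_continuous_at)
    then have "\<forall>\<^sub>F s in at t0. 0 < p s (b s) + b' s"
      using pos unfolding isCont_def by (rule order_tendstoD)
    then obtain d where d: "d > 0" "\<And>s. s \<noteq> t0 \<Longrightarrow> dist s t0 < d \<Longrightarrow> 0 < p s (b s) + b' s"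
      unfolding eventually_at by auto
    define u where "u = min (t0 + d / 2) t1"
    have u: "t0 < u" "u \<le> t1" "u < t0 + d" using d t0' by (auto simp: u_def)
    have "out u \<le> out t0"
    proof (rule DERIV_nonpos_imp_decreasing_open[of t0 u out])
      show "\<exists>y. (out has_real_derivative y) (at s) \<and> y \<le> 0" if s: "t0 < s" "s < u" for s
      proof -
        have ss: "s \<in> {0<..<T}" using s u t0' t1 by auto
        have "0 \<le> M s (b s)" using M0[of s] ss by auto
        then show ?thesis using outd[OF ss] d(2)[of s] s u by (intro exI[of _ "- (M s (b s) * (p s (b s) + b' s))"]) (auto simp: dist_real_def)
      qed
      show "continuous_on {t0..u} out" by (rule continuous_on_subset[OF outc]) (use t0' u t1 in auto)
    qed (use u in auto)
    then have "out u = 0" using out0[of u] t0' u t1 by auto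
    then have "u \<in> A" using u t0' by (auto simp: A_def)
    then show False using t0(2) u by force
  qed
  then show ?thesis using vacuum[of t1 x] t x by auto
qed

context mfg_eps
begin

text \<open>The barrier Q \<tau>^\<alpha> covers the initial support because of R, and because of C
  / \<alpha> it moves at least as fast as the bound on the vacuum side allows. The result contains
  neither L nor N, which depend on \<epsilon>.\<close>

lemma support_bound:
  assumes C: "0 \<le> C"
    and vac: "\<And>t. t \<in> {0<..<T} \<Longrightarrow> AE x in lborel. M t x = 0 \<longrightarrow> \<bar>dx U t x\<bar> \<le> C * (t + \<epsilon>) powr (\<alpha> - 1)"
    and fin: "\<And>t x. t \<in> {0..T} \<Longrightarrow> R * \<epsilon> powr \<alpha> + L * t < \<bar>x\<bar> \<Longrightarrow> M t x = 0" and L: "0 \<le> L"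
    and t: "t1 \<in> {0<..<T}" and x: "max R (C / \<alpha>) * (t1 + \<epsilon>) powr \<alpha> < \<bar>x\<bar>"
  shows "M t1 x = 0"
proof -
  define Q where "Q = max R (C / \<alpha>)"
  have Q: "R \<le> Q" "C \<le> Q * \<alpha>"
  proof -
    have "C / \<alpha> \<le> Q" by (simp add: Q_def)
    then show "C \<le> Q * \<alpha>" using al(1) by (simp only: pos_divide_le_eq)
  qed (simp add: Q_def)
  \<comment> \<open>The two additions \<delta> and \<delta> t together use up less than the gap to
    |x|. The constant part outlasts finite speed for a short time; the linear part makes the barrier
    strictly faster than the vacuum bound.\<close>
  define \<delta> where "\<delta> = (\<bar>x\<bar> - Q * (t1 + \<epsilon>) powr \<alpha>) / (2 + 2 * T)"
  have del: "0 < \<delta>" using x T by (simp add: \<delta>_def Q_def)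
  define b where "b = (\<lambda>t. Q * (t + \<epsilon>) powr \<alpha> + \<delta> + \<delta> * t)"
  define b' where "b' = (\<lambda>t. Q * \<alpha> * (t + \<epsilon>) powr (\<alpha> - 1) + \<delta>)"
  have bd: "(b has_real_derivative b' t) (at t)" if "0 \<le> t" for t
    unfolding b_def b'_def using that eps by (auto intro!: derivative_eq_intros)
  have b'c: "continuous_on {0<..<T} b'"
    unfolding b'_def by (intro continuous_intros) (use eps in auto)
  have bge: "Q * (t + \<epsilon>) powr \<alpha> + \<delta> \<le> b t" "0 \<le> b t" if "0 \<le> t" for t
  proof -
    have "0 \<le> Q * (t + \<epsilon>) powr \<alpha>" "0 \<le> \<delta> * t" using Q R del that by auto
    then show "Q * (t + \<epsilon>) powr \<alpha> + \<delta> \<le> b t" "0 \<le> b t" unfolding b_def using del by linarith+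
  qed
  have bx: "b t1 < \<bar>x\<bar>"
  proof -
    have "\<delta> * t1 < \<delta> * T" "0 < \<delta> * T" using del t T by auto
    moreover have "\<delta> * (2 + 2 * T) = 2 * \<delta> + 2 * (\<delta> * T)" by (simp add: algebra_simps)
    ultimately have "\<delta> + \<delta> * t1 < \<delta> * (2 + 2 * T)" using del by linarith
    also have "\<dots> = \<bar>x\<bar> - Q * (t1 + \<epsilon>) powr \<alpha>" using T by (simp add: \<delta>_def)
    finally show ?thesis by (simp add: b_def)
  qed
  have bc: "continuous_on {0..T} b"
    using bd by (meson DERIV_isCont atLeastAtMost_iff continuous_at_imp_continuous_on)
  have Bb: "C * (t + \<epsilon>) powr (\<alpha> - 1) < b' t" for t
    unfolding b'_def using mult_right_mono[OF Q(2), of "(t + \<epsilon>) powr (\<alpha> - 1)"] del by simp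
  \<comment> \<open>During this time the support grows by at most L t \<le> \<delta>; L + 1 in place
    of L avoids a division by 0.\<close>
  have init: "M t y = 0" if "t \<in> {0..T}" "t < \<delta> / (L + 1)" "b t < \<bar>y\<bar>" for t y
  proof -
    have "L * t \<le> (L + 1) * t" using that by (simp add: algebra_simps)
    also have "\<dots> \<le> \<delta>" using that L by (simp add: field_simps)
    finally have "L * t \<le> \<delta>" .
    moreover have "R * \<epsilon> powr \<alpha> \<le> Q * (t + \<epsilon>) powr \<alpha>"
      using Q R eps al that by (intro mult_mono powr_mono2) auto
    ultimately show ?thesis using fin[OF that(1), of y] that(3) bge(1)[of t] that(1) by auto
  qed
  have dl: "0 < \<delta> / (L + 1)" using del L by simp
  show ?thesis
  proof (cases "0 \<le> x")
    case True
    show ?thesis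
    proof (rule vacuum_barrier[where M = M and q = "\<lambda>t x. M t x * dx U t x" and p = "dx U" and b = b and b' = b' and N = N
            and B = "\<lambda>t. C * (t + \<epsilon>) powr (\<alpha> - 1)" and T = T and ?t3.0 = "\<delta> / (L + 1)"])
      show "(b has_real_derivative b' t) (at t)" if "t \<in> {0<..<T}" for t using bd that by simp
      show "0 \<le> b t" if "t \<in> {0..T}" for t using bge(2) that by simp
      show "M t y = 0" if "t \<in> {0..T}" "t < \<delta> / (L + 1)" "b t < y" for t y
        using init[OF that(1,2)] that(3) by (simp add: less_le_trans[OF _ abs_ge_self])
      show "b t1 < x" using bx True by simp
    qed (assumption | rule refl T M_cont M_nonneg b_cont U_cont(2) balance M_support bc b'c vac Bb dl t)+
  next
    case False
    have M': "continuous_on ({0..T} \<times> UNIV) (\<lambda>(t, x). M t (- x))"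
      unfolding case_prod_unfold
      by (intro continuous_on_compose2[OF M_cont[unfolded case_prod_unfold], of _ "\<lambda>q. (fst q, - snd q)", simplified] continuous_intros) auto
    have b_: "continuous_on (strip T) (\<lambda>(t, x). - (M t (- x) * dx U t (- x)))"
      unfolding case_prod_unfold
      by (intro continuous_on_minus continuous_on_compose2[OF b_cont[unfolded case_prod_unfold], of _ "\<lambda>q. (fst q, - snd q)", simplified] continuous_intros) auto
    have p_: "continuous_on (strip T) (\<lambda>(t, x). - dx U t (- x))"
      unfolding case_prod_unfold
      by (intro continuous_on_minus continuous_on_compose2[OF U_cont(2)[unfolded case_prod_unfold], of _ "\<lambda>q. (fst q, - snd q)", simplified] continuous_intros) auto
    have vac': "AE x in lborel. M t (- x) = 0 \<longrightarrow> \<bar>- dx U t (- x)\<bar> \<le> C * (t + \<epsilon>) powr (\<alpha> - 1)" if tt: "t \<in> {0<..<T}" for t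
    proof -
      have [measurable]: "M t \<in> borel_measurable borel" "dx U t \<in> borel_measurable borel"
        using M_slice[of t UNIV] continuous_on_slice2[OF U_cont(2) tt, of UNIV] tt
        by (auto intro!: borel_measurable_continuous_onI)
      show ?thesis
        using AE_borel_affine[of "-1" "\<lambda>x. M t x = 0 \<longrightarrow> \<bar>dx U t x\<bar> \<le> C * (t + \<epsilon>) powr (\<alpha> - 1)" 0, OF _ _ vac[OF tt]]
        by simp
    qed
    have "M t1 (- (- x)) = 0"
    proof (rule vacuum_barrier[where M = "\<lambda>t x. M t (- x)" and q = "\<lambda>t x. - (M t (- x) * dx U t (- x))" and p = "\<lambda>t x. - dx U t (- x)" and b = b and b' = b' and N = N
            and B = "\<lambda>t. C * (t + \<epsilon>) powr (\<alpha> - 1)" and T = T and ?t3.0 = "\<delta> / (L + 1)"])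
      show "(b has_real_derivative b' t) (at t)" if "t \<in> {0<..<T}" for t using bd that by simp
      show "0 \<le> b t" if "t \<in> {0..T}" for t using bge(2) that by simp
      show "M t (- y) = 0" if "t \<in> {0..T}" "t < \<delta> / (L + 1)" "b t < y" for t y
        using init[OF that(1,2), of "- y"] that(3) by (simp add: less_le_trans[OF _ abs_ge_self])
      show "b t1 < - x" using bx False by simp
      show "- (M t (- x) * dx U t (- x)) = M t (- x) * - dx U t (- x)" for t x by simp
      show "M t (- y) = 0" if "t \<in> {0..T}" "N \<le> \<bar>y\<bar>" for t y using M_support[of t "- y"] that by simp
      show "0 \<le> M t (- y)" if "t \<in> {0..T}" for t y using M_nonneg that by simp
    qed (assumption | rule T M' b_ p_ flux_balance_reflect[OF M_cont balance] bc b'c vac' Bb dl t)+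
    then show ?thesis by simp
  qed
qed

end

section \<open>Interior maxima of the density\<close>

text \<open>\<open>K\<close> is the equation of the log density, elliptic with principal part (d_t -
  p d_x)^2 + \<theta> E d_x^2. At an interior maximum of the log density plus h the gradients are
  opposite, the second-derivative tests \<open>D\<close> bound the operator from above, and the
  first-order terms reduce to a square minus \<theta> (1 + \<theta>) E hx^2.\<close>

lemma maximum_principle_algebra:
  fixes Lt Lx Ltt Ltx Lxx ht hx htt htx hxx p E \<theta> :: real
  assumes K: "Ltt - 2 * p * Ltx + p\<^sup>2 * Lxx + \<theta> * E * Lxx
      = (p * Lt - p\<^sup>2 * Lx - \<theta> * E * Lx) * Lx + (Lt - p * Lx) * Lt - 2 * p * (Lt - p * Lx) * Lx - \<theta>\<^sup>2 * E * Lx\<^sup>2"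
    and c: "Lt = - ht" "Lx = - hx" "0 \<le> E" "0 < \<theta>"
    and D: "Ltt + htt - 2 * p * (Ltx + htx) + p\<^sup>2 * (Lxx + hxx) \<le> 0" "Lxx + hxx \<le> 0"
  shows "\<theta> * E * (hxx - (1 + \<theta>) * hx\<^sup>2) \<le> - htt + 2 * p * htx - p\<^sup>2 * hxx"
proof -
  have "\<theta> * E * (Lxx + hxx) \<le> 0" using c D(2) by (intro mult_nonneg_nonpos) auto
  moreover have "(p * Lt - p\<^sup>2 * Lx - \<theta> * E * Lx) * Lx + (Lt - p * Lx) * Lt - 2 * p * (Lt - p * Lx) * Lx - \<theta>\<^sup>2 * E * Lx\<^sup>2
     = (ht - p * hx)\<^sup>2 - \<theta> * (1 + \<theta>) * E * hx\<^sup>2"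
    unfolding c by (simp add: power2_eq_square algebra_simps)
  moreover have "0 \<le> (ht - p * hx)\<^sup>2" by simp
  moreover have "\<theta> * E * (hxx - (1 + \<theta>) * hx\<^sup>2) = \<theta> * E * (Lxx + hxx) - \<theta> * E * Lxx - \<theta> * (1 + \<theta>) * E * hx\<^sup>2"
    by (simp add: algebra_simps)
  moreover have "Ltt + htt - 2 * p * (Ltx + htx) + p\<^sup>2 * (Lxx + hxx) = (Ltt - 2 * p * Ltx + p\<^sup>2 * Lxx) + (htt - 2 * p * htx + p\<^sup>2 * hxx)"
    by (simp add: algebra_simps)
  ultimately show ?thesis using K D(1) by linarith
qed

text \<open>Here h = \<alpha> ln \<tau> + k x^2 \<tau>^(-2 \<alpha>) and \<open>K2\<close> is the
  power of \<tau>. The smallness \<open>kx\<close> lets half of hxx absorb (1 + \<theta>) hx^2. On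
  the right the terms with p complete to a square of negative sign, and 3 = 1 + 2 bounds \<alpha>
  plus 8 \<alpha>^2 y.\<close>

lemma barrier_algebra:
  fixes \<tau> k x K2 \<alpha> \<theta> p E :: real
  assumes pos: "0 < \<tau>" "0 < K2" "0 < \<alpha>" "\<alpha> < 1" "0 < \<theta>" "0 \<le> E" "0 < k"
    and kx: "4 * (1 + \<theta>) * (k * (x\<^sup>2 * K2)) \<le> 1"
    and h: "\<theta> * E * (2 * k * K2 - (1 + \<theta>) * (2 * k * x * K2)\<^sup>2)
      \<le> - (- \<alpha> / \<tau>\<^sup>2 + 2 * \<alpha> * (2 * \<alpha> + 1) * k * x\<^sup>2 * K2 / \<tau>\<^sup>2) + 2 * p * (- 4 * \<alpha> * k * x * K2 / \<tau>) - p\<^sup>2 * (2 * k * K2)"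
  shows "\<theta> * E * k * K2 * \<tau>\<^sup>2 \<le> 3"
proof -
  define y where "y = k * (x\<^sup>2 * K2)"
  have y: "0 \<le> y" "4 * (1 + \<theta>) * y \<le> 1" using pos kx by (auto simp: y_def)
  have "4 * y \<le> 4 * (1 + \<theta>) * y" using pos y by (simp add: algebra_simps)
  then have y4: "4 * y \<le> 1" using y by linarith
  have "(1 + \<theta>) * (2 * k * x * K2)\<^sup>2 = k * K2 * (4 * (1 + \<theta>) * y)"
    unfolding y_def by (simp add: power2_eq_square algebra_simps)
  also have "\<dots> \<le> k * K2 * 1" using pos y by (intro mult_left_mono) auto
  finally have "k * K2 \<le> 2 * k * K2 - (1 + \<theta>) * (2 * k * x * K2)\<^sup>2" by (simp add: mult.commute[of K2 k])
  then have "\<theta> * E * (k * K2) \<le> \<theta> * E * (2 * k * K2 - (1 + \<theta>) * (2 * k * x * K2)\<^sup>2)"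
    using pos by (intro mult_left_mono) auto
  also note h
  also have "- (- \<alpha> / \<tau>\<^sup>2 + 2 * \<alpha> * (2 * \<alpha> + 1) * k * x\<^sup>2 * K2 / \<tau>\<^sup>2) + 2 * p * (- 4 * \<alpha> * k * x * K2 / \<tau>) - p\<^sup>2 * (2 * k * K2)
     = \<alpha> / \<tau>\<^sup>2 - 2 * \<alpha> * (2 * \<alpha> + 1) * y / \<tau>\<^sup>2 + 8 * \<alpha>\<^sup>2 * y / \<tau>\<^sup>2 - 2 * k * K2 * (p + 2 * \<alpha> * x / \<tau>)\<^sup>2"
    unfolding y_def using pos by (simp add: power2_eq_square field_simps)
  also have "\<dots> \<le> 3 / \<tau>\<^sup>2"
  proof -
    have "0 \<le> 2 * k * K2 * (p + 2 * \<alpha> * x / \<tau>)\<^sup>2" using pos by simp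
    moreover have "0 \<le> 2 * \<alpha> * (2 * \<alpha> + 1) * y / \<tau>\<^sup>2" using pos y by simp
    moreover have "8 * \<alpha>\<^sup>2 * y / \<tau>\<^sup>2 \<le> 2 / \<tau>\<^sup>2"
    proof (rule divide_right_mono)
      have "\<alpha>\<^sup>2 * (4 * y) \<le> 1 * 1" using pos y y4 by (intro mult_mono) (auto simp: power_le_one)
      then show "8 * \<alpha>\<^sup>2 * y \<le> 2" by (simp add: mult_ac)
    qed simp
    moreover have "\<alpha> / \<tau>\<^sup>2 \<le> 1 / \<tau>\<^sup>2" using pos by (intro divide_right_mono) auto
    moreover have "3 / \<tau>\<^sup>2 = 1 / \<tau>\<^sup>2 + 2 / \<tau>\<^sup>2" by (simp add: add_divide_distrib[symmetric])
    ultimately show ?thesis by linarith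
  qed
  finally show ?thesis using pos by (simp add: pos_le_divide_eq mult.assoc)
qed

lemma has_grad_minus_x2: "has_grad (\<lambda>t x. x\<^sup>2) 0 (2 * x) t x"
  using has_grad_mult[OF has_grad_space has_grad_space] by (simp add: power2_eq_square)

section \<open>Classical equations where the density is positive\<close>

locale mfg_eps_smooth = mfg_eps \<theta> R T N U M \<epsilon> L
  for \<theta> R T N :: real and U M :: "real \<Rightarrow> real \<Rightarrow> real" and \<epsilon> L :: real +
  assumes smooth_U: "Cinf_on {(t, x). t \<in> {0<..<T} \<and> 0 < M t x} U"
    and smooth_M: "Cinf_on {(t, x). t \<in> {0<..<T} \<and> 0 < M t x} M"
begin

definition Pos :: "(real \<times> real) set" where "Pos = {(t, x). t \<in> {0<..<T} \<and> 0 < M t x}"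

lemma Pos_iff: "(t, x) \<in> Pos \<longleftrightarrow> t \<in> {0<..<T} \<and> 0 < M t x" by (simp add: Pos_def)

lemma Pos_open: "open Pos"
proof -
  have "continuous_on (strip T) (\<lambda>(t, x). M t x)" by (rule continuous_on_subset[OF M_cont]) auto
  then have "open (strip T \<inter> (\<lambda>(t, x). M t x) -` {0<..})"
    by (rule continuous_open_preimage) (auto intro: open_Times)
  also have "strip T \<inter> (\<lambda>(t, x). M t x) -` {0<..} = Pos" by (auto simp: Pos_def)
  finally show ?thesis .
qed

lemma C2: "Ck_on (Suc (Suc 0)) Pos U" "Ck_on (Suc (Suc 0)) Pos M"
  using smooth_U smooth_M by (auto simp: Cinf_on_def Pos_def)

lemma C1: "Ck_on (Suc 0) Pos (dt M)" "Ck_on (Suc 0) Pos (dx M)" "Ck_on (Suc 0) Pos (dt U)" "Ck_on (Suc 0) Pos (dx U)"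
  using C2 by (simp_all only: Ck_on.simps(2)[of "Suc 0"])

lemma Pos_N: "(t, x) \<in> Pos \<Longrightarrow> \<bar>x\<bar> < N"
  using M_support[of t x] by (force simp: Pos_iff)

lemma grads:
  assumes "(t, x) \<in> Pos"
  shows "has_grad M (dt M t x) (dx M t x) t x"
    "has_grad (dt M) (dt (dt M) t x) (dx (dt M) t x) t x"
    "has_grad (dx M) (dt (dx M) t x) (dx (dx M) t x) t x"
    "has_grad (dx U) (dt (dx U) t x) (dx (dx U) t x) t x"
    "has_grad (dt U) (dt (dt U) t x) (dx (dt U) t x) t x"
proof -
  note g = Ck_on_Suc_has_grad[OF Pos_open _ assms]
  show "has_grad M (dt M t x) (dx M t x) t x" by (rule g[OF C2(2)])
  show "has_grad (dt M) (dt (dt M) t x) (dx (dt M) t x) t x" by (rule g[OF C1(1)])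
  show "has_grad (dx M) (dt (dx M) t x) (dx (dx M) t x) t x" by (rule g[OF C1(2)])
  show "has_grad (dx U) (dt (dx U) t x) (dx (dx U) t x) t x" by (rule g[OF C1(4)])
  show "has_grad (dt U) (dt (dt U) t x) (dx (dt U) t x) t x" by (rule g[OF C1(3)])
qed

lemma conts:
  "continuous_on Pos (\<lambda>p. M (fst p) (snd p))"
  "continuous_on Pos (\<lambda>p. dt M (fst p) (snd p))" "continuous_on Pos (\<lambda>p. dx M (fst p) (snd p))"
  "continuous_on Pos (\<lambda>p. dx U (fst p) (snd p))"
  "continuous_on Pos (\<lambda>p. dt (dt M) (fst p) (snd p))" "continuous_on Pos (\<lambda>p. dx (dt M) (fst p) (snd p))"
  "continuous_on Pos (\<lambda>p. dt (dx M) (fst p) (snd p))" "continuous_on Pos (\<lambda>p. dx (dx M) (fst p) (snd p))"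
  "continuous_on Pos (\<lambda>p. dt (dx U) (fst p) (snd p))" "continuous_on Pos (\<lambda>p. dx (dx U) (fst p) (snd p))"
  "continuous_on Pos (\<lambda>p. dx (dt U) (fst p) (snd p))"
proof -
  have C0: "Ck_on 0 Pos (dt (dt M))" "Ck_on 0 Pos (dx (dt M))" "Ck_on 0 Pos (dt (dx M))" "Ck_on 0 Pos (dx (dx M))"
    "Ck_on 0 Pos (dx (dt U))" "Ck_on 0 Pos (dt (dx U))" "Ck_on 0 Pos (dx (dx U))"
    using C1 by (simp_all only: Ck_on.simps(2)[of 0])
  note c = Ck_on_continuous[unfolded case_prod_unfold]
  show "continuous_on Pos (\<lambda>p. M (fst p) (snd p))" by (rule c[OF C2(2)])
  show "continuous_on Pos (\<lambda>p. dt M (fst p) (snd p))" by (rule c[OF C1(1)])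
  show "continuous_on Pos (\<lambda>p. dx M (fst p) (snd p))" by (rule c[OF C1(2)])
  show "continuous_on Pos (\<lambda>p. dx U (fst p) (snd p))" by (rule c[OF C1(4)])
  show "continuous_on Pos (\<lambda>p. dt (dt M) (fst p) (snd p))" by (rule c[OF C0(1)])
  show "continuous_on Pos (\<lambda>p. dx (dt M) (fst p) (snd p))" by (rule c[OF C0(2)])
  show "continuous_on Pos (\<lambda>p. dt (dx M) (fst p) (snd p))" by (rule c[OF C0(3)])
  show "continuous_on Pos (\<lambda>p. dx (dx M) (fst p) (snd p))" by (rule c[OF C0(4)])
  show "continuous_on Pos (\<lambda>p. dt (dx U) (fst p) (snd p))" by (rule c[OF C0(6)])
  show "continuous_on Pos (\<lambda>p. dx (dx U) (fst p) (snd p))" by (rule c[OF C0(7)])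
  show "continuous_on Pos (\<lambda>p. dx (dt U) (fst p) (snd p))" by (rule c[OF C0(5)])
qed

text \<open>The continuity equation is given only in integrated form. Its classical version is the
  symmetry of the mixed derivatives of \<open>F\<close>, whose gradient is (M dx U, M).\<close>

lemma mixed:
  assumes "(t, x) \<in> Pos"
  shows "dx (dt M) t x = dt (dx M) t x" "dx (dt U) t x = dt (dx U) t x"
    "dx M t x * dx U t x + M t x * dx (dx U) t x = dt M t x"
proof -
  show "dx (dt M) t x = dt (dx M) t x"
  proof (rule mixed_partials_eq[OF Pos_open assms, where f = M and a = "dt M" and b = "dx M" and c = "dx (dt M)" and d = "dt (dx M)"])
    fix s y assume P: "(s, y) \<in> Pos"
    show "((\<lambda>s. M s y) has_real_derivative dt M s y) (at s)" by (rule has_grad_fst[OF grads(1)[OF P]])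
    show "(M s has_real_derivative dx M s y) (at y)" by (rule has_grad_snd[OF grads(1)[OF P]])
    show "(dt M s has_real_derivative dx (dt M) s y) (at y)" by (rule has_grad_snd[OF grads(2)[OF P]])
    show "((\<lambda>s. dx M s y) has_real_derivative dt (dx M) s y) (at s)" by (rule has_grad_fst[OF grads(3)[OF P]])
  qed (unfold case_prod_unfold, rule conts, rule conts)
  have gU: "has_grad U (dt U s y) (dx U s y) s y" if "(s, y) \<in> Pos" for s y
    using U_has_grad[of s y] that by (simp add: Pos_iff)
  show "dx (dt U) t x = dt (dx U) t x"
  proof (rule mixed_partials_eq[OF Pos_open assms, where f = U and a = "dt U" and b = "dx U" and c = "dx (dt U)" and d = "dt (dx U)"])
    fix s y assume P: "(s, y) \<in> Pos"
    show "((\<lambda>s. U s y) has_real_derivative dt U s y) (at s)" by (rule has_grad_fst[OF gU[OF P]])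
    show "(U s has_real_derivative dx U s y) (at y)" by (rule has_grad_snd[OF gU[OF P]])
    show "(dt U s has_real_derivative dx (dt U) s y) (at y)" by (rule has_grad_snd[OF grads(5)[OF P]])
    show "((\<lambda>s. dx U s y) has_real_derivative dt (dx U) s y) (at s)" by (rule has_grad_fst[OF grads(4)[OF P]])
  qed (unfold case_prod_unfold, rule conts, rule conts)
  have gF: "has_grad F (M s y * dx U s y) (M s y) s y" if "(s, y) \<in> Pos" for s y
    using F_has_grad[of s y] that Pos_N[OF that] by (auto simp: Pos_iff)
  have gMp: "has_grad (\<lambda>t x. M t x * dx U t x) (dt M s y * dx U s y + M s y * dt (dx U) s y) (dx M s y * dx U s y + M s y * dx (dx U) s y) s y"
    if "(s, y) \<in> Pos" for s y by (intro has_grad_mult grads that)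
  show "dx M t x * dx U t x + M t x * dx (dx U) t x = dt M t x"
  proof (rule mixed_partials_eq[OF Pos_open assms, where f = F and a = "\<lambda>t x. M t x * dx U t x" and b = M])
    show "continuous_on Pos (\<lambda>(s, y). dx M s y * dx U s y + M s y * dx (dx U) s y)"
      unfolding case_prod_unfold by (intro continuous_intros conts)
    show "continuous_on Pos (\<lambda>(s, y). dt M s y)" using conts(2) by (simp add: case_prod_unfold)
  qed (use gF gMp grads(1) has_grad_fst has_grad_snd in blast)+
qed

text \<open>\<open>Lt\<close> to \<open>Lxx\<close> are the first and second derivatives of ln M in
  closed form; one \<open>Ltx\<close> serves both orders by \<open>mixed\<close>.\<close>

definition Lt where "Lt t x = dt M t x * inverse (M t x)"
definition Lx where "Lx t x = dx M t x * inverse (M t x)"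
definition Ltt where "Ltt t x = dt (dt M) t x * inverse (M t x) - (Lt t x)\<^sup>2"
definition Ltx where "Ltx t x = dt (dx M) t x * inverse (M t x) - Lt t x * Lx t x"
definition Lxx where "Lxx t x = dx (dx M) t x * inverse (M t x) - (Lx t x)\<^sup>2"

lemma L_grads:
  assumes P: "(t, x) \<in> Pos"
  shows "has_grad (\<lambda>t x. ln (M t x)) (Lt t x) (Lx t x) t x"
    "has_grad Lt (Ltt t x) (Ltx t x) t x" "has_grad Lx (Ltx t x) (Lxx t x) t x"
    "has_grad (\<lambda>t x. M t x powr \<theta>) (\<theta> * M t x powr \<theta> * Lt t x) (\<theta> * M t x powr \<theta> * Lx t x) t x"
proof -
  have m: "0 < M t x" using P by (simp add: Pos_iff)
  have "(ln has_real_derivative inverse (M t x)) (at (M t x))" by (rule DERIV_ln[OF m])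
  from has_grad_chain[OF this grads(1)[OF P]]
  show "has_grad (\<lambda>t x. ln (M t x)) (Lt t x) (Lx t x) t x" by (simp add: Lt_def Lx_def mult.commute)
  have "(inverse has_real_derivative - (inverse (M t x) ^ Suc (Suc 0))) (at (M t x))"
    by (rule DERIV_inverse) (use m in simp)
  note gi = has_grad_chain[OF this grads(1)[OF P]]
  from has_grad_mult[OF grads(2)[OF P] gi]
  show "has_grad Lt (Ltt t x) (Ltx t x) t x"
    unfolding Lt_def[abs_def] by (rule has_grad_cong) (simp_all add: Ltt_def Ltx_def Lt_def Lx_def mixed[OF P] power2_eq_square)
  from has_grad_mult[OF grads(3)[OF P] gi]
  show "has_grad Lx (Ltx t x) (Lxx t x) t x"
    unfolding Lx_def[abs_def] by (rule has_grad_cong) (simp_all add: Lxx_def Ltx_def Lt_def Lx_def power2_eq_square)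
  have "((\<lambda>z. z powr \<theta>) has_real_derivative \<theta> * M t x powr (\<theta> - 1)) (at (M t x))"
    by (rule has_real_derivative_powr[OF m])
  from has_grad_chain[OF this grads(1)[OF P]]
  show "has_grad (\<lambda>t x. M t x powr \<theta>) (\<theta> * M t x powr \<theta> * Lt t x) (\<theta> * M t x powr \<theta> * Lx t x) t x"
    by (rule has_grad_cong) (use m in \<open>simp_all add: Lt_def Lx_def powr_diff field_simps\<close>)
qed

text \<open>The first line is the continuity equation and the second the space derivative of the
  Hamilton-Jacobi equation. Both derivatives of \<open>dx U\<close> are thereby expressed by
  \<open>dx U\<close> itself and the density.\<close>

lemma p_grad:
  assumes P: "(t, x) \<in> Pos"
  shows "dx (dx U) t x = Lt t x - dx U t x * Lx t x"
    "dt (dx U) t x = dx U t x * Lt t x - (dx U t x)\<^sup>2 * Lx t x - \<theta> * M t x powr \<theta> * Lx t x"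
proof -
  have m: "0 < M t x" "t \<in> {0<..<T}" using P by (auto simp: Pos_iff)
  show 1: "dx (dx U) t x = Lt t x - dx U t x * Lx t x"
    using mixed(3)[OF P] m by (simp add: Lt_def Lx_def field_simps)
  have eq: "dt U t y = 1/2 * (dx U t y * dx U t y) - M t y powr \<theta>" for y
    using HJ[OF m(2), of y] by (simp add: power2_eq_square)
  have half: "has_grad (\<lambda>t x. 1/2 * (dx U t x * dx U t x)) (0 * (dx U t x * dx U t x) + 1/2 * (dt (dx U) t x * dx U t x + dx U t x * dt (dx U) t x))
     (0 * (dx U t x * dx U t x) + 1/2 * (dx (dx U) t x * dx U t x + dx U t x * dx (dx U) t x)) t x"
    by (intro has_grad_mult grads[OF P] has_grad_time DERIV_const)
  have "((\<lambda>y. 1/2 * (dx U t y * dx U t y) - M t y powr \<theta>) has_real_derivative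
      (0 * (dx U t x * dx U t x) + 1/2 * (dx (dx U) t x * dx U t x + dx U t x * dx (dx U) t x)) - \<theta> * M t x powr \<theta> * Lx t x) (at x)"
    by (rule has_grad_snd[OF has_grad_diff[OF half L_grads(4)[OF P]]])
  then have "(dt U t has_real_derivative dx U t x * dx (dx U) t x - \<theta> * M t x powr \<theta> * Lx t x) (at x)"
    unfolding eq[symmetric, abs_def] by (simp add: mult.commute)
  then have "dx (dt U) t x = dx U t x * dx (dx U) t x - \<theta> * M t x powr \<theta> * Lx t x"
    by (rule DERIV_imp_deriv)
  then show "dt (dx U) t x = dx U t x * Lt t x - (dx U t x)\<^sup>2 * Lx t x - \<theta> * M t x powr \<theta> * Lx t x"
    unfolding mixed(2)[OF P] 1 by (simp add: power2_eq_square algebra_simps)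
qed

text \<open>With \<open>p_grad\<close>, the symmetry of the mixed derivatives of \<open>dx U\<close>
  becomes an equation for ln M. The derivatives of \<open>dx U\<close> are differentiated through
  the formulas of \<open>p_grad\<close>, so second derivatives of \<open>U\<close> and
  \<open>M\<close> suffice.\<close>

lemma log_density_equation:
  assumes P: "(t, x) \<in> Pos"
  shows "Ltt t x - 2 * dx U t x * Ltx t x + (dx U t x)\<^sup>2 * Lxx t x + \<theta> * M t x powr \<theta> * Lxx t x
      = (dx U t x * Lt t x - (dx U t x)\<^sup>2 * Lx t x - \<theta> * M t x powr \<theta> * Lx t x) * Lx t x + (Lt t x - dx U t x * Lx t x) * Lt t x
        - 2 * dx U t x * (Lt t x - dx U t x * Lx t x) * Lx t x - \<theta>\<^sup>2 * M t x powr \<theta> * (Lx t x)\<^sup>2"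
proof -
  define p pt px E where "p = dx U" and "pt = dt (dx U)" and "px = dx (dx U)" and "E = (\<lambda>t x. M t x powr \<theta>)"
  have gp: "has_grad p (pt s y) (px s y) s y" if "(s, y) \<in> Pos" for s y
    unfolding p_def pt_def px_def by (rule grads(4)[OF that])
  have gE: "has_grad E (\<theta> * E s y * Lt s y) (\<theta> * E s y * Lx s y) s y" if "(s, y) \<in> Pos" for s y
    unfolding E_def by (rule L_grads(4)[OF that])
  define P1 P2 where "P1 = (\<lambda>t x. Lt t x - p t x * Lx t x)"
    and "P2 = (\<lambda>t x. p t x * Lt t x - p t x * p t x * Lx t x - \<theta> * E t x * Lx t x)"
  have P12: "px s y = P1 s y" "pt s y = P2 s y" if "(s, y) \<in> Pos" for s y
    using p_grad[OF that] by (simp_all add: px_def pt_def P1_def P2_def p_def E_def power2_eq_square)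
  define c where "c = (\<lambda>t x. (px t x * Lt t x + p t x * Ltx t x) - ((px t x * p t x + p t x * px t x) * Lx t x + p t x * p t x * Lxx t x)
      - ((0 * E t x + \<theta> * (\<theta> * E t x * Lx t x)) * Lx t x + \<theta> * E t x * Lxx t x))"
  define d where "d = (\<lambda>t x. Ltt t x - (pt t x * Lx t x + p t x * Ltx t x))"
  have g1: "has_grad P1 (d s y) (Ltx s y - (px s y * Lx s y + p s y * Lxx s y)) s y" if "(s, y) \<in> Pos" for s y
    unfolding P1_def d_def by (intro has_grad_diff has_grad_mult L_grads gp that)
  have g2: "has_grad P2 ((pt s y * Lt s y + p s y * Ltt s y) - ((pt s y * p s y + p s y * pt s y) * Lx s y + p s y * p s y * Ltx s y)
      - ((0 * E s y + \<theta> * (\<theta> * E s y * Lt s y)) * Lx s y + \<theta> * E s y * Ltx s y)) (c s y) s y" if "(s, y) \<in> Pos" for s y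
    unfolding P2_def c_def by (intro has_grad_diff has_grad_mult L_grads gp gE that has_grad_time DERIV_const)
  have Ec: "continuous_on Pos (\<lambda>p. E (fst p) (snd p))"
    unfolding E_def by (intro continuous_on_powr_nonneg conts) (use th in \<open>auto simp: Pos_def\<close>)
  have inv: "continuous_on Pos (\<lambda>p. inverse (M (fst p) (snd p)))"
    by (intro continuous_on_inverse conts) (auto simp: Pos_def)
  have Lc: "continuous_on Pos (\<lambda>p. Lt (fst p) (snd p))" "continuous_on Pos (\<lambda>p. Lx (fst p) (snd p))"
    unfolding Lt_def Lx_def by (intro continuous_on_mult conts inv)+
  have Lc2: "continuous_on Pos (\<lambda>p. Ltt (fst p) (snd p))" "continuous_on Pos (\<lambda>p. Ltx (fst p) (snd p))" "continuous_on Pos (\<lambda>p. Lxx (fst p) (snd p))"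
    unfolding Ltt_def Ltx_def Lxx_def by (intro continuous_on_diff continuous_on_mult continuous_on_power conts inv Lc)+
  have pc: "continuous_on Pos (\<lambda>q. p (fst q) (snd q))" "continuous_on Pos (\<lambda>q. pt (fst q) (snd q))" "continuous_on Pos (\<lambda>q. px (fst q) (snd q))"
    unfolding p_def pt_def px_def by (intro conts)+
  have "c t x = d t x"
  proof (rule mixed_partials_eq[OF Pos_open P, where f = p and a = P2 and b = P1])
    show "((\<lambda>s. p s y) has_real_derivative P2 s y) (at s)" "(p s has_real_derivative P1 s y) (at y)" if "(s, y) \<in> Pos" for s y
      using has_grad_fst[OF gp[OF that]] has_grad_snd[OF gp[OF that]] P12[OF that] by simp_all
    show "(P2 s has_real_derivative c s y) (at y)" if "(s, y) \<in> Pos" for s y by (rule has_grad_snd[OF g2[OF that]])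
    show "((\<lambda>s. P1 s y) has_real_derivative d s y) (at s)" if "(s, y) \<in> Pos" for s y by (rule has_grad_fst[OF g1[OF that]])
    show "continuous_on Pos (\<lambda>(s, y). c s y)" "continuous_on Pos (\<lambda>(s, y). d s y)"
      unfolding c_def d_def case_prod_unfold
      by (intro continuous_on_diff continuous_on_add continuous_on_mult continuous_on_const Lc Lc2 pc Ec)+
  qed
  then have eq: "d t x = c t x" by simp
  have pe: "dx U t x = p t x" by (simp add: p_def)
  show ?thesis
    using eq unfolding c_def d_def P12[OF P] P1_def P2_def pe
    by (simp add: power2_eq_square algebra_simps E_def)
qed

text \<open>The term \<alpha> ln \<tau> compensates the expected decay \<tau>^(-\<alpha>) of the
  density. The term k x^2 \<tau>^(-2 \<alpha>) is convex in x and supplies the positive second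
  derivative against which M^\<theta> is bounded.\<close>

lemma interior_maximum:
  assumes P: "(t0, x0) \<in> Pos" and k: "0 < k" "4 * (1 + \<theta>) * (k * (x0\<^sup>2 * (t0 + \<epsilon>) powr (-2 * \<alpha>))) \<le> 1"
    and max: "\<And>t x. (t, x) \<in> Pos \<Longrightarrow> ln (M t x) + (\<alpha> * ln (t + \<epsilon>) + k * (x\<^sup>2 * (t + \<epsilon>) powr (-2 * \<alpha>)))
        \<le> ln (M t0 x0) + (\<alpha> * ln (t0 + \<epsilon>) + k * (x0\<^sup>2 * (t0 + \<epsilon>) powr (-2 * \<alpha>)))"
  shows "\<theta> * M t0 x0 powr \<theta> * k * (t0 + \<epsilon>) powr (-2 * \<alpha>) * (t0 + \<epsilon>)\<^sup>2 \<le> 3"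
proof -
  define p where "p = dx U t0 x0"
  define K2 where "K2 = (\<lambda>t. (t + \<epsilon>) powr (-2 * \<alpha>))"
  define ht where "ht = (\<lambda>t x. \<alpha> / (t + \<epsilon>) + k * (x\<^sup>2 * (- 2 * \<alpha> * K2 t / (t + \<epsilon>))))"
  define hx where "hx = (\<lambda>t x. k * (2 * x * K2 t))"
  define htt where "htt = (\<lambda>t x. - \<alpha> / (t + \<epsilon>)\<^sup>2 + 2 * \<alpha> * (2 * \<alpha> + 1) * k * x\<^sup>2 * K2 t / (t + \<epsilon>)\<^sup>2)"
  define htx where "htx = (\<lambda>t x. - 4 * \<alpha> * k * x * K2 t / (t + \<epsilon>))"
  define hxx where "hxx = (\<lambda>t. 2 * k * K2 t)"
  have K2d: "(K2 has_real_derivative - 2 * \<alpha> * K2 t / (t + \<epsilon>)) (at t)" if "0 < t" for t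
    unfolding K2_def using that eps
    by (auto intro!: derivative_eq_intros simp: powr_diff)
  have K2d2: "((\<lambda>t. - 2 * \<alpha> * K2 t / (t + \<epsilon>)) has_real_derivative 2 * \<alpha> * (2 * \<alpha> + 1) * K2 t / (t + \<epsilon>)\<^sup>2) (at t)" if "0 < t" for t
  proof -
    have q: "t + \<epsilon> \<noteq> 0" using that eps by simp
    have "((\<lambda>t. - 2 * \<alpha> * K2 t / (t + \<epsilon>)) has_real_derivative
       (- 2 * \<alpha> * (- 2 * \<alpha> * K2 t / (t + \<epsilon>)) * (t + \<epsilon>) - - 2 * \<alpha> * K2 t * (1 + 0)) / ((t + \<epsilon>) * (t + \<epsilon>))) (at t)"
      by (intro DERIV_divide DERIV_cmult K2d that DERIV_add DERIV_ident DERIV_const q)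
    moreover have "- 2 * \<alpha> * (- 2 * \<alpha> * K2 t / (t + \<epsilon>)) * (t + \<epsilon>) = 4 * \<alpha> * \<alpha> * K2 t"
      using q by simp
    ultimately show ?thesis by (simp add: power2_eq_square algebra_simps)
  qed
  have hg: "has_grad (\<lambda>t x. \<alpha> * ln (t + \<epsilon>) + k * (x\<^sup>2 * K2 t)) (ht t x) (hx t x) t x" if "0 < t" for t x
  proof -
    have "((\<lambda>t. \<alpha> * ln (t + \<epsilon>)) has_real_derivative \<alpha> / (t + \<epsilon>)) (at t)"
      using that eps by (auto intro!: derivative_eq_intros)
    from has_grad_add[OF has_grad_time[OF this] has_grad_mult[OF has_grad_time[OF DERIV_const[of k]] has_grad_mult[OF has_grad_minus_x2 has_grad_time[OF K2d[OF that]]]]]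
    show ?thesis by (rule has_grad_cong) (simp_all add: ht_def hx_def)
  qed
  have htg: "has_grad ht (htt t x) (htx t x) t x" if "0 < t" for t x
  proof -
    have "((\<lambda>t. \<alpha> / (t + \<epsilon>)) has_real_derivative - \<alpha> / (t + \<epsilon>)\<^sup>2) (at t)"
      using that eps by (auto intro!: derivative_eq_intros simp: power2_eq_square)
    from has_grad_add[OF has_grad_time[OF this] has_grad_mult[OF has_grad_time[OF DERIV_const[of k]] has_grad_mult[OF has_grad_minus_x2 has_grad_time[OF K2d2[OF that]]]]]
    show ?thesis unfolding ht_def by (rule has_grad_cong) (simp_all add: htt_def htx_def algebra_simps)
  qed
  have hxg: "has_grad hx (htx t x) (hxx t) t x" if "0 < t" for t x
    using has_grad_mult[OF has_grad_time[OF DERIV_const[of k]] has_grad_mult[OF has_grad_mult[OF has_grad_time[OF DERIV_const[of 2]] has_grad_space] has_grad_time[OF K2d[OF that]]]]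
    unfolding hx_def by (rule has_grad_cong) (simp_all add: hxx_def htx_def)
  define W where "W = (\<lambda>t x. ln (M t x) + (\<alpha> * ln (t + \<epsilon>) + k * (x\<^sup>2 * K2 t)))"
  have tp: "0 < t" if "(t, x) \<in> Pos" for t x using that by (simp add: Pos_iff)
  have Wg: "has_grad W (Lt t x + ht t x) (Lx t x + hx t x) t x" if "(t, x) \<in> Pos" for t x
    unfolding W_def by (intro has_grad_add L_grads(1) that hg tp[OF that])
  have Wtg: "has_grad (\<lambda>t x. Lt t x + ht t x) (Ltt t x + htt t x) (Ltx t x + htx t x) t x" if "(t, x) \<in> Pos" for t x
    by (intro has_grad_add L_grads(2) that htg tp[OF that])
  have Wxg: "has_grad (\<lambda>t x. Lx t x + hx t x) (Ltx t x + htx t x) (Lxx t x + hxx t) t x" if "(t, x) \<in> Pos" for t x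
    by (intro has_grad_add L_grads(3) that hxg tp[OF that])
  have Wmax: "W t x \<le> W t0 x0" if "(t, x) \<in> Pos" for t x
    using max[OF that] by (simp add: W_def K2_def)
  have line: "\<exists>r>0. \<forall>s. \<bar>s\<bar> < r \<longrightarrow> (t0 + a * s, x0 + b * s) \<in> Pos" for a b
  proof -
    have "isCont (\<lambda>s. (t0 + a * s, x0 + b * s)) 0" by (intro continuous_intros)
    then have "((\<lambda>s. (t0 + a * s, x0 + b * s)) \<longlongrightarrow> (t0, x0)) (at 0)" by (simp add: isCont_def)
    then have "\<forall>\<^sub>F s in at 0. (t0 + a * s, x0 + b * s) \<in> Pos" using Pos_open P by (rule topological_tendstoD)
    then obtain r where r: "r > 0" "\<And>s. s \<noteq> 0 \<Longrightarrow> dist s 0 < r \<Longrightarrow> (t0 + a * s, x0 + b * s) \<in> Pos"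
      unfolding eventually_at by auto
    show ?thesis
    proof (intro exI[of _ r] conjI allI impI r(1))
      fix s assume "\<bar>s\<bar> < r"
      then show "(t0 + a * s, x0 + b * s) \<in> Pos" using r(2)[of s] P by (cases "s = 0") auto
    qed
  qed
  \<comment> \<open>First and second derivative tests along the line through the maximum in
    direction (a, b). The directions used are the two axes and the flow direction (1, - dx
    U).\<close>
  have test: "a * (Lt t0 x0 + ht t0 x0) + b * (Lx t0 x0 + hx t0 x0) = 0 \<and>
      a * ((Ltt t0 x0 + htt t0 x0) * a + (Ltx t0 x0 + htx t0 x0) * b) + b * ((Ltx t0 x0 + htx t0 x0) * a + (Lxx t0 x0 + hxx t0) * b) \<le> 0" for a b
  proof -
    obtain r where r: "r > 0" "\<And>s. \<bar>s\<bar> < r \<Longrightarrow> (t0 + a * s, x0 + b * s) \<in> Pos" using line by blast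
    define \<phi> where "\<phi> = (\<lambda>s. W (t0 + a * s) (x0 + b * s))"
    define \<phi>' where "\<phi>' = (\<lambda>s. a * (Lt (t0 + a * s) (x0 + b * s) + ht (t0 + a * s) (x0 + b * s)) + b * (Lx (t0 + a * s) (x0 + b * s) + hx (t0 + a * s) (x0 + b * s)))"
    have lin: "((\<lambda>s. t0 + a * s) has_real_derivative a) (at s)" "((\<lambda>s. x0 + b * s) has_real_derivative b) (at s)" for s
      by (auto intro!: derivative_eq_intros)
    have d: "(\<phi> has_real_derivative \<phi>' s) (at s)" if "\<bar>s\<bar> < r" for s
      using has_grad_curve[OF Wg[OF r(2)[OF that]] lin] unfolding \<phi>_def \<phi>'_def by (simp add: mult.commute)
    have z: "\<bar>0\<bar> < r" using r(1) by simp
    have D: "(\<phi>' has_real_derivative (a * ((Ltt t0 x0 + htt t0 x0) * a + (Ltx t0 x0 + htx t0 x0) * b) + b * ((Ltx t0 x0 + htx t0 x0) * a + (Lxx t0 x0 + hxx t0) * b))) (at 0)"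
    proof -
      have P0: "(t0 + a * 0, x0 + b * 0) \<in> Pos" using P by simp
      have "(\<phi>' has_real_derivative a * ((Ltt (t0 + a * 0) (x0 + b * 0) + htt (t0 + a * 0) (x0 + b * 0)) * a + (Ltx (t0 + a * 0) (x0 + b * 0) + htx (t0 + a * 0) (x0 + b * 0)) * b)
         + b * ((Ltx (t0 + a * 0) (x0 + b * 0) + htx (t0 + a * 0) (x0 + b * 0)) * a + (Lxx (t0 + a * 0) (x0 + b * 0) + hxx (t0 + a * 0)) * b)) (at 0)"
        unfolding \<phi>'_def
        by (intro DERIV_add DERIV_cmult has_grad_curve[OF Wtg[OF P0] lin] has_grad_curve[OF Wxg[OF P0] lin])
      then show ?thesis by simp
    qed
    have m: "\<phi> s \<le> \<phi> 0" if "\<bar>s\<bar> < r" for s using Wmax[OF r(2)[OF that]] by (simp add: \<phi>_def)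
    show ?thesis
      using second_derivative_at_max[OF r(1) m d D] by (simp add: \<phi>'_def)
  qed
  have Lx0: "Lx t0 x0 = - hx t0 x0" and Lt0: "Lt t0 x0 = - ht t0 x0"
    using test[of 0 1] test[of 1 0] by auto
  have "\<theta> * M t0 x0 powr \<theta> * (hxx t0 - (1 + \<theta>) * (hx t0 x0)\<^sup>2) \<le> - htt t0 x0 + 2 * p * htx t0 x0 - p\<^sup>2 * hxx t0"
    unfolding p_def
  proof (rule maximum_principle_algebra[OF log_density_equation[OF P] Lt0 Lx0 _ th])
    show "Ltt t0 x0 + htt t0 x0 - 2 * dx U t0 x0 * (Ltx t0 x0 + htx t0 x0) + (dx U t0 x0)\<^sup>2 * (Lxx t0 x0 + hxx t0) \<le> 0"
      using test[of 1 "- dx U t0 x0"] by (simp add: power2_eq_square algebra_simps)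
    show "Lxx t0 x0 + hxx t0 \<le> 0" using test[of 0 1] by simp
  qed simp
  then have "\<theta> * M t0 x0 powr \<theta> * (2 * k * K2 t0 - (1 + \<theta>) * (2 * k * x0 * K2 t0)\<^sup>2)
      \<le> - (- \<alpha> / (t0 + \<epsilon>)\<^sup>2 + 2 * \<alpha> * (2 * \<alpha> + 1) * k * x0\<^sup>2 * K2 t0 / (t0 + \<epsilon>)\<^sup>2) + 2 * p * (- 4 * \<alpha> * k * x0 * K2 t0 / (t0 + \<epsilon>)) - p\<^sup>2 * (2 * k * K2 t0)"
    by (simp add: hxx_def hx_def htt_def htx_def mult_ac)
  moreover have "0 < K2 t0" "0 < t0 + \<epsilon>" using tp[OF P] eps by (auto simp: K2_def)
  ultimately have "\<theta> * M t0 x0 powr \<theta> * k * K2 t0 * (t0 + \<epsilon>)\<^sup>2 \<le> 3"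
    by (intro barrier_algebra[of "t0 + \<epsilon>" "K2 t0" \<alpha> \<theta> "M t0 x0 powr \<theta>" k x0 p]) (use al th k in \<open>auto simp: K2_def\<close>)
  then show ?thesis by (simp add: K2_def)
qed

end

section \<open>Weak-star convergence\<close>

lemma infdist_Icc_Lipschitz: "\<bar>infdist x A - infdist y A\<bar> \<le> \<bar>x - y\<bar>" for x y :: real
  using infdist_triangle[of x A y] infdist_triangle[of y A x] by (auto simp: dist_real_def abs_le_iff abs_minus_commute)

lemma far_from_Icc: "a \<le> b \<Longrightarrow> x \<notin> {a-1..b+1} \<Longrightarrow> 1 \<le> infdist x {a..b::real}"
proof -
  assume h: "a \<le> b" "x \<notin> {a-1..b+1}"
  have ne: "{a..b} \<noteq> {}" using h by simp
  have "1 \<le> (INF y\<in>{a..b}. dist x y)"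
  proof (rule cINF_greatest[OF ne])
    fix y assume "y \<in> {a..b}"
    then show "1 \<le> dist x y" using h unfolding dist_real_def by auto
  qed
  then show ?thesis using ne by (simp add: infdist_notempty)
qed

text \<open>Bounded functions: convergence against Lipschitz functions of bounded support extends to
  indicators of intervals, then of bounded Borel sets, then to \<open>L\<^sup>1\<close>, each time by \<open>L\<^sup>1\<close>-limits.\<close>

lemma weak_star_tendstoI:
  fixes f :: "'i \<Rightarrow> real \<Rightarrow> real" and g :: "real \<Rightarrow> real" and F :: "'i filter"
  assumes f: "\<forall>\<^sub>F i in F. f i \<in> borel_measurable lborel \<and> (\<forall>x. \<bar>f i x\<bar> \<le> K)"
    and g: "g \<in> borel_measurable lborel" "\<And>x. \<bar>g x\<bar> \<le> K"
    and test: "\<And>h G r. (\<And>x y. \<bar>h x - h y\<bar> \<le> G * \<bar>x - y\<bar>) \<Longrightarrow> (\<And>x. r < \<bar>x\<bar> \<Longrightarrow> h x = 0) \<Longrightarrow>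
       ((\<lambda>i. LINT x|lborel. f i x * h x) \<longlongrightarrow> (LINT x|lborel. g x * h x)) F"
  shows "weak_star_tendsto f g F"
proof -
  have K: "0 \<le> K" using g(2)[of 0] by simp
  \<comment> \<open>The integrable test functions for which convergence holds. They form a linear
    space closed under L^1 limits, the latter because \<open>f i\<close> and \<open>g\<close> share
    the bound K.\<close>
  define good where "good h \<longleftrightarrow> integrable lborel h \<and>
     ((\<lambda>i. LINT x|lborel. f i x * h x) \<longlongrightarrow> (LINT x|lborel. g x * h x)) F" for h :: "real \<Rightarrow> real"
  have ii: "integrable lborel (\<lambda>x. k x * h x)" and ib: "\<bar>LINT x|lborel. k x * h x\<bar> \<le> K * (LINT x|lborel. \<bar>h x\<bar>)"
    if "k \<in> borel_measurable lborel" "\<And>x. \<bar>k x\<bar> \<le> K" "integrable lborel h" for k h :: "real \<Rightarrow> real"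
  proof -
    have b: "integrable lborel (\<lambda>x. K * \<bar>h x\<bar>)" using that(3) by auto
    show i: "integrable lborel (\<lambda>x. k x * h x)"
      by (rule Bochner_Integration.integrable_bound[OF b])
        (use that K in \<open>auto simp: abs_mult intro!: mult_right_mono borel_measurable_times AE_I2\<close>)
    have "\<bar>LINT x|lborel. k x * h x\<bar> \<le> (LINT x|lborel. \<bar>k x * h x\<bar>)" by (rule integral_abs_bound)
    also have "\<dots> \<le> (LINT x|lborel. K * \<bar>h x\<bar>)"
      by (rule integral_mono[OF integrable_abs[OF i] b]) (use that(2) in \<open>auto simp: abs_mult intro!: mult_right_mono\<close>)
    finally show "\<bar>LINT x|lborel. k x * h x\<bar> \<le> K * (LINT x|lborel. \<bar>h x\<bar>)" by simp
  qed
  have good_add: "good (\<lambda>x. h1 x + h2 x)" if "good h1" "good h2" for h1 h2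
  proof -
    have int: "integrable lborel h1" "integrable lborel h2" using that by (auto simp: good_def)
    have "((\<lambda>i. (LINT x|lborel. f i x * h1 x) + (LINT x|lborel. f i x * h2 x)) \<longlongrightarrow> (LINT x|lborel. g x * h1 x) + (LINT x|lborel. g x * h2 x)) F"
      using that by (auto simp: good_def intro!: tendsto_add)
    moreover have "\<forall>\<^sub>F i in F. (LINT x|lborel. f i x * h1 x) + (LINT x|lborel. f i x * h2 x) = (LINT x|lborel. f i x * (h1 x + h2 x))"
      using f by eventually_elim (simp add: distrib_left ii int)
    ultimately have "((\<lambda>i. LINT x|lborel. f i x * (h1 x + h2 x)) \<longlongrightarrow> (LINT x|lborel. g x * h1 x) + (LINT x|lborel. g x * h2 x)) F"
      by (rule Lim_transform_eventually)
    moreover have "(LINT x|lborel. g x * h1 x) + (LINT x|lborel. g x * h2 x) = (LINT x|lborel. g x * (h1 x + h2 x))"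
      using ii[OF g int(1)] ii[OF g int(2)] by (simp add: distrib_left)
    ultimately show ?thesis using int by (auto simp: good_def)
  qed
  have good_scale: "good (\<lambda>x. h x * c)" if "good h" for h c
    using that by (auto simp: good_def mult.assoc[symmetric] intro!: tendsto_mult_right)
  have good_lim: "good h" if h: "integrable lborel h" and hn: "\<And>n. good (s n)"
    and lim: "(\<lambda>n. LINT x|lborel. \<bar>s n x - h x\<bar>) \<longlonglongrightarrow> 0" for h :: "real \<Rightarrow> real" and s :: "nat \<Rightarrow> real \<Rightarrow> real"
  proof -
    have "((\<lambda>i. LINT x|lborel. f i x * h x) \<longlongrightarrow> (LINT x|lborel. g x * h x)) F"
    proof (rule tendstoI)
      fix e :: real assume e: "0 < e"
      have "\<forall>\<^sub>F n in sequentially. (LINT x|lborel. \<bar>s n x - h x\<bar>) < e / (3 * (K + 1))"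
        using lim by (rule order_tendstoD) (use e K in auto)
      then obtain n where n: "(LINT x|lborel. \<bar>s n x - h x\<bar>) < e / (3 * (K + 1))" by (meson eventually_happens sequentially_bot)
      have sn: "integrable lborel (s n)" using hn[of n] by (simp add: good_def)
      have small: "\<bar>(LINT x|lborel. k x * s n x) - (LINT x|lborel. k x * h x)\<bar> < e / 3"
        if k: "k \<in> borel_measurable lborel" "\<And>x. \<bar>k x\<bar> \<le> K" for k
      proof -
        have "(LINT x|lborel. k x * s n x) - (LINT x|lborel. k x * h x) = (LINT x|lborel. k x * (s n x - h x))"
          using ii[OF k sn] ii[OF k h] by (simp add: right_diff_distrib)
        then have "\<bar>(LINT x|lborel. k x * s n x) - (LINT x|lborel. k x * h x)\<bar> \<le> K * (LINT x|lborel. \<bar>s n x - h x\<bar>)"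
          using ib[OF k, of "\<lambda>x. s n x - h x"] sn h by simp
        also have "\<dots> \<le> (K + 1) * (LINT x|lborel. \<bar>s n x - h x\<bar>)" by (intro mult_right_mono) auto
        also have "\<dots> < e / 3" using n K by (simp add: pos_less_divide_eq field_simps)
        finally show ?thesis .
      qed
      have "\<forall>\<^sub>F i in F. dist (LINT x|lborel. f i x * s n x) (LINT x|lborel. g x * s n x) < e / 3"
        using hn[of n] e unfolding good_def by (intro tendstoD) auto
      with f show "\<forall>\<^sub>F i in F. dist (LINT x|lborel. f i x * h x) (LINT x|lborel. g x * h x) < e"
      proof eventually_elim
        case (elim i)
        have "\<bar>(LINT x|lborel. f i x * s n x) - (LINT x|lborel. f i x * h x)\<bar> < e / 3"
          "\<bar>(LINT x|lborel. g x * s n x) - (LINT x|lborel. g x * h x)\<bar> < e / 3"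
          using elim g by (intro small; simp)+
        with elim show ?case unfolding dist_real_def by linarith
      qed
    qed
    with h show ?thesis by (simp add: good_def)
  qed
  have good_Icc: "good (indicator {a..b})" if ab: "a \<le> b" for a b
  proof -
    \<comment> \<open>Lipschitz cutoffs equal to 1 on the interval and to 0 beyond distance 1 / (n +
      1).\<close>
    define s where "s = (\<lambda>n x. max 0 (1 - real (Suc n) * infdist x {a..b}))"
    have sb: "0 \<le> s n x" "s n x \<le> 1" for n x by (auto simp: s_def infdist_nonneg)
    have s0: "s n x = 0" if "x \<notin> {a-1..b+1}" for n x
    proof -
      have "1 * 1 \<le> real (Suc n) * infdist x {a..b}" using far_from_Icc[OF ab that] by (intro mult_mono) auto
      then show ?thesis by (simp add: s_def)
    qed
    have s1: "s n x = 1" if "x \<in> {a..b}" for n x using that by (simp add: s_def)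
    have sm [measurable]: "s n \<in> borel_measurable lborel" for n
      unfolding s_def by (auto intro!: borel_measurable_continuous_onI continuous_intros)
    have bi: "integrable lborel (indicator {a-1..b+1} :: real \<Rightarrow> real)"
      by (rule integrable_real_indicator) (auto simp: emeasure_lborel_Icc_eq)
    have si: "integrable lborel (s n)" for n
      by (rule Bochner_Integration.integrable_bound[OF bi]) (use sb s0 in \<open>auto simp: indicator_def intro!: AE_I2\<close>)
    have gs: "good (s n)" for n
    proof -
      have "\<bar>s n x - s n y\<bar> \<le> real (Suc n) * \<bar>x - y\<bar>" for x y
      proof -
        have "\<bar>s n x - s n y\<bar> \<le> \<bar>real (Suc n) * (infdist x {a..b} - infdist y {a..b})\<bar>"
          unfolding s_def right_diff_distrib by linarith
        also have "\<dots> \<le> real (Suc n) * \<bar>x - y\<bar>"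
          unfolding abs_mult using infdist_Icc_Lipschitz[of x "{a..b}" y] by (intro mult_mono) auto
        finally show ?thesis .
      qed
      moreover have "s n x = 0" if "\<bar>a\<bar> + \<bar>b\<bar> + 1 < \<bar>x\<bar>" for x using that by (intro s0) auto
      ultimately have "((\<lambda>i. LINT x|lborel. f i x * s n x) \<longlongrightarrow> (LINT x|lborel. g x * s n x)) F" by (rule test)
      then show ?thesis using si by (simp add: good_def)
    qed
    have lm: "(\<lambda>n. LINT x|lborel. \<bar>s n x - indicator {a..b} x\<bar>) \<longlonglongrightarrow> (LINT x|(lborel::real measure). 0)"
    proof (rule integral_dominated_convergence[where w = "indicator {a-1..b+1}"])
      show "AE x in lborel. (\<lambda>n. \<bar>s n x - indicator {a..b} x\<bar>) \<longlonglongrightarrow> 0"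
      proof (rule AE_I2)
        fix x :: real
        show "(\<lambda>n. \<bar>s n x - indicator {a..b} x\<bar>) \<longlonglongrightarrow> 0"
        proof (cases "x \<in> {a..b}")
          case True
          then show ?thesis by (simp add: s1)
        next
          case False
          then have pos: "0 < infdist x {a..b}"
            using infdist_pos_not_in_closed[of "{a..b}" x] ab by auto
          obtain n0 where n0: "1 / infdist x {a..b} < real n0" using reals_Archimedean2 by blast
          have "\<forall>\<^sub>F n in sequentially. \<bar>s n x - indicator {a..b} x\<bar> = 0"
          proof (rule eventually_sequentiallyI[of n0])
            fix n assume "n0 \<le> n"
            then have "1 / infdist x {a..b} < real (Suc n)" using n0 by linarith
            then have "1 < real (Suc n) * infdist x {a..b}" using pos by (simp add: pos_divide_less_eq)
            then show "\<bar>s n x - indicator {a..b} x\<bar> = 0" using False by (simp add: s_def)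
          qed
          then show ?thesis by (rule tendsto_eventually)
        qed
      qed
      show "AE x in lborel. norm \<bar>s n x - indicator {a..b} x\<bar> \<le> indicator {a-1..b+1} x" for n
      proof (rule AE_I2)
        fix x show "norm \<bar>s n x - indicator {a..b} x\<bar> \<le> indicator {a-1..b+1} x"
          using sb[of n x] s0[of x n] s1[of x n] by (cases "x \<in> {a..b}"; cases "x \<in> {a-1..b+1}") auto
      qed
    qed (use bi in auto)
    have "integrable lborel (indicator {a..b} :: real \<Rightarrow> real)"
      by (rule integrable_real_indicator) (auto simp: emeasure_lborel_Icc_eq)
    from good_lim[OF this gs lm[unfolded Bochner_Integration.integral_zero]] show ?thesis .
  qed
  have zero: "good (\<lambda>x. 0)" by (simp add: good_def)
  \<comment> \<open>The windows [-n, n] keep the indicators integrable; without them the step to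
    complements would leave L^1.\<close>
  have good_set: "good (indicator (A \<inter> {-real n..real n}))" if "A \<in> sets borel" for A n
    using that
  proof (induction rule: borel_set_induct)
    case empty
    then show ?case using zero by (simp add: indicator_def[abs_def])
  next
    case (interval a b)
    have "{a..b} \<inter> {-real n..real n} = {max a (-real n)..min b (real n)}" by auto
    then show ?case using good_Icc[of "max a (-real n)" "min b (real n)"] zero
      by (cases "max a (-real n) \<le> min b (real n)") (auto simp: indicator_def[abs_def])
  next
    case (compl A)
    have "good (\<lambda>x. indicator {-real n..real n} x + indicator (A \<inter> {-real n..real n}) x * (-1))"
      by (intro good_add good_scale compl good_Icc) simp
    moreover have "(\<lambda>x. indicator {-real n..real n} x + indicator (A \<inter> {-real n..real n}) x * (-1)) = (indicator (- A \<inter> {-real n..real n}) :: real \<Rightarrow> real)"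
      by (auto simp: fun_eq_iff indicator_def)
    ultimately show ?case by (simp add: Compl_eq_Diff_UNIV)
  next
    case (union A)
    \<comment> \<open>Finite unions, whose indicators are sums by disjointness; the indicator of the
      full union is their L^1 limit.\<close>
    define B where "B = (\<lambda>m. (\<Union>i<m. A i) \<inter> {-real n..real n})"
    have meas: "A i \<in> sets borel" for i using union.hyps by auto
    have gB: "good (indicator (B m))" for m
    proof (induction m)
      case 0
      then show ?case using zero by (simp add: B_def indicator_def[abs_def])
    next
      case (Suc m)
      have "(indicator (B (Suc m)) :: real \<Rightarrow> real) = (\<lambda>x. indicator (B m) x + indicator (A m \<inter> {-real n..real n}) x)"
      proof
        fix x
        have "x \<in> A m \<Longrightarrow> i < m \<Longrightarrow> x \<notin> A i" for i
          using union.hyps(1) by (metis UNIV_I disjoint_family_on_def disjoint_iff less_irrefl)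
        then show "(indicator (B (Suc m)) x :: real) = indicator (B m) x + indicator (A m \<inter> {-real n..real n}) x"
          by (auto simp: B_def indicator_def lessThan_Suc)
      qed
      then show ?case using good_add[OF Suc union.IH[of m]] by simp
    qed
    have bi: "integrable lborel (indicator {-real n..real n} :: real \<Rightarrow> real)"
      by (rule integrable_real_indicator) (auto simp: emeasure_lborel_Icc_eq)
    have Bm [measurable]: "B m \<in> sets borel" for m using meas by (auto simp: B_def)
    have Um [measurable]: "(\<Union>i. A i) \<inter> {-real n..real n} \<in> sets borel" using meas by auto
    have lm: "(\<lambda>m. LINT x|lborel. \<bar>indicator (B m) x - indicator ((\<Union>i. A i) \<inter> {-real n..real n}) x\<bar>) \<longlonglongrightarrow> (LINT x|(lborel::real measure). (0::real))"
    proof (rule integral_dominated_convergence[OF _ _ bi])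
      show "AE x in lborel. (\<lambda>m. \<bar>indicator (B m) x - indicator ((\<Union>i. A i) \<inter> {-real n..real n}) x\<bar>) \<longlonglongrightarrow> (0::real)"
      proof (rule AE_I2)
        fix x :: real
        show "(\<lambda>m. \<bar>indicator (B m) x - indicator ((\<Union>i. A i) \<inter> {-real n..real n}) x\<bar>) \<longlonglongrightarrow> (0::real)"
        proof (cases "x \<in> (\<Union>i. A i) \<inter> {-real n..real n}")
          case True
          then obtain i where i: "x \<in> A i" by auto
          have "\<forall>\<^sub>F m in sequentially. \<bar>indicator (B m) x - indicator ((\<Union>i. A i) \<inter> {-real n..real n}) x\<bar> = (0::real)"
          proof (rule eventually_sequentiallyI[of "Suc i"])
            fix m assume "Suc i \<le> m"
            then have "x \<in> B m" using i True by (auto simp: B_def)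
            then show "\<bar>indicator (B m) x - indicator ((\<Union>i. A i) \<inter> {-real n..real n}) x\<bar> = (0::real)" using True by simp
          qed
          then show ?thesis by (rule tendsto_eventually)
        next
          case False
          then have "x \<notin> B m" for m by (auto simp: B_def)
          then show ?thesis using False by simp
        qed
      qed
      show "AE x in lborel. norm \<bar>(indicator (B m) x :: real) - indicator ((\<Union>i. A i) \<inter> {-real n..real n}) x\<bar> \<le> (indicator {-real n..real n} x :: real)" for m
        by (rule AE_I2) (auto simp: B_def indicator_def)
    qed measurable
    have "integrable lborel (indicator ((\<Union>i. A i) \<inter> {-real n..real n}) :: real \<Rightarrow> real)"
      by (rule Bochner_Integration.integrable_bound[OF bi]) (auto simp: indicator_def intro!: AE_I2)
    from good_lim[OF this gB lm[unfolded Bochner_Integration.integral_zero]] show ?case .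
  qed
  have good_all: "good h" if "integrable lborel h" for h
    using that
  proof (induction rule: integrable_induct)
    case (base A c)
    have A: "A \<in> sets borel" "emeasure lborel A < \<infinity>" using base by auto
    have iA: "integrable lborel (indicator A :: real \<Rightarrow> real)" using A by (intro integrable_real_indicator) auto
    have "(\<lambda>n. LINT x|lborel. \<bar>indicator (A \<inter> {-real n..real n}) x - indicator A x\<bar>) \<longlonglongrightarrow> (LINT x|(lborel::real measure). (0::real))"
    proof (rule integral_dominated_convergence[OF _ _ iA])
      show "AE x in lborel. (\<lambda>n. \<bar>indicator (A \<inter> {-real n..real n}) x - indicator A x\<bar>) \<longlonglongrightarrow> (0::real)"
      proof (rule AE_I2)
        fix x :: real
        obtain n0 where n0: "\<bar>x\<bar> < real n0" using reals_Archimedean2 by blast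
        have "\<forall>\<^sub>F n in sequentially. \<bar>indicator (A \<inter> {-real n..real n}) x - indicator A x\<bar> = (0::real)"
        proof (rule eventually_sequentiallyI[of n0])
          fix n assume "n0 \<le> n"
          then have "x \<in> {-real n..real n}" using n0 by auto
          then show "\<bar>indicator (A \<inter> {-real n..real n}) x - indicator A x\<bar> = (0::real)" by (simp add: indicator_def)
        qed
        then show "(\<lambda>n. \<bar>indicator (A \<inter> {-real n..real n}) x - indicator A x\<bar>) \<longlonglongrightarrow> (0::real)" by (rule tendsto_eventually)
      qed
      show "AE x in lborel. norm \<bar>(indicator (A \<inter> {-real n..real n}) x :: real) - indicator A x\<bar> \<le> (indicator A x :: real)" for n
        by (rule AE_I2) (auto simp: indicator_def)
    qed (use A in auto)
    then have "good (indicator A)"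
      unfolding Bochner_Integration.integral_zero
      by (rule good_lim[OF iA good_set[OF A(1)]])
    then show ?case using good_scale[of "indicator A" c] by simp
  next
    case (add h1 h2)
    then show ?case by (intro good_add)
  next
    case (lim h s)
    have L: "\<And>i. integrable lborel (s i)" "\<And>x. (\<lambda>i. s i x) \<longlonglongrightarrow> h x"
      "\<And>i x. norm (s i x) \<le> 2 * norm (h x)" "integrable lborel h" "\<And>i. good (s i)"
      using lim by simp_all
    have "(\<lambda>n. LINT x|lborel. \<bar>s n x - h x\<bar>) \<longlonglongrightarrow> (LINT x|(lborel::real measure). (0::real))"
    proof (rule integral_dominated_convergence[where w = "\<lambda>x. 3 * norm (h x)"])
      show "AE x in lborel. (\<lambda>n. \<bar>s n x - h x\<bar>) \<longlonglongrightarrow> 0"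
        by (rule AE_I2) (rule tendsto_rabs_zero[OF LIM_zero[OF L(2)]])
      show "AE x in lborel. norm \<bar>s n x - h x\<bar> \<le> 3 * norm (h x)" for n
      proof (rule AE_I2)
        fix x
        show "norm \<bar>s n x - h x\<bar> \<le> 3 * norm (h x)" using L(3)[of n x] by simp
      qed
      show "(\<lambda>x. \<bar>s n x - h x\<bar>) \<in> borel_measurable lborel" for n
        using L(1)[of n] L(4) by (intro borel_measurable_abs borel_measurable_diff borel_measurable_integrable)
      show "integrable lborel (\<lambda>x. 3 * norm (h x))" using L(4) by (intro integrable_mult_right integrable_norm)
    qed simp
    then show ?case unfolding Bochner_Integration.integral_zero by (rule good_lim[OF L(4) L(5)])
  qed
  show ?thesis
    unfolding weak_star_tendsto_def Linf_def
  proof (intro conjI allI impI)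
    show "\<forall>\<^sub>F i in F. f i \<in> borel_measurable lborel \<and> (\<exists>C. AE x in lborel. \<bar>f i x\<bar> \<le> C)"
      using f by eventually_elim (auto intro!: exI[of _ K] AE_I2)
    show "\<exists>C. AE x in lborel. \<bar>g x\<bar> \<le> C" using g by (auto intro!: exI[of _ K] AE_I2)
    show "((\<lambda>i. LINT x|lborel. f i x * h x) \<longlongrightarrow> (LINT x|lborel. g x * h x)) F" if "integrable lborel h" for h
      using good_all[OF that] by (simp add: good_def)
  qed (rule g(1))
qed

section \<open>Uniform bounds and the limit\<close>

locale mfg_eps_full = mfg_eps_init \<theta> R T N U M \<epsilon> L B + mfg_eps_smooth \<theta> R T N U M \<epsilon> L
  for \<theta> R T N :: real and U M :: "real \<Rightarrow> real \<Rightarrow> real" and \<epsilon> L B :: real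
begin

text \<open>Before time T the weight exp (k x^2 / \<tau>^(2 \<alpha>)) is at most exp 1 on the
  support, so it costs only a constant. The three entries of the maximum belong to a maximum of the
  weighted density in the interior, at time 0 and at time T.\<close>

lemma sup_bound:
  assumes e1: "\<epsilon> < 1" and Q: "R \<le> Q"
    and supp: "\<And>t x. t \<in> {0<..<T} \<Longrightarrow> M t x \<noteq> 0 \<Longrightarrow> \<bar>x\<bar> \<le> Q * (t + \<epsilon>) powr \<alpha>"
    and Km: "\<And>x. M T x \<le> Km" and t: "t \<in> {0..T}"
  shows "M t x * (t + \<epsilon>) powr \<alpha> \<le> max (exp 1 * (12 * (1 + \<theta>) * Q\<^sup>2 / \<theta>) powr (1 / \<theta>))
     (max (exp 1 * phi \<theta> R 0) (Km * (T + 1) powr \<alpha> * exp (B\<^sup>2 * T powr (-2 * \<alpha>) / (4 * (1 + \<theta>) * Q\<^sup>2))))"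
    (is "_ \<le> ?K")
proof -
  \<comment> \<open>The largest k for which the smallness condition of
    \<open>interior_maximum\<close> holds on |x| \<le> Q \<tau>^\<alpha>, with equality at the
    edge.\<close>
  define k where "k = 1 / (4 * (1 + \<theta>) * Q\<^sup>2)"
  have Qp: "0 < Q" using Q R by simp
  have k: "0 < k" using Qp th by (simp add: k_def)
  have kQ: "4 * (1 + \<theta>) * (k * Q\<^sup>2) = 1" using Qp th by (simp add: k_def)
  have kQ1: "k * Q\<^sup>2 \<le> 1"
  proof -
    have "0 \<le> k * Q\<^sup>2" using k by simp
    then have "k * Q\<^sup>2 \<le> 4 * (1 + \<theta>) * (k * Q\<^sup>2)" using th mult_right_mono[of 1 "4 * (1 + \<theta>)" "k * Q\<^sup>2"] by simp
    then show ?thesis using kQ by simp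
  qed
  define h where "h = (\<lambda>t x. k * (x\<^sup>2 * (t + \<epsilon>) powr (-2 * \<alpha>)))"
  define Psi where "Psi = (\<lambda>t x. M t x * (t + \<epsilon>) powr \<alpha> * exp (h t x))"
  have K0: "0 \<le> ?K" by (rule max.coboundedI1) simp
  have hp: "0 \<le> h t x" for t x using k by (simp add: h_def)
  have inside: "h t x \<le> 1" "4 * (1 + \<theta>) * h t x \<le> 1" if "0 \<le> t" "\<bar>x\<bar> \<le> Q * (t + \<epsilon>) powr \<alpha>" for t x
  proof -
    have tp: "0 < t + \<epsilon>" using that eps by simp
    have "x\<^sup>2 \<le> (Q * (t + \<epsilon>) powr \<alpha>)\<^sup>2" using that(2) by (metis abs_ge_zero power2_abs power_mono)
    also have "\<dots> = Q\<^sup>2 * (t + \<epsilon>) powr (2 * \<alpha>)" using tp by (simp add: power_mult_distrib powr_power mult.commute)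
    finally have "x\<^sup>2 * (t + \<epsilon>) powr (-2 * \<alpha>) \<le> Q\<^sup>2 * (t + \<epsilon>) powr (2 * \<alpha>) * (t + \<epsilon>) powr (-2 * \<alpha>)"
      by (intro mult_right_mono) auto
    also have "\<dots> = Q\<^sup>2" using tp by (simp add: mult.assoc powr_add[symmetric])
    finally have hk: "h t x \<le> k * Q\<^sup>2" unfolding h_def using k by (intro mult_left_mono) auto
    then show "h t x \<le> 1" using kQ1 by simp
    have "4 * (1 + \<theta>) * h t x \<le> 4 * (1 + \<theta>) * (k * Q\<^sup>2)" using th hk by (intro mult_left_mono) auto
    then show "4 * (1 + \<theta>) * h t x \<le> 1" using kQ by simp
  qed
  have ex: "exp (h t x) \<le> exp 1" if "0 \<le> t" "\<bar>x\<bar> \<le> Q * (t + \<epsilon>) powr \<alpha>" for t x using inside(1)[OF that] by simp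
  have Mc: "continuous_on ({0..T} \<times> {-N..N}) (\<lambda>p. M (fst p) (snd p))"
    by (rule continuous_on_subset[OF M_cont[unfolded case_prod_unfold]]) auto
  have "continuous_on ({0..T} \<times> {-N..N}) (\<lambda>p. Psi (fst p) (snd p))"
    unfolding Psi_def h_def by (intro continuous_intros Mc) (use eps in auto)
  moreover have "compact ({0..T} \<times> {-N..N})" by (intro compact_Times compact_Icc)
  moreover have "{0..T} \<times> {-N..N} \<noteq> {}" using T N by auto
  ultimately obtain p where p: "p \<in> {0..T} \<times> {-N..N}" "\<And>q. q \<in> {0..T} \<times> {-N..N} \<Longrightarrow> Psi (fst q) (snd q) \<le> Psi (fst p) (snd p)"
    using continuous_attains_sup[of "{0..T} \<times> {-N..N}" "\<lambda>p. Psi (fst p) (snd p)"] by blast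
  define t0 x0 where "t0 = fst p" and "x0 = snd p"
  have t0: "t0 \<in> {0..T}" "x0 \<in> {-N..N}" using p(1) by (auto simp: t0_def x0_def)
  have max0: "Psi t y \<le> Psi t0 x0" if "t \<in> {0..T}" "y \<in> {-N..N}" for t y
    using p(2)[of "(t, y)"] that by (simp add: t0_def x0_def)
  have main: "Psi t0 x0 \<le> ?K"
  proof (cases "M t0 x0 = 0")
    case True
    then show ?thesis using K0 by (simp add: Psi_def)
  next
    case False
    then have m0: "0 < M t0 x0" using M_nonneg[OF t0(1), of x0] by simp
    have tp: "0 < t0 + \<epsilon>" by (rule tau[OF t0(1)])
    consider "t0 = 0" | "t0 = T" | "0 < t0" "t0 < T" using t0 by force
    then show ?thesis
    proof cases
      case 1
      have ea: "0 < \<epsilon> powr \<alpha>" using eps by simp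
      have eq: "M t0 x0 * (t0 + \<epsilon>) powr \<alpha> = phi \<theta> R (\<epsilon> powr (- \<alpha>) * x0)"
        using ea by (simp add: 1 init powr_minus)
      have "\<bar>\<epsilon> powr (- \<alpha>) * x0\<bar> < R"
      proof (rule ccontr)
        assume "\<not> ?thesis"
        then have "phi \<theta> R (\<epsilon> powr (- \<alpha>) * x0) = 0" by (intro phi_zero) simp
        then show False using m0 by (simp add: 1 init)
      qed
      then have "\<bar>x0\<bar> \<le> R * \<epsilon> powr \<alpha>" using ea by (simp add: powr_minus abs_mult field_simps)
      also have "\<dots> \<le> Q * (t0 + \<epsilon>) powr \<alpha>" using Q by (simp add: 1 mult_right_mono)
      finally have "exp (h t0 x0) \<le> exp 1" using ex[of t0 x0] 1 by simp
      then have "Psi t0 x0 \<le> phi \<theta> R 0 * exp 1" unfolding Psi_def eq by (intro mult_mono phi_le phi_nonneg) auto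
      then show ?thesis by (simp add: mult.commute)
    next
      case 2
      have xB: "\<bar>x0\<bar> \<le> B" using terminal False 2 by simp
      have Km0: "0 \<le> Km" using Km[of x0] m0 2 by simp
      have "h t0 x0 \<le> k * (B\<^sup>2 * T powr (-2 * \<alpha>))"
        unfolding h_def 2
      proof (intro mult_left_mono mult_mono)
        show "x0\<^sup>2 \<le> B\<^sup>2" using xB by (metis abs_ge_zero power2_abs power_mono)
        show "(T + \<epsilon>) powr (-2 * \<alpha>) \<le> T powr (-2 * \<alpha>)" using T eps al by (intro powr_mono2') auto
      qed (use k in auto)
      moreover have "(T + \<epsilon>) powr \<alpha> \<le> (T + 1) powr \<alpha>" using T eps al e1 by (intro powr_mono2) auto
      ultimately have "Psi t0 x0 \<le> Km * (T + 1) powr \<alpha> * exp (k * (B\<^sup>2 * T powr (-2 * \<alpha>)))"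
        unfolding Psi_def using Km[of x0] Km0 m0 2 by (intro mult_mono) auto
      then show ?thesis by (simp add: k_def)
    next
      case 3
      have P: "(t0, x0) \<in> Pos" using 3 m0 by (simp add: Pos_iff)
      have xQ: "\<bar>x0\<bar> \<le> Q * (t0 + \<epsilon>) powr \<alpha>" using supp[of t0 x0] 3 False by simp
      have ln_Psi: "ln (Psi t x) = ln (M t x) + (\<alpha> * ln (t + \<epsilon>) + h t x)" if "(t, x) \<in> Pos" for t x
      proof -
        have "0 < M t x" "0 < t + \<epsilon>" using that eps by (auto simp: Pos_iff)
        then show ?thesis unfolding Psi_def by (simp add: ln_mult ln_powr)
      qed
      have "\<theta> * M t0 x0 powr \<theta> * k * (t0 + \<epsilon>) powr (-2 * \<alpha>) * (t0 + \<epsilon>)\<^sup>2 \<le> 3"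
      proof (rule interior_maximum[OF P k])
        show "4 * (1 + \<theta>) * (k * (x0\<^sup>2 * (t0 + \<epsilon>) powr (-2 * \<alpha>))) \<le> 1"
          using inside(2)[of t0 x0] xQ 3 unfolding h_def by simp
        fix s y assume sy: "(s, y) \<in> Pos"
        have "0 < M s y" "0 < s + \<epsilon>" using sy eps by (auto simp: Pos_iff)
        then have "0 < Psi s y" by (simp add: Psi_def)
        moreover have "Psi s y \<le> Psi t0 x0"
        proof (rule max0)
          show "s \<in> {0..T}" using sy by (auto simp: Pos_iff)
          show "y \<in> {-N..N}" using Pos_N[OF sy] by (auto simp: abs_less_iff)
        qed
        ultimately have "ln (Psi s y) \<le> ln (Psi t0 x0)" by simp
        then show "ln (M s y) + (\<alpha> * ln (s + \<epsilon>) + k * (y\<^sup>2 * (s + \<epsilon>) powr (-2 * \<alpha>)))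
          \<le> ln (M t0 x0) + (\<alpha> * ln (t0 + \<epsilon>) + k * (x0\<^sup>2 * (t0 + \<epsilon>) powr (-2 * \<alpha>)))"
          unfolding ln_Psi[OF sy] ln_Psi[OF P] by (simp add: h_def)
      qed
      \<comment> \<open>By \<alpha> \<theta> = 2 - 2 \<alpha> the powers of \<tau> in the maximum
        principle are exactly those of (M \<tau>^\<alpha>)^\<theta>.\<close>
      moreover have "(t0 + \<epsilon>) powr (-2 * \<alpha>) * (t0 + \<epsilon>)\<^sup>2 = ((t0 + \<epsilon>) powr \<alpha>) powr \<theta>"
      proof -
        have "(t0 + \<epsilon>)\<^sup>2 = (t0 + \<epsilon>) powr 2" using tp by simp
        then show ?thesis using al(3) unfolding powr_powr al(3) by (simp add: powr_add[symmetric])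
      qed
      ultimately have "\<theta> * k * (M t0 x0 powr \<theta> * ((t0 + \<epsilon>) powr \<alpha>) powr \<theta>) \<le> 3" by (simp add: mult_ac)
      then have "\<theta> * k * (M t0 x0 * (t0 + \<epsilon>) powr \<alpha>) powr \<theta> \<le> 3" using m0 by (simp add: powr_mult)
      then have "(M t0 x0 * (t0 + \<epsilon>) powr \<alpha>) powr \<theta> \<le> 3 / (\<theta> * k)" using k th by (simp add: field_simps)
      also have "3 / (\<theta> * k) = 12 * (1 + \<theta>) * Q\<^sup>2 / \<theta>" using th Qp by (simp add: k_def field_simps)
      finally have "((M t0 x0 * (t0 + \<epsilon>) powr \<alpha>) powr \<theta>) powr (1 / \<theta>) \<le> (12 * (1 + \<theta>) * Q\<^sup>2 / \<theta>) powr (1 / \<theta>)"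
        using th by (intro powr_mono2) auto
      then have "M t0 x0 * (t0 + \<epsilon>) powr \<alpha> \<le> (12 * (1 + \<theta>) * Q\<^sup>2 / \<theta>) powr (1 / \<theta>)"
        using th m0 by (simp add: powr_powr)
      then have "Psi t0 x0 \<le> (12 * (1 + \<theta>) * Q\<^sup>2 / \<theta>) powr (1 / \<theta>) * exp 1"
        unfolding Psi_def using ex[of t0 x0] xQ 3 by (intro mult_mono) auto
      then show ?thesis by (simp add: mult.commute)
    qed
  qed
  show ?thesis
  proof (cases "x \<in> {-N..N}")
    case True
    have "M t x * (t + \<epsilon>) powr \<alpha> * 1 \<le> Psi t x"
      unfolding Psi_def using M_nonneg[OF t, of x] hp by (intro mult_left_mono) auto
    then show ?thesis using max0[OF t True] main by linarith
  next
    case False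
    then have "M t x = 0" using M_support[OF t, of x] by auto
    then show ?thesis using K0 by simp
  qed
qed

end

section \<open>Constants independent of \<epsilon> and the passage to the limit\<close>

lemma globally_holder_continuous:
  assumes "globally_holder T f"
  shows "continuous_on ({0..T} \<times> UNIV) (\<lambda>(t, x). f t x)"
proof -
  obtain K \<gamma> where g: "0 < \<gamma>" and K: "\<And>p q. p \<in> {0..T} \<times> UNIV \<Longrightarrow> q \<in> {0..T} \<times> UNIV \<Longrightarrow>
       \<bar>case_prod f p - case_prod f q\<bar> \<le> K * dist p q powr \<gamma>"
    using assms unfolding globally_holder_def by blast
  show ?thesis unfolding continuous_on_def
  proof
    fix p assume p: "p \<in> {0..T} \<times> (UNIV :: real set)"
    have "((\<lambda>q. dist q p) \<longlongrightarrow> dist p p) (at p within {0..T} \<times> UNIV)" by (intro tendsto_intros)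
    then have "((\<lambda>q. K * dist q p powr \<gamma>) \<longlongrightarrow> K * 0 powr \<gamma>) (at p within {0..T} \<times> UNIV)"
      using g by (intro tendsto_mult tendsto_const tendsto_powr') auto
    then have z: "((\<lambda>q. K * dist q p powr \<gamma>) \<longlongrightarrow> 0) (at p within {0..T} \<times> UNIV)" by simp
    have "((\<lambda>q. case_prod f q - case_prod f p) \<longlongrightarrow> 0) (at p within {0..T} \<times> UNIV)"
      by (rule Lim_null_comparison[OF _ z]) (use K p in \<open>auto simp: eventually_at_filter intro!: always_eventually\<close>)
    then show "((\<lambda>(t, x). f t x) \<longlongrightarrow> (case p of (t, x) \<Rightarrow> f t x)) (at p within {0..T} \<times> UNIV)"
      by (rule LIM_zero_cancel)
  qed
qed

lemma continuous_on_of_Lipschitz: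
  fixes g :: "real \<Rightarrow> real"
  assumes "\<And>x y. \<bar>g x - g y\<bar> \<le> G * \<bar>x - y\<bar>"
  shows "continuous_on X g"
proof -
  have "0 \<le> G" using assms[of 0 1] by simp
  then have "G-lipschitz_on X g" using assms by (auto simp: lipschitz_on_def dist_real_def)
  then show ?thesis by (rule lipschitz_on_continuous_on)
qed

lemma derivative_bound_of_Lipschitz:
  fixes f :: "real \<Rightarrow> real"
  assumes "(f has_real_derivative D) (at x)" "\<And>y. \<bar>f y - f x\<bar> \<le> L * \<bar>y - x\<bar>"
  shows "\<bar>D\<bar> \<le> L"
proof -
  have "((\<lambda>y. \<bar>(f y - f x) / (y - x)\<bar>) \<longlongrightarrow> \<bar>D\<bar>) (at x)"
    using assms(1) unfolding has_field_derivative_iff by (rule tendsto_rabs)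
  then show ?thesis
  proof (rule tendsto_upperbound)
    show "\<forall>\<^sub>F y in at x. \<bar>(f y - f x) / (y - x)\<bar> \<le> L"
      unfolding eventually_at_filter
    proof (intro always_eventually allI impI)
      fix y assume "y \<noteq> x"
      then show "\<bar>(f y - f x) / (y - x)\<bar> \<le> L" using assms(2)[of y] by (simp add: abs_divide pos_divide_le_eq)
    qed
  qed simp
qed

lemma lborel_integral_compact_support:
  fixes f :: "real \<Rightarrow> real"
  assumes "continuous_on UNIV f" "\<And>x. r < \<bar>x\<bar> \<Longrightarrow> f x = 0"
  shows "integrable lborel f" "(LINT x|lborel. f x) = integral {-r..r} f"
proof -
  have c: "continuous_on {-r..r} f" using assms(1) continuous_on_subset by blast
  have eq: "f x = indicator {-r..r} x *\<^sub>R f x" for x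
    using assms(2)[of x] by (cases "x \<in> {-r..r}") (auto simp: abs_if split: if_splits)
  have i: "set_integrable lborel {-r..r} f" by (rule borel_integrable_atLeastAtMost'[OF c])
  then show "integrable lborel f" unfolding set_integrable_def eq[symmetric] .
  have "(LINT x|lborel. f x) = (LINT x:{-r..r}|lborel. f x)" unfolding set_lebesgue_integral_def eq[symmetric] ..
  then show "(LINT x|lborel. f x) = integral {-r..r} f" using set_borel_integral_eq_integral(2)[OF i] by simp
qed

lemma law_mass:
  assumes "prob_space (law f)" "continuous_on UNIV f" "\<And>x. 0 \<le> f x" "\<And>x. r < \<bar>x\<bar> \<Longrightarrow> f x = 0"
  shows "integral {-r..r} f = 1"
proof -
  have [measurable]: "f \<in> borel_measurable borel" using assms(2) by (rule borel_measurable_continuous_onI)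
  have "emeasure (law f) (space (law f)) = 1" by (rule prob_space.emeasure_space_1[OF assms(1)])
  then have "(\<integral>\<^sup>+x. ennreal (f x) \<partial>lborel) = 1" by (simp add: emeasure_density)
  moreover have "(\<integral>\<^sup>+x. ennreal (f x) \<partial>lborel) = ennreal (LINT x|lborel. f x)"
    by (rule nn_integral_eq_integral[OF lborel_integral_compact_support(1)[OF assms(2,4)]]) (use assms(3) in auto)
  ultimately have "ennreal (LINT x|lborel. f x) = ennreal 1" by simp
  then have "(LINT x|lborel. f x) = 1" by (subst (asm) ennreal_inj) (use assms(3) in \<open>auto intro!: integral_nonneg_AE\<close>)
  then show ?thesis using lborel_integral_compact_support(2)[OF assms(2,4)] by simp
qed

text \<open>The Lipschitz constant L and the support radius N depend on \<epsilon>. That is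
  harmless, since the right-hand sides of \<open>coupling\<close> and \<open>sup_bound\<close>
  contain neither.\<close>

lemma approximating_family_instance:
  assumes T: "0 < T" and th: "0 < \<theta>" and rad: "profile_radius \<theta> R" and td: "terminal_density \<theta> a b mT"
    and fam: "approximating_family \<theta> T R mT U M" and e: "\<epsilon> \<in> {0<..<1}"
  obtains N L where "mfg_eps_full \<theta> R T N (U \<epsilon>) (M \<epsilon>) \<epsilon> L (\<bar>a\<bar> + \<bar>b\<bar>)" "0 \<le> L"
    "\<And>t x. t \<in> {0..T} \<Longrightarrow> R * \<epsilon> powr alpha \<theta> + L * t < \<bar>x\<bar> \<Longrightarrow> M \<epsilon> t x = 0"
proof -
  interpret profile \<theta> R using th rad by unfold_locales
  define u m where "u = U \<epsilon>" and "m = M \<epsilon>"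
  have sol: "mfg_solution \<theta> T (law (approx_initial \<theta> R \<epsilon>)) (law mT) u (\<lambda>t. law (m t)) m"
    and m0: "m 0 = approx_initial \<theta> R \<epsilon>" and mT: "m T = mT"
    and lip: "\<exists>L. L-lipschitz_on ({0..T} \<times> UNIV) (\<lambda>(t, x). u t x)" and hol: "globally_holder T m"
    and su: "Cinf_on {(t, x). t \<in> {0<..<T} \<and> 0 < m t x} u" and sm: "Cinf_on {(t, x). t \<in> {0<..<T} \<and> 0 < m t x} m"
    using fam e unfolding approximating_family_def u_def m_def by auto
  have mc: "continuous_on ({0..T} \<times> UNIV) (\<lambda>(t, x). m t x)" by (rule globally_holder_continuous[OF hol])
  have uC1: "Ck_on 1 (strip T) u" using sol by (simp add: mfg_solution_def)
  have uc: "continuous_on (strip T) (\<lambda>(t, x). dx u t x)" using uC1 by (simp add: numeral_eq_Suc)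
  have ud: "(u t has_real_derivative dx u t x) (at x)" if "t \<in> {0<..<T}" for t x
  proof -
    have "\<forall>(t, x)\<in>strip T. (\<lambda>s. u s x) differentiable (at t) \<and> u t differentiable (at x)"
      using uC1 by (simp add: numeral_eq_Suc)
    then show ?thesis using that by (auto simp: DERIV_deriv_iff_real_differentiable)
  qed
  have m_nonneg: "0 \<le> m t x" if t: "t \<in> {0..T}" for t x
  proof -
    consider "t = 0" | "t = T" | "t \<in> {0<..<T}" using t by force
    then show ?thesis
    proof cases
      case 1
      then show ?thesis using phi_nonneg by (simp add: m0 approx_initial_def)
    next
      case 2
      then show ?thesis using td by (simp add: mT terminal_density_def prob_density_def)
    next
      case 3
      then show ?thesis using sol by (simp add: mfg_solution_def)
    qed
  qed
  obtain L where L: "L-lipschitz_on ({0..T} \<times> UNIV) (\<lambda>(t, x). u t x)" using lip by blast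
  have L0: "0 \<le> L" using L by (rule lipschitz_on_nonneg)
  have uL: "\<bar>dx u t x\<bar> \<le> L" if t: "t \<in> {0<..<T}" for t x
  proof (rule derivative_bound_of_Lipschitz[OF ud[OF t]])
    fix y
    have "dist (u t y) (u t x) \<le> L * dist (t, y) (t, x)"
      using lipschitz_onD[OF L, of "(t, y)" "(t, x)"] t by simp
    then show "\<bar>u t y - u t x\<bar> \<le> L * \<bar>y - x\<bar>" by (simp add: dist_real_def dist_Pair_Pair)
  qed
  define fl where "fl = (\<lambda>t x. m t x * dx u t x)"
  have bc: "continuous_on (strip T) (\<lambda>(t, x). fl t x)"
    unfolding fl_def case_prod_unfold
    by (intro continuous_on_mult continuous_on_subset[OF mc[unfolded case_prod_unfold]] uc[unfolded case_prod_unfold]) auto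
  have bal: "flux_balance T m fl"
    unfolding flux_balance_def
  proof (intro allI impI)
    fix t1 t2 x1 x2 :: real assume h: "0 < t1 \<and> t1 < t2 \<and> t2 < T \<and> x1 < x2"
    show "integral {x1..x2} (m t2) - integral {x1..x2} (m t1) = integral {t1..t2} (\<lambda>t. fl t x2) - integral {t1..t2} (\<lambda>t. fl t x1)"
    proof (rule box_identity)
      show "continuous_on (strip T) (\<lambda>(t, x). m t x)" by (rule continuous_on_subset[OF mc]) auto
      show "(LINT p:strip T|lborel. (case p of (t, x) \<Rightarrow> - m t x * dt \<psi> t x + fl t x * dx \<psi> t x)) = 0" if "test_fun T \<psi>" for \<psi>
        using sol that unfolding mfg_solution_def fl_def by blast
    qed (use bc h in auto)
  qed
  have bL: "\<bar>fl t x\<bar> \<le> L * m t x" if t: "t \<in> {0<..<T}" for t x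
  proof -
    have "0 \<le> m t x" using m_nonneg t by auto
    then show ?thesis using mult_left_mono[OF uL[OF t, of x], of "m t x"] by (simp add: fl_def abs_mult mult.commute)
  qed
  have init0: "m 0 x = 0" if "R * \<epsilon> powr \<alpha> < \<bar>x\<bar>" for x
  proof -
    have "R \<le> \<bar>\<epsilon> powr (- \<alpha>) * x\<bar>" using that e by (simp add: powr_minus abs_mult field_simps)
    then show ?thesis by (simp add: m0 approx_initial_def phi_zero)
  qed
  have speed: "m t x = 0" if "t \<in> {0..T}" "R * \<epsilon> powr \<alpha> + L * t < \<bar>x\<bar>" for t x
    by (rule finite_speed_two_sided[OF T L0 mc m_nonneg bc bL bal init0 that])
  \<comment> \<open>Finite speed up to time T; the added 1 provides the strict inequality that
    \<open>speed\<close> asks for.\<close>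
  define N where "N = R * \<epsilon> powr \<alpha> + L * T + 1"
  have LT: "L * t \<le> L * T" if "t \<in> {0..T}" for t using that L0 by (intro mult_left_mono) auto
  have N0: "0 < N" "R * \<epsilon> powr \<alpha> \<le> N"
  proof -
    have "0 \<le> R * \<epsilon> powr \<alpha>" "0 \<le> L * T" using R L0 T by auto
    then show "0 < N" "R * \<epsilon> powr \<alpha> \<le> N" unfolding N_def by linarith+
  qed
  have supp: "m t x = 0" if "t \<in> {0..T}" "N \<le> \<bar>x\<bar>" for t x
    using speed[OF that(1), of x] LT[OF that(1)] that(2) unfolding N_def by linarith
  have mass: "integral {-N..N} (m t) = 1" if t: "t \<in> {0..T}" for t
  proof (rule law_mass)
    have "real_distribution (law (m t))"
      using sol t by (simp add: mfg_solution_def weakly_continuous_curve_def)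
    then show "prob_space (law (m t))" by (rule real_distribution.axioms)
    show "continuous_on UNIV (m t)" by (rule continuous_on_slice2[OF mc t]) auto
  qed (use m_nonneg supp t in auto)
  have terminal: "\<bar>x\<bar> \<le> \<bar>a\<bar> + \<bar>b\<bar>" if "m T x \<noteq> 0" for x
  proof -
    have "x \<in> {a..b}" using td that unfolding mT terminal_density_def by blast
    then show ?thesis by auto
  qed
  have "mfg_eps_full \<theta> R T N u m \<epsilon> L (\<bar>a\<bar> + \<bar>b\<bar>)"
  proof unfold_locales
    show "- dt u t x + 1/2 * (dx u t x)\<^sup>2 = m t x powr \<theta>" if "t \<in> {0<..<T}" for t x
      using sol that by (simp add: mfg_solution_def)
    show "m 0 x = \<epsilon> powr (- \<alpha>) * phi \<theta> R (\<epsilon> powr (- \<alpha>) * x)" for x by (simp add: m0 approx_initial_def)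
    show "flux_balance T m (\<lambda>t x. m t x * dx u t x)" using bal by (simp add: fl_def[abs_def])
    show "continuous_on (strip T) (\<lambda>(t, x). m t x * dx u t x)" using bc by (simp add: fl_def)
    show "\<bar>x\<bar> \<le> \<bar>a\<bar> + \<bar>b\<bar>" if "m T x \<noteq> 0" for x by (rule terminal[OF that])
    show "Cinf_on {(t, x). t \<in> {0<..<T} \<and> 0 < m t x} u" "Cinf_on {(t, x). t \<in> {0<..<T} \<and> 0 < m t x} m" by (fact su, fact sm)
    show "\<bar>dx u t x\<bar> \<le> L" if "t \<in> {0<..<T}" for t x by (rule uL[OF that])
  qed (fact T | fact N0 | fact mc | rule m_nonneg | rule supp | rule mass | fact uC1 | use e in \<open>simp add: N_def\<close> | simp)+
  then show ?thesis using L0 speed by (intro that) (auto simp: u_def m_def)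
qed

lemma approximating_family_bounds:
  assumes T: "0 < T" and th: "0 < \<theta>" and rad: "profile_radius \<theta> R" and td: "terminal_density \<theta> a b mT"
    and fam: "approximating_family \<theta> T R mT U M"
  obtains K D where
    "\<And>\<epsilon> t x. \<epsilon> \<in> {0<..<1} \<Longrightarrow> t \<in> {0<..<T} \<Longrightarrow> M \<epsilon> t x * (t + \<epsilon>) powr alpha \<theta> \<le> K"
    "\<And>\<epsilon> t g G r. \<epsilon> \<in> {0<..<1} \<Longrightarrow> t \<in> {0<..<T} \<Longrightarrow> (\<And>x y. \<bar>g x - g y\<bar> \<le> G * \<bar>x - y\<bar>) \<Longrightarrow>
      (\<And>x. r < \<bar>x\<bar> \<Longrightarrow> g x = 0) \<Longrightarrow>
      \<bar>integral {-r..r} (\<lambda>x. M \<epsilon> t x * g x) - integral {-R..R} (\<lambda>y. phi \<theta> R y * g ((t + \<epsilon>) powr alpha \<theta> * y))\<bar>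
        \<le> G * (D * (t + \<epsilon>) powr ((1 + alpha \<theta>) / 2))"
proof -
  interpret profile \<theta> R using th rad by unfold_locales
  obtain C where C: "\<And>\<epsilon> t. \<epsilon> \<in> {0<..<1} \<Longrightarrow> t \<in> {0..T} \<Longrightarrow>
      AE x in lborel. M \<epsilon> t x = 0 \<longrightarrow> \<bar>dx (U \<epsilon>) t x\<bar> \<le> C * (t + \<epsilon>) powr (\<alpha> - 1)"
    using fam unfolding approximating_family_def by blast
  \<comment> \<open>Nothing fixes the sign of the constant C of the vacuum bound, whereas
    \<open>support_bound\<close> asks for a nonnegative one.\<close>
  define Q where "Q = max R (max C 0 / \<alpha>)"
  define B where "B = \<bar>a\<bar> + \<bar>b\<bar>"
  obtain C0 where C0: "1 < C0" "\<And>x. x \<in> {a..b} \<Longrightarrow> mT x \<le> C0 * infdist x {a, b} powr (1 / \<theta>)"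
    and mT0: "\<And>x. x \<notin> {a..b} \<Longrightarrow> mT x = 0"
    using td unfolding terminal_density_def by blast
  define Km where "Km = C0 * (b - a) powr (1 / \<theta>)"
  have Km: "mT x \<le> Km" for x
  proof (cases "x \<in> {a..b}")
    case True
    have "infdist x {a, b} \<le> dist x a" by (rule infdist_le) simp
    then have "infdist x {a, b} \<le> b - a" using True by (simp add: dist_real_def)
    then have "C0 * infdist x {a, b} powr (1 / \<theta>) \<le> Km"
      unfolding Km_def using C0(1) th by (intro mult_left_mono powr_mono2) (auto simp: infdist_nonneg)
    then show ?thesis using C0(2)[OF True] by linarith
  qed (use C0(1) mT0 in \<open>auto simp: Km_def\<close>)
  \<comment> \<open>Dominates the constant of \<open>coupling\<close> for all \<epsilon> < 1: T +
    \<epsilon> is enlarged to T + 1 in the numerator and shrunk to T in the denominator.\<close>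
  define E where "E = 1/2 * (B + (T + 1) powr \<alpha> * R)\<^sup>2 / T powr (1 + \<alpha>)"
  show thesis
  proof (rule that)
    fix \<epsilon> t x :: real assume e: "\<epsilon> \<in> {0<..<1}" and t: "t \<in> {0<..<T}"
    obtain N L where full: "mfg_eps_full \<theta> R T N (U \<epsilon>) (M \<epsilon>) \<epsilon> L B" and L: "0 \<le> L"
      and sp: "\<And>t x. t \<in> {0..T} \<Longrightarrow> R * \<epsilon> powr alpha \<theta> + L * t < \<bar>x\<bar> \<Longrightarrow> M \<epsilon> t x = 0"
      by (rule approximating_family_instance[OF T th rad td fam e, folded B_def]) (rule that)
    interpret mfg_eps_full \<theta> R T N "U \<epsilon>" "M \<epsilon>" \<epsilon> L B by (rule full)
    have MT: "M \<epsilon> T = mT" using fam e unfolding approximating_family_def by blast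
    show "M \<epsilon> t x * (t + \<epsilon>) powr \<alpha> \<le> max (exp 1 * (12 * (1 + \<theta>) * Q\<^sup>2 / \<theta>) powr (1 / \<theta>))
      (max (exp 1 * phi \<theta> R 0) (Km * (T + 1) powr \<alpha> * exp (B\<^sup>2 * T powr (-2 * \<alpha>) / (4 * (1 + \<theta>) * Q\<^sup>2))))"
    proof (rule sup_bound)
      show "\<bar>x\<bar> \<le> Q * (t + \<epsilon>) powr \<alpha>" if t: "t \<in> {0<..<T}" and nz: "M \<epsilon> t x \<noteq> 0" for t x
      proof (rule ccontr)
        assume "\<not> ?thesis"
        then have x: "max R (max C 0 / \<alpha>) * (t + \<epsilon>) powr \<alpha> < \<bar>x\<bar>" by (simp add: Q_def)
        have "M \<epsilon> t x = 0"
        proof (rule support_bound[OF _ _ sp L t x])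
          fix s assume s: "s \<in> {0<..<T}"
          have "C * (s + \<epsilon>) powr (\<alpha> - 1) \<le> max C 0 * (s + \<epsilon>) powr (\<alpha> - 1)" by (intro mult_right_mono) auto
          moreover have "AE x in lborel. M \<epsilon> s x = 0 \<longrightarrow> \<bar>dx (U \<epsilon>) s x\<bar> \<le> C * (s + \<epsilon>) powr (\<alpha> - 1)"
            using s by (intro C e) auto
          ultimately show "AE x in lborel. M \<epsilon> s x = 0 \<longrightarrow> \<bar>dx (U \<epsilon>) s x\<bar> \<le> max C 0 * (s + \<epsilon>) powr (\<alpha> - 1)"
            by (auto elim!: eventually_mono)
        qed auto
        then show False using nz by simp
      qed
    qed (use e t Km MT in \<open>auto simp: Q_def\<close>)
  next
    fix \<epsilon> t G r :: real and g :: "real \<Rightarrow> real"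
    assume e: "\<epsilon> \<in> {0<..<1}" and t: "t \<in> {0<..<T}" and g: "\<And>x y. \<bar>g x - g y\<bar> \<le> G * \<bar>x - y\<bar>"
      and g0: "\<And>x. r < \<bar>x\<bar> \<Longrightarrow> g x = 0"
    obtain N L where full: "mfg_eps_full \<theta> R T N (U \<epsilon>) (M \<epsilon>) \<epsilon> L B"
      by (rule approximating_family_instance[OF T th rad td fam e, folded B_def]) (rule that)
    interpret mfg_eps_full \<theta> R T N "U \<epsilon>" "M \<epsilon>" \<epsilon> L B by (rule full)
    have G: "0 \<le> G" using g[of 0 1] by simp
    have gc: "continuous_on UNIV g" by (rule continuous_on_of_Lipschitz[OF g])
    have t': "t \<in> {0..T}" using t by simp
    \<comment> \<open>Balances the two terms of \<open>coupling\<close>, which are of order \<delta>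
      and \<tau>^(1+\<alpha>) / \<delta>.\<close>
    define \<delta> where "\<delta> = (t + \<epsilon>) powr ((1 + \<alpha>) / 2)"
    have d: "0 < \<delta>" using t e by (simp add: \<delta>_def)
    have dd: "(t + \<epsilon>) powr (1 + \<alpha>) = \<delta> * \<delta>" by (simp add: \<delta>_def powr_add[symmetric])
    define E' where "E' = 1/2 * (B + (T + \<epsilon>) powr \<alpha> * R)\<^sup>2 / (T + \<epsilon>) powr (1 + \<alpha>)"
    have E: "E' \<le> E" unfolding E_def E'_def
    proof (intro frac_le mult_left_mono power_mono add_left_mono mult_right_mono powr_mono2)
      show "0 \<le> B + (T + \<epsilon>) powr \<alpha> * R" using B R by simp
    qed (use T e al R in auto)
    define r' where "r' = max \<bar>r\<bar> N"
    have "integral {-N..N} (\<lambda>x. M \<epsilon> t x * g x) = integral {-r'..r'} (\<lambda>x. M \<epsilon> t x * g x)"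
      by (rule integral_zero_outside[symmetric]) (use M_support[OF t'] in \<open>auto simp: r'_def not_le\<close>)
    also have "\<dots> = integral {-r..r} (\<lambda>x. M \<epsilon> t x * g x)"
      by (rule integral_zero_outside) (use g0 in \<open>auto simp: r'_def not_le\<close>)
    finally have "\<bar>integral {-r..r} (\<lambda>x. M \<epsilon> t x * g x) - integral {-R..R} (\<lambda>y. phi \<theta> R y * g ((t + \<epsilon>) powr \<alpha> * y))\<bar>
        \<le> G * (\<delta> / 2 + \<delta> * \<delta> * E' / \<delta>)"
      using coupling[OF t' g gc d] unfolding E'_def dd by simp
    also have "\<dots> = G * ((1/2 + E') * \<delta>)" using d by (simp add: field_simps)
    also have "\<dots> \<le> G * ((1/2 + E) * \<delta>)" using d E G by (intro mult_left_mono mult_right_mono) auto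
    finally show "\<bar>integral {-r..r} (\<lambda>x. M \<epsilon> t x * g x) - integral {-R..R} (\<lambda>y. phi \<theta> R y * g ((t + \<epsilon>) powr \<alpha> * y))\<bar>
        \<le> G * ((1/2 + E) * (t + \<epsilon>) powr ((1 + \<alpha>) / 2))" by (simp add: \<delta>_def)
  qed
qed

text \<open>At fixed t > 0 both bounds survive locally uniform convergence. Test functions of
  bounded support keep the integrals on a fixed compact interval, so no tightness argument
  enters.\<close>

lemma constructed_solution_bounds:
  assumes T: "0 < T" and th: "0 < \<theta>" and rad: "profile_radius \<theta> R" and td: "terminal_density \<theta> a b mT"
    and fam: "approximating_family \<theta> T R mT U M" and con: "constructed_solution \<theta> T mT U M u m"
  obtains K D where
    "\<And>t x. t \<in> {0<..<T} \<Longrightarrow> m t x * t powr alpha \<theta> \<le> K"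
    "\<And>t g G r. t \<in> {0<..<T} \<Longrightarrow> (\<And>x y. \<bar>g x - g y\<bar> \<le> G * \<bar>x - y\<bar>) \<Longrightarrow>
      (\<And>x. r < \<bar>x\<bar> \<Longrightarrow> g x = 0) \<Longrightarrow>
      \<bar>integral {-r..r} (\<lambda>x. m t x * g x) - integral {-R..R} (\<lambda>y. phi \<theta> R y * g (t powr alpha \<theta> * y))\<bar>
        \<le> G * (D * t powr ((1 + alpha \<theta>) / 2))"
proof -
  interpret profile \<theta> R using th rad by unfold_locales
  obtain K D where
    K: "\<And>\<epsilon> t x. \<epsilon> \<in> {0<..<1} \<Longrightarrow> t \<in> {0<..<T} \<Longrightarrow> M \<epsilon> t x * (t + \<epsilon>) powr \<alpha> \<le> K" and
    D: "\<And>\<epsilon> t g G r. \<epsilon> \<in> {0<..<1} \<Longrightarrow> t \<in> {0<..<T} \<Longrightarrow> (\<And>x y. \<bar>g x - g y\<bar> \<le> G * \<bar>x - y\<bar>) \<Longrightarrow>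
      (\<And>x. r < \<bar>x\<bar> \<Longrightarrow> g x = 0) \<Longrightarrow>
      \<bar>integral {-r..r} (\<lambda>x. M \<epsilon> t x * g x) - integral {-R..R} (\<lambda>y. phi \<theta> R y * g ((t + \<epsilon>) powr \<alpha> * y))\<bar>
        \<le> G * (D * (t + \<epsilon>) powr ((1 + \<alpha>) / 2))"
    using approximating_family_bounds[OF T th rad td fam] by blast
  obtain \<epsilon> where e: "\<And>k. \<epsilon> k \<in> {0<..<1}" "\<epsilon> \<longlonglongrightarrow> 0" and lim: "loc_uniform_limit T (\<lambda>k. M (\<epsilon> k)) m"
    and mc: "continuous_on (strip T) (\<lambda>(t, x). m t x)"
    using con unfolding constructed_solution_def mfg_solution_def by blast
  have Mc: "continuous_on (strip T) (\<lambda>(t, x). M (\<epsilon> k) t x)" for k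
    using fam e(1)[of k] unfolding approximating_family_def mfg_solution_def by blast
  have tau: "(\<lambda>k. (t + \<epsilon> k) powr p) \<longlonglongrightarrow> t powr p" if t: "0 < t" for t p :: real
    using tendsto_powr[OF tendsto_add[OF tendsto_const e(2)] tendsto_const, of t p] t by simp
  have ul: "uniform_limit {-r..r} (\<lambda>k x. M (\<epsilon> k) t x) (m t) sequentially" if t: "t \<in> {0<..<T}" for t r
  proof -
    have "uniform_limit ({t} \<times> {-r..r}) (\<lambda>k (t, x). M (\<epsilon> k) t x) (\<lambda>(t, x). m t x) sequentially"
    proof (rule lim[unfolded loc_uniform_limit_def, rule_format])
      show "compact ({t} \<times> {-r..r}) \<and> {t} \<times> {-r..r} \<subseteq> strip T" using t by (intro conjI compact_Times) auto
    qed
    note D = uniform_limitD[OF this]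
    show ?thesis
    proof (rule uniform_limitI)
      fix d :: real assume "0 < d"
      then show "\<forall>\<^sub>F k in sequentially. \<forall>x\<in>{-r..r}. dist (M (\<epsilon> k) t x) (m t x) < d"
        by (rule eventually_mono[OF D]) simp
    qed
  qed
  show thesis
  proof (rule that)
    fix t x assume t: "t \<in> {0<..<T}"
    have "(\<lambda>k. M (\<epsilon> k) t x) \<longlonglongrightarrow> m t x"
      by (rule tendsto_uniform_limitI[OF ul[OF t, of "\<bar>x\<bar>"]]) auto
    then have "(\<lambda>k. M (\<epsilon> k) t x * (t + \<epsilon> k) powr \<alpha>) \<longlonglongrightarrow> m t x * t powr \<alpha>"
      using t by (intro tendsto_mult tau) auto
    then show "m t x * t powr \<alpha> \<le> K"
      by (rule LIMSEQ_le_const2) (use K[OF e(1) t] in auto)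
  next
    fix t G r :: real and g :: "real \<Rightarrow> real"
    assume t: "t \<in> {0<..<T}" and g: "\<And>x y. \<bar>g x - g y\<bar> \<le> G * \<bar>x - y\<bar>"
      and g0: "\<And>x. r < \<bar>x\<bar> \<Longrightarrow> g x = 0"
    have gc: "continuous_on X g" for X by (rule continuous_on_of_Lipschitz[OF g])
    have mt: "continuous_on {-r..r} (m t)" by (rule continuous_on_slice2[OF mc t]) auto
    have Mt: "continuous_on {-r..r} (M (\<epsilon> k) t)" for k by (rule continuous_on_slice2[OF Mc t]) auto
    have bd: "bounded (f ` {-r..r})" if "continuous_on {-r..r} f" for f :: "real \<Rightarrow> real"
      by (intro compact_imp_bounded compact_continuous_image that compact_Icc)
    have ug: "uniform_limit {-r..r} (\<lambda>k x. M (\<epsilon> k) t x * g x) (\<lambda>x. m t x * g x) sequentially"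
      by (rule uniform_lim_mult[OF ul[OF t] uniform_limit_const bd[OF mt] bd[OF gc]])
    obtain I J where IJ: "\<And>k. ((\<lambda>x. M (\<epsilon> k) t x * g x) has_integral I k) {-r..r}"
      "((\<lambda>x. m t x * g x) has_integral J) {-r..r}" "I \<longlonglongrightarrow> J"
      by (rule uniform_limit_integral[OF ug]) (auto intro!: continuous_intros Mt gc)
    have l1: "(\<lambda>k. integral {-r..r} (\<lambda>x. M (\<epsilon> k) t x * g x)) \<longlonglongrightarrow> integral {-r..r} (\<lambda>x. m t x * g x)"
      using IJ(3) integral_unique[OF IJ(1)] integral_unique[OF IJ(2)] by simp
    have "continuous_on UNIV (\<lambda>c. integral {-R..R} (\<lambda>y. phi \<theta> R y * g (c * y)))"
    proof (rule continuous_on_integral_slice)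
      have "continuous_on (UNIV \<times> {-R..R}) (\<lambda>p. phi \<theta> R (snd p))"
        by (rule continuous_on_compose2[OF phi_cont[of UNIV]]) (auto intro!: continuous_intros)
      moreover have "continuous_on (UNIV \<times> {-R..R}) (\<lambda>p. g (fst p * snd p))"
        by (rule continuous_on_compose2[OF gc[of UNIV]]) (auto intro!: continuous_intros)
      ultimately show "continuous_on (UNIV \<times> {-R..R}) (\<lambda>(c, y). phi \<theta> R y * g (c * y))"
        unfolding case_prod_unfold by (rule continuous_on_mult)
    qed
    then have l2: "(\<lambda>k. integral {-R..R} (\<lambda>y. phi \<theta> R y * g ((t + \<epsilon> k) powr \<alpha> * y))) \<longlonglongrightarrow>
        integral {-R..R} (\<lambda>y. phi \<theta> R y * g (t powr \<alpha> * y))"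
      by (rule continuous_on_tendsto_compose) (use tau t in auto)
    show "\<bar>integral {-r..r} (\<lambda>x. m t x * g x) - integral {-R..R} (\<lambda>y. phi \<theta> R y * g (t powr \<alpha> * y))\<bar>
        \<le> G * (D * t powr ((1 + \<alpha>) / 2))"
    proof (rule LIMSEQ_le[OF tendsto_rabs[OF tendsto_diff[OF l1 l2]]])
      show "(\<lambda>k. G * (D * (t + \<epsilon> k) powr ((1 + \<alpha>) / 2))) \<longlonglongrightarrow> G * (D * t powr ((1 + \<alpha>) / 2))"
        using t by (intro tendsto_mult tendsto_const tau) auto
    qed (use D[OF e(1) t g g0] in blast)
  qed
qed

theorem theorem3p1:
  fixes T \<theta> R a b :: real
    and mT :: "real \<Rightarrow> real"
    and U M :: "real \<Rightarrow> real \<Rightarrow> real \<Rightarrow> real"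
    and u m :: "real \<Rightarrow> real \<Rightarrow> real"
  assumes "0 < T" and "0 < \<theta>"
    and "profile_radius \<theta> R"
    and "terminal_density \<theta> a b mT"
    and "approximating_family \<theta> T R mT U M"
    and "constructed_solution \<theta> T mT U M u m"
  shows "weak_star_tendsto (\<lambda>t x. t powr alpha \<theta> * m t (t powr alpha \<theta> * x))
           (phi \<theta> R) (at_right 0)"
proof -
  interpret profile \<theta> R using assms by unfold_locales
  obtain K D where K: "\<And>t x. t \<in> {0<..<T} \<Longrightarrow> m t x * t powr \<alpha> \<le> K"
    and D: "\<And>t g G r. t \<in> {0<..<T} \<Longrightarrow> (\<And>x y. \<bar>g x - g y\<bar> \<le> G * \<bar>x - y\<bar>) \<Longrightarrow>
      (\<And>x. r < \<bar>x\<bar> \<Longrightarrow> g x = 0) \<Longrightarrow>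
      \<bar>integral {-r..r} (\<lambda>x. m t x * g x) - integral {-R..R} (\<lambda>y. phi \<theta> R y * g (t powr \<alpha> * y))\<bar>
        \<le> G * (D * t powr ((1 + \<alpha>) / 2))"
    using constructed_solution_bounds[OF assms] by blast
  have mc: "continuous_on (strip T) (\<lambda>(t, x). m t x)" and m0: "\<And>t x. t \<in> {0<..<T} \<Longrightarrow> 0 \<le> m t x"
    using assms(6) unfolding constructed_solution_def mfg_solution_def by blast+
  have fc: "continuous_on X (\<lambda>x. t powr \<alpha> * m t (t powr \<alpha> * x))" if t: "t \<in> {0<..<T}" for t X
  proof -
    have mt: "continuous_on UNIV (m t)" by (rule continuous_on_slice2[OF mc t]) auto
    show ?thesis by (intro continuous_intros continuous_on_compose2[OF mt]) auto
  qed
  have small: "\<forall>\<^sub>F t in at_right 0. t \<in> {0<..<T}"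
    using assms(1) by (auto simp: eventually_at_right_field)
  show ?thesis
  proof (rule weak_star_tendstoI[where K = "max K (phi \<theta> R 0)"])
    show "\<forall>\<^sub>F t in at_right 0. (\<lambda>x. t powr \<alpha> * m t (t powr \<alpha> * x)) \<in> borel_measurable lborel \<and>
        (\<forall>x. \<bar>t powr \<alpha> * m t (t powr \<alpha> * x)\<bar> \<le> max K (phi \<theta> R 0))"
      using small
    proof (rule eventually_mono, intro conjI allI)
      fix t x assume t: "t \<in> {0<..<T}"
      show "(\<lambda>x. t powr \<alpha> * m t (t powr \<alpha> * x)) \<in> borel_measurable lborel"
        using fc[OF t] by (simp add: borel_measurable_continuous_onI)
      show "\<bar>t powr \<alpha> * m t (t powr \<alpha> * x)\<bar> \<le> max K (phi \<theta> R 0)"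
        using K[OF t, of "t powr \<alpha> * x"] m0[OF t, of "t powr \<alpha> * x"] by (simp add: abs_mult mult.commute)
    qed
    show "phi \<theta> R \<in> borel_measurable lborel" using phi_cont[of UNIV] by (simp add: borel_measurable_continuous_onI)
    show "\<bar>phi \<theta> R x\<bar> \<le> max K (phi \<theta> R 0)" for x using phi_le[of x] phi_nonneg[of x] by simp
  next
    fix h :: "real \<Rightarrow> real" and G r
    assume h: "\<And>x y. \<bar>h x - h y\<bar> \<le> G * \<bar>x - y\<bar>" and h0: "\<And>x. r < \<bar>x\<bar> \<Longrightarrow> h x = 0"
    have hc: "continuous_on X h" for X by (rule continuous_on_of_Lipschitz[OF h])
    \<comment> \<open>The radius r may be 0 or negative; the change of variables below works on a
      nondegenerate interval.\<close>
    define q where "q = max r 1"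
    have q: "0 < q" "\<And>x. q < \<bar>x\<bar> \<Longrightarrow> h x = 0" using h0 by (auto simp: q_def)
    have lim: "(LINT x|lborel. phi \<theta> R x * h x) = integral {-R..R} (\<lambda>y. phi \<theta> R y * h y)"
      by (rule lborel_integral_compact_support(2)) (use phi_zero in \<open>auto intro!: continuous_intros phi_cont hc\<close>)
    \<comment> \<open>Undoing the scaling replaces h by h (x / c) with c = t^\<alpha>, whose
      Lipschitz constant is G / c. The bound of order t^((1+\<alpha>)/2) thus loses a factor
      t^\<alpha>, and the exponent (1 - \<alpha>) / 2 that remains is positive because \<alpha> <
      1.\<close>
    have est: "\<bar>(LINT x|lborel. t powr \<alpha> * m t (t powr \<alpha> * x) * h x) - (LINT x|lborel. phi \<theta> R x * h x)\<bar>
        \<le> G * D * t powr ((1 - \<alpha>) / 2)" if t: "t \<in> {0<..<T}" for t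
    proof -
      define c where "c = t powr \<alpha>"
      have c: "0 < c" using t by (simp add: c_def)
      have "(LINT x|lborel. c * m t (c * x) * h x) = integral {-q..q} (\<lambda>x. c * m t (c * x) * h x)"
        by (rule lborel_integral_compact_support(2))
          (use q in \<open>auto intro!: continuous_on_mult[OF fc[OF t, folded c_def] hc]\<close>)
      also have "\<dots> = integral {-(q * c)..q * c} (\<lambda>x. m t x * h (x / c))"
      proof (rule integral_unique)
        have mt: "continuous_on X (m t)" for X by (rule continuous_on_slice2[OF mc t]) auto
        have "((\<lambda>x. c *\<^sub>R (m t (c * x) * h (c * x / c))) has_integral
            integral {c * - q..c * q} (\<lambda>x. m t x * h (x / c))) {-q..q}"
        proof (rule has_integral_substitution[where c = "-(q * c)" and d = "q * c"])
          show "continuous_on {-(q * c)..q * c} (\<lambda>x. m t x * h (x / c))"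
            using c by (intro continuous_on_mult mt continuous_on_compose2[OF hc[of UNIV]] continuous_intros) auto
          show "(*) c ` {-q..q} \<subseteq> {-(q * c)..q * c}"
          proof clarsimp
            fix x assume "-q \<le> x" "x \<le> q"
            then show "- (q * c) \<le> c * x \<and> c * x \<le> q * c"
              using c mult_left_mono[of "-q" x c] mult_left_mono[of x q c] by (simp add: mult.commute)
          qed
        qed (use c q in \<open>auto intro!: derivative_eq_intros\<close>)
        then show "((\<lambda>x. c * m t (c * x) * h x) has_integral integral {-(q * c)..q * c} (\<lambda>x. m t x * h (x / c))) {-q..q}"
          using c by (simp add: mult_ac)
      qed
      finally have L: "(LINT x|lborel. c * m t (c * x) * h x) = integral {-(q * c)..q * c} (\<lambda>x. m t x * h (x / c))" .
      have "\<bar>integral {-(q * c)..q * c} (\<lambda>x. m t x * h (x / c)) - integral {-R..R} (\<lambda>y. phi \<theta> R y * h (t powr \<alpha> * y / c))\<bar>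
          \<le> (G / c) * (D * t powr ((1 + \<alpha>) / 2))"
      proof (rule D[OF t])
        show "\<bar>h (x / c) - h (y / c)\<bar> \<le> G / c * \<bar>x - y\<bar>" for x y
          using h[of "x / c" "y / c"] c by (simp add: diff_divide_distrib[symmetric] abs_divide)
        show "h (x / c) = 0" if "q * c < \<bar>x\<bar>" for x
          using that c by (intro q(2)) (simp add: abs_divide pos_less_divide_eq)
      qed
      also have "(G / c) * (D * t powr ((1 + \<alpha>) / 2)) = G * D * t powr ((1 - \<alpha>) / 2)"
      proof -
        have "(1 + \<alpha>) / 2 = (1 - \<alpha>) / 2 + \<alpha>" by (simp add: field_simps)
        then have "t powr ((1 + \<alpha>) / 2) = t powr ((1 - \<alpha>) / 2) * c" by (simp only: powr_add c_def)
        then show ?thesis using c by simp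
      qed
      finally show ?thesis using c unfolding L[unfolded c_def] lim by (simp add: c_def)
    qed
    have "((\<lambda>t. t powr ((1 - \<alpha>) / 2)) \<longlongrightarrow> 0 powr ((1 - \<alpha>) / 2)) (at_right (0::real))"
      using al by (intro tendsto_powr' tendsto_ident_at tendsto_const) (auto simp: eventually_at_filter)
    then have "((\<lambda>t. G * D * t powr ((1 - \<alpha>) / 2)) \<longlongrightarrow> G * D * 0) (at_right 0)"
      by (intro tendsto_mult tendsto_const) simp
    then have z: "((\<lambda>t. G * D * t powr ((1 - \<alpha>) / 2)) \<longlongrightarrow> 0) (at_right 0)" by simp
    show "((\<lambda>t. LINT x|lborel. t powr \<alpha> * m t (t powr \<alpha> * x) * h x) \<longlongrightarrow> (LINT x|lborel. phi \<theta> R x * h x)) (at_right 0)"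
      by (rule LIM_zero_cancel, rule Lim_null_comparison[OF eventually_mono[OF small] z]) (use est in simp)
  qed
qed

end
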